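(* Let $\mathbb{F}\in\{\mathbb{R},\mathbb{C}\}$. There are universal constants (hidden in the $O(\cdot)$ notation below, independent of $d,r$) such that the SparseRTT test matrix $\Omega = DFS\in\mathbb{F}^{d\times k}$ is an $(r,1/2)$-OSI for some embedding dimension $k = O(r)$ and some column sparsity $\xi = O\big((1+\tfrac{\log d}{r})\log r\big)$. With these parameters, for an input matrix $A\in\mathbb{F}^{n\times d}$, the sketch $A\Omega$ can be computed with $O(nd\log r)$ arithmetic operations.
   Context: SparseRTT: $\Omega = DFS$ where $D\in\mathbb{F}^{d\times d}$ is diagonal with iid Rademacher ($\pm1$ equiprobable) entries; $F\in\mathbb{F}^{d\times d}$ is a unitary trigonometric transform: the (unitary) Walsh–Hadamard transform (when $d$ is a power of 2) or the discrete cosine transform, or, when $\mathbb{F}=\mathbb{C}$, the discrete Fourier transform; $S\in\mathbb{F}^{d\times k}$ is an independent SparseCol matrix with column sparsity $\xi\in\mathbb{N}$: $S = k^{-1/2}[\omega_1,\dots,\omega_k]$ where the $\omega_j$ are iid copies of $\omega = \sqrt{d/\xi}\sum_{i=1}^{\xi}\varrho_i e_{s_i}$, with $\varrho_1,\dots,\varrho_\xi$ iid Rademacher, $s_1,\dots,s_\xi$ sampled uniformly from $\{1,\dots,d\}$ without replacement, and $e_i$ the standard basis vectors of $\mathbb{F}^d$. A random matrix $\Omega\in\mathbb{F}^{d\times k}$ is an $(r,\alpha)$-OSI ($k\ge r$, $\alpha\in(0,1]$) if (1) $\mathbb{E}\|\Omega^*x\|_2^2=\|x\|_2^2$ for all $x\in\mathbb{F}^d$;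 and (2) for each fixed $r$-dimensional subspace $V\subseteq\mathbb{F}^d$, with probability at least $19/20$, $\alpha\|x\|_2^2\le\|\Omega^*x\|_2^2$ for all $x\in V$. $^*$ is conjugate transpose. *)

theory Defs
  imports
    "HOL-Probability.Probability"
    "Jordan_Normal_Form.Schur_Decomposition"
    "Jordan_Normal_Form.VS_Connect"
begin

hide_const (open) Finite_Cartesian_Product.mat Finite_Cartesian_Product.vec
hide_type (open) Finite_Cartesian_Product.vec
no_notation Finite_Cartesian_Product.vec_nth (infixl \<open>$\<close> 90)
no_notation Inner_Product.real_inner_class.inner (infix \<open>\<bullet>\<close> 70)

text \<open>
  Dimensions vary below a single choice of constants, so vectors and matrices are the
  dynamically dimensioned ones of Jordan_Normal_Form, with indices starting at 0.
  The field is \<^typ>\<open>real\<close> or \<^typ>\<open>complex\<close>, both instances of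
  the classes \<^class>\<open>conjugatable_field\<close> and \<^class>\<open>real_normed_field\<close>.
  Subspaces, dimension and \<^const>\<open>mat_adjoint\<close> (conjugate transpose) refer to that field.
\<close>

definition sqnorm :: "'a :: real_normed_field vec \<Rightarrow> real" where
  "sqnorm v = (\<Sum>i<dim_vec v. (norm (v $ i))\<^sup>2)"


section \<open>Unitary trigonometric transforms\<close>

text \<open>Walsh--Hadamard matrix of order $2^q$ in the natural (Sylvester) ordering.\<close>
definition walsh_hadamard :: "nat \<Rightarrow> 'a :: real_normed_field mat" where
  "walsh_hadamard q = mat (2 ^ q) (2 ^ q) (\<lambda>(i, j).
     of_real ((- 1) ^ card {t. t < q \<and> bit i t \<and> bit j t} / sqrt (2 ^ q)))"

text \<open>Orthonormal discrete cosine transform of type II (the standard DCT).\<close>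
definition dct :: "nat \<Rightarrow> 'a :: real_normed_field mat" where
  "dct d = mat d d (\<lambda>(i, j).
     of_real (sqrt ((if i = 0 then 1 else 2) / real d)
              * cos (pi * (2 * real j + 1) * real i / (2 * real d))))"

definition dft :: "nat \<Rightarrow> complex mat" where
  "dft d = mat d d (\<lambda>(i, j). cis (- 2 * pi * real i * real j / real d) / of_real (sqrt (real d)))"

definition real_trig_transforms :: "nat \<Rightarrow> 'a :: real_normed_field mat set" where
  "real_trig_transforms d = {dct d} \<union> {walsh_hadamard q | q. d = 2 ^ q}"

definition complex_trig_transforms :: "nat \<Rightarrow> complex mat set" where
  "complex_trig_transforms d = real_trig_transforms d \<union> {dft d}"


section \<open>The SparseRTT random matrix\<close>

definition rademacher :: "'a :: real_normed_field pmf" where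
  "rademacher = pmf_of_set {1, - 1}"

text \<open>
  \<open>\<omega> = sqrt (d / \<xi>) * (\<Sum>i<\<xi>. \<rho>\<^sub>i e\<^bsub>s\<^sub>i\<^esub>)\<close>. The positions, sampled without replacement, form a
  uniformly random duplicate-free list; such lists exist only for \<open>\<xi> \<le> d\<close>.
\<close>
definition sparse_column :: "nat \<Rightarrow> nat \<Rightarrow> 'a :: real_normed_field vec pmf" where
  "sparse_column d \<xi> = do {
     \<rho> \<leftarrow> replicate_pmf \<xi> rademacher;
     s \<leftarrow> pmf_of_set {s. length s = \<xi> \<and> distinct s \<and> set s \<subseteq> {..<d}};
     return_pmf (vec d (\<lambda>l.
       of_real (sqrt (real d / real \<xi>)) * (\<Sum>i<\<xi>. \<rho> ! i * unit_vec d (s ! i) $ l)))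
   }"

definition sparse_col :: "nat \<Rightarrow> nat \<Rightarrow> nat \<Rightarrow> 'a :: real_normed_field mat pmf" where
  "sparse_col d k \<xi> = do {
     \<omega>s \<leftarrow> replicate_pmf k (sparse_column d \<xi>);
     return_pmf (of_real (1 / sqrt (real k)) \<cdot>\<^sub>m mat_of_cols d \<omega>s)
   }"

definition sparse_rtt :: "'a :: real_normed_field mat \<Rightarrow> nat \<Rightarrow> nat \<Rightarrow> nat \<Rightarrow> 'a mat pmf" where
  "sparse_rtt F d k \<xi> = do {
     \<sigma> \<leftarrow> replicate_pmf d rademacher;
     S \<leftarrow> sparse_col d k \<xi>;
     return_pmf (mat_diag d (\<lambda>i. \<sigma> ! i) * F * S)
   }"


section \<open>Oblivious subspace injections\<close>

text \<open>
  A random matrix is given by its law, here a discrete one. The Bochner integral of a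
  non-integrable function is 0, so the first moment condition includes integrability.
\<close>
definition osi ::
  "nat \<Rightarrow> nat \<Rightarrow> nat \<Rightarrow> real \<Rightarrow> 'a :: {real_normed_field, conjugatable_field} mat pmf \<Rightarrow> bool" where
  "osi d k r \<alpha> P \<longleftrightarrow>
     set_pmf P \<subseteq> carrier_mat d k \<and> r \<le> k \<and> 0 < \<alpha> \<and> \<alpha> \<le> 1 \<and>
     (\<forall>x \<in> carrier_vec d.
        measure_pmf.expectation P (\<lambda>\<Omega>. sqnorm (mat_adjoint \<Omega> *\<^sub>v x)) = sqnorm x) \<and>
     (\<forall>V. VectorSpace.subspace class_ring V (module_vec TYPE('a) d) \<and>
          vectorspace.dim class_ring ((module_vec TYPE('a) d)\<lparr>carrier := V\<rparr>) = r \<longrightarrow>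
        measure_pmf.prob P
          {\<Omega>. \<forall>x \<in> V. \<alpha> * sqnorm x \<le> sqnorm (mat_adjoint \<Omega> *\<^sub>v x)} \<ge> 19 / 20)"


section \<open>Arithmetic operations\<close>

text \<open>
  Straight-line programs over the field: instruction number \<open>t\<close> performs one arithmetic operation
  and stores its result in register \<open>t\<close>. Operands are entries of the input matrix, earlier
  results, and scalars of the field; reading them is free. Hence the number of operations is
  the length of the program. Division is omitted: with \<open>x / 0 = 0\<close> it would provide a zero test.
\<close>
datatype 'a operand = Input nat nat | Reg nat | Scalar 'a

datatype 'a instruction =
    Add "'a operand" "'a operand"
  | Sub "'a operand" "'a operand"
  | Mul "'a operand" "'a operand"

fun operand_value :: "'a :: comm_ring_1 mat \<Rightarrow> 'a list \<Rightarrow> 'a operand \<Rightarrow> 'a" where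
  "operand_value A regs (Input i j) = (if i < dim_row A \<and> j < dim_col A then A $$ (i, j) else 0)"
| "operand_value A regs (Reg t) = (if t < length regs then regs ! t else 0)"
| "operand_value A regs (Scalar c) = c"

fun instruction_value :: "'a :: comm_ring_1 mat \<Rightarrow> 'a list \<Rightarrow> 'a instruction \<Rightarrow> 'a" where
  "instruction_value A regs (Add a b) = operand_value A regs a + operand_value A regs b"
| "instruction_value A regs (Sub a b) = operand_value A regs a - operand_value A regs b"
| "instruction_value A regs (Mul a b) = operand_value A regs a * operand_value A regs b"

definition run :: "'a :: comm_ring_1 mat \<Rightarrow> 'a instruction list \<Rightarrow> 'a list" where
  "run A p = foldl (\<lambda>regs c. regs @ [instruction_value A regs c]) [] p"

text \<open>
  The matrix \<open>\<Omega>\<close> is already drawn, so the program may depend on it (but not on \<open>A\<close>);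
  \<open>out i j\<close> says where the entry \<open>(i, j)\<close> of the product is found.
\<close>
definition computes_sketch :: "nat \<Rightarrow> 'a :: comm_ring_1 mat \<Rightarrow> 'a instruction list \<Rightarrow> bool" where
  "computes_sketch n \<Omega> p \<longleftrightarrow>
     (\<exists>out :: nat \<Rightarrow> nat \<Rightarrow> 'a operand. \<forall>A \<in> carrier_mat n (dim_row \<Omega>).
        \<forall>i < n. \<forall>j < dim_col \<Omega>. operand_value A (run A p) (out i j) = (A * \<Omega>) $$ (i, j))"


section \<open>Logarithmic factors\<close>

text \<open>
  Inside $O(\cdot)$, the factor $\log r$ has to be bounded away from 0: for \<open>r = 1\<close> the
  sparsity and the cost would vanish otherwise. For \<open>r \<ge> 2\<close> this changes constants only.
\<close>
definition log_factor :: "nat \<Rightarrow> real" where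
  "log_factor r = max 1 (ln (real r))"

end

theory Submission
  imports Defs
begin

text \<open>
  Let \<open>z\<^sub>l(x)\<close> be the \<open>l\<close>-th entry of $F^* D x$ for \<open>x\<close> in a fixed \<open>r\<close>-dimensional space. For a fixed
  sign vector the forms \<open>z\<^sub>l\<close> are a Parseval frame, and the squared entries of $\Omega^* x$ are
  independent random forms built from \<open>\<xi>\<close> of them, so the smallest eigenvalue of their sum \<open>B\<close> has to be
  bounded from below. This is done with a barrier: every column also subtracts $3/4$ times the
  identity from \<open>B\<close>, starting from a multiple of \<open>r\<close> times the identity, and with $M = B^{-1}$ the potential
  $c \, r \, tr(M^2) + c' \sum_l M[z_l]^p$ with \<open>p\<close> of order $\log r$ is a supermartingale while it is at most
  1. The first summand controls the norm of \<open>M\<close>; the second shows that few rows are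
  atypical for \<open>M\<close>, so that the sparse column behaves like a dense one as soon as \<open>\<xi>\<close> is of order \<open>p\<close>.
  As only averages over the rows enter, a fourth moment bound for the leverage scores of
  the signed transform suffices. Markov's inequality at the start of the process gives the failure
  probability.

  For the cost, at most \<open>k\<xi>\<close> entries of the transform are needed. For the cosine and Fourier
  transforms they are values of one polynomial of degree less than \<open>d\<close> at \<open>m\<close> points, computed by Horner's
  scheme in $x^m$ modulo the polynomial vanishing at these points; each step is a
  pair of Toeplitz products, done by fast Fourier transforms of size \<open>O(m)\<close>. The Walsh--Hadamard
  recursion is pruned to the needed entries. Programs over the reals simulate complex ones.
\<close>

section \<open>Cost of evaluating families of linear forms\<close>

text \<open>A matrix Chernoff bound would cost a factor log r in \<open>k\<close>. The barrier
  avoids it, because a column has to be handled only in expectation given the current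
  \<open>M\<close>. The square trace replaces the trace: if tr(M^2) is of order 1/(c^2 N) with N =
  2r, then tr(M) is of order 1/c and the norm of \<open>M\<close> of order 1/(c sqrt N). A p-th
  power is affordable as its second order Taylor term, of relative size p times this norm plus p/(c
  \<xi>), stays below a constant: p is both O(sqrt N) and O(\<xi>). It is strong enough as 2^p
  exceeds a multiple of N^2, so Markov's inequality leaves so few atypical rows that crude bounds
  suffice there. The shift 3/4 fits both drifts: tr(M^2) gains 2 - 1/2 against a loss of 2 * 3/4,
  each p-th power gains 1 - 1/4 against 3/4. Half of the failure probability 1/20 pays for the
  signs, half for the columns. All forms are real: a complex form is a pair of real vectors, and
  even for real matrices the process runs on the 2r real coordinates of the complexified subspace,
  so both fields share one argument.\<close>

definition avail :: "('e \<Rightarrow> 'a) set \<Rightarrow> ('e \<Rightarrow> 'a) \<Rightarrow> bool" where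
  "avail Y f \<longleftrightarrow> f \<in> Y \<or> (\<exists>s. f = (\<lambda>_. s))"

text \<open>A program is represented by the set of functions of the environment \<open>e\<close>
  that it has computed so far. Functions are compared extensionally, so algebraic identities cost
  nothing and no register has to be named.\<close>

inductive slp :: "('e \<Rightarrow> 'a::comm_ring_1) set \<Rightarrow> nat \<Rightarrow> ('e \<Rightarrow> 'a) set \<Rightarrow> bool"
  for X where
  base: "slp X 0 X"
| add: "slp X c Y \<Longrightarrow> avail Y f \<Longrightarrow> avail Y g \<Longrightarrow> slp X (Suc c) (insert (\<lambda>e. f e + g e) Y)"
| sub: "slp X c Y \<Longrightarrow> avail Y f \<Longrightarrow> avail Y g \<Longrightarrow> slp X (Suc c) (insert (\<lambda>e. f e - g e) Y)"
| mul: "slp X c Y \<Longrightarrow> avail Y f \<Longrightarrow> avail Y g \<Longrightarrow> slp X (Suc c) (insert (\<lambda>e. f e * g e) Y)"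

definition cost :: "('e \<Rightarrow> 'a::comm_ring_1) set \<Rightarrow> nat \<Rightarrow> ('e \<Rightarrow> 'a) set \<Rightarrow> bool" where
  "cost X c Z \<longleftrightarrow> (\<exists>c' Y. slp X c' Y \<and> c' \<le> c \<and> (\<forall>f\<in>Z. avail Y f))"

lemma avail_const [simp]: "avail Y (\<lambda>_. s)"
  by (auto simp: avail_def)

lemma avail_mono: "avail Y f \<Longrightarrow> Y \<subseteq> Y' \<Longrightarrow> avail Y' f"
  by (auto simp: avail_def)

lemma avail_trans: "avail Y f \<Longrightarrow> \<forall>g\<in>Y. avail Y' g \<Longrightarrow> avail Y' f"
  by (auto simp: avail_def)

lemma avail_mem: "f \<in> Y \<Longrightarrow> avail Y f"
  by (simp add: avail_def)

text \<open>The second program runs on whatever the first one provides. Its results are only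
  \<open>avail\<close> in the joint set, since an input that is a constant need not have been
  stored.\<close>

lemma slp_append:
  assumes "slp Y c' Z" "slp X c Y0" "\<forall>f\<in>Y. avail Y0 f"
  shows "\<exists>Z0. slp X (c + c') Z0 \<and> Y0 \<subseteq> Z0 \<and> (\<forall>f\<in>Z. avail Z0 f)"
  using assms(1)
proof (induction rule: slp.induct)
  case base
  then show ?case using assms(2,3) by auto
next
  case (add c' Z f g)
  then obtain Z0 where Z0: "slp X (c + c') Z0" "Y0 \<subseteq> Z0" "\<forall>f\<in>Z. avail Z0 f" by auto
  have "slp X (Suc (c + c')) (insert (\<lambda>e. f e + g e) Z0)"
    by (rule slp.add[OF Z0(1)]) (use add Z0 in \<open>auto intro: avail_trans\<close>)
  then show ?case using Z0
    by (intro exI[of _ "insert (\<lambda>e. f e + g e) Z0"]) (auto intro: avail_mono avail_mem)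
next
  case (sub c' Z f g)
  then obtain Z0 where Z0: "slp X (c + c') Z0" "Y0 \<subseteq> Z0" "\<forall>f\<in>Z. avail Z0 f" by auto
  have "slp X (Suc (c + c')) (insert (\<lambda>e. f e - g e) Z0)"
    by (rule slp.sub[OF Z0(1)]) (use sub Z0 in \<open>auto intro: avail_trans\<close>)
  then show ?case using Z0
    by (intro exI[of _ "insert (\<lambda>e. f e - g e) Z0"]) (auto intro: avail_mono avail_mem)
next
  case (mul c' Z f g)
  then obtain Z0 where Z0: "slp X (c + c') Z0" "Y0 \<subseteq> Z0" "\<forall>f\<in>Z. avail Z0 f" by auto
  have "slp X (Suc (c + c')) (insert (\<lambda>e. f e * g e) Z0)"
    by (rule slp.mul[OF Z0(1)]) (use mul Z0 in \<open>auto intro: avail_trans\<close>)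
  then show ?case using Z0
    by (intro exI[of _ "insert (\<lambda>e. f e * g e) Z0"]) (auto intro: avail_mono avail_mem)
qed

lemma slp_superset: "slp X c Y \<Longrightarrow> X \<subseteq> Y"
  by (induction rule: slp.induct) auto

lemma cost_trans:
  assumes "cost X c Y" "cost Y c' Z"
  shows "cost X (c + c') Z"
proof -
  obtain c1 Y1 where 1: "slp X c1 Y1" "c1 \<le> c" "\<forall>f\<in>Y. avail Y1 f"
    using assms(1) by (auto simp: cost_def)
  obtain c2 Z2 where 2: "slp Y c2 Z2" "c2 \<le> c'" "\<forall>f\<in>Z. avail Z2 f"
    using assms(2) by (auto simp: cost_def)
  from slp_append[OF 2(1) 1(1,3)] obtain Z0
    where "slp X (c1 + c2) Z0" "\<forall>f\<in>Z2. avail Z0 f" by auto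
  then show ?thesis using 1 2 unfolding cost_def
    by (intro exI[of _ "c1 + c2"] exI[of _ Z0]) (auto intro: avail_trans)
qed

lemma cost_union:
  assumes "cost X c Y" "cost X c' Z"
  shows "cost X (c + c') (Y \<union> Z)"
proof -
  obtain c1 Y1 where 1: "slp X c1 Y1" "c1 \<le> c" "\<forall>f\<in>Y. avail Y1 f"
    using assms(1) by (auto simp: cost_def)
  obtain c2 Z2 where 2: "slp X c2 Z2" "c2 \<le> c'" "\<forall>f\<in>Z. avail Z2 f"
    using assms(2) by (auto simp: cost_def)
  have "\<forall>f\<in>X. avail Y1 f" using slp_superset[OF 1(1)] by (auto intro: avail_mem)
  from slp_append[OF 2(1) 1(1) this] obtain Z0
    where "slp X (c1 + c2) Z0" "Y1 \<subseteq> Z0" "\<forall>f\<in>Z2. avail Z0 f" by auto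
  then show ?thesis using 1 2 unfolding cost_def
    by (intro exI[of _ "c1 + c2"] exI[of _ Z0]) (auto intro: avail_trans avail_mono)
qed

lemma cost_mono: "cost X c Z \<Longrightarrow> c \<le> c' \<Longrightarrow> Z' \<subseteq> Z \<Longrightarrow> cost X c' Z'"
  unfolding cost_def by (meson le_trans subset_iff)

lemma cost_0: "\<forall>f\<in>Z. avail X f \<Longrightarrow> cost X 0 Z"
  unfolding cost_def using slp.base by blast

lemma cost_weaken: "cost X c Z \<Longrightarrow> \<forall>f\<in>X. avail X' f \<Longrightarrow> cost X' c Z"
  using cost_trans[OF cost_0[of X X'], of c Z] by simp

lemma cost_UN:
  assumes "finite I" "\<And>i. i \<in> I \<Longrightarrow> cost X (c i) (Y i)"
  shows "cost X (\<Sum>i\<in>I. c i) (\<Union>i\<in>I. Y i)"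
  using assms
proof (induction rule: finite_induct)
  case empty
  then show ?case by (auto intro: cost_0)
next
  case (insert i I)
  then show ?case using cost_union[of X "c i" "Y i" "\<Sum>i\<in>I. c i" "\<Union>i\<in>I. Y i"] by auto
qed

lemma cost_UN_const:
  assumes "finite I" "\<And>i. i \<in> I \<Longrightarrow> cost X c (Y i)"
  shows "cost X (card I * c) (\<Union>i\<in>I. Y i)"
  using cost_UN[of I X "\<lambda>_. c" Y] assms by simp

lemma cost_image:
  assumes "finite I" "\<And>i. i \<in> I \<Longrightarrow> cost X c {f i}"
  shows "cost X (card I * c) (f ` I)"
  using cost_UN_const[OF assms] by (simp add: UNION_singleton_eq_range)

lemma cost_add: "avail X f \<Longrightarrow> avail X g \<Longrightarrow> cost X 1 {\<lambda>e. f e + g e}"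
  unfolding cost_def using slp.add[OF slp.base, of X f g]
  by (intro exI[of _ "Suc 0"] exI[of _ "insert (\<lambda>e. f e + g e) X"]) (auto intro: avail_mem)

lemma cost_diff: "avail X f \<Longrightarrow> avail X g \<Longrightarrow> cost X 1 {\<lambda>e. f e - g e}"
  unfolding cost_def using slp.sub[OF slp.base, of X f g]
  by (intro exI[of _ "Suc 0"] exI[of _ "insert (\<lambda>e. f e - g e) X"]) (auto intro: avail_mem)

lemma cost_scale: "avail X f \<Longrightarrow> cost X 1 {\<lambda>e. s * f e}"
  unfolding cost_def using slp.mul[OF slp.base, of X "\<lambda>_. s" f]
  by (intro exI[of _ "Suc 0"] exI[of _ "insert (\<lambda>e. s * f e) X"]) (auto intro: avail_mem)

lemma cost_sum:
  assumes "finite I" "\<And>i. i \<in> I \<Longrightarrow> avail X (f i)"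
  shows "cost X (card I) {\<lambda>e. \<Sum>i\<in>I. f i e}"
  using assms
proof (induction rule: finite_induct)
  case empty
  then show ?case by (auto intro: cost_0)
next
  case (insert i I)
  let ?s = "\<lambda>e. \<Sum>i\<in>I. f i e"
  have "cost X (card I) ({?s} \<union> {f i})"
    using cost_union[of X "card I" "{?s}" 0 "{f i}"] insert cost_0[of "{f i}" X] by auto
  moreover have "cost ({?s} \<union> {f i}) 1 {\<lambda>e. f i e + ?s e}"
    by (intro cost_add) (auto intro: avail_mem)
  ultimately have "cost X (card I + 1) {\<lambda>e. f i e + ?s e}" by (rule cost_trans)
  then show ?case using insert by simp
qed

lemma cost_lincomb:
  assumes "finite I" "\<And>i. i \<in> I \<Longrightarrow> avail X (f i)"
  shows "cost X (2 * card I) {\<lambda>e. \<Sum>i\<in>I. a i * f i e}"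
proof -
  have "cost X (card I * 1) ((\<lambda>i e. a i * f i e) ` I)"
    by (intro cost_image cost_scale assms)
  moreover have "cost ((\<lambda>i e. a i * f i e) ` I) (card I) {\<lambda>e. \<Sum>i\<in>I. a i * f i e}"
    by (intro cost_sum assms) (auto intro: avail_mem)
  ultimately show ?thesis by (rule cost_mono[OF cost_trans]) auto
qed

text \<open>Substituting \<open>h\<close> into the environment turns a program on abstract
  coordinates into one on any given functions; this is what makes the fast transforms usable as
  subroutines.\<close>

lemma slp_subst:
  assumes "slp X c Y"
  shows "\<exists>Y'. slp ((\<lambda>f e. f (h e)) ` X) c Y' \<and> (\<forall>f\<in>Y. avail Y' (\<lambda>e. f (h e)))"
  using assms
proof (induction rule: slp.induct)
  case base
  then show ?case by (meson avail_mem image_eqI slp.base)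
next
  case (add c Z f g)
  then obtain Y' where Y': "slp ((\<lambda>f e. f (h e)) ` X) c Y'" "\<forall>f\<in>Z. avail Y' (\<lambda>e. f (h e))" by auto
  have av: "avail Y' (\<lambda>e. k (h e))" if "avail Z k" for k using that Y'(2) by (auto simp: avail_def)
  show ?case using slp.add[OF Y'(1) av[OF add(2)] av[OF add(3)]] Y'(2)
    by (intro exI[of _ "insert (\<lambda>e. f (h e) + g (h e)) Y'"]) (auto intro: avail_mono avail_mem)
next
  case (sub c Z f g)
  then obtain Y' where Y': "slp ((\<lambda>f e. f (h e)) ` X) c Y'" "\<forall>f\<in>Z. avail Y' (\<lambda>e. f (h e))" by auto
  have av: "avail Y' (\<lambda>e. k (h e))" if "avail Z k" for k using that Y'(2) by (auto simp: avail_def)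
  show ?case using slp.sub[OF Y'(1) av[OF sub(2)] av[OF sub(3)]] Y'(2)
    by (intro exI[of _ "insert (\<lambda>e. f (h e) - g (h e)) Y'"]) (auto intro: avail_mono avail_mem)
next
  case (mul c Z f g)
  then obtain Y' where Y': "slp ((\<lambda>f e. f (h e)) ` X) c Y'" "\<forall>f\<in>Z. avail Y' (\<lambda>e. f (h e))" by auto
  have av: "avail Y' (\<lambda>e. k (h e))" if "avail Z k" for k using that Y'(2) by (auto simp: avail_def)
  show ?case using slp.mul[OF Y'(1) av[OF mul(2)] av[OF mul(3)]] Y'(2)
    by (intro exI[of _ "insert (\<lambda>e. f (h e) * g (h e)) Y'"]) (auto intro: avail_mono avail_mem)
qed

lemma cost_subst:
  assumes "cost X c Z"
  shows "cost ((\<lambda>f e. f (h e)) ` X) c ((\<lambda>f e. f (h e)) ` Z)"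
proof -
  obtain c1 Y1 where 1: "slp X c1 Y1" "c1 \<le> c" "\<forall>f\<in>Z. avail Y1 f"
    using assms by (auto simp: cost_def)
  obtain Y' where Y': "slp ((\<lambda>f e. f (h e)) ` X) c1 Y'" "\<forall>f\<in>Y1. avail Y' (\<lambda>e. f (h e))"
    using slp_subst[OF 1(1)] by blast
  have av: "avail Y' (\<lambda>e. k (h e))" if "avail Y1 k" for k using that Y'(2) by (auto simp: avail_def)
  show ?thesis unfolding cost_def
    by (intro exI[of _ c1] exI[of _ Y']) (use Y'(1) 1 av in auto)
qed

text \<open>A complex product takes four real multiplications and two real additions.\<close>

lemma slp_Re_Im:
  fixes X :: "('e \<Rightarrow> complex) set" and X' :: "('e \<Rightarrow> real) set"
  assumes "slp X c Y" "\<forall>f\<in>X. avail X' (\<lambda>e. Re (f e)) \<and> avail X' (\<lambda>e. Im (f e))"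
  shows "cost X' (6 * c) ((\<lambda>f e. Re (f e)) ` Y \<union> (\<lambda>f e. Im (f e)) ` Y)"
  using assms(1)
proof (induction rule: slp.induct)
  case base
  then show ?case using assms(2) by (auto intro!: cost_0)
next
  case (add c Y f g)
  let ?Z = "(\<lambda>f e. Re (f e)) ` Y \<union> (\<lambda>f e. Im (f e)) ` Y"
  have av: "avail ?Z (\<lambda>e. Re (k e))" "avail ?Z (\<lambda>e. Im (k e))" if "avail Y k" for k
    using that by (auto simp: avail_def)
  have "cost ?Z (0 + (1 + 1)) (?Z \<union> ({\<lambda>e. Re (f e) + Re (g e)} \<union> {\<lambda>e. Im (f e) + Im (g e)}))"
    by (intro cost_union cost_add av add cost_0) (auto intro: avail_mem)
  from cost_trans[OF add.IH this] show ?case by (rule cost_mono) auto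
next
  case (sub c Y f g)
  let ?Z = "(\<lambda>f e. Re (f e)) ` Y \<union> (\<lambda>f e. Im (f e)) ` Y"
  have av: "avail ?Z (\<lambda>e. Re (k e))" "avail ?Z (\<lambda>e. Im (k e))" if "avail Y k" for k
    using that by (auto simp: avail_def)
  have "cost ?Z (0 + (1 + 1)) (?Z \<union> ({\<lambda>e. Re (f e) - Re (g e)} \<union> {\<lambda>e. Im (f e) - Im (g e)}))"
    by (intro cost_union cost_diff av sub cost_0) (auto intro: avail_mem)
  from cost_trans[OF sub.IH this] show ?case by (rule cost_mono) auto
next
  case (mul c Y f g)
  let ?Z = "(\<lambda>f e. Re (f e)) ` Y \<union> (\<lambda>f e. Im (f e)) ` Y"
  have av: "avail ?Z (\<lambda>e. Re (k e))" "avail ?Z (\<lambda>e. Im (k e))" if "avail Y k" for k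
    using that by (auto simp: avail_def)
  have m: "cost ?Z 1 {\<lambda>e. p e * q e}" if "avail ?Z p" "avail ?Z q" for p q
    unfolding cost_def using slp.mul[OF slp.base that]
    by (intro exI[of _ "Suc 0"] exI[of _ "insert (\<lambda>e. p e * q e) ?Z"]) (auto intro: avail_mem)
  let ?W = "?Z \<union> ({\<lambda>e. Re (f e) * Re (g e)} \<union> ({\<lambda>e. Im (f e) * Im (g e)} \<union>
     ({\<lambda>e. Re (f e) * Im (g e)} \<union> {\<lambda>e. Im (f e) * Re (g e)})))"
  have "cost ?Z (0 + (1 + (1 + (1 + 1)))) ?W"
    by (intro cost_union m av mul cost_0) (auto intro: avail_mem)
  moreover have "cost ?W (0 + (1 + 1)) (?Z \<union>
     ({\<lambda>e. Re (f e) * Re (g e) - Im (f e) * Im (g e)} \<union> {\<lambda>e. Re (f e) * Im (g e) + Im (f e) * Re (g e)}))"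
    by (intro cost_union cost_add cost_diff cost_0) (auto intro: avail_mem)
  ultimately have "cost ?Z 6 (?Z \<union>
     ({\<lambda>e. Re (f e) * Re (g e) - Im (f e) * Im (g e)} \<union> {\<lambda>e. Re (f e) * Im (g e) + Im (f e) * Re (g e)}))"
    by (rule cost_mono[OF cost_trans]) auto
  from cost_trans[OF mul.IH this] show ?case by (rule cost_mono) auto
qed

lemma cost_Re:
  assumes "cost X c Z" "\<forall>f\<in>X. avail X' (\<lambda>e. Re (f e)) \<and> avail X' (\<lambda>e. Im (f e))"
  shows "cost X' (6 * c) ((\<lambda>f e. Re (f e)) ` Z)"
proof -
  obtain c1 Y1 where 1: "slp X c1 Y1" "c1 \<le> c" "\<forall>f\<in>Z. avail Y1 f"
    using assms by (auto simp: cost_def)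
  let ?Z = "(\<lambda>f e. Re (f e)) ` Y1 \<union> (\<lambda>f e. Im (f e)) ` Y1"
  have "cost ?Z 0 ((\<lambda>f e. Re (f e)) ` Z)"
    using 1(3) by (intro cost_0) (auto simp: avail_def)
  from cost_trans[OF slp_Re_Im[OF 1(1) assms(2)] this] show ?thesis
    by (rule cost_mono) (use 1 in auto)
qed

section \<open>From computed functions to instruction lists\<close>

lemma run_append: "run A (p @ [c]) = run A p @ [instruction_value A (run A p) c]"
  by (simp add: run_def)

lemma length_run: "length (run A p) = length p"
  by (induction p rule: rev_induct) (auto simp: run_append run_def)

text \<open>A register that is not yet filled reads as 0 and would change its value when the program
  grows; operands with this property keep theirs.\<close>

fun operand_ok :: "nat \<Rightarrow> 'a operand \<Rightarrow> bool" where
  "operand_ok n (Reg t) = (t < n)"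
| "operand_ok n _ = True"

lemma operand_value_append:
  "operand_ok (length regs) o' \<Longrightarrow> operand_value A (regs @ rs) o' = operand_value A regs o'"
  by (cases o') (auto simp: nth_append)

lemma operand_ok_mono: "operand_ok n o' \<Longrightarrow> n \<le> n' \<Longrightarrow> operand_ok n' o'"
  by (cases o') auto

definition located :: "'a::comm_ring_1 instruction list \<Rightarrow> ('a mat \<Rightarrow> 'a) \<Rightarrow> bool" where
  "located p f \<longleftrightarrow> (\<exists>o'. operand_ok (length p) o' \<and> (\<forall>A. operand_value A (run A p) o' = f A))"

lemma located_avail: "avail Y f \<Longrightarrow> \<forall>g\<in>Y. located p g \<Longrightarrow> located p f"
proof (unfold avail_def, elim disjE exE)
  fix s assume "f = (\<lambda>_. s)"
  then show ?thesis unfolding located_def by (intro exI[of _ "Scalar s"]) auto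
qed auto

lemma located_append: "located p f \<Longrightarrow> located (p @ [c]) f"
  unfolding located_def
  by (metis length_append length_run operand_ok_mono operand_value_append run_append le_add1)

lemma located_new:
  assumes "\<And>A. instruction_value A (run A p) c = f A"
  shows "located (p @ [c]) f"
  unfolding located_def
  by (intro exI[of _ "Reg (length p)"]) (auto simp: run_append length_run nth_append assms)

text \<open>Stated through \<open>operand_value\<close> with its default 0, because
  \<open>located\<close> compares functions on all matrices and not only on those of the right
  format.\<close>

definition matrix_entries :: "nat \<Rightarrow> nat \<Rightarrow> ('a::comm_ring_1 mat \<Rightarrow> 'a) set" where
  "matrix_entries n d = {\<lambda>A. operand_value A [] (Input i j) | i j. i < n \<and> j < d}"

lemma slp_program:
  assumes "slp (matrix_entries n d) c Y"
  shows "\<exists>p. length p = c \<and> (\<forall>f\<in>Y. located p f)"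
  using assms
proof (induction rule: slp.induct)
  case base
  have "located [] (\<lambda>A. operand_value A [] (Input i j))" for i j
    unfolding located_def by (intro exI[of _ "Input i j"]) (auto simp: run_def)
  then show ?case by (intro exI[of _ "[]"]) (auto simp: matrix_entries_def simp del: operand_value.simps)
next
  case (add c Y f g)
  then obtain p where p: "length p = c" "\<forall>f\<in>Y. located p f" by auto
  obtain o1 o2 where o: "\<forall>A. operand_value A (run A p) o1 = f A" "\<forall>A. operand_value A (run A p) o2 = g A"
    using located_avail[OF add(2) p(2)] located_avail[OF add(3) p(2)] by (auto simp: located_def)
  have "located (p @ [Add o1 o2]) (\<lambda>A. f A + g A)" by (rule located_new) (use o in auto)
  then show ?case using p by (intro exI[of _ "p @ [Add o1 o2]"]) (auto intro: located_append)
next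
  case (sub c Y f g)
  then obtain p where p: "length p = c" "\<forall>f\<in>Y. located p f" by auto
  obtain o1 o2 where o: "\<forall>A. operand_value A (run A p) o1 = f A" "\<forall>A. operand_value A (run A p) o2 = g A"
    using located_avail[OF sub(2) p(2)] located_avail[OF sub(3) p(2)] by (auto simp: located_def)
  have "located (p @ [Sub o1 o2]) (\<lambda>A. f A - g A)" by (rule located_new) (use o in auto)
  then show ?case using p by (intro exI[of _ "p @ [Sub o1 o2]"]) (auto intro: located_append)
next
  case (mul c Y f g)
  then obtain p where p: "length p = c" "\<forall>f\<in>Y. located p f" by auto
  obtain o1 o2 where o: "\<forall>A. operand_value A (run A p) o1 = f A" "\<forall>A. operand_value A (run A p) o2 = g A"
    using located_avail[OF mul(2) p(2)] located_avail[OF mul(3) p(2)] by (auto simp: located_def)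
  have "located (p @ [Mul o1 o2]) (\<lambda>A. f A * g A)" by (rule located_new) (use o in auto)
  then show ?case using p by (intro exI[of _ "p @ [Mul o1 o2]"]) (auto intro: located_append)
qed

lemma cost_program:
  assumes "cost (matrix_entries n d) c Z"
  shows "\<exists>p. length p \<le> c \<and> (\<forall>f\<in>Z. located p f)"
  using assms slp_program located_avail unfolding cost_def by metis

text \<open>Row vector times the matrix \<open>K\<close>: \<open>I\<close> indexes the inputs and
  \<open>J\<close> the outputs, as for one row of \<open>A\<close> times \<Omega>. The environment
  is the vector itself, so that other functions can be substituted for its entries.\<close>

definition linop :: "nat set \<Rightarrow> nat set \<Rightarrow> (nat \<Rightarrow> nat \<Rightarrow> complex) \<Rightarrow> nat \<Rightarrow> bool" where
  "linop I J K c \<longleftrightarrow> cost ((\<lambda>i e. e i) ` I) c ((\<lambda>j e. \<Sum>i\<in>I. K i j * e i) ` J)"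

lemma linop_cost:
  assumes "linop I J K c" "\<And>i. i \<in> I \<Longrightarrow> avail X (x i)"
  shows "cost X c ((\<lambda>j e. \<Sum>i\<in>I. K i j * x i e) ` J)"
proof -
  have "cost ((\<lambda>f e. f (\<lambda>i. x i e)) ` ((\<lambda>i e. e i) ` I)) c
      ((\<lambda>f e. f (\<lambda>i. x i e)) ` ((\<lambda>j e. \<Sum>i\<in>I. K i j * e i) ` J))"
    by (rule cost_subst) (use assms(1) in \<open>simp add: linop_def\<close>)
  then have "cost (x ` I) c ((\<lambda>j e. \<Sum>i\<in>I. K i j * x i e) ` J)"
    by (simp add: image_image)
  then show ?thesis by (rule cost_weaken) (use assms(2) in auto)
qed

lemma linopI:
  assumes "cost ((\<lambda>i e. e i) ` I) c ((\<lambda>j e. f j e) ` J)"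
    and "\<And>j e. j \<in> J \<Longrightarrow> f j e = (\<Sum>i\<in>I. K i j * e i)"
  shows "linop I J K c"
proof -
  have "(\<lambda>j e. f j e) ` J = (\<lambda>j e. \<Sum>i\<in>I. K i j * e i) ` J"
    using assms(2) by (intro image_cong) auto
  then show ?thesis using assms(1) by (simp add: linop_def)
qed

lemma linop_mono: "linop I J K c \<Longrightarrow> c \<le> c' \<Longrightarrow> J' \<subseteq> J \<Longrightarrow> linop I J' K c'"
  unfolding linop_def by (erule cost_mono) auto

section \<open>Fast transforms\<close>

lemma linop_comp:
  assumes "linop I J K c" "linop J L K' c'"
  shows "linop I L (\<lambda>i l. \<Sum>j\<in>J. K i j * K' j l) (c + c')"
proof (rule linopI)
  show "cost ((\<lambda>i e. e i) ` I) (c + c') ((\<lambda>l e. \<Sum>j\<in>J. K' j l * (\<Sum>i\<in>I. K i j * e i)) ` L)"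
    by (rule cost_trans[OF assms(1)[unfolded linop_def]], rule linop_cost[OF assms(2)])
       (auto intro: avail_mem)
next
  fix l e
  have "(\<Sum>j\<in>J. K' j l * (\<Sum>i\<in>I. K i j * e i)) = (\<Sum>j\<in>J. \<Sum>i\<in>I. K i j * K' j l * e i)"
    by (simp add: sum_distrib_left mult_ac)
  also have "\<dots> = (\<Sum>i\<in>I. \<Sum>j\<in>J. K i j * K' j l * e i)" by (rule sum.swap)
  finally show "(\<Sum>j\<in>J. K' j l * (\<Sum>i\<in>I. K i j * e i)) = (\<Sum>i\<in>I. (\<Sum>j\<in>J. K i j * K' j l) * e i)"
    by (simp add: sum_distrib_right)
qed

lemma linop_scale_in:
  assumes "linop I J K c" "finite I"
  shows "linop I J (\<lambda>i j. a i * K i j) (card I + c)"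
proof (rule linopI)
  have "cost ((\<lambda>i e. e i) ` I) (card I * 1) ((\<lambda>i e. a i * e i) ` I)"
    by (intro cost_image cost_scale assms avail_mem) auto
  then have s: "cost ((\<lambda>i e. e i) ` I) (card I) ((\<lambda>i e. a i * e i) ` I)" by simp
  show "cost ((\<lambda>i e. e i) ` I) (card I + c) ((\<lambda>j e. \<Sum>i\<in>I. K i j * (a i * e i)) ` J)"
    by (rule cost_trans[OF s], rule linop_cost[OF assms(1)]) (auto intro: avail_mem)
qed (simp add: mult_ac)

lemma linop_scale_out:
  assumes "linop I J K c" "finite J"
  shows "linop I J (\<lambda>i j. K i j * b j) (c + card J)"
proof (rule linopI)
  have "cost ((\<lambda>j e. \<Sum>i\<in>I. K i j * e i) ` J) (card J * 1) ((\<lambda>j e. b j * (\<Sum>i\<in>I. K i j * e i)) ` J)"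
    by (intro cost_image cost_scale assms avail_mem) auto
  from cost_trans[OF assms(1)[unfolded linop_def] this]
  show "cost ((\<lambda>i e. e i) ` I) (c + card J) ((\<lambda>j e. b j * (\<Sum>i\<in>I. K i j * e i)) ` J)" by simp
qed (simp add: mult_ac sum_distrib_left)

lemma linop_add:
  assumes "linop I J K c" "linop I J K' c'" "finite J"
  shows "linop I J (\<lambda>i j. K i j + K' i j) (c + c' + card J)"
proof (rule linopI)
  let ?f = "\<lambda>K j e. \<Sum>i\<in>I. K i j * e i"
  have "cost (?f K ` J \<union> ?f K' ` J) (card J * 1) ((\<lambda>j e. ?f K j e + ?f K' j e) ` J)"
    by (intro cost_image cost_add assms avail_mem) auto
  from cost_trans[OF cost_union[OF assms(1,2)[unfolded linop_def]] this]
  show "cost ((\<lambda>i e. e i) ` I) (c + c' + card J) ((\<lambda>j e. ?f K j e + ?f K' j e) ` J)" by simp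
qed (simp add: sum.distrib distrib_right)

lemma linop_cong:
  "linop I J K c \<Longrightarrow> (\<And>i j. i \<in> I \<Longrightarrow> j \<in> J \<Longrightarrow> K i j = K' i j) \<Longrightarrow> linop I J K' c"
  by (rule linopI[of I c "\<lambda>j e. \<Sum>i\<in>I. K i j * e i"]) (auto simp: linop_def intro!: sum.cong)

section \<open>Fast Fourier transform, circulant and Toeplitz matrices\<close>

lemma sum_split_parity:
  fixes g :: "nat \<Rightarrow> 'a::comm_monoid_add"
  shows "(\<Sum>i<2*h. g i) = (\<Sum>i<h. g (2*i)) + (\<Sum>i<h. g (2*i+1))"
  by (induction h) (auto simp: add_ac)

text \<open>Radix two Cooley-Tukey recursion, with one multiplication and one addition per output
  and level. Any \<open>w\<close> with w^(2^p) = 1 is allowed, so the same bound serves the inverse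
  transform.\<close>

lemma linop_fft:
  assumes "w ^ (2^p) = 1"
  shows "linop {..<2^p} {..<2^p} (\<lambda>i j. w ^ (i*j)) (2 * p * 2^p)"
  using assms
proof (induction p arbitrary: w)
  case 0
  then show ?case by (intro linopI[of _ _ "\<lambda>j e. e 0"]) (auto intro!: cost_0 avail_mem)
next
  case (Suc p)
  define h where "h = (2::nat)^p"
  have IH: "linop {..<h} {..<h} (\<lambda>i j. (w^2) ^ (i*j)) (2 * p * h)"
    unfolding h_def by (rule Suc.IH) (use Suc.prems in \<open>simp add: power_mult[symmetric]\<close>)
  define X where "X = ((\<lambda>i (e::nat\<Rightarrow>complex). e i) ` {..<2*h})"
  define E where "E = (\<lambda>j (e::nat\<Rightarrow>complex). \<Sum>i<h. (w^2)^(i*j) * e (2*i))"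
  define D where "D = (\<lambda>j (e::nat\<Rightarrow>complex). \<Sum>i<h. (w^2)^(i*j) * e (2*i+1))"
  have "cost X (2*p*h) (E ` {..<h})" unfolding E_def
    by (rule linop_cost[OF IH, of X "\<lambda>i e. e (2*i)"]) (auto simp: X_def intro!: avail_mem)
  moreover have "cost X (2*p*h) (D ` {..<h})" unfolding D_def
    by (rule linop_cost[OF IH, of X "\<lambda>i e. e (2*i+1)"]) (auto simp: X_def intro!: avail_mem)
  ultimately have 1: "cost X (2*p*h + 2*p*h) (E ` {..<h} \<union> D ` {..<h})"
    by (rule cost_union)
  have h0: "h > 0" by (simp add: h_def)
  have "cost (E ` {..<h} \<union> D ` {..<h}) (card {..<2*h} * 2)
      ((\<lambda>j e. E (j mod h) e + w^j * D (j mod h) e) ` {..<2*h})"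
  proof (rule cost_image)
    fix j assume "j \<in> {..<2*h}"
    have a: "avail (E ` {..<h} \<union> D ` {..<h}) (E (j mod h))" "avail (E ` {..<h} \<union> D ` {..<h}) (D (j mod h))"
      using h0 by (auto intro!: avail_mem)
    let ?S = "E ` {..<h} \<union> D ` {..<h} \<union> {\<lambda>e. w^j * D (j mod h) e}"
    have "cost (E ` {..<h} \<union> D ` {..<h}) (0+1) ?S"
      by (intro cost_union cost_scale a cost_0) (auto intro: avail_mem)
    moreover have "cost ?S 1 {\<lambda>e. E (j mod h) e + w^j * D (j mod h) e}"
      by (intro cost_add avail_mono[OF a(1)]) (auto intro: avail_mem)
    ultimately show "cost (E ` {..<h} \<union> D ` {..<h}) 2 {\<lambda>e. E (j mod h) e + w^j * D (j mod h) e}"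
      by (rule cost_mono[OF cost_trans]) auto
  qed auto
  from cost_trans[OF 1 this] have "cost X (2 * Suc p * (2*h)) ((\<lambda>j e. E (j mod h) e + w^j * D (j mod h) e) ` {..<2*h})"
    by (rule cost_mono) (auto simp: algebra_simps)
  moreover have "E (j mod h) e + w^j * D (j mod h) e = (\<Sum>i<2*h. w^(i*j) * e i)" for j e
  proof -
    have "(w^2)^h = 1" using Suc.prems by (simp add: h_def power_mult[symmetric])
    \<comment> \<open>The half transforms are computed only for indices below \<open>h\<close>;
      since the order of \<open>w^2\<close> divides \<open>h\<close>, reducing \<open>j\<close>
      modulo \<open>h\<close> does not change them.\<close>
    then have per: "(w^2)^(i*(j mod h)) = (w^2)^(i*j)" for i
    proof -
      have "i * j = i * (h * (j div h) + j mod h)" by simp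
      then have "i * j = i * (j mod h) + h * (i * (j div h))" by (simp only: distrib_left mult_ac add_ac)
      then have "(w^2)^(i*j) = (w^2)^(i*(j mod h)) * ((w^2)^h)^(i * (j div h))"
        by (simp only: power_add power_mult[symmetric] mult.assoc)
      then show ?thesis using \<open>(w^2)^h = 1\<close> by simp
    qed
    show ?thesis unfolding E_def D_def sum_split_parity per
      by (simp add: sum_distrib_left power_mult[symmetric] power_add algebra_simps)
  qed
  ultimately show ?case unfolding X_def h_def
    by (intro linopI) (auto simp: mult.commute)
qed

lemma sum_root_of_unity:
  fixes n m :: nat
  assumes "m < n"
  shows "(\<Sum>a<n. cis (2*pi/n) ^ (a*m)) = (if m = 0 then of_nat n else 0)"
proof (cases "m = 0")
  case False
  let ?z = "cis (2*pi*m/n)"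
  have n0: "n > 0" using assms by simp
  have z: "cis (2*pi/n) ^ (a*m) = ?z ^ a" for a
    by (simp add: Complex.DeMoivre mult_ac)
  have "?z \<noteq> 1"
  proof
    assume "?z = 1"
    then have "cos (2*pi*m/n) = 1" by (metis cis.simps(1) one_complex.simps(1))
    then obtain k :: int where k: "2*pi*m/n = of_int k * 2 * pi" using cos_one_2pi_int by blast
    then have "real m = of_int k * n" using n0 pi_gt_zero by (simp add: field_simps)
    then have "int m = k * int n" by (metis of_int_eq_iff of_int_mult of_int_of_nat_eq)
    then show False using assms False
      by (metis dvd_triv_right int_dvd_int_iff nat_dvd_not_less neq0_conv)
  qed
  moreover have "?z ^ n = 1"
  proof -
    have "?z ^ n = cis (2 * pi * real m)" using n0 by (simp add: Complex.DeMoivre)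
    then show ?thesis using cis_multiple_2pi[of "real m"] by simp
  qed
  ultimately have "(\<Sum>a<n. ?z ^ a) = 0" by (simp add: geometric_sum)
  then show ?thesis using False z by simp
qed (simp)

text \<open>Circulant matrices are diagonal in the Fourier basis: transform, multiply by the
  eigenvalues, transform back. The index \<open>j + (n - i)\<close> is j - i modulo n without
  leaving the naturals.\<close>

lemma linop_cyclic:
  fixes t :: "nat \<Rightarrow> complex" and p :: nat
  defines "n \<equiv> (2::nat)^p"
  shows "linop {..<n} {..<n} (\<lambda>i j. t ((j + (n - i)) mod n)) ((4*p+1)*n)"
proof -
  define w where "w = cis (2*pi/n)"
  have n0: "n > 0" by (simp add: n_def)
  have wn: "w ^ n = 1" unfolding w_def using n0 by (simp add: Complex.DeMoivre)
  define v where "v = inverse w"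
  have w0: "w \<noteq> 0" by (simp add: w_def)
  have vn: "v ^ n = 1" unfolding v_def by (simp add: power_inverse wn)
  have vw: "v ^ k * w ^ k = 1" for k by (simp add: v_def power_inverse w0)
  \<comment> \<open>The eigenvalues of the circulant, with the factor 1/n of the inverse transform
    absorbed. They do not depend on the input and are therefore free scalars.\<close>
  define s where "s = (\<lambda>a. (\<Sum>m<n. t m * w^(m*a)) / of_nat n)"
  have F: "linop {..<n} {..<n} (\<lambda>i a. w^(i*a)) (2*p*n)" unfolding n_def by (rule linop_fft) (use wn n_def in simp)
  have G: "linop {..<n} {..<n} (\<lambda>a j. v^(a*j)) (2*p*n)" unfolding n_def by (rule linop_fft) (use vn n_def in simp)
  have "linop {..<n} {..<n} (\<lambda>i j. \<Sum>a<n. w^(i*a) * s a * v^(a*j)) (2*p*n + card {..<n} + 2*p*n)"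
    by (rule linop_comp[OF linop_scale_out[OF F] G]) auto
  then have "linop {..<n} {..<n} (\<lambda>i j. \<Sum>a<n. w^(i*a) * s a * v^(a*j)) ((4*p+1)*n)"
    by (rule linop_mono) (auto simp: algebra_simps)
  then show ?thesis
  proof (rule linop_cong)
    fix i j assume ij: "i \<in> {..<n}" "j \<in> {..<n}"
    have per: "w ^ (k mod n) = w ^ k" for k
    proof -
      have "w ^ k = w ^ (n * (k div n) + k mod n)" by simp
      also have "\<dots> = w ^ (k mod n)" unfolding power_add power_mult wn by simp
      finally show ?thesis ..
    qed
    have orth: "(\<Sum>a<n. w^(i*a) * w^(m*a) * v^(a*j)) = (if m = (j + (n-i)) mod n then of_nat n else 0)"
      if "m < n" for m
    proof -
      let ?r = "(i + m + (n - j)) mod n"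
      have "w^(i*a) * w^(m*a) * v^(a*j) = w^(a*?r)" for a
      proof -
        have "w^(a*?r) = (w^((i+m+(n-j)) mod n))^a" by (simp only: power_mult[symmetric] mult.commute)
        also have "\<dots> = (w^(i+m+(n-j)))^a" by (simp add: per)
        also have "\<dots> = (w^(i+m+(n-j)))^a * (v^j * w^j)^a" by (simp add: vw)
        also have "\<dots> = (w^(i+m) * v^j * w^(n-j+j))^a" by (simp only: power_add power_mult_distrib mult_ac)
        also have "\<dots> = (w^(i+m) * v^j)^a" using ij wn by simp
        finally show ?thesis by (simp only: power_mult_distrib power_mult[symmetric] power_add distrib_left mult_ac)
      qed
      then have "(\<Sum>a<n. w^(i*a) * w^(m*a) * v^(a*j)) = (if ?r = 0 then of_nat n else 0)"
        using sum_root_of_unity[of ?r n] n0 by (simp add: w_def)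
      moreover have "?r = 0 \<longleftrightarrow> m = (j + (n-i)) mod n"
      proof -
        have "int ?r = (int i + int m - int j + int n) mod int n"
          using ij by (simp add: of_nat_diff zmod_int algebra_simps)
        then have "int ?r = (int i + int m - int j) mod int n" by simp
        moreover have "int ((j + (n-i)) mod n) = (int j - int i + int n) mod int n"
          using ij by (simp add: of_nat_diff zmod_int algebra_simps)
        then have "int ((j + (n-i)) mod n) = (int j - int i) mod int n" by simp
        moreover have "(int i + int m - int j) mod int n = 0 \<longleftrightarrow> int m mod int n = (int j - int i) mod int n"
          by (simp add: mod_eq_dvd_iff dvd_eq_mod_eq_0[symmetric] algebra_simps)
        ultimately show ?thesis using that by (metis of_nat_0_eq_iff of_nat_eq_iff of_nat_mod mod_less)
      qed
      ultimately show ?thesis by simp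
    qed
    have "(\<Sum>a<n. w^(i*a) * s a * v^(a*j)) = (\<Sum>a<n. \<Sum>m<n. t m / of_nat n * (w^(i*a) * w^(m*a) * v^(a*j)))"
      by (simp add: s_def sum_distrib_left sum_distrib_right sum_divide_distrib mult_ac)
    also have "\<dots> = (\<Sum>m<n. t m / of_nat n * (\<Sum>a<n. w^(i*a) * w^(m*a) * v^(a*j)))"
      by (subst sum.swap) (simp add: sum_distrib_left)
    also have "\<dots> = (\<Sum>m<n. if m = (j + (n-i)) mod n then t m else 0)"
      by (intro sum.cong) (auto simp: orth n0)
    also have "\<dots> = t ((j + (n-i)) mod n)" using n0 by simp
    finally show "(\<Sum>a<n. w^(i*a) * s a * v^(a*j)) = t ((j + (n-i)) mod n)" .
  qed
qed

text \<open>The matrix is a corner of a circulant of order 2^p: as a + b \<le> 2^p, nonnegative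
  differences have residues below \<open>b\<close> and negative ones have residues from
  \<open>b\<close> on, so they do not collide. The input is padded with zeros, which are scalars and
  cost nothing.\<close>

lemma linop_toeplitz_pow2:
  assumes "a + b \<le> 2^p"
  shows "linop {..<a} {..<b} (\<lambda>i j. \<tau> (int j - int i)) ((4*p+1)*2^p)"
proof -
  define n where "n = (2::nat)^p"
  define t where "t = (\<lambda>m. if m < b then \<tau> (int m) else \<tau> (int m - int n))"
  have C: "linop {..<n} {..<n} (\<lambda>i j. t ((j + (n - i)) mod n)) ((4*p+1)*n)"
    unfolding n_def by (rule linop_cyclic)
  let ?x = "\<lambda>i (e::nat\<Rightarrow>complex). if i < a then e i else 0"
  have "cost ((\<lambda>i e. e i) ` {..<a}) ((4*p+1)*n) ((\<lambda>j e. \<Sum>i<n. t ((j + (n - i)) mod n) * ?x i e) ` {..<n})"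
  proof (rule linop_cost[OF C])
    fix i show "avail ((\<lambda>i e. e i) ` {..<a}) (?x i)"
      by (cases "i < a") (auto intro: avail_mem)
  qed
  then have "cost ((\<lambda>i e. e i) ` {..<a}) ((4*p+1)*n) ((\<lambda>j e. \<Sum>i<n. t ((j + (n - i)) mod n) * ?x i e) ` {..<b})"
    by (rule cost_mono) (use assms n_def in auto)
  then show ?thesis unfolding n_def[symmetric]
  proof (rule linopI)
    fix j e assume j: "j \<in> {..<b}"
    have "(\<Sum>i<n. t ((j + (n - i)) mod n) * ?x i e) = (\<Sum>i\<in>{..<a}. t ((j + (n - i)) mod n) * ?x i e)"
      by (rule sum.mono_neutral_right) (use assms n_def in auto)
    also have "\<dots> = (\<Sum>i<a. \<tau> (int j - int i) * e i)"
    proof (rule sum.cong)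
      fix i assume i: "i \<in> {..<a}"
      have ab: "a + b \<le> n" using assms n_def by simp
      show "t ((j + (n - i)) mod n) * ?x i e = \<tau> (int j - int i) * e i"
      proof (cases "i \<le> j")
        case True
        have "(j + (n - i)) mod n = (j - i + n) mod n" using True i ab by (intro arg_cong[of _ _ "\<lambda>x. x mod n"]) auto
        also have "\<dots> = j - i" using i j ab by simp
        finally have "(j + (n - i)) mod n = j - i" .
        then show ?thesis using i j True by (auto simp: t_def of_nat_diff)
      next
        case False
        have "(j + (n - i)) mod n = j + (n - i)" using False i j ab by (intro mod_less) auto
        moreover have "\<not> j + (n - i) < b" using i j ab by auto
        moreover have "int (j + (n - i)) - int n = int j - int i" using i ab by auto
        ultimately show ?thesis using i by (auto simp: t_def)
      qed
    qed simp
    finally show "(\<Sum>i<n. t ((j + (n - i)) mod n) * ?x i e) = (\<Sum>i<a. \<tau> (int j - int i) * e i)" .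
  qed
qed

text \<open>Bluestein's identity 2ij = i^2 + j^2 - (j - i)^2 makes the kernel a Toeplitz matrix
  between two diagonal scalings. Thus power of two transforms suffice for every \<open>d\<close>;
  the even exponent avoids a square root of \<open>u\<close>.\<close>

lemma linop_chirp_pow2:
  fixes u :: complex
  assumes "2 * d \<le> 2^p" "u \<noteq> 0"
  shows "linop {..<d} {..<d} (\<lambda>i j. u ^ (2*i*j)) (2*d + (4*p+1)*2^p)"
proof -
  have "linop {..<d} {..<d} (\<lambda>i j. u^(i^2) * inverse u ^ nat ((int j - int i)^2) * u^(j^2))
    (card {..<d} + (4*p+1)*2^p + card {..<d})"
    by (intro linop_scale_out linop_scale_in linop_toeplitz_pow2[of d d p "\<lambda>z. inverse u ^ nat (z^2)"])
       (use assms in auto)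
  then have "linop {..<d} {..<d} (\<lambda>i j. u^(i^2) * inverse u ^ nat ((int j - int i)^2) * u^(j^2)) (2*d + (4*p+1)*2^p)"
    by (rule linop_mono) auto
  then show ?thesis
  proof (rule linop_cong)
    fix i j
    let ?k = "nat ((int j - int i)^2)"
    have "int ?k = (int j - int i)^2" by simp
    then have "int (i^2 + j^2) = int (?k + 2*i*j)" unfolding of_nat_add by (simp add: power2_eq_square algebra_simps)
    then have "i^2 + j^2 = ?k + 2*i*j" by (simp only: of_nat_eq_iff)
    then have "u^(i^2) * u^(j^2) = u^?k * u^(2*i*j)" by (metis power_add)
    then show "u^(i^2) * inverse u ^ ?k * u^(j^2) = u^(2*i*j)"
      using assms(2) by (simp add: power_inverse field_simps)
  qed
qed

section \<open>Evaluation of one polynomial at few points\<close>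

text \<open>Multiplication by $x^m$ modulo a monic polynomial of degree \<open>m\<close> is the product of two
  triangular Toeplitz matrices: the quotient is read off from the inverse of the reversed
  polynomial, and the low coefficients of quotient times modulus give the remainder.\<close>

lemma shift_mod_poly:
  fixes z :: "nat \<Rightarrow> complex" and a :: "nat \<Rightarrow> complex" and m :: nat
  defines "M \<equiv> \<Prod>j<m. [:- z j, 1:]"
  defines "t \<equiv> inverse (Abs_fps (\<lambda>e. if e \<le> m then coeff M (m - e) else 0))"
  defines "q \<equiv> \<lambda>i. \<Sum>i'<m. (if int i - int i' \<le> 0 then fps_nth t (nat (- (int i - int i'))) else 0) * a i'"
  assumes j: "j < m"
  shows "(\<Sum>s<m. (\<Sum>i<m. (if int s - int i \<ge> 0 then - coeff M (nat (int s - int i)) else 0) * q i) * z j ^ s)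
    = z j ^ m * (\<Sum>i<m. a i * z j ^ i)"
proof -
  have degM: "degree M = m" unfolding M_def by (subst degree_prod_eq_sum_degree) auto
  have "lead_coeff M = 1" unfolding M_def lead_coeff_prod by simp
  then have leadM: "coeff M m = 1" using degM by simp
  define R where "R = Abs_fps (\<lambda>e. if e \<le> m then coeff M (m - e) else 0)"
  \<comment> \<open>\<open>R\<close> is the reversed polynomial. Its constant term is the leading
    coefficient 1 of \<open>M\<close>, so it is invertible as a power series.\<close>
  have Rt: "R * t = 1" unfolding t_def R_def
    by (subst mult.commute, rule inverse_mult_eq_1) (simp add: leadM)
  define Pa where "Pa = (\<Sum>i<m. monom (a i) i)"
  define Q where "Q = (\<Sum>i<m. monom (q i) i)"
  have cPa: "coeff Pa n = (if n < m then a n else 0)" for n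
    unfolding Pa_def by (simp add: coeff_sum if_distrib cong: if_cong)
  have cQ: "coeff Q n = (if n < m then q n else 0)" for n
    unfolding Q_def by (simp add: coeff_sum if_distrib cong: if_cong)
  \<comment> \<open>\<open>Q\<close> is the claimed quotient, and \<open>D\<close> agrees with x^m
    times \<open>Pa\<close> at every root of \<open>M\<close>. It remains to see that
    \<open>D\<close> has degree below \<open>m\<close> and that its low coefficients are those of
    the second Toeplitz product.\<close>
  define D where "D = monom 1 m * Pa - Q * M"
  have M0: "coeff M n = 0" if "n > m" for n using that degM by (simp add: coeff_eq_0)
  have low: "coeff D s = (\<Sum>i<m. (if int s - int i \<ge> 0 then - coeff M (nat (int s - int i)) else 0) * q i)"
    if s: "s < m" for s
  proof -
    have "coeff D s = - (\<Sum>i\<le>s. coeff Q i * coeff M (s - i))"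
      unfolding D_def using s by (simp add: coeff_monom_mult coeff_mult)
    also have "(\<Sum>i\<le>s. coeff Q i * coeff M (s - i)) = (\<Sum>i\<le>s. q i * coeff M (s - i))"
      using s by (intro sum.cong) (auto simp: cQ)
    also have "- \<dots> = (\<Sum>i\<in>{..s}. (if int s - int i \<ge> 0 then - coeff M (nat (int s - int i)) else 0) * q i)"
      unfolding sum_negf[symmetric] by (intro sum.cong) (auto simp: nat_diff_distrib' mult.commute)
    also have "\<dots> = (\<Sum>i<m. (if int s - int i \<ge> 0 then - coeff M (nat (int s - int i)) else 0) * q i)"
      by (rule sum.mono_neutral_left) (use s in auto)
    finally show ?thesis .
  qed
  \<comment> \<open>The coefficient of \<open>Q * M\<close> at x^(m+s) is a correlation of
    \<open>q\<close> with the reversed polynomial. Inserting \<open>q\<close> and exchanging the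
    sums produces the convolution \<open>R * t\<close> = 1, which leaves \<open>a s\<close>.\<close>
  have high: "coeff D (m + s) = 0" for s
  proof (cases "s < m")
    case False
    have "coeff Q i * coeff M (m + s - i) = 0" for i
      using False M0[of "m + s - i"] by (cases "i < m") (auto simp: cQ)
    then show ?thesis using False unfolding D_def by (simp add: coeff_monom_mult coeff_mult cPa)
  next
    case True
    have "coeff (Q * M) (m + s) = (\<Sum>i\<le>m+s. coeff Q i * coeff M (m + s - i))"
      by (simp add: coeff_mult)
    also have "\<dots> = (\<Sum>i<m. coeff Q i * coeff M (m + s - i))"
      by (rule sum.mono_neutral_right) (auto simp: cQ)
    also have "\<dots> = (\<Sum>i<m. if s \<le> i then q i * fps_nth R (i - s) else 0)"
      by (intro sum.cong) (auto simp: cQ R_def M0)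
    also have "\<dots> = (\<Sum>i<m. \<Sum>i'<m. if s \<le> i \<and> i \<le> i' then a i' * (fps_nth R (i - s) * fps_nth t (i' - i)) else 0)"
      unfolding q_def by (intro sum.cong refl) (auto simp: sum_distrib_right sum_distrib_left nat_diff_distrib' mult_ac intro!: sum.cong)
    also have "\<dots> = (\<Sum>i'<m. \<Sum>i<m. if s \<le> i \<and> i \<le> i' then a i' * (fps_nth R (i - s) * fps_nth t (i' - i)) else 0)"
      by (rule sum.swap)
    also have "\<dots> = (\<Sum>i'<m. if i' = s then a s else 0)"
    proof (intro sum.cong refl)
      fix i' assume i': "i' \<in> {..<m}"
      have "(\<Sum>i<m. if s \<le> i \<and> i \<le> i' then a i' * (fps_nth R (i - s) * fps_nth t (i' - i)) else 0)
          = (\<Sum>i\<in>{s..i'}. a i' * (fps_nth R (i - s) * fps_nth t (i' - i)))"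
        by (subst sum.inter_filter[symmetric]) (use i' in \<open>auto intro!: sum.cong\<close>)
      also have "\<dots> = (if i' = s then a s else 0)"
      proof (cases "s \<le> i'")
        case True
        have "(\<Sum>i\<in>{s..i'}. a i' * (fps_nth R (i - s) * fps_nth t (i' - i)))
            = a i' * (\<Sum>e\<in>{0..i'-s}. fps_nth R e * fps_nth t (i' - s - e))"
          unfolding sum_distrib_left
          by (rule sum.reindex_bij_witness[of _ "\<lambda>e. e + s" "\<lambda>i. i - s"]) (use True in auto)
        also have "\<dots> = a i' * fps_nth (R * t) (i' - s)" by (simp add: fps_mult_nth)
        finally show ?thesis using True by (auto simp: Rt)
      qed auto
      finally show "(\<Sum>i<m. if s \<le> i \<and> i \<le> i' then a i' * (fps_nth R (i - s) * fps_nth t (i' - i)) else 0)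
          = (if i' = s then a s else 0)" .
    qed
    also have "\<dots> = a s" using True by simp
    finally show ?thesis using True unfolding D_def by (simp add: coeff_monom_mult cPa)
  qed
  have Dc: "coeff D n = 0" if "n \<ge> m" for n using high[of "n - m"] that by simp
  have "poly D (z j) = (\<Sum>s<m. coeff D s * z j ^ s)"
  proof -
    have "D = (\<Sum>s<m. monom (coeff D s) s)"
      by (rule poly_eqI) (auto simp: coeff_sum if_distrib Dc cong: if_cong)
    then have "poly D (z j) = poly (\<Sum>s<m. monom (coeff D s) s) (z j)" by simp
    then show ?thesis by (simp add: poly_sum poly_monom)
  qed
  moreover have "poly M (z j) = 0" unfolding M_def poly_prod using j by (auto intro!: prod_zero)
  then have "poly D (z j) = z j ^ m * (\<Sum>i<m. a i * z j ^ i)"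
    unfolding D_def Pa_def by (simp add: poly_monom poly_sum)
  ultimately show ?thesis using low by simp
qed

lemma sum_lessThan_add:
  fixes g :: "nat \<Rightarrow> 'a::comm_monoid_add"
  shows "(\<Sum>i<m+n. g i) = (\<Sum>i<m. g i) + (\<Sum>i<n. g (m+i))"
  by (induction n) (auto simp: add_ac)

text \<open>Horner's scheme on blocks of \<open>m\<close> coefficients; the induction peels off the
  lowest block. \<open>R\<close> lists the coefficients of a polynomial of degree below
  \<open>m\<close> with the right values at the points. Only these values matter, so the points may
  coincide.\<close>

lemma cost_horner:
  fixes z :: "nat \<Rightarrow> complex"
  assumes "2 * m \<le> 2^p"
  shows "\<exists>R :: nat \<Rightarrow> (nat \<Rightarrow> complex) \<Rightarrow> complex.
    cost ((\<lambda>i e. e i) ` {..<b*m}) (b * (2 * ((4*p+1) * 2^p) + m)) (R ` {..<m}) \<and>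
    (\<forall>e. \<forall>j<m. (\<Sum>s<m. R s e * z j ^ s) = (\<Sum>i<b*m. e i * z j ^ i))"
proof (induction b)
  case 0
  show ?case by (intro exI[of _ "\<lambda>_ _. 0"]) (auto intro: cost_0)
next
  case (Suc b)
  then obtain R :: "nat \<Rightarrow> (nat \<Rightarrow> complex) \<Rightarrow> complex" where
    R: "cost ((\<lambda>i e. e i) ` {..<b*m}) (b * (2 * ((4*p+1) * 2^p) + m)) (R ` {..<m})"
    "\<And>e j. j < m \<Longrightarrow> (\<Sum>s<m. R s e * z j ^ s) = (\<Sum>i<b*m. e i * z j ^ i)" by blast
  define X where "X = (\<lambda>i (e::nat\<Rightarrow>complex). e i) ` {..<Suc b*m}"
  define M where "M = (\<Prod>j<m. [:- z j, 1:])"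
  define t where "t = inverse (Abs_fps (\<lambda>e. if e \<le> m then coeff M (m - e) else 0))"
  define K1 where "K1 = (\<lambda>k::int. if k \<le> 0 then fps_nth t (nat (-k)) else 0)"
  define K2 where "K2 = (\<lambda>k::int. if k \<ge> 0 then - coeff M (nat k) else 0)"
  define A where "A = (\<lambda>s (e::nat\<Rightarrow>complex). R s (\<lambda>i. e (m + i)))"
  define Q where "Q = (\<lambda>j e. \<Sum>i<m. K1 (int j - int i) * A i e)"
  define V where "V = (\<lambda>j e. \<Sum>i<m. K2 (int j - int i) * Q i e)"
  define R' where "R' = (\<lambda>s e. e s + V s e)"
  have A: "cost X (b * (2 * ((4*p+1) * 2^p) + m)) (A ` {..<m})"
  proof -
    have "cost ((\<lambda>f e. f (\<lambda>i. e (m + i))) ` ((\<lambda>i (e::nat\<Rightarrow>complex). e i) ` {..<b*m}))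
       (b * (2 * ((4*p+1) * 2^p) + m)) ((\<lambda>f e. f (\<lambda>i. e (m + i))) ` (R ` {..<m}))"
      by (rule cost_subst[OF R(1)])
    then have "cost ((\<lambda>i (e::nat\<Rightarrow>complex). e (m + i)) ` {..<b*m}) (b * (2 * ((4*p+1) * 2^p) + m)) (A ` {..<m})"
      by (simp add: image_image A_def)
    then show ?thesis by (rule cost_weaken) (auto simp: X_def intro!: avail_mem)
  qed
  have T: "linop {..<m} {..<m} (\<lambda>i j. K (int j - int i)) ((4*p+1) * 2^p)" for K
    by (rule linop_toeplitz_pow2) (use assms in simp)
  have Q: "cost (A ` {..<m}) ((4*p+1) * 2^p) (Q ` {..<m})"
    unfolding Q_def by (rule linop_cost[OF T]) (auto intro: avail_mem)
  have V: "cost (Q ` {..<m}) ((4*p+1) * 2^p) (V ` {..<m})"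
    unfolding V_def by (rule linop_cost[OF T]) (auto intro: avail_mem)
  have "cost X (0 + (b * (2 * ((4*p+1) * 2^p) + m) + ((4*p+1) * 2^p) + ((4*p+1) * 2^p))) (X \<union> V ` {..<m})"
    by (intro cost_union cost_trans[OF cost_trans[OF A Q] V] cost_0) (auto intro: avail_mem)
  moreover have "cost (X \<union> V ` {..<m}) (card {..<m} * 1) (R' ` {..<m})"
    unfolding R'_def by (intro cost_image cost_add) (auto simp: X_def intro!: avail_mem)
  ultimately have "cost X (0 + (b * (2 * ((4*p+1) * 2^p) + m) + ((4*p+1) * 2^p) + ((4*p+1) * 2^p)) + card {..<m} * 1) (R' ` {..<m})"
    by (rule cost_trans)
  then have "cost X (Suc b * (2 * ((4*p+1) * 2^p) + m)) (R' ` {..<m})"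
    by (rule cost_mono) auto
  moreover have "(\<Sum>s<m. R' s e * z j ^ s) = (\<Sum>i<Suc b*m. e i * z j ^ i)" if j: "j < m" for e j
  proof -
    have "(\<Sum>s<m. V s e * z j ^ s) = z j ^ m * (\<Sum>i<m. A i e * z j ^ i)"
      using shift_mod_poly[OF j, of z "\<lambda>i. A i e"]
      unfolding V_def Q_def K1_def K2_def t_def M_def by simp
    also have "\<dots> = z j ^ m * (\<Sum>i<b*m. e (m + i) * z j ^ i)"
      unfolding A_def using R(2)[OF j, of "\<lambda>i. e (m + i)"] by simp
    finally have "(\<Sum>s<m. R' s e * z j ^ s) = (\<Sum>s<m. e s * z j ^ s) + (\<Sum>i<b*m. e (m + i) * z j ^ (m + i))"
      unfolding R'_def distrib_right sum.distrib sum_distrib_left power_add by (simp only: mult_ac)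
    also have "\<dots> = (\<Sum>i<m+b*m. e i * z j ^ i)" by (rule sum_lessThan_add[symmetric])
    finally show ?thesis by simp
  qed
  ultimately show ?case unfolding X_def by (intro exI[of _ R']) blast
qed

text \<open>After the Horner steps only \<open>m\<close> coefficients are left, and evaluating them
  naively costs 2m^2. This is harmless in the application, where m^2 \<le> d.\<close>

lemma linop_vandermonde_pow2:
  fixes z :: "nat \<Rightarrow> complex"
  assumes "2 * m \<le> 2^p" "d \<le> b * m"
  shows "linop {..<d} {..<m} (\<lambda>i j. z j ^ i) (b * (2 * ((4*p+1) * 2^p) + m) + m * (2 * m))"
proof -
  obtain R :: "nat \<Rightarrow> (nat \<Rightarrow> complex) \<Rightarrow> complex" where
    R: "cost ((\<lambda>i e. e i) ` {..<b*m}) (b * (2 * ((4*p+1) * 2^p) + m)) (R ` {..<m})"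
    "\<And>e j. j < m \<Longrightarrow> (\<Sum>s<m. R s e * z j ^ s) = (\<Sum>i<b*m. e i * z j ^ i)"
    using cost_horner[OF assms(1), of b z] by blast
  have "cost (R ` {..<m}) (card {..<m} * (2 * card {..<m})) ((\<lambda>j e. \<Sum>s<m. z j ^ s * R s e) ` {..<m})"
    by (intro cost_image cost_lincomb) (auto intro: avail_mem)
  from cost_trans[OF R(1) this]
  have "cost ((\<lambda>i e. e i) ` {..<b*m}) (b * (2 * ((4*p+1) * 2^p) + m) + m * (2 * m)) ((\<lambda>j e. \<Sum>s<m. z j ^ s * R s e) ` {..<m})"
    by simp
  then have L: "linop {..<b*m} {..<m} (\<lambda>i j. z j ^ i) (b * (2 * ((4*p+1) * 2^p) + m) + m * (2 * m))"
  proof (rule linopI)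
    fix j e assume "j \<in> {..<m}"
    then show "(\<Sum>s<m. z j ^ s * R s e) = (\<Sum>i<b*m. z j ^ i * e i)"
      using R(2)[of j e] by (simp only: lessThan_iff mult.commute)
  qed
  let ?x = "\<lambda>i (e::nat\<Rightarrow>complex). if i < d then e i else 0"
  have "cost ((\<lambda>i e. e i) ` {..<d}) (b * (2 * ((4*p+1) * 2^p) + m) + m * (2 * m)) ((\<lambda>j e. \<Sum>i<b*m. z j ^ i * ?x i e) ` {..<m})"
  proof (rule linop_cost[OF L])
    fix i show "avail ((\<lambda>i e. e i) ` {..<d}) (?x i)"
      by (cases "i < d") (auto intro: avail_mem)
  qed
  then show ?thesis
  proof (rule linopI)
    fix j e
    have "(\<Sum>i<b*m. z j ^ i * ?x i e) = (\<Sum>i\<in>{..<d}. z j ^ i * ?x i e)"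
      by (rule sum.mono_neutral_right) (use assms(2) in auto)
    then show "(\<Sum>i<b*m. z j ^ i * ?x i e) = (\<Sum>i<d. z j ^ i * e i)" by simp
  qed
qed

lemma ex_pow2_between:
  fixes n :: nat
  assumes "n \<ge> 1"
  shows "\<exists>p. n \<le> 2^p \<and> 2^p \<le> 2*n \<and> real p \<le> 1 + log 2 n"
proof -
  define p where "p = (LEAST p. n \<le> 2^p)"
  have ex: "n \<le> 2^n" using less_exp[of n] by simp
  have 1: "n \<le> 2^p" unfolding p_def by (rule LeastI[of "\<lambda>p. n \<le> 2^p", OF ex])
  have 2: "2^p \<le> 2*n"
  proof (cases p)
    case (Suc p')
    then have "\<not> n \<le> 2^p'" using not_less_Least[of p' "\<lambda>p. n \<le> 2^p"] by (auto simp: p_def)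
    then show ?thesis using Suc by simp
  qed (use assms in simp)
  have "real (2^p) \<le> real (2*n)" using 2 by (simp only: of_nat_le_iff)
  then have "2^p \<le> 2 * real n" by simp
  then have "log 2 (2^p) \<le> log 2 (2 * real n)" by (intro log_mono) auto
  moreover have "log 2 (2 * real n) = 1 + log 2 n" using assms by (subst log_mult) auto
  ultimately have "real p \<le> 1 + log 2 n" by simp
  then show ?thesis using 1 2 by blast
qed

text \<open>Two regimes put log m in place of log d. If m^2 \<le> d, the blocked Horner scheme uses
  transforms of size O(m) only; otherwise log d is at most 2 log m and the full chirp transform is
  affordable.\<close>

lemma linop_points:
  fixes \<beta> u :: complex
  assumes "u \<noteq> 0" "J \<subseteq> {..<d}" "J \<noteq> {}"
  shows "\<exists>c. linop {..<d} J (\<lambda>i j. (\<beta> * u^(2*j))^i) c \<and> real c \<le> real d * (150 + 64 * log 2 (card J))"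
proof -
  define m where "m = card J"
  have finJ: "finite J" using assms(2) finite_subset by auto
  have m1: "m \<ge> 1" using assms(3) finJ unfolding m_def by (simp add: Suc_leI card_gt_0_iff)
  have md: "m \<le> d" using card_mono[OF _ assms(2)] by (simp add: m_def)
  have lg: "log 2 m \<ge> 0" using m1 by simp
  show ?thesis
  proof (cases "m^2 \<le> d")
    case True
    obtain p where p: "2*m \<le> 2^p" "2^p \<le> 2*(2*m)" "real p \<le> 1 + log 2 (2*m)"
      using ex_pow2_between[of "2*m"] m1 by auto
    have p': "real p \<le> 2 + log 2 m" using p(3) m1 by (simp add: log_mult)
    \<comment> \<open>The number of blocks. It is rounded up, so that b * m exceeds d by at most m
      and hence stays below 2d.\<close>
    define b where "b = d div m + 1"
    have db: "d \<le> b * m"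
    proof -
      have "d mod m < m" using m1 by simp
      then show ?thesis using div_mult_mod_eq[of d m] unfolding b_def add_mult_distrib by linarith
    qed
    have "d div m * m \<le> d" by simp
    then have bm: "b * m \<le> 2 * d" using md unfolding b_def add_mult_distrib by linarith
    obtain g where g: "bij_betw g {..<m} J"
      using ex_bij_betw_nat_finite[OF finJ] by (auto simp: m_def lessThan_atLeast0)
    define c where "c = b * (2 * ((4*p+1) * 2^p) + m) + m * (2 * m)"
    have L: "linop {..<d} {..<m} (\<lambda>i k. (\<beta> * u^(2*g k))^i) c"
      unfolding c_def by (rule linop_vandermonde_pow2[OF p(1) db])
    have "(\<lambda>j e. \<Sum>i<d. (\<beta> * u^(2*j))^i * e i) ` J = (\<lambda>k e. \<Sum>i<d. (\<beta> * u^(2*g k))^i * e i) ` {..<m}"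
      unfolding bij_betw_imp_surj_on[OF g, symmetric] by (simp add: image_image)
    then have "linop {..<d} J (\<lambda>i j. (\<beta> * u^(2*j))^i) c" using L by (simp add: linop_def)
    moreover have "real c \<le> real d * (150 + 64 * log 2 m)"
    proof -
      have "c \<le> b * (2 * ((4*p+1) * (2*(2*m))) + m) + 2 * d"
      proof -
        have mm: "m * (2 * m) \<le> 2 * d" using True by (simp add: power2_eq_square)
        show ?thesis unfolding c_def
          by (rule add_mono[OF mult_le_mono[OF le_refl add_mono[OF mult_le_mono[OF le_refl mult_le_mono[OF le_refl p(2)]] le_refl]] mm])
      qed
      also have "\<dots> = (b*m) * (32 * p + 9) + 2 * d" by (simp add: algebra_simps)
      also have "\<dots> \<le> (2*d) * (32 * p + 9) + 2 * d" using bm by (intro add_mono[OF mult_le_mono1] le_refl)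
      finally have "real c \<le> real ((2*d) * (32 * p + 9) + 2 * d)" by (simp only: of_nat_le_iff)
      also have "\<dots> = real d * (64 * p + 20)" by (simp add: algebra_simps)
      also have "\<dots> \<le> real d * (64 * (2 + log 2 m) + 20)" using p' by (intro mult_left_mono) auto
      also have "\<dots> \<le> real d * (150 + 64 * log 2 m)" by (intro mult_left_mono) auto
      finally show ?thesis .
    qed
    ultimately show ?thesis unfolding m_def by blast
  next
    case False
    have d1: "d \<ge> 1" using md m1 by simp
    obtain p where p: "2*d \<le> 2^p" "2^p \<le> 2*(2*d)" "real p \<le> 1 + log 2 (2*d)"
      using ex_pow2_between[of "2*d"] d1 by auto
    have "d \<le> m^2" using False by simp
    then have "real d \<le> real (m^2)" by (simp only: of_nat_le_iff)
    then have "log 2 d \<le> log 2 (m^2)" using d1 by (intro log_mono) auto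
    then have "log 2 d \<le> 2 * log 2 m" using m1 by (simp add: log_nat_power)
    then have p': "real p \<le> 2 + 2 * log 2 m" using p(3) d1 by (simp add: log_mult)
    define c where "c = d + (2*d + (4*p+1)*2^p)"
    have "linop {..<d} {..<d} (\<lambda>i j. \<beta>^i * u^(2*i*j)) (card {..<d} + (2*d + (4*p+1)*2^p))"
      by (intro linop_scale_in linop_chirp_pow2 p(1) assms(1)) auto
    then have "linop {..<d} {..<d} (\<lambda>i j. (\<beta> * u^(2*j))^i) c"
      unfolding c_def by (rule linop_cong[OF linop_mono])
        (auto simp: power_mult_distrib power_mult[symmetric] mult_ac)
    then have "linop {..<d} J (\<lambda>i j. (\<beta> * u^(2*j))^i) c" by (rule linop_mono) (use assms(2) in auto)
    moreover have "real c \<le> real d * (150 + 64 * log 2 m)"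
    proof -
      have "c \<le> d + (2*d + (4*p+1)*(2*(2*d)))" unfolding c_def using p(2)
        by (intro add_mono mult_le_mono le_refl) auto
      also have "\<dots> = d * (16*p+7)" by (simp add: algebra_simps)
      finally have "real c \<le> real (d * (16*p+7))" by (simp only: of_nat_le_iff)
      also have "\<dots> = real d * (16*p+7)" by simp
      also have "\<dots> \<le> real d * (16*(2+2*log 2 m)+7)" using p' by (intro mult_left_mono) auto
      also have "\<dots> \<le> real d * (150 + 64 * log 2 m)" using lg by (intro mult_left_mono) auto
      finally show ?thesis .
    qed
    ultimately show ?thesis unfolding m_def by blast
  qed
qed

section \<open>Pruned Walsh-Hadamard transform\<close>

definition wht_sign :: "nat \<Rightarrow> nat \<Rightarrow> nat \<Rightarrow> complex" where
  "wht_sign q i j = (-1) ^ card {t. t < q \<and> bit i t \<and> bit j t}"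

lemma wht_sign_0 [simp]: "wht_sign 0 i j = 1"
  by (simp add: wht_sign_def)

lemma wht_sign_Suc:
  "wht_sign (Suc q) i j = (if odd i \<and> odd j then -1 else 1) * wht_sign q (i div 2) (j div 2)"
proof -
  have "{t. t < Suc q \<and> bit i t \<and> bit j t} =
    (if odd i \<and> odd j then {0} else {}) \<union> Suc ` {t. t < q \<and> bit (i div 2) t \<and> bit (j div 2) t}"
    (is "?L = ?R")
  proof -
    have "t \<in> ?L \<longleftrightarrow> t \<in> ?R" for t
      by (cases t) (auto simp: bit_0 bit_Suc)
    then show ?thesis by blast
  qed
  moreover have "card ((if odd i \<and> odd j then {0} else {}) \<union> Suc ` {t. t < q \<and> bit (i div 2) t \<and> bit (j div 2) t})
     = (if odd i \<and> odd j then 1 else 0) + card {t. t < q \<and> bit (i div 2) t \<and> bit (j div 2) t}"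
    by (subst card_Un_disjoint) (auto simp: card_image)
  ultimately have "card {t. t < Suc q \<and> bit i t \<and> bit j t} =
     (if odd i \<and> odd j then 1 else 0) + card {t. t < q \<and> bit (i div 2) t \<and> bit (j div 2) t}"
    by simp
  then show ?thesis by (simp add: wht_sign_def)
qed

text \<open>The lowest bit combines the inputs into sums and differences and splits the outputs into
  even and odd ones. A class that \<open>J\<close> misses is never computed. If \<open>J\<close>
  meets both classes in a and b elements, the bound closes because 2 + log a + log b \<le> 2 log(a +
  b), which is 4ab \<le> (a + b)^2.\<close>

lemma linop_wht:
  assumes "J \<subseteq> {..<2^q}" "J \<noteq> {}"
  shows "\<exists>c. linop {..<2^q} J (wht_sign q) c \<and> real c \<le> 2^q * (2 + log 2 (card J))"
  using assms
proof (induction q arbitrary: J)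
  case 0
  then have J: "J = {0}" by auto
  have "linop {..<2^0} J (wht_sign 0) 0"
    by (rule linopI[of _ _ "\<lambda>j e. e 0"]) (auto simp: J intro!: cost_0 avail_mem)
  moreover have "real 0 \<le> 2^0 * (2 + log 2 (card J))" by (simp add: J)
  ultimately show ?case by blast
next
  case (Suc q)
  define h where "h = (2::nat)^q"
  have finJ: "finite J" using Suc.prems(1) finite_subset by blast
  define J0 where "J0 = {j. 2*j \<in> J}"
  define J1 where "J1 = {j. 2*j+1 \<in> J}"
  have Jeq: "J = (\<lambda>j. 2*j) ` J0 \<union> (\<lambda>j. 2*j+1) ` J1"
  proof -
    have "j \<in> J \<longleftrightarrow> j \<in> (\<lambda>j. 2*j) ` J0 \<union> (\<lambda>j. 2*j+1) ` J1" for j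
      by (cases "even j") (auto simp: J0_def J1_def elim!: evenE oddE)
    then show ?thesis by blast
  qed
  have sub: "J0 \<subseteq> {..<2^q}" "J1 \<subseteq> {..<2^q}" using Suc.prems(1) by (auto simp: J0_def J1_def)
  have fin: "finite J0" "finite J1" using sub finite_subset by blast+
  have cardJ: "card J = card J0 + card J1"
  proof -
    have "card J = card ((\<lambda>j. 2*j) ` J0) + card ((\<lambda>j. 2*j+1) ` J1)"
      unfolding Jeq by (rule card_Un_disjoint) (use fin in \<open>auto, presburger\<close>)
    then show ?thesis by (simp add: card_image inj_on_def)
  qed
  define X where "X = (\<lambda>i (e::nat\<Rightarrow>complex). e i) ` {..<2*h}"
  define y where "y = (\<lambda>s i (e::nat\<Rightarrow>complex). if s then e (2*i) - e (2*i+1) else e (2*i) + e (2*i+1))"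
  define out where "out = (\<lambda>j (e::nat\<Rightarrow>complex). \<Sum>i<2*h. wht_sign (Suc q) i j * e i)"
  have cy: "cost X h (y s ` {..<h})" for s
  proof -
    have "cost X (card {..<h} * 1) (y s ` {..<h})"
    proof (rule cost_image)
      fix i assume "i \<in> {..<h}"
      then have "avail X (\<lambda>e. e (2*i))" "avail X (\<lambda>e. e (2*i+1))"
        by (auto simp: X_def intro!: avail_mem)
      then show "cost X 1 {y s i}" unfolding y_def using cost_add cost_diff by (cases s) auto
    qed simp
    then show ?thesis by simp
  qed
  have outy: "out (2*j + (if s then 1 else 0)) e = (\<Sum>i<h. wht_sign q i j * y s i e)" for j e s
  proof -
    have "out (2*j + (if s then 1 else 0)) e = (\<Sum>i<h. wht_sign q i j * e (2*i)) +
      (\<Sum>i<h. (if s then -1 else 1) * wht_sign q i j * e (2*i+1))"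
      unfolding out_def sum_split_parity wht_sign_Suc by (cases s) auto
    then show ?thesis unfolding y_def
      by (cases s) (simp_all add: right_diff_distrib distrib_left sum.distrib sum_subtractf sum_negf)
  qed
  have step: "\<exists>c. cost X (h + c) (out ` ((\<lambda>j. 2*j + (if s then 1 else 0)) ` J')) \<and> real c \<le> h * (2 + log 2 (card J'))"
    if J': "J' \<subseteq> {..<2^q}" "J' \<noteq> {}" for s J'
  proof -
    obtain c where c: "linop {..<2^q} J' (wht_sign q) c" "real c \<le> 2^q * (2 + log 2 (card J'))"
      using Suc.IH[OF J'] by blast
    have "cost (y s ` {..<h}) c ((\<lambda>j e. \<Sum>i<h. wht_sign q i j * y s i e) ` J')"
      unfolding h_def by (rule linop_cost[OF c(1)]) (auto intro: avail_mem)
    then have "cost X (h + c) ((\<lambda>j e. \<Sum>i<h. wht_sign q i j * y s i e) ` J')"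
      by (rule cost_trans[OF cy])
    moreover have "(\<lambda>j e. \<Sum>i<h. wht_sign q i j * y s i e) ` J' = out ` ((\<lambda>j. 2*j + (if s then 1 else 0)) ` J')"
      unfolding image_image by (intro image_cong refl ext) (rule outy[symmetric])
    ultimately show ?thesis using c(2) h_def by auto
  qed
  have "\<exists>c. cost X c (out ` J) \<and> real c \<le> 2*h * (2 + log 2 (card J))"
  proof (cases "J0 = {} \<or> J1 = {}")
    case True
    have "\<exists>s J'. J' \<subseteq> {..<2^q} \<and> J' \<noteq> {} \<and> J = (\<lambda>j. 2*j + (if s then 1 else 0)) ` J' \<and> card J = card J'"
    proof (cases "J0 = {}")
      case J0: True
      have "J = (\<lambda>j. 2*j+1) ` J1" using Jeq J0 by simp
      moreover have "J1 \<noteq> {}" using calculation Suc.prems(2) by auto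
      ultimately show ?thesis using sub(2) cardJ J0
        by (intro exI[of _ True] exI[of _ J1]) auto
    next
      case J0: False
      then have "J1 = {}" using True by simp
      then show ?thesis using J0 Jeq sub(1) cardJ
        by (intro exI[of _ False] exI[of _ J0]) auto
    qed
    then obtain s J' where J': "J' \<subseteq> {..<2^q}" "J' \<noteq> {}" "J = (\<lambda>j. 2*j + (if s then 1 else 0)) ` J'"
      "card J = card J'" by blast
    obtain c where c: "cost X (h + c) (out ` J)" "real c \<le> h * (2 + log 2 (card J))"
      using step[OF J'(1,2), of s] J'(3,4) by auto
    have "card J \<ge> 1" using finJ Suc.prems(2) by (simp add: Suc_le_eq card_gt_0_iff)
    then have "log 2 (card J) \<ge> 0" by simp
    then have "real h * 1 \<le> real h * (2 + log 2 (card J))" by (intro mult_left_mono) auto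
    then have "real (h + c) \<le> 2*h * (2 + log 2 (card J))" using c(2) by simp
    then show ?thesis using c(1) by blast
  next
    case False
    obtain c0 where c0: "cost X (h + c0) (out ` ((\<lambda>j. 2*j) ` J0))" "real c0 \<le> h * (2 + log 2 (card J0))"
      using step[OF sub(1), of False] False by auto
    obtain c1 where c1: "cost X (h + c1) (out ` ((\<lambda>j. 2*j+1) ` J1))" "real c1 \<le> h * (2 + log 2 (card J1))"
      using step[OF sub(2), of True] False by auto
    have "cost X (h + c0 + (h + c1)) (out ` J)"
      unfolding Jeq image_Un by (rule cost_union[OF c0(1) c1(1)])
    moreover have "real (h + c0 + (h + c1)) \<le> 2*h * (2 + log 2 (card J))"
    proof -
      define a b where "a = real (card J0)" and "b = real (card J1)"
      have ab: "a \<ge> 1" "b \<ge> 1" using False fin unfolding a_def b_def by (auto simp: Suc_le_eq card_gt_0_iff)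
      have "(a-b)^2 \<ge> 0" by simp
      then have "4 * (a * b) \<le> (a + b)^2" by (simp add: power2_eq_square algebra_simps)
      then have "log 2 (4 * (a * b)) \<le> log 2 ((a + b)^2)" using ab by (intro log_mono) auto
      moreover have "log 2 (4 * (a * b)) = 2 + log 2 a + log 2 b"
        using ab log_pow_cancel[of 2 2] by (simp add: log_mult)
      moreover have "log 2 ((a + b)^2) = 2 * log 2 (a + b)"
        using ab by (subst log_nat_power) auto
      ultimately have "2 + log 2 a + log 2 b \<le> 2 * log 2 (a + b)" by simp
      then have "real h * (2 + log 2 a + log 2 b) \<le> real h * (2 * log 2 (a + b))" by (intro mult_left_mono) auto
      moreover have "real (h + c0 + (h + c1)) \<le> 2 * h + h * (2 + log 2 a) + h * (2 + log 2 b)"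
        using c0(2) c1(2) by (simp add: a_def b_def)
      ultimately show ?thesis by (simp add: cardJ a_def[symmetric] b_def[symmetric] algebra_simps)
    qed
    ultimately show ?thesis by blast
  qed
  then show ?case unfolding X_def out_def h_def linop_def by (simp add: mult.commute)
qed

section \<open>Cost of sketching with a signed and sampled transform\<close>

lemma linop_trig:
  assumes F: "F \<in> complex_trig_transforms d" and J: "J \<subseteq> {..<d}" "J \<noteq> {}"
  shows "\<exists>c. linop {..<d} J (\<lambda>i j. F $$ (i,j)) c \<and> real c \<le> real d * (310 + 128 * log 2 (card J))"
proof -
  have finJ: "finite J" using J(1) finite_subset by blast
  have cJ: "1 \<le> card J" "card J \<le> d"
    using J finJ card_mono[OF _ J(1)] by (auto simp: Suc_le_eq card_gt_0_iff)
  have lg: "log 2 (card J) \<ge> 0" using cJ(1) by simp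
  have d0: "d > 0" using cJ by simp
  have lgd: "real d * log 2 (card J) \<ge> 0" using lg by simp
  consider (dct) "F = dct d" | (wht) q where "d = 2^q" "F = walsh_hadamard q" | (dft) "F = dft d"
    using F by (auto simp: complex_trig_transforms_def real_trig_transforms_def)
  then show ?thesis
  proof cases
    case dct
    \<comment> \<open>The cosine is half the sum of two exponentials with opposite angles. Each is
      the i-th power of a point \<beta> u^(2j) with \<beta> = u; the half goes into
      \<open>a\<close>.\<close>
    define a where "a = (\<lambda>i::nat. complex_of_real (sqrt ((if i = 0 then 1 else 2) / real d) / 2))"
    have pts: "\<exists>c. linop {..<d} J (\<lambda>i j. (cis (s*pi/(2*d)) * cis (s*pi/(2*d))^(2*j))^i) c \<and>
      real c \<le> real d * (150 + 64 * log 2 (card J))" for s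
      by (rule linop_points) (use J in auto)
    obtain c1 where c1: "linop {..<d} J (\<lambda>i j. (cis (1*pi/(2*d)) * cis (1*pi/(2*d))^(2*j))^i) c1"
      "real c1 \<le> real d * (150 + 64 * log 2 (card J))" using pts[of 1] by blast
    obtain c2 where c2: "linop {..<d} J (\<lambda>i j. (cis ((-1)*pi/(2*d)) * cis ((-1)*pi/(2*d))^(2*j))^i) c2"
      "real c2 \<le> real d * (150 + 64 * log 2 (card J))" using pts[of "-1"] by blast
    have "linop {..<d} J (\<lambda>i j. a i * ((cis (1*pi/(2*d)) * cis (1*pi/(2*d))^(2*j))^i +
       (cis ((-1)*pi/(2*d)) * cis ((-1)*pi/(2*d))^(2*j))^i)) (card {..<d} + (c1 + c2 + card J))"
      by (intro linop_scale_in linop_add c1 c2 finJ) auto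
    then have "linop {..<d} J (\<lambda>i j. F $$ (i,j)) (card {..<d} + (c1 + c2 + card J))"
    proof (rule linop_cong)
      fix i j :: nat assume ij: "i \<in> {..<d}" "j \<in> J"
      define th where "th = pi * (2 * real j + 1) * real i / (2 * real d)"
      have pt: "(cis (s*pi/(2*d)) * cis (s*pi/(2*d))^(2*j))^i = cis (s * th)" for s
        using d0 by (simp add: Complex.DeMoivre cis_mult th_def field_simps)
      have "a i * (cis (1 * th) + cis ((-1) * th)) = F $$ (i,j)"
      proof -
        have "i < d" "j < d" using ij J by auto
        then have "F $$ (i,j) = complex_of_real (sqrt ((if i = 0 then 1 else 2) / real d)) * complex_of_real (cos th)"
          unfolding dct dct_def th_def by simp
        then show ?thesis unfolding a_def by (simp only: complex_eq_iff) simp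
      qed
      then show "a i * ((cis (1*pi/(2*d)) * cis (1*pi/(2*d))^(2*j))^i +
       (cis ((-1)*pi/(2*d)) * cis ((-1)*pi/(2*d))^(2*j))^i) = F $$ (i,j)"
        unfolding pt .
    qed
    moreover have "real (card {..<d} + (c1 + c2 + card J)) \<le> real d * (310 + 128 * log 2 (card J))"
    proof -
      have "real (card J) \<le> real d" using cJ by simp
      then show ?thesis using c1(2) c2(2) by (simp add: algebra_simps)
    qed
    ultimately show ?thesis by blast
  next
    case wht
    obtain c where c: "linop {..<2^q} J (wht_sign q) c" "real c \<le> 2^q * (2 + log 2 (card J))"
      using linop_wht[of J q] J wht by auto
    have "linop {..<d} J (\<lambda>i j. wht_sign q i j * (1 / complex_of_real (sqrt (2^q)))) (c + card J)"
      unfolding wht(1) by (intro linop_scale_out c finJ)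
    then have "linop {..<d} J (\<lambda>i j. F $$ (i,j)) (c + card J)"
      by (rule linop_cong) (use wht J in \<open>auto simp: walsh_hadamard_def wht_sign_def\<close>)
    moreover have "real (c + card J) \<le> real d * (310 + 128 * log 2 (card J))"
    proof -
      have "real (card J) \<le> real d" using cJ by simp
      moreover have "real c \<le> real d * (2 + log 2 (card J))" using c(2) wht(1) by simp
      ultimately show ?thesis using lgd by (simp add: algebra_simps)
    qed
    ultimately show ?thesis by blast
  next
    case dft
    \<comment> \<open>Half the usual angle, since the points are even powers of
      \<open>u\<close>.\<close>
    obtain c where c: "linop {..<d} J (\<lambda>i j. (1 * cis (-pi/d)^(2*j))^i) c" "real c \<le> real d * (150 + 64 * log 2 (card J))"
      using linop_points[of "cis (-pi/d)" J d 1] J by auto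
    have "linop {..<d} J (\<lambda>i j. (1 * cis (-pi/d)^(2*j))^i * (1 / complex_of_real (sqrt d))) (c + card J)"
      by (intro linop_scale_out c finJ)
    then have "linop {..<d} J (\<lambda>i j. F $$ (i,j)) (c + card J)"
      by (rule linop_cong) (use dft J in \<open>auto simp: dft_def Complex.DeMoivre algebra_simps\<close>)
    moreover have "real (c + card J) \<le> real d * (310 + 128 * log 2 (card J))"
    proof -
      have "real (card J) \<le> real d" using cJ by simp
      then show ?thesis using c(2) lgd by (simp add: algebra_simps)
    qed
    ultimately show ?thesis by blast
  qed
qed

lemma linop_sparse:
  assumes "finite I" "finite J" "\<And>j. j \<in> J \<Longrightarrow> T j \<subseteq> I \<and> card (T j) \<le> s"
    and "\<And>i j. j \<in> J \<Longrightarrow> i \<in> I \<Longrightarrow> i \<notin> T j \<Longrightarrow> K i j = 0"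
  shows "linop I J K (card J * (2 * s))"
proof (rule linopI)
  show "cost ((\<lambda>i e. e i) ` I) (card J * (2 * s)) ((\<lambda>j e. \<Sum>i\<in>T j. K i j * e i) ` J)"
  proof (rule cost_image[OF assms(2)])
    fix j assume j: "j \<in> J"
    have "cost ((\<lambda>i e. e i) ` I) (2 * card (T j)) {\<lambda>e. \<Sum>i\<in>T j. K i j * e i}"
      using assms(1) assms(3)[OF j] by (intro cost_lincomb) (auto intro: finite_subset avail_mem)
    then show "cost ((\<lambda>i e. e i) ` I) (2 * s) {\<lambda>e. \<Sum>i\<in>T j. K i j * e i}"
      by (rule cost_mono) (use assms(3)[OF j] in auto)
  qed
  fix j e assume j: "j \<in> J"
  show "(\<Sum>i\<in>T j. K i j * e i) = (\<Sum>i\<in>I. K i j * e i)"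
    by (rule sum.mono_neutral_left) (use assms j in auto)
qed

text \<open>Only the columns of the transform that some support meets are computed, at most k * s of
  them; they are then combined for each output. The signs cost one multiplication per input.\<close>

lemma linop_sparse_rtt:
  assumes F: "F \<in> complex_trig_transforms d" and "d > 0" "k > 0"
    and T: "\<And>j. j < k \<Longrightarrow> T j \<subseteq> {..<d} \<and> T j \<noteq> {} \<and> card (T j) \<le> s"
    and S: "\<And>l j. j < k \<Longrightarrow> l < d \<Longrightarrow> l \<notin> T j \<Longrightarrow> S l j = 0"
  shows "\<exists>c. linop {..<d} {..<k} (\<lambda>i j. \<Sum>l<d. \<sigma> i * F $$ (i,l) * S l j) c \<and>
     real c \<le> real d * (311 + 128 * log 2 (k * s)) + 2 * k * s"
proof -
  define J where "J = (\<Union>j<k. T j)"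
  have J: "J \<subseteq> {..<d}" "J \<noteq> {}" using T \<open>k > 0\<close> by (auto simp: J_def)
  have cJ: "card J \<le> k * s"
  proof -
    have "card J \<le> (\<Sum>j<k. card (T j))" unfolding J_def by (rule card_UN_le) simp
    also have "\<dots> \<le> (\<Sum>j<k. s)" by (rule sum_mono) (use T in auto)
    finally show ?thesis by simp
  qed
  have J1: "card J \<ge> 1" using J finite_subset[OF J(1)] by (simp add: Suc_le_eq card_gt_0_iff)
  obtain c where c: "linop {..<d} J (\<lambda>i j. F $$ (i,j)) c" "real c \<le> real d * (310 + 128 * log 2 (card J))"
    using linop_trig[OF F J] by blast
  have "linop {..<d} {..<k} (\<lambda>i j. \<Sum>l\<in>J. \<sigma> i * F $$ (i,l) * S l j) (card {..<d} + c + card {..<k} * (2 * s))"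
    by (rule linop_comp[OF linop_scale_in[OF c(1)] linop_sparse[of J "{..<k}" T]])
       (use T S J finite_subset[OF J(1)] in \<open>auto simp: J_def\<close>)
  then have "linop {..<d} {..<k} (\<lambda>i j. \<Sum>l<d. \<sigma> i * F $$ (i,l) * S l j) (card {..<d} + c + card {..<k} * (2 * s))"
    by (rule linop_cong) (use S J in \<open>auto intro!: sum.mono_neutral_left simp: J_def\<close>)
  moreover have "real (card {..<d} + c + card {..<k} * (2 * s)) \<le> real d * (311 + 128 * log 2 (k * s)) + 2 * k * s"
  proof -
    have "log 2 (card J) \<le> log 2 (k * s)" using cJ J1 by (intro log_mono) (auto simp flip: of_nat_mult)
    then have "real d * (310 + 128 * log 2 (card J)) \<le> real d * (310 + 128 * log 2 (k * s))"
      by (intro mult_left_mono) auto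
    then show ?thesis using c(2) by (simp add: algebra_simps)
  qed
  ultimately show ?thesis by blast
qed

text \<open>The same program is run on every row. The first version feeds real entries to a complex
  program, in preparation for \<open>cost_Re\<close>.\<close>

lemma linop_rows:
  assumes "linop {..<d} {..<k} K c"
  shows "cost ((\<lambda>f A. complex_of_real (f A)) ` matrix_entries n d) (n * c)
     (\<Union>i<n. (\<lambda>j A. \<Sum>l<d. K l j * complex_of_real (operand_value A [] (Input i l))) ` {..<k})"
    and "cost (matrix_entries n d) (n * c)
     (\<Union>i<n. (\<lambda>j A. \<Sum>l<d. K l j * operand_value A [] (Input i l)) ` {..<k})"
proof -
  have "cost ((\<lambda>f A. complex_of_real (f A)) ` matrix_entries n d) (card {..<n} * c)
     (\<Union>i<n. (\<lambda>j A. \<Sum>l<d. K l j * complex_of_real (operand_value A [] (Input i l))) ` {..<k})"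
  proof (rule cost_UN_const)
    fix i assume i: "i \<in> {..<n}"
    show "cost ((\<lambda>f A. complex_of_real (f A)) ` matrix_entries n d) c
       ((\<lambda>j A. \<Sum>l<d. K l j * complex_of_real (operand_value A [] (Input i l))) ` {..<k})"
    proof (rule linop_cost[OF assms], rule avail_mem)
      fix l assume l: "l \<in> {..<d}"
      show "(\<lambda>A. complex_of_real (operand_value A [] (Input i l))) \<in> (\<lambda>f A. complex_of_real (f A)) ` matrix_entries n d"
        by (rule image_eqI[of _ _ "\<lambda>A. operand_value A [] (Input i l)"])
           (use i l in \<open>auto simp: matrix_entries_def simp del: operand_value.simps\<close>)
    qed
  qed auto
  then show "cost ((\<lambda>f A. complex_of_real (f A)) ` matrix_entries n d) (n * c)
     (\<Union>i<n. (\<lambda>j A. \<Sum>l<d. K l j * complex_of_real (operand_value A [] (Input i l))) ` {..<k})" by simp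
  have "cost (matrix_entries n d) (card {..<n} * c)
     (\<Union>i<n. (\<lambda>j A. \<Sum>l<d. K l j * operand_value A [] (Input i l)) ` {..<k})"
    by (rule cost_UN_const) (auto intro!: linop_cost[OF assms] avail_mem simp: matrix_entries_def simp del: operand_value.simps)
  then show "cost (matrix_entries n d) (n * c)
     (\<Union>i<n. (\<lambda>j A. \<Sum>l<d. K l j * operand_value A [] (Input i l)) ` {..<k})" by simp
qed

lemma computes_sketchI:
  fixes \<Omega> :: "'a::comm_ring_1 mat"
  assumes "\<Omega> \<in> carrier_mat d k"
    and "\<And>i j. i < n \<Longrightarrow> j < k \<Longrightarrow> located p (\<lambda>A. \<Sum>l<d. \<Omega> $$ (l,j) * operand_value A [] (Input i l))"
  shows "computes_sketch n \<Omega> p"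
proof -
  define f where "f = (\<lambda>i j (A::'a mat). \<Sum>l<d. \<Omega> $$ (l,j) * operand_value A [] (Input i l))"
  have "\<exists>o'. \<forall>A. operand_value A (run A p) o' = f i j A" if "i < n" "j < k" for i j
    using assms(2)[OF that] by (auto simp: located_def f_def)
  then obtain out where out: "\<And>i j A. i < n \<Longrightarrow> j < k \<Longrightarrow> operand_value A (run A p) (out i j) = f i j A"
    by metis
  show ?thesis unfolding computes_sketch_def
  proof (intro exI[of _ out] ballI allI impI)
    fix A :: "'a mat" and i j assume A: "A \<in> carrier_mat n (dim_row \<Omega>)" and ij: "i < n" "j < dim_col \<Omega>"
    have "(A * \<Omega>) $$ (i,j) = (\<Sum>l<d. A $$ (i,l) * \<Omega> $$ (l,j))"
      using A ij assms(1) by (auto simp: scalar_prod_def lessThan_atLeast0 intro!: sum.cong)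
    also have "\<dots> = f i j A" unfolding f_def
      using A ij assms(1) by (intro sum.cong) (auto simp: mult.commute)
    finally show "operand_value A (run A p) (out i j) = (A * \<Omega>) $$ (i,j)"
      using out[of i j A] ij assms(1) by auto
  qed
qed

lemma sketch_complex:
  assumes "\<Omega> \<in> carrier_mat d k" "linop {..<d} {..<k} (\<lambda>l j. \<Omega> $$ (l,j)) c"
  shows "\<exists>p. computes_sketch n \<Omega> p \<and> length p \<le> n * c"
proof -
  obtain p where p: "length p \<le> n * c"
    "\<forall>f\<in>(\<Union>i<n. (\<lambda>j A. \<Sum>l<d. \<Omega> $$ (l,j) * operand_value A [] (Input i l)) ` {..<k}). located p f"
    using cost_program[OF linop_rows(2)[OF assms(2)]] by blast
  have "computes_sketch n \<Omega> p"
    by (rule computes_sketchI[OF assms(1)]) (use p(2) in \<open>auto simp del: operand_value.simps\<close>)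
  then show ?thesis using p(1) by blast
qed

lemma sketch_real:
  fixes \<Omega> :: "real mat"
  assumes "\<Omega> \<in> carrier_mat d k" "linop {..<d} {..<k} (\<lambda>l j. complex_of_real (\<Omega> $$ (l,j))) c"
  shows "\<exists>p. computes_sketch n \<Omega> p \<and> length p \<le> n * (6 * c)"
proof -
  have "cost (matrix_entries n d :: (real mat \<Rightarrow> real) set) (6 * (n * c)) ((\<lambda>f e. Re (f e)) `
    (\<Union>i<n. (\<lambda>j A. \<Sum>l<d. complex_of_real (\<Omega> $$ (l,j)) * complex_of_real (operand_value A [] (Input i l))) ` {..<k}))"
    by (rule cost_Re[OF linop_rows(1)[OF assms(2)]]) (auto intro: avail_mem)
  then obtain p where p: "length p \<le> 6 * (n * c)"
    "\<forall>f\<in>((\<lambda>f e. Re (f e)) `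
    (\<Union>i<n. (\<lambda>j A. \<Sum>l<d. complex_of_real (\<Omega> $$ (l,j)) * complex_of_real (operand_value A [] (Input i l))) ` {..<k})). located p f"
    using cost_program by blast
  have "computes_sketch n \<Omega> p"
  proof (rule computes_sketchI[OF assms(1)])
    fix i j assume "i < n" "j < k"
    then have "located p (\<lambda>A. Re (\<Sum>l<d. complex_of_real (\<Omega> $$ (l,j)) * complex_of_real (operand_value A [] (Input i l))))"
      using p(2) by (auto simp del: operand_value.simps)
    then show "located p (\<lambda>A. \<Sum>l<d. \<Omega> $$ (l,j) * operand_value A [] (Input i l))"
      by (simp del: operand_value.simps flip: of_real_mult of_real_sum)
  qed
  then show ?thesis using p(1) by (auto simp: mult_ac)
qed

section \<open>Expectations over finitely supported distributions\<close>

abbreviation EV :: "'a pmf \<Rightarrow> ('a \<Rightarrow> real) \<Rightarrow> real" where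
  "EV q f \<equiv> measure_pmf.expectation q f"

lemma EV_mono:
  assumes "finite (set_pmf q)" "\<And>x. x \<in> set_pmf q \<Longrightarrow> f x \<le> g x"
  shows "EV q f \<le> EV q g"
  by (rule integral_mono_AE) (use assms in \<open>auto simp: integrable_measure_pmf_finite AE_measure_pmf_iff\<close>)

lemma EV_cong: "(\<And>x. x \<in> set_pmf q \<Longrightarrow> f x = g x) \<Longrightarrow> EV q f = EV q g"
  by (rule integral_cong_AE) (auto simp: AE_measure_pmf_iff)

lemma EV_add: "finite (set_pmf q) \<Longrightarrow> EV q (\<lambda>x. f x + g x) = EV q f + EV q g"
  by (simp add: integrable_measure_pmf_finite)

lemma EV_diff: "finite (set_pmf q) \<Longrightarrow> EV q (\<lambda>x. f x - g x) = EV q f - EV q g"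
  by (simp add: integrable_measure_pmf_finite)

lemma EV_cmult: "EV q (\<lambda>x. c * f x) = c * EV q f"
  by simp

lemma EV_sum: "finite (set_pmf q) \<Longrightarrow> EV q (\<lambda>x. \<Sum>i\<in>I. f i x) = (\<Sum>i\<in>I. EV q (f i))"
  by (simp add: integrable_measure_pmf_finite)

lemma EV_bind:
  assumes "finite (set_pmf p)" "\<And>x. x \<in> set_pmf p \<Longrightarrow> finite (set_pmf (f x))"
  shows "EV (bind_pmf p f) h = EV p (\<lambda>x. EV (f x) h)"
proof -
  have "EV p (\<lambda>x. EV (f x) h) = (\<Sum>a\<in>set_pmf p. pmf p a *\<^sub>R EV (f a) h)"
    by (rule integral_measure_pmf) (use assms in auto)
  then show ?thesis using pmf_expectation_bind[of "set_pmf p" f p h] assms by auto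
qed

lemma prob_eq_EV: "measure_pmf.prob p A = EV p (indicator A)"
  by simp

lemma finite_set_replicate_pmf: "finite (set_pmf q) \<Longrightarrow> finite (set_pmf (replicate_pmf n q))"
  by (induction n) auto

lemma EV_replicate_Suc:
  assumes "finite (set_pmf q)"
  shows "EV (replicate_pmf (Suc n) q) f = EV q (\<lambda>x. EV (replicate_pmf n q) (\<lambda>xs. f (x # xs)))"
proof -
  have "EV (replicate_pmf (Suc n) q) f = EV q (\<lambda>x. EV (replicate_pmf n q \<bind> (\<lambda>xs. return_pmf (x # xs))) f)"
    unfolding replicate_pmf.simps by (rule EV_bind[OF assms]) (use finite_set_replicate_pmf[OF assms] in auto)
  also have "\<dots> = EV q (\<lambda>x. EV (replicate_pmf n q) (\<lambda>xs. f (x # xs)))"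
    by (subst EV_bind) (use finite_set_replicate_pmf[OF assms] in auto)
  finally show ?thesis .
qed

lemma prob_replicate_Suc:
  assumes "finite (set_pmf q)"
  shows "measure_pmf.prob (replicate_pmf (Suc n) q) A
    = EV q (\<lambda>x. measure_pmf.prob (replicate_pmf n q) {xs. x # xs \<in> A})"
proof -
  have "indicator A (x # xs) = (indicator {xs. x # xs \<in> A} xs :: real)" for x xs
    by (simp add: indicator_def)
  then show ?thesis unfolding prob_eq_EV EV_replicate_Suc[OF assms] by simp
qed

lemma EV_pair:
  assumes "finite (set_pmf p)" "finite (set_pmf q)"
  shows "EV (pair_pmf p q) f = EV p (\<lambda>x. EV q (\<lambda>y. f (x, y)))"
proof -
  have "EV (pair_pmf p q) f = EV p (\<lambda>x. EV (q \<bind> (\<lambda>y. return_pmf (x, y))) f)"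
    unfolding pair_pmf_def by (rule EV_bind[OF assms(1)]) (use assms in auto)
  also have "\<dots> = EV p (\<lambda>x. EV q (\<lambda>y. f (x, y)))"
    by (subst EV_bind) (use assms in auto)
  finally show ?thesis .
qed

section \<open>Positive operators and low rank updates\<close>

definition selfadj :: "('h::real_inner \<Rightarrow> 'h) \<Rightarrow> bool" where
  "selfadj P \<longleftrightarrow> linear P \<and> (\<forall>x y. inner (P x) y = inner x (P y))"

definition qf :: "('h::real_inner \<Rightarrow> 'h) \<Rightarrow> 'h \<Rightarrow> real" where
  "qf P x = inner x (P x)"

definition psd :: "('h::real_inner \<Rightarrow> 'h) \<Rightarrow> bool" where
  "psd P \<longleftrightarrow> selfadj P \<and> (\<forall>x. 0 \<le> qf P x)"

lemma selfadjD:
  assumes "selfadj P"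
  shows "linear P" "inner (P x) y = inner x (P y)" "P (x + y) = P x + P y"
    "P (c *\<^sub>R x) = c *\<^sub>R P x" "P (x - y) = P x - P y" "P 0 = 0"
  using assms unfolding selfadj_def
  by (auto simp: linear_add linear_scale linear_diff linear_0)

text \<open>The discriminant criterion, including the degenerate case \<open>a = 0\<close>. A
  negative \<open>a\<close> is refuted at a point \<open>s\<close> so large that the quadratic term
  outweighs the other two.\<close>

lemma quadratic_nonneg:
  fixes a b c :: real
  assumes "\<And>t. 0 \<le> c + 2 * t * b + t^2 * a"
  shows "b^2 \<le> a * c"
proof (cases "a = 0")
  case True
  have "b = 0"
  proof (rule ccontr)
    assume "b \<noteq> 0"
    then show False using assms[of "- (c + 1) / (2 * b)"] True by (simp add: field_simps)
  qed
  then show ?thesis using True by simp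
next
  case False
  have "0 \<le> a"
  proof (rule ccontr)
    assume "\<not> 0 \<le> a"
    then have a: "a < 0" by simp
    define s where "s = (2 * \<bar>b\<bar> + \<bar>c\<bar> + 1) / (- a) + 1"
    have s1: "s \<ge> 1" using a by (simp add: s_def divide_nonneg_neg)
    have "s * (- a) = 2 * \<bar>b\<bar> + \<bar>c\<bar> + 1 - a" using a by (simp add: s_def field_simps)
    then have "s * (- a) > 2 * \<bar>b\<bar> + \<bar>c\<bar>" using a by linarith
    then have "s * (s * (- a)) > s * (2 * \<bar>b\<bar> + \<bar>c\<bar>)" using s1 by (intro mult_strict_left_mono) auto
    moreover have "s * \<bar>c\<bar> \<ge> 1 * \<bar>c\<bar>" using s1 by (intro mult_right_mono) auto
    moreover have "s * b \<le> s * \<bar>b\<bar>" using s1 by (intro mult_left_mono) auto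
    ultimately have "c + 2 * s * b + s^2 * a < 0"
      by (simp add: power2_eq_square algebra_simps)
    then show False using assms[of s] by simp
  qed
  then have a: "a > 0" using False by simp
  have "0 \<le> c + 2 * (- b / a) * b + (- b / a)^2 * a" by (rule assms)
  also have "\<dots> = (a * c - b^2) / a" using a by (simp add: field_simps power2_eq_square)
  finally show ?thesis using a by (simp add: zero_le_divide_iff)
qed

lemma psd_cauchy_schwarz:
  assumes "psd P"
  shows "(inner x (P y))^2 \<le> qf P x * qf P y"
proof -
  have sa: "selfadj P" using assms by (simp add: psd_def)
  note l = selfadjD[OF sa]
  have "0 \<le> qf P x + 2 * t * inner x (P y) + t^2 * qf P y" for t
  proof -
    have "qf P (x + t *\<^sub>R y) = qf P x + 2 * t * inner x (P y) + t^2 * qf P y"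
      using l(2)[of y x] by (simp add: qf_def l inner_add_left inner_add_right inner_commute power2_eq_square algebra_simps)
    then show ?thesis using assms unfolding psd_def by metis
  qed
  then show ?thesis using quadratic_nonneg[of "qf P x" "inner x (P y)" "qf P y"] by (simp add: mult.commute)
qed

text \<open>Passing to the rotated pair a x + b y, b x - a y multiplies the sum of the two values by
  a^2 + b^2, and the second value is nonnegative.\<close>

lemma psd_combination:
  assumes "psd P"
  shows "qf P (a *\<^sub>R x + b *\<^sub>R y) \<le> (a^2 + b^2) * (qf P x + qf P y)"
proof -
  have sa: "selfadj P" using assms by (simp add: psd_def)
  note l = selfadjD[OF sa]
  have "qf P (a *\<^sub>R x + b *\<^sub>R y) + qf P (b *\<^sub>R x - a *\<^sub>R y) = (a^2 + b^2) * (qf P x + qf P y)"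
    using l(2)[of y x] by (simp add: qf_def l inner_add_left inner_add_right inner_diff_left inner_diff_right inner_commute power2_eq_square algebra_simps)
  moreover have "0 \<le> qf P (b *\<^sub>R x - a *\<^sub>R y)" using assms by (simp add: psd_def)
  ultimately show ?thesis by linarith
qed

definition inv_pair :: "('h::real_inner \<Rightarrow> 'h) \<Rightarrow> ('h \<Rightarrow> 'h) \<Rightarrow> bool" where
  "inv_pair B M \<longleftrightarrow> selfadj B \<and> selfadj M \<and> (\<forall>x. M (B x) = x) \<and> (\<forall>x. B (M x) = x)"

lemma selfadj_rank_one:
  assumes "selfadj B"
  shows "selfadj (\<lambda>x. B x + (c * inner m x) *\<^sub>R m)"
  unfolding selfadj_def using selfadjD[OF assms]
  by (intro conjI allI linearI)
     (auto simp: inner_add_left inner_add_right inner_commute algebra_simps scaleR_add_left)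

text \<open>The Sherman-Morrison formula. Inverses are carried along explicitly, because the ambient
  space may have infinite dimension.\<close>

lemma inv_pair_rank_one:
  assumes "inv_pair B M" "1 + c * qf M m \<noteq> 0"
  shows "inv_pair (\<lambda>x. B x + (c * inner m x) *\<^sub>R m)
    (\<lambda>x. M x + (- c / (1 + c * qf M m) * inner (M m) x) *\<^sub>R M m)"
proof -
  have B: "selfadj B" and M: "selfadj M" and MB: "M (B x) = x" and BM: "B (M x) = x" for x
    using assms(1) by (auto simp: inv_pair_def)
  note b = selfadjD[OF B] and mm = selfadjD[OF M]
  define D where "D = 1 + c * qf M m"
  have D0: "D \<noteq> 0" using assms(2) by (simp add: D_def)
  have q: "inner (M m) m = qf M m" "inner m (M m) = qf M m" by (simp_all add: qf_def inner_commute)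
  have i: "inner (M m) (B x) = inner m x" for x using mm(2)[of m "B x"] by (simp add: MB)
  have i': "inner m (M x) = inner (M m) x" for x using mm(2)[of m x] by simp
  have "M (B x + (c * inner m x) *\<^sub>R m) + (- c / D * inner (M m) (B x + (c * inner m x) *\<^sub>R m)) *\<^sub>R M m = x" for x
  proof -
    have "M (B x + (c * inner m x) *\<^sub>R m) + (- c / D * inner (M m) (B x + (c * inner m x) *\<^sub>R m)) *\<^sub>R M m
       = x + (c * inner m x + (- c / D * (inner m x + c * inner m x * qf M m))) *\<^sub>R M m"
      by (simp only: mm MB inner_add_right inner_scaleR_right i q scaleR_add_left add.assoc)
    moreover have "c * inner m x + (- c / D * (inner m x + c * inner m x * qf M m)) = 0"
      using D0 by (simp add: field_simps) (simp add: D_def algebra_simps)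
    ultimately show ?thesis by simp
  qed
  moreover have "B (M x + (- c / D * inner (M m) x) *\<^sub>R M m) + (c * inner m (M x + (- c / D * inner (M m) x) *\<^sub>R M m)) *\<^sub>R m = x" for x
  proof -
    have "B (M x + (- c / D * inner (M m) x) *\<^sub>R M m) + (c * inner m (M x + (- c / D * inner (M m) x) *\<^sub>R M m)) *\<^sub>R m
      = x + (- c / D * inner (M m) x + c * (inner (M m) x + (- c / D * inner (M m) x) * qf M m)) *\<^sub>R m"
      by (simp only: b BM inner_add_right inner_scaleR_right i' q scaleR_add_left add.assoc)
    moreover have "- c / D * inner (M m) x + c * (inner (M m) x + (- c / D * inner (M m) x) * qf M m) = 0"
      using D0 by (simp add: field_simps) (simp add: D_def algebra_simps)
    ultimately show ?thesis by simp
  qed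
  ultimately show ?thesis unfolding inv_pair_def D_def[symmetric]
    using selfadj_rank_one[OF B] selfadj_rank_one[OF M] by blast
qed

text \<open>Successive Sherman-Morrison updates in which negative coefficients are allowed:
  invertibility is preserved as long as every partial sum is a positive definite form.\<close>

lemma inv_pair_updates:
  fixes m :: "nat \<Rightarrow> 'h::real_inner"
  assumes "inv_pair B M"
    and "\<And>k x. k \<le> n \<Longrightarrow> x \<noteq> 0 \<Longrightarrow> 0 < qf B x + (\<Sum>i<k. c i * (inner (m i) x)^2)"
  shows "\<exists>M'. inv_pair (\<lambda>x. B x + (\<Sum>i<n. (c i * inner (m i) x) *\<^sub>R m i)) M'"
  using assms(2)
proof (induction n)
  case 0
  then show ?case using assms(1) by auto
next
  case (Suc n)
  let ?B = "\<lambda>n x. B x + (\<Sum>i<n. (c i * inner (m i) x) *\<^sub>R m i)"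
  obtain M' where M': "inv_pair (?B n) M'" using Suc by force
  have qB: "qf (?B k) x = qf B x + (\<Sum>i<k. c i * (inner (m i) x)^2)" for k x
    by (simp add: qf_def inner_add_right inner_sum_right power2_eq_square inner_commute mult_ac)
  have "1 + c n * qf M' (m n) \<noteq> 0"
  proof (cases "m n = 0")
    case True
    then show ?thesis by (simp add: qf_def)
  next
    case False
    have M'M: "?B n (M' x) = x" "M' (?B n x) = x" "inner (M' x) y = inner x (M' y)" for x y
      using M' by (auto simp: inv_pair_def selfadj_def)
    let ?x = "M' (m n)"
    have "B 0 = 0" using assms(1) selfadjD(6) by (auto simp: inv_pair_def)
    then have x0: "?x \<noteq> 0" using False M'M(1)[of "m n"] by auto
    \<comment> \<open>Tested at \<open>M' (m n)\<close>, the updated form factors into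
      \<open>qf M' (m n)\<close> and the Sherman-Morrison denominator, which is therefore
      nonzero.\<close>
    have "0 < qf (?B (Suc n)) ?x" unfolding qB using Suc.prems[of "Suc n" ?x] x0 by simp
    also have "qf (?B (Suc n)) ?x = inner ?x (?B n ?x) + c n * (inner (m n) ?x)^2"
      by (simp add: qf_def inner_add_right power2_eq_square inner_commute algebra_simps)
    also have "\<dots> = qf M' (m n) * (1 + c n * qf M' (m n))"
      unfolding M'M(1) by (simp add: qf_def inner_commute power2_eq_square algebra_simps)
    finally show ?thesis by auto
  qed
  from inv_pair_rank_one[OF M' this] show ?case by (auto simp: add.assoc)
qed

text \<open>The expression is the trace of the product of two positive semidefinite 2 by 2 matrices,
  written in entries. The determinant conditions and the arithmetic-geometric mean inequality
  control the mixed term.\<close>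

lemma psd2_trace_nonneg:
  fixes a b c x y z :: real
  assumes "0 \<le> a" "0 \<le> c" "b^2 \<le> a * c" "0 \<le> x" "0 \<le> z" "y^2 \<le> x * z"
  shows "0 \<le> a * x + 2 * (b * y) + c * z"
proof -
  have "(b * y)^2 \<le> (a * c) * (x * z)" unfolding power_mult_distrib
    using assms by (intro mult_mono) auto
  moreover have "4 * ((a * x) * (c * z)) \<le> (a * x + c * z)^2"
    using zero_le_power2[of "a * x - c * z"] by (simp add: power2_eq_square algebra_simps)
  ultimately have "(2 * (b * y))^2 \<le> (a * x + c * z)^2"
    by (simp add: power_mult_distrib algebra_simps)
  then have "\<bar>2 * (b * y)\<bar> \<le> a * x + c * z" using assms
    by (metis abs_le_square_iff abs_of_nonneg add_nonneg_nonneg mult_nonneg_nonneg)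
  then show ?thesis by linarith
qed

lemma psd2_coeffs:
  fixes a b c :: real
  assumes "\<And>s t. 0 \<le> a * s^2 + 2 * b * (s * t) + c * t^2"
  shows "0 \<le> a" "0 \<le> c" "b^2 \<le> a * c"
proof -
  show "0 \<le> a" using assms[of 1 0] by simp
  show "0 \<le> c" using assms[of 0 1] by simp
  show "b^2 \<le> a * c" using quadratic_nonneg[of a b c] assms[of 1] by (simp add: mult_ac)
qed

text \<open>Here $k = V^* M_+ V$ for a rank two update \<open>VV\<^sup>*\<close>, and $S = I - k$.\<close>

lemma rank_two_trace_bound:
  fixes k1 k12 k2 K1 K12 K2 L1 L12 L2 G1 G2 :: real
  assumes k: "\<And>s t. 0 \<le> k1 * s^2 + 2 * k12 * (s * t) + k2 * t^2"
    and k1: "\<And>s t. k1 * s^2 + 2 * k12 * (s * t) + k2 * t^2 \<le> s^2 + t^2"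
    and kg: "\<And>s t. k1 * s^2 + 2 * k12 * (s * t) + k2 * t^2 \<le> (G1 + G2) * (s^2 + t^2)"
    and K: "0 \<le> K1" "0 \<le> K2" "K12^2 \<le> K1 * K2"
    and L: "0 \<le> L1" "0 \<le> L2" "L12^2 \<le> L1 * L2"
    and G: "0 \<le> G1" "0 \<le> G2" "K1^2 \<le> G1 * L1" "K2^2 \<le> G2 * L2"
  defines "S1 \<equiv> 1 - k1" and "S2 \<equiv> 1 - k2" and "S12 \<equiv> - k12"
  shows "- 2 * (S1 * L1 + 2 * S12 * L12 + S2 * L2)
     + ((S1 * K1 + S12 * K12)^2 + 2 * (S1 * K12 + S12 * K2) * (S12 * K1 + S2 * K12) + (S12 * K12 + S2 * K2)^2)
     \<le> - 2 * (L1 + L2) + 3 * ((G1 + G2) * (L1 + L2))"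
proof -
  define g where "g = G1 + G2"
  have kp: "0 \<le> k1" "0 \<le> k2" "k12^2 \<le> k1 * k2" using psd2_coeffs[OF k] by auto
  have Sp: "0 \<le> S1" "0 \<le> S2" "S12^2 \<le> S1 * S2"
    by (rule psd2_coeffs[of S1 S12 S2]; use k1 in \<open>simp add: S1_def S2_def S12_def algebra_simps\<close>)+
  have T: "0 \<le> g - k1" "0 \<le> g - k2" "(- k12)^2 \<le> (g - k1) * (g - k2)"
    by (rule psd2_coeffs[of "g - k1" "- k12" "g - k2"]; use kg in \<open>simp add: g_def algebra_simps\<close>)+
  have 1: "k1 * L1 + 2 * k12 * L12 + k2 * L2 \<le> g * (L1 + L2)"
    using psd2_trace_nonneg[OF T L] by (simp add: algebra_simps)
  \<comment> \<open>\<open>X\<close> is tr(SK), and the quadratic part of the claim is the trace of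
    the square of SK, which equals X^2 - 2 det(S) det(K). \<open>G\<close>, \<open>K\<close> and
    \<open>L\<close> stand for the compressions of M, M^2 and M^3 to the columns of V.\<close>
  define X where "X = S1 * K1 + 2 * S12 * K12 + S2 * K2"
  have X0: "0 \<le> X" using psd2_trace_nonneg[OF Sp K] by (simp add: X_def algebra_simps)
  have X1: "X \<le> K1 + K2" using psd2_trace_nonneg[OF kp K]
    by (simp add: X_def S1_def S2_def S12_def algebra_simps)
  have "0 \<le> (S1 * S2 - S12^2) * (K1 * K2 - K12^2)" using Sp K by simp
  moreover have "(S1 * K1 + S12 * K12)^2 + 2 * (S1 * K12 + S12 * K2) * (S12 * K1 + S2 * K12) + (S12 * K12 + S2 * K2)^2
     = X^2 - 2 * ((S1 * S2 - S12^2) * (K1 * K2 - K12^2))"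
    by (simp add: X_def power2_eq_square algebra_simps)
  moreover have "X^2 \<le> (K1 + K2)^2" using X0 X1 by (simp add: power_mono)
  \<comment> \<open>Summed Cauchy-Schwarz: M^2 lies between M and M^3.\<close>
  moreover have "(K1 + K2)^2 \<le> g * (L1 + L2)"
  proof -
    have "(2 * (K1 * K2))^2 \<le> (G1 * L2 + G2 * L1)^2"
    proof -
      have "(K1 * K2)^2 \<le> (G1 * L1) * (G2 * L2)" unfolding power_mult_distrib
        using G L by (intro mult_mono) auto
      moreover have "4 * ((G1 * L2) * (G2 * L1)) \<le> (G1 * L2 + G2 * L1)^2"
        using zero_le_power2[of "G1 * L2 - G2 * L1"] by (simp add: power2_eq_square algebra_simps)
      ultimately show ?thesis by (simp add: power_mult_distrib algebra_simps)
    qed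
    then have "2 * (K1 * K2) \<le> G1 * L2 + G2 * L1"
      using G L by (meson abs_le_square_iff add_nonneg_nonneg mult_nonneg_nonneg power2_le_imp_le)
    then show ?thesis using G by (simp add: g_def power2_eq_square algebra_simps)
  qed
  ultimately have "(S1 * K1 + S12 * K12)^2 + 2 * (S1 * K12 + S12 * K2) * (S12 * K1 + S2 * K12) + (S12 * K12 + S2 * K2)^2
     \<le> g * (L1 + L2)" by linarith
  moreover have "S1 * L1 + 2 * S12 * L12 + S2 * L2 \<ge> (L1 + L2) - g * (L1 + L2)"
    using 1 by (simp add: S1_def S2_def S12_def algebra_simps)
  ultimately show ?thesis by (simp add: g_def)
qed

lemma inv_pairD:
  assumes "inv_pair B M"
  shows "selfadj B" "selfadj M" "M (B x) = x" "B (M x) = x"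
  using assms by (auto simp: inv_pair_def)

text \<open>A complex row acts on real coordinates through two real vectors, one for the real and
  one for the imaginary part; both contribute to the squared modulus.\<close>

definition qf2 :: "('h::real_inner \<Rightarrow> 'h) \<Rightarrow> 'h \<times> 'h \<Rightarrow> real" where
  "qf2 P e = qf P (fst e) + qf P (snd e)"

section \<open>Parseval frames and the operators carried by the barrier\<close>

locale parseval_frame =
  fixes E :: "nat \<Rightarrow> 'h::real_inner \<times> 'h" and d :: nat and H :: "'h set"
  assumes H_zero: "0 \<in> H" and H_add: "x \<in> H \<Longrightarrow> y \<in> H \<Longrightarrow> x + y \<in> H"
    and H_scale: "x \<in> H \<Longrightarrow> c *\<^sub>R x \<in> H"
    and frame_in: "l < d \<Longrightarrow> fst (E l) \<in> H" "l < d \<Longrightarrow> snd (E l) \<in> H"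
    and parseval: "y \<in> H \<Longrightarrow> (\<Sum>l<d. (inner (fst (E l)) y)^2 + (inner (snd (E l)) y)^2) = inner y y"
begin

text \<open>For a Parseval frame, \<open>fsum (qf P)\<close> is the trace of \<open>P\<close> on
  \<open>H\<close>; no orthonormal basis of \<open>H\<close> has to be chosen.\<close>

definition fsum :: "('h \<Rightarrow> 'b::comm_monoid_add) \<Rightarrow> 'b" where
  "fsum f = (\<Sum>l<d. f (fst (E l)) + f (snd (E l)))"

lemma fsum_add: "fsum (\<lambda>m. f m + g m) = fsum f + fsum g"
  by (simp add: fsum_def sum.distrib add_ac)

lemma fsum_scale: "fsum (\<lambda>m. c * f m) = (c::real) * fsum f"
  by (simp add: fsum_def sum_distrib_left distrib_left)

lemma fsum_mono: "(\<And>m. m \<in> H \<Longrightarrow> f m \<le> g m) \<Longrightarrow> fsum f \<le> (fsum g :: real)"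
  unfolding fsum_def by (intro sum_mono add_mono) (auto simp: frame_in)

lemma fsum_cong: "(\<And>m. m \<in> H \<Longrightarrow> f m = g m) \<Longrightarrow> fsum f = fsum g"
  unfolding fsum_def by (intro sum.cong arg_cong2[of _ _ _ _ "(+)"]) (auto simp: frame_in)

lemma fsum_nonneg: "(\<And>m. m \<in> H \<Longrightarrow> 0 \<le> f m) \<Longrightarrow> 0 \<le> (fsum f :: real)"
  unfolding fsum_def by (intro sum_nonneg add_nonneg_nonneg) (auto simp: frame_in)

lemma parseval': "y \<in> H \<Longrightarrow> fsum (\<lambda>m. (inner m y)^2) = inner y y"
  using parseval by (simp add: fsum_def)

lemma H_diff: "x \<in> H \<Longrightarrow> y \<in> H \<Longrightarrow> x - y \<in> H"
  using H_add[of x "(-1) *\<^sub>R y"] H_scale[of y "-1"] by simp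

lemma H_sum: "(\<And>i. i \<in> I \<Longrightarrow> f i \<in> H) \<Longrightarrow> sum f I \<in> H"
  by (induction I rule: infinite_finite_induct) (auto intro: H_zero H_add)

lemma parseval2: 
  assumes "x \<in> H" "y \<in> H"
  shows "fsum (\<lambda>m. inner m x * inner m y) = inner x y"
proof -
  have "fsum (\<lambda>m. (inner m (x + y))^2) = fsum (\<lambda>m. ((inner m x)^2 + (inner m y)^2) + 2 * (inner m x * inner m y))"
    by (rule fsum_cong) (simp add: inner_add_right power2_eq_square algebra_simps)
  then have "inner (x + y) (x + y) = inner x x + inner y y + 2 * fsum (\<lambda>m. inner m x * inner m y)"
    unfolding fsum_add fsum_scale using assms H_add by (simp add: parseval')
  then show ?thesis by (simp add: inner_add_left inner_add_right inner_commute)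
qed

text \<open>The frame operator, which for a Parseval frame is the orthogonal projection onto
  \<open>H\<close>. It plays the part of the identity in the shift.\<close>

definition Pi :: "'h \<Rightarrow> 'h" where
  "Pi y = fsum (\<lambda>m. inner m y *\<^sub>R m)"

lemma inner_fsum: "inner z (fsum f) = fsum (\<lambda>m. inner z (f m))"
  by (simp add: fsum_def inner_sum_right inner_add_right)

lemma Pi_in: "Pi y \<in> H"
  unfolding Pi_def fsum_def
  by (intro H_sum H_add H_scale) (auto simp: frame_in)

lemma inner_Pi: "inner z (Pi y) = fsum (\<lambda>m. inner m y * inner m z)"
  unfolding Pi_def inner_fsum by (simp add: inner_commute mult.commute)

lemma Pi_selfadj: "selfadj Pi"
  unfolding selfadj_def
proof (intro conjI allI linearI)
  fix x y c
  show "Pi (x + y) = Pi x + Pi y"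
    by (simp add: Pi_def inner_add_right scaleR_add_left fsum_add)
  show "Pi (c *\<^sub>R x) = c *\<^sub>R Pi x"
    by (simp add: Pi_def fsum_def scaleR_sum_right scaleR_add_right)
  show "inner (Pi x) y = inner x (Pi y)"
    using inner_Pi[of y x] inner_Pi[of x y] by (simp add: inner_commute mult.commute)
qed

lemma Pi_id: "y \<in> H \<Longrightarrow> Pi y = y"
proof -
  assume y: "y \<in> H"
  have z: "Pi y - y \<in> H" using y Pi_in H_diff by blast
  have "inner (Pi y - y) (Pi y) = inner (Pi y - y) y"
    unfolding inner_Pi using parseval2[OF y z] by (simp add: inner_commute)
  then have "inner (Pi y - y) (Pi y - y) = 0" by (simp add: inner_diff_right)
  then show ?thesis by simp
qed

lemma qf_Pi: "qf Pi x = inner (Pi x) (Pi x)"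
  using selfadjD(2)[OF Pi_selfadj, of x "Pi x"] Pi_id[OF Pi_in] by (simp add: qf_def)

lemma inner_Pi_right: "v \<in> H \<Longrightarrow> inner v (Pi x) = inner v x"
  using selfadjD(2)[OF Pi_selfadj, of v x] Pi_id by simp

text \<open>\<open>B\<close> is the barrier matrix and \<open>M\<close> its inverse on the whole
  space. Commuting with \<open>Pi\<close> keeps \<open>H\<close> invariant under both, and the
  positivity of \<open>B\<close> is what the process maintains.\<close>

definition good :: "('h \<Rightarrow> 'h) \<Rightarrow> ('h \<Rightarrow> 'h) \<Rightarrow> bool" where
  "good B M \<longleftrightarrow> inv_pair B M \<and> (\<forall>x. 0 \<le> qf B x) \<and> (\<forall>x. B (Pi x) = Pi (B x))"

lemma goodD:
  assumes "good B M"
  shows "inv_pair B M" "psd B" "psd M" "selfadj B" "selfadj M" "M (B x) = x" "B (M x) = x"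
    "B (Pi x) = Pi (B x)" "M (Pi x) = Pi (M x)" "x \<in> H \<Longrightarrow> M x \<in> H" "x \<noteq> 0 \<Longrightarrow> 0 < qf B x"
    "inner (M y) x = inner y (M x)"
proof -
  show 1: "inv_pair B M" "B (Pi x) = Pi (B x)" using assms by (auto simp: good_def)
  show 2: "selfadj B" "selfadj M" "M (B x) = x" "B (M x) = x" using inv_pairD[OF 1(1)] by auto
  show B: "psd B" using assms 2 by (simp add: good_def psd_def)
  have MB: "M (B y) = y" "B (M y) = y" for y using inv_pairD[OF 1(1)] by auto
  have "qf M y = qf B (M y)" for y by (simp add: qf_def MB inner_commute)
  then show "psd M" using assms 2 by (simp add: good_def psd_def)
  have "B (Pi (M x)) = Pi (B (M x))" using assms by (simp add: good_def)
  then have "M (B (Pi (M x))) = M (Pi x)" by (simp add: MB)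
  then show MP: "M (Pi x) = Pi (M x)" by (simp add: MB)
  show "x \<in> H \<Longrightarrow> M x \<in> H" using MP Pi_id Pi_in by metis
  show "inner (M y) x = inner y (M x)" using selfadjD(2)[OF 2(2)] .
  show "0 < qf B x" if "x \<noteq> 0"
  proof (rule ccontr)
    assume "\<not> 0 < qf B x"
    then have "qf B x = 0" using B by (auto simp: psd_def not_less intro: antisym)
    \<comment> \<open>A vector on which a semidefinite form vanishes lies in its kernel, by
      Cauchy-Schwarz; here the kernel is trivial.\<close>
    then have "(inner (B x) (B x))^2 \<le> 0" using psd_cauchy_schwarz[OF B, of "B x" x] by simp
    then have "B x = 0" by simp
    then have "M (B x) = M 0" by simp
    then show False using that MB selfadjD(6)[OF 2(2)] by simp
  qed
qed

definition trsq :: "('h \<Rightarrow> 'h) \<Rightarrow> real" where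
  "trsq M = fsum (\<lambda>m. inner (M m) (M m))"

text \<open>On \<open>H\<close> the operator norm is at most the Hilbert-Schmidt norm, whose square
  is \<open>trsq M\<close>. The last bound expresses the same for \<open>B\<close> by
  Cauchy-Schwarz.\<close>

lemma norm_bound:
  assumes "good B M" "trsq M \<le> \<eta>^2" "x \<in> H" "0 \<le> \<eta>"
  shows "inner (M x) (M x) \<le> \<eta>^2 * inner x x" "norm (M x) \<le> \<eta> * norm x" "qf M x \<le> \<eta> * inner x x"
    "inner x x \<le> \<eta> * qf B x"
proof -
  note g = goodD[OF assms(1)]
  have "inner (M x) (M x) = fsum (\<lambda>m. (inner m (M x))^2)"
    using g(10)[OF assms(3)] parseval' by simp
  also have "\<dots> \<le> fsum (\<lambda>m. inner x x * inner (M m) (M m))"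
  proof (rule fsum_mono)
    fix m show "(inner m (M x))^2 \<le> inner x x * inner (M m) (M m)"
      using Cauchy_Schwarz_ineq[of "M m" x] by (simp add: g(12) mult.commute)
  qed
  also have "\<dots> = inner x x * trsq M" by (simp add: fsum_scale trsq_def)
  also have "\<dots> \<le> inner x x * \<eta>^2" using assms(2) by (intro mult_left_mono) auto
  finally show 1: "inner (M x) (M x) \<le> \<eta>^2 * inner x x" by (simp add: mult.commute)
  then have "(norm (M x))^2 \<le> (\<eta> * norm x)^2" by (simp add: power2_norm_eq_inner power_mult_distrib)
  then show 2: "norm (M x) \<le> \<eta> * norm x" by (rule power2_le_imp_le) (simp add: assms(4))
  have "qf M x \<le> norm x * norm (M x)" unfolding qf_def by (rule norm_cauchy_schwarz)
  also have "\<dots> \<le> norm x * (\<eta> * norm x)" using 2 by (intro mult_left_mono) auto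
  also have "\<dots> = \<eta> * inner x x" by (simp add: power2_norm_eq_inner[symmetric] power2_eq_square)
  finally show 3: "qf M x \<le> \<eta> * inner x x" .
  show "inner x x \<le> \<eta> * qf B x"
  proof (cases "x = 0")
    case False
    have "(inner x x)^2 = (inner x (M (B x)))^2" by (simp add: g)
    also have "\<dots> \<le> qf M x * qf M (B x)" by (rule psd_cauchy_schwarz[OF g(3)])
    also have "qf M (B x) = qf B x" by (simp add: qf_def g inner_commute)
    also have "qf M x * qf B x \<le> (\<eta> * inner x x) * qf B x"
      using 3 g(2) by (intro mult_right_mono) (auto simp: psd_def)
    finally have "inner x x * inner x x \<le> inner x x * (\<eta> * qf B x)" by (simp add: power2_eq_square mult_ac)
    then show ?thesis using False by (simp add: mult_le_cancel_left)
  qed (simp add: qf_def)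
qed

text \<open>The projection is subtracted in 2d rank one updates with coefficient -\<delta>. Each
  partial sum dominates the full one, which is positive because \<delta> \<eta> < 1 and
  \<open>B\<close> is at least 1/\<eta> on \<open>H\<close>.\<close>

lemma shift_exists:
  assumes g: "good B M" "trsq M \<le> \<eta>^2" "0 \<le> \<eta>" "0 \<le> \<delta>" "\<delta> * \<eta> < 1"
  shows "\<exists>M'. good (\<lambda>x. B x - \<delta> *\<^sub>R Pi x) M'"
proof -
  define m where "m = (\<lambda>i. if i < d then fst (E i) else snd (E (i - d)))"
  have split: "(\<Sum>i<d+n. f i) = (\<Sum>i<d. f i) + (\<Sum>i<n. f (d + i))" for f :: "nat \<Rightarrow> 'b::comm_monoid_add" and n
    by (induction n) (auto simp: add_ac)
  have full: "(\<Sum>i<d+d. f (m i)) = fsum f" for f :: "'h \<Rightarrow> 'b::comm_monoid_add"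
    unfolding split by (simp add: m_def fsum_def sum.distrib)
  note gd = goodD[OF g(1)]
  \<comment> \<open>\<open>B\<close> does not mix \<open>H\<close> with its orthogonal complement,
    so that the component of \<open>x\<close> in \<open>H\<close> can be treated alone.\<close>
  have key: "0 < qf B x - \<delta> * qf Pi x" if "x \<noteq> 0" for x
  proof (cases "Pi x = 0")
    case True
    then show ?thesis using gd(11)[OF that] by (simp add: qf_def)
  next
    case False
    define p q where "p = Pi x" and "q = x - Pi x"
    have "B p \<in> H" unfolding p_def by (simp add: gd(8) Pi_in)
    then have "inner q (B p) = 0"
      using inner_Pi_right[of "B p" x] unfolding q_def by (simp add: inner_diff_left inner_diff_right inner_commute)
    moreover have "inner p (B q) = 0" using calculation selfadjD(2)[OF gd(4), of q p] selfadjD(2)[OF gd(4), of p q]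
      by (simp add: inner_commute)
    moreover have x: "x = p + q" by (simp add: p_def q_def)
    ultimately have "qf B x = qf B p + qf B q"
      by (simp add: qf_def x selfadjD(3)[OF gd(4)] inner_add_left inner_add_right)
    then have 1: "qf B x \<ge> qf B p" using gd(2) by (simp add: psd_def)
    have "inner p p \<le> \<eta> * qf B p" using norm_bound(4)[OF g(1,2) _ g(3)] Pi_in by (simp add: p_def)
    moreover have "inner p p > 0" using False by (simp add: p_def)
    ultimately have 2: "\<eta> * qf B p > 0" by linarith
    then have "qf B p > 0" using g(3) by (auto simp: zero_less_mult_iff)
    have "\<delta> * inner p p \<le> \<delta> * (\<eta> * qf B p)" using \<open>inner p p \<le> \<eta> * qf B p\<close> g(4) by (intro mult_left_mono) auto
    also have "\<dots> = (\<delta> * \<eta>) * qf B p" by simp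
    also have "\<dots> < 1 * qf B p" using g(5) \<open>qf B p > 0\<close> by (intro mult_strict_right_mono)
    finally show ?thesis using 1 by (simp add: qf_Pi p_def)
  qed
  have "\<exists>M'. inv_pair (\<lambda>x. B x + (\<Sum>i<d+d. (- \<delta> * inner (m i) x) *\<^sub>R m i)) M'"
  proof (rule inv_pair_updates[OF gd(1)])
    fix k and x :: 'h assume k: "k \<le> d + d" and x: "x \<noteq> 0"
    have "(\<Sum>i<k. (inner (m i) x)^2) \<le> (\<Sum>i<d+d. (inner (m i) x)^2)"
      by (rule sum_mono2) (use k in auto)
    also have "\<dots> = qf Pi x" unfolding full[of "\<lambda>m. (inner m x)^2"] by (simp add: qf_def inner_Pi power2_eq_square)
    finally have "\<delta> * (\<Sum>i<k. (inner (m i) x)^2) \<le> \<delta> * qf Pi x" using g(4) by (rule mult_left_mono)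
    then show "0 < qf B x + (\<Sum>i<k. - \<delta> * (inner (m i) x)^2)"
      using key[OF x] by (simp add: sum_distrib_left sum_negf)
  qed
  moreover have eq: "(\<lambda>x. B x + (\<Sum>i<d+d. (- \<delta> * inner (m i) x) *\<^sub>R m i)) = (\<lambda>x. B x - \<delta> *\<^sub>R Pi x)"
  proof
    fix x
    have "(\<Sum>i<d+d. (- \<delta> * inner (m i) x) *\<^sub>R m i) = fsum (\<lambda>m. (- \<delta> * inner m x) *\<^sub>R m)"
      by (rule full[of "\<lambda>m. (- \<delta> * inner m x) *\<^sub>R m"])
    also have "\<dots> = - (\<delta> *\<^sub>R Pi x)"
      by (simp add: Pi_def fsum_def scaleR_sum_right sum_negf[symmetric] algebra_simps)
    finally show "B x + (\<Sum>i<d+d. (- \<delta> * inner (m i) x) *\<^sub>R m i) = B x - \<delta> *\<^sub>R Pi x" by simp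
  qed
  ultimately obtain M' where M': "inv_pair (\<lambda>x. B x - \<delta> *\<^sub>R Pi x) M'" by auto
  have "good (\<lambda>x. B x - \<delta> *\<^sub>R Pi x) M'"
    unfolding good_def
  proof (intro conjI allI M')
    fix x
    have "qf (\<lambda>x. B x - \<delta> *\<^sub>R Pi x) x = qf B x - \<delta> * qf Pi x"
      by (simp add: qf_def inner_diff_right)
    then show "0 \<le> qf (\<lambda>x. B x - \<delta> *\<^sub>R Pi x) x"
      using key[of x] by (cases "x = 0") (auto simp: qf_def)
    show "B (Pi x) - \<delta> *\<^sub>R Pi (Pi x) = Pi (B x - \<delta> *\<^sub>R Pi x)"
      by (simp add: gd(8) selfadjD[OF Pi_selfadj])
  qed
  then show ?thesis by blast
qed

text \<open>Everything comes from the resolvent identity Mt = M + \<delta> M Mt on \<open>H\<close>: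
  as \<delta> \<eta> \<le> 1/4, the correction has at most a quarter of the norm of the left
  side.\<close>

lemma shift_bounds:
  assumes g: "good B M" "trsq M \<le> \<eta>^2" "0 \<le> \<eta>" "0 \<le> \<delta>" "\<delta> * \<eta> \<le> 1/4"
    and gt: "good (\<lambda>x. B x - \<delta> *\<^sub>R Pi x) Mt" and u: "u \<in> H"
  shows "qf Mt u \<le> qf M u + \<delta> * inner (Mt u) (Mt u)"
    "inner (Mt u) (Mt u) \<le> inner (M u) (M u) + 2 * \<delta> * qf Mt (Mt u)"
    "norm (Mt u) \<le> 2 * norm (M u)"
    "qf Mt u \<le> 2 * qf M u"
    "inner (Mt u) (Mt u) \<le> 2 * \<eta> * qf Mt u"
proof -
  note gd = goodD[OF g(1)] and gtd = goodD[OF gt]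
  note l = selfadjD[OF gd(5)]
  have eq: "Mt y = M y + \<delta> *\<^sub>R M (Mt y)" if "y \<in> H" for y
  proof -
    have "M (B (Mt y) - \<delta> *\<^sub>R Pi (Mt y)) = M y" using gtd(7)[of y] by simp
    moreover have "Pi (Mt y) = Mt y" using gtd(10)[OF that] Pi_id by blast
    ultimately show ?thesis by (simp add: l gd(6) algebra_simps)
  qed
  have nt: "norm (Mt y) \<le> 2 * norm (M y)" if "y \<in> H" for y
  proof -
    have "norm (Mt y) \<le> norm (M y) + \<delta> * norm (M (Mt y))"
      using norm_triangle_ineq[of "M y" "\<delta> *\<^sub>R M (Mt y)"] eq[OF that] g(4) by simp
    moreover have "\<delta> * norm (M (Mt y)) \<le> \<delta> * (\<eta> * norm (Mt y))"
      using norm_bound(2)[OF g(1,2) gtd(10)[OF that] g(3)] g(4) by (intro mult_left_mono)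
    moreover have "(\<delta> * \<eta>) * norm (Mt y) \<le> (1/4) * norm (Mt y)" using g(5) by (intro mult_right_mono) auto
    moreover have "0 \<le> norm (Mt y)" by simp
    ultimately show ?thesis by (simp only: mult.assoc)
  qed
  then show "norm (Mt u) \<le> 2 * norm (M u)" using u .
  define w where "w = Mt u"
  have w: "w \<in> H" using gtd(10)[OF u] by (simp add: w_def)
  have ew: "w = M u + \<delta> *\<^sub>R M w" using eq[OF u] by (simp add: w_def)
  have qMw: "0 \<le> qf M w" using gd(3) by (simp add: psd_def)
  have iuw: "inner u (M w) = inner (M u) w" using gd(12) by simp
  have d1: "qf Mt u - qf M u = \<delta> * inner (M u) w"
  proof -
    have "qf Mt u = inner u w" by (simp add: qf_def w_def)
    also have "\<dots> = qf M u + \<delta> * inner u (M w)" by (subst ew) (simp add: qf_def inner_add_right)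
    finally show ?thesis by (simp add: iuw)
  qed
  have Mu: "M u = w - \<delta> *\<^sub>R M w" using ew by (simp add: algebra_simps)
  have d2: "inner (M u) w = inner w w - \<delta> * qf M w"
    unfolding Mu by (simp add: inner_diff_left qf_def inner_commute[of "M w" w])
  have "\<delta> * (\<delta> * qf M w) \<ge> 0" using g(4) qMw by simp
  then show 1: "qf Mt u \<le> qf M u + \<delta> * inner (Mt u) (Mt u)"
  proof -
    have "qf Mt u - qf M u = \<delta> * inner w w - \<delta> * (\<delta> * qf M w)" using d1 d2 by (simp add: right_diff_distrib)
    then show ?thesis unfolding w_def[symmetric] using \<open>0 \<le> \<delta> * (\<delta> * qf M w)\<close> by linarith
  qed
  have mono: "qf M y \<le> qf Mt y" if y: "y \<in> H" for y
  proof -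
    have yw: "Mt y \<in> H" using gtd(10)[OF y] .
    have "qf Mt y - qf M y = \<delta> * inner (M y) (Mt y)"
    proof -
      have "qf Mt y = inner y (M y + \<delta> *\<^sub>R M (Mt y))" using eq[OF y] by (simp add: qf_def)
      then show ?thesis using gd(12)[of y "Mt y"] by (simp add: qf_def inner_add_right)
    qed
    moreover have "inner (M y) (Mt y) = inner (Mt y) (Mt y) - \<delta> * qf M (Mt y)"
    proof -
      have "M y = Mt y - \<delta> *\<^sub>R M (Mt y)" using eq[OF y] by (simp add: algebra_simps)
      then show ?thesis by (simp add: inner_diff_left qf_def inner_commute[of "M (Mt y)" "Mt y"])
    qed
    moreover have "\<delta> * qf M (Mt y) \<le> inner (Mt y) (Mt y)"
    proof -
      have "\<delta> * qf M (Mt y) \<le> \<delta> * (\<eta> * inner (Mt y) (Mt y))"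
        using norm_bound(3)[OF g(1,2) yw g(3)] g(4) by (intro mult_left_mono)
      moreover have "(\<delta> * \<eta>) * inner (Mt y) (Mt y) \<le> 1 * inner (Mt y) (Mt y)" using g(5) by (intro mult_right_mono) auto
      ultimately show ?thesis by simp
    qed
    ultimately have "0 \<le> qf Mt y - qf M y" using g(4) by simp
    then show ?thesis by simp
  qed
  show "inner (Mt u) (Mt u) \<le> inner (M u) (M u) + 2 * \<delta> * qf Mt (Mt u)"
  proof -
    have "inner w w - inner (M u) (M u) = inner (w - M u) (w + M u)"
      by (simp add: inner_diff_left inner_add_right inner_commute[of "M u" w])
    also have "w - M u = \<delta> *\<^sub>R M w" using ew by (metis add_diff_cancel_left')
    also have "w + M u = 2 *\<^sub>R w - \<delta> *\<^sub>R M w" unfolding Mu by (simp add: scaleR_2)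
    also have "inner (\<delta> *\<^sub>R M w) (2 *\<^sub>R w - \<delta> *\<^sub>R M w) = 2 * \<delta> * qf M w - \<delta>^2 * inner (M w) (M w)"
      by (simp add: inner_diff_right qf_def inner_commute power2_eq_square)
    also have "\<dots> \<le> 2 * \<delta> * qf Mt w"
    proof -
      have "0 \<le> \<delta>^2 * inner (M w) (M w)" by simp
      moreover have "2 * \<delta> * qf M w \<le> 2 * \<delta> * qf Mt w" using mono[OF w] g(4) by (intro mult_left_mono) auto
      ultimately show ?thesis by linarith
    qed
    finally show ?thesis by (simp add: w_def)
  qed
  have "inner w w \<le> 2 * \<eta> * qf Mt u"
  proof (cases "w = 0")
    case True
    then show ?thesis using gtd(3) g(3) by (simp add: psd_def)
  next
    case False
    have "inner u (Mt w) = inner w w" unfolding w_def using gtd(12)[of u "Mt u"] by simp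
    then have "(inner w w)^2 \<le> qf Mt u * qf Mt w" using psd_cauchy_schwarz[OF gtd(3), of u w] by simp
    also have "qf Mt w \<le> 2 * \<eta> * inner w w"
    proof -
      have "qf Mt w \<le> norm w * norm (Mt w)" unfolding qf_def by (rule norm_cauchy_schwarz)
      also have "\<dots> \<le> norm w * (2 * (\<eta> * norm w))"
        using nt[OF w] norm_bound(2)[OF g(1,2) w g(3)] by (intro mult_left_mono) auto
      also have "\<dots> = 2 * \<eta> * inner w w" by (simp add: power2_norm_eq_inner[symmetric] power2_eq_square)
      finally show ?thesis .
    qed
    then have "qf Mt u * qf Mt w \<le> qf Mt u * (2 * \<eta> * inner w w)" using gtd(3) by (intro mult_left_mono) (auto simp: psd_def)
    finally have "inner w w * inner w w \<le> inner w w * (2 * \<eta> * qf Mt u)" by (simp add: power2_eq_square mult_ac)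
    then show ?thesis using False by (simp add: mult_le_cancel_left)
  qed
  then show "inner (Mt u) (Mt u) \<le> 2 * \<eta> * qf Mt u" by (simp add: w_def)
  from \<open>inner w w \<le> 2 * \<eta> * qf Mt u\<close> have "\<delta> * inner w w \<le> \<delta> * (2 * \<eta> * qf Mt u)" using g(4) by (rule mult_left_mono)
  also have "\<dots> = (2 * (\<delta> * \<eta>)) * qf Mt u" by simp
  also have "\<dots> \<le> (1/2) * qf Mt u" using g(5) gtd(3) by (intro mult_right_mono) (auto simp: psd_def)
  finally show "qf Mt u \<le> 2 * qf M u" using 1 by (simp add: w_def)
qed

end

section \<open>Adding one column: rank two updates\<close>

context parseval_frame
begin

definition upd :: "('h \<Rightarrow> 'h) \<Rightarrow> 'h \<times> 'h \<Rightarrow> 'h \<Rightarrow> 'h" where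
  "upd B v x = B x + inner (fst v) x *\<^sub>R fst v + inner (snd v) x *\<^sub>R snd v"

lemma qf_upd: "qf (upd B v) x = qf B x + (inner (fst v) x)^2 + (inner (snd v) x)^2"
  by (simp add: qf_def upd_def inner_add_right power2_eq_square inner_commute)

lemma upd_exists:
  assumes g: "good B M" and v: "fst v \<in> H" "snd v \<in> H"
  shows "\<exists>M'. good (upd B v) M'"
proof -
  define m where "m = (\<lambda>i::nat. if i = 0 then fst v else snd v)"
  note gd = goodD[OF g]
  have "\<exists>M'. inv_pair (\<lambda>x. B x + (\<Sum>i<2. (1 * inner (m i) x) *\<^sub>R m i)) M'"
  proof (rule inv_pair_updates[OF gd(1)])
    fix k x assume "x \<noteq> (0::'h)"
    then show "0 < qf B x + (\<Sum>i<k. 1 * (inner (m i) x)^2)"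
      using gd(11) by (intro add_pos_nonneg sum_nonneg) auto
  qed
  moreover have "(\<lambda>x. B x + (\<Sum>i<2. (1 * inner (m i) x) *\<^sub>R m i)) = upd B v"
    by (rule ext) (simp add: upd_def m_def numeral_2_eq_2 add.assoc)
  ultimately obtain M' where M': "inv_pair (upd B v) M'" by auto
  have "good (upd B v) M'" unfolding good_def
  proof (intro conjI allI M')
    fix x
    show "0 \<le> qf (upd B v) x" using gd(2) by (simp add: qf_upd psd_def)
    show "upd B v (Pi x) = Pi (upd B v x)"
      using v by (simp add: upd_def gd(8) selfadjD[OF Pi_selfadj] inner_Pi_right Pi_id)
  qed
  then show ?thesis by blast
qed

text \<open>Let V have the two vectors of \<open>v\<close> as columns and put k = V* Mp V. Then Mp =
  M - M V (I - k) V* M, and the bounds follow from 0 \<le> k, k \<le> I and k \<le> g I with g =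
  \<open>qf2 M v\<close>.\<close>

lemma upd_bounds:
  assumes g: "good B M" and gp: "good (upd B v) Mp" and v: "fst v \<in> H" "snd v \<in> H"
  defines "P \<equiv> \<lambda>u. (inner (M u) (fst v))^2 + (inner (M u) (snd v))^2"
  shows "qf M u - qf Mp u \<le> P u" "(1 - qf2 M v) * P u \<le> qf M u - qf Mp u"
    "trsq Mp \<le> trsq M - 2 * (qf M (M (fst v)) + qf M (M (snd v)))
       + 3 * (qf2 M v * (qf M (M (fst v)) + qf M (M (snd v))))"
    "0 \<le> qf Mp u" "qf Mp u \<le> qf M u"
proof -
  note gd = goodD[OF g] and gpd = goodD[OF gp]
  note l = selfadjD[OF gd(5)] and lp = selfadjD[OF gpd(5)]
  show "0 \<le> qf Mp u" using gpd(3) by (simp add: psd_def)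
  define v1 v2 where "v1 = fst v" and "v2 = snd v"
  define g1 g2 where "g1 = M v1" and "g2 = M v2"
  define k1 k12 k2 where "k1 = qf Mp v1" and "k12 = inner v1 (Mp v2)" and "k2 = qf Mp v2"
  define S1 S12 S2 where "S1 = 1 - k1" and "S12 = - k12" and "S2 = 1 - k2"
  have upd: "upd B v x = B x + inner v1 x *\<^sub>R v1 + inner v2 x *\<^sub>R v2" for x
    by (simp add: upd_def v1_def v2_def)
  have k21: "inner v2 (Mp v1) = k12" using gpd(12)[of v2 v1] by (simp add: k12_def inner_commute)
  have Mp0: "Mp x = M x - inner v1 (Mp x) *\<^sub>R g1 - inner v2 (Mp x) *\<^sub>R g2" for x
  proof -
    have "M (upd B v (Mp x)) = M x" using gpd(7) by simp
    then have "Mp x + inner v1 (Mp x) *\<^sub>R g1 + inner v2 (Mp x) *\<^sub>R g2 = M x"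
      by (simp add: upd l gd(6) g1_def g2_def)
    then show ?thesis by (simp add: algebra_simps)
  qed
  have sym: "inner v1 (Mp x) = inner (Mp v1) x" "inner v2 (Mp x) = inner (Mp v2) x" for x
    using gpd(12) by simp_all
  have Mpv1: "Mp v1 = S1 *\<^sub>R g1 + S12 *\<^sub>R g2"
    using Mp0[of v1] k21 by (simp add: k1_def qf_def S1_def S12_def g1_def scaleR_diff_left)
  have Mpv2: "Mp v2 = S12 *\<^sub>R g1 + S2 *\<^sub>R g2"
    using Mp0[of v2] by (simp add: k12_def k2_def qf_def S2_def S12_def g2_def scaleR_diff_left algebra_simps)
  have Mp: "Mp x = M x - (S1 * inner g1 x + S12 * inner g2 x) *\<^sub>R g1 - (S12 * inner g1 x + S2 * inner g2 x) *\<^sub>R g2" for x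
    using Mp0[of x] unfolding sym Mpv1 Mpv2 by (simp add: inner_add_left)
  have gi: "inner x g1 = inner (M x) v1" "inner x g2 = inner (M x) v2" for x
    using gd(12) by (simp_all add: g1_def g2_def)
  have kform: "k1 * s^2 + 2 * k12 * (s * t) + k2 * t^2 = qf Mp (s *\<^sub>R v1 + t *\<^sub>R v2)" for s t
    by (simp add: qf_def lp inner_add_left inner_add_right k1_def k2_def k12_def k21 power2_eq_square algebra_simps)
  have k0: "0 \<le> k1 * s^2 + 2 * k12 * (s * t) + k2 * t^2" for s t
    unfolding kform using gpd(3) by (simp add: psd_def)
  \<comment> \<open>Inversion reverses the order. Writing x = B w + z with w = \<open>Mp x\<close>,
    the two forms differ by \<open>inner z w + qf M z\<close>, and both terms are
    nonnegative.\<close>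
  have mono: "qf Mp x \<le> qf M x" for x
  proof -
    define w where "w = Mp x"
    have x: "x = upd B v w" using gpd(7) by (simp add: w_def)
    define z where "z = inner v1 w *\<^sub>R v1 + inner v2 w *\<^sub>R v2"
    have xz: "x = B w + z" by (simp add: x upd z_def add.assoc)
    have "M x = w + M z" by (simp add: xz l gd(6))
    then have "qf M x = inner (B w) w + inner (B w) (M z) + inner z w + qf M z"
      by (simp add: qf_def xz inner_add_left inner_add_right)
    also have "inner (B w) (M z) = inner w z" using gd(12)[of "B w" z] gd(6) by simp
    finally have "qf M x = inner (B w) w + 2 * inner z w + qf M z" by (simp add: inner_commute)
    moreover have "qf Mp x = inner x w" by (simp add: qf_def w_def)
    then have "qf Mp x = inner (B w) w + inner z w" unfolding inner_add_left[symmetric] xz[symmetric] .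
    moreover have "inner z w \<ge> 0" by (simp add: z_def inner_add_left)
    moreover have "qf M z \<ge> 0" using gd(3) by (simp add: psd_def)
    ultimately show ?thesis by linarith
  qed
  then show "qf Mp u \<le> qf M u" .
  have kg: "k1 * s^2 + 2 * k12 * (s * t) + k2 * t^2 \<le> (qf M v1 + qf M v2) * (s^2 + t^2)" for s t
    unfolding kform using mono psd_combination[OF gd(3), of s v1 t v2] by (metis mult.commute order_trans)
  \<comment> \<open>If \<kappa> is the value of k at (s, t), Cauchy-Schwarz gives \<kappa>^2 \<le>
    (s^2 + t^2) \<kappa>, because \<open>upd B v\<close> dominates its rank two part.\<close>
  have k1': "k1 * s^2 + 2 * k12 * (s * t) + k2 * t^2 \<le> s^2 + t^2" for s t
  proof -
    define w where "w = Mp (s *\<^sub>R v1 + t *\<^sub>R v2)"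
    define \<kappa> where "\<kappa> = qf Mp (s *\<^sub>R v1 + t *\<^sub>R v2)"
    have "\<kappa> = s * inner v1 w + t * inner v2 w" by (simp add: \<kappa>_def qf_def w_def inner_add_left)
    then have "\<kappa>^2 \<le> (s^2 + t^2) * ((inner v1 w)^2 + (inner v2 w)^2)"
      using zero_le_power2[of "s * inner v2 w - t * inner v1 w"] by (simp add: power2_eq_square algebra_simps)
    also have "\<dots> \<le> (s^2 + t^2) * \<kappa>"
    proof (rule mult_left_mono)
      have "\<kappa> = qf (upd B v) w" using gpd(7) by (simp add: \<kappa>_def qf_def w_def inner_commute)
      also have "\<dots> = qf B w + (inner v1 w)^2 + (inner v2 w)^2" by (simp add: qf_upd v1_def v2_def)
      finally show "(inner v1 w)^2 + (inner v2 w)^2 \<le> \<kappa>" using gd(2) by (simp add: psd_def)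
    qed simp
    finally have "\<kappa> * \<kappa> \<le> (s^2 + t^2) * \<kappa>" by (simp add: power2_eq_square)
    moreover have "0 \<le> \<kappa>" using gpd(3) by (simp add: \<kappa>_def psd_def)
    ultimately show ?thesis unfolding kform \<kappa>_def[symmetric]
      by (cases "\<kappa> = 0") (auto simp: mult_le_cancel_right)
  qed
  have Y: "qf M u - qf Mp u = (inner g1 u)^2 + (inner g2 u)^2
      - (k1 * (inner g1 u)^2 + 2 * k12 * (inner g1 u * inner g2 u) + k2 * (inner g2 u)^2)"
    unfolding qf_def Mp by (simp add: inner_diff_right S1_def S12_def S2_def inner_commute power2_eq_square algebra_simps)
  have Pu: "P u = (inner g1 u)^2 + (inner g2 u)^2"
    using gi[of u] by (simp add: P_def v1_def v2_def inner_commute)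
  show "qf M u - qf Mp u \<le> P u" unfolding Y Pu using k0[of "inner g1 u" "inner g2 u"] by simp
  show "(1 - qf2 M v) * P u \<le> qf M u - qf Mp u"
    unfolding Y Pu using kg[of "inner g1 u" "inner g2 u"] by (simp add: qf2_def v1_def v2_def algebra_simps)
  have gH: "g1 \<in> H" "g2 \<in> H" unfolding g1_def g2_def v1_def v2_def using gd(10) v by auto
  have gMH: "M g1 \<in> H" "M g2 \<in> H" using gd(10) gH by auto
  define K1 K12 K2 where "K1 = inner g1 g1" and "K12 = inner g1 g2" and "K2 = inner g2 g2"
  define L1 L12 L2 where "L1 = qf M g1" and "L12 = inner g1 (M g2)" and "L2 = qf M g2"
  have L21: "inner g2 (M g1) = L12" using gd(12)[of g2 g1] by (simp add: L12_def inner_commute)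
  \<comment> \<open>Expanded into products of two inner products with \<open>m\<close>, so that
    \<open>parseval2\<close> sums every term over the frame.\<close>
  have "trsq Mp = fsum (\<lambda>m. inner (M m) (M m)
     + (-2) * (S1 * (inner m g1 * inner m (M g1)) + S12 * (inner m g2 * inner m (M g1)) + (S12 * (inner m g1 * inner m (M g2)) + S2 * (inner m g2 * inner m (M g2))))
     + (K1 * (S1^2 * (inner m g1 * inner m g1) + 2 * S1 * S12 * (inner m g1 * inner m g2) + S12^2 * (inner m g2 * inner m g2))
      + 2 * K12 * (S1 * S12 * (inner m g1 * inner m g1) + (S1 * S2 + S12 * S12) * (inner m g1 * inner m g2) + S12 * S2 * (inner m g2 * inner m g2))
      + K2 * (S12^2 * (inner m g1 * inner m g1) + 2 * S12 * S2 * (inner m g1 * inner m g2) + S2^2 * (inner m g2 * inner m g2))))"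
    unfolding trsq_def
  proof (rule fsum_cong)
    fix m
    define a b where "a = inner m g1" and "b = inner m g2"
    define p q where "p = S1 * a + S12 * b" and "q = S12 * a + S2 * b"
    have i: "inner g1 m = a" "inner g2 m = b" by (simp_all add: a_def b_def inner_commute)
    have iM: "inner (M m) g1 = inner m (M g1)" "inner (M m) g2 = inner m (M g2)"
      "inner g1 (M m) = inner m (M g1)" "inner g2 (M m) = inner m (M g2)"
      using gd(12) by (simp_all add: inner_commute)
    have "inner (Mp m) (Mp m) = inner (M m) (M m) - 2 * (p * inner m (M g1) + q * inner m (M g2))
       + (p^2 * K1 + 2 * (p * q) * K12 + q^2 * K2)"
      unfolding Mp[of m] i p_def[symmetric] q_def[symmetric]
      by (simp add: inner_diff_left inner_diff_right iM K1_def K12_def K2_def power2_eq_square algebra_simps inner_commute[of g2 g1])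
    then show "inner (Mp m) (Mp m) = inner (M m) (M m)
     + (-2) * (S1 * (inner m g1 * inner m (M g1)) + S12 * (inner m g2 * inner m (M g1)) + (S12 * (inner m g1 * inner m (M g2)) + S2 * (inner m g2 * inner m (M g2))))
     + (K1 * (S1^2 * (inner m g1 * inner m g1) + 2 * S1 * S12 * (inner m g1 * inner m g2) + S12^2 * (inner m g2 * inner m g2))
      + 2 * K12 * (S1 * S12 * (inner m g1 * inner m g1) + (S1 * S2 + S12 * S12) * (inner m g1 * inner m g2) + S12 * S2 * (inner m g2 * inner m g2))
      + K2 * (S12^2 * (inner m g1 * inner m g1) + 2 * S12 * S2 * (inner m g1 * inner m g2) + S2^2 * (inner m g2 * inner m g2)))"
      unfolding a_def[symmetric] b_def[symmetric] p_def q_def by (simp add: power2_eq_square algebra_simps)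
  qed
  also have "\<dots> = trsq M + (-2) * (S1 * L1 + S12 * L12 + (S12 * L12 + S2 * L2))
     + (K1 * (S1^2 * K1 + 2 * S1 * S12 * K12 + S12^2 * K2)
      + 2 * K12 * (S1 * S12 * K1 + (S1 * S2 + S12 * S12) * K12 + S12 * S2 * K2)
      + K2 * (S12^2 * K1 + 2 * S12 * S2 * K12 + S2^2 * K2))"
    unfolding fsum_add fsum_scale trsq_def[symmetric]
      parseval2[OF gH(1) gMH(1)] parseval2[OF gH(2) gMH(1)] parseval2[OF gH(1) gMH(2)] parseval2[OF gH(2) gMH(2)]
      parseval2[OF gH(1) gH(1)] parseval2[OF gH(1) gH(2)] parseval2[OF gH(2) gH(2)]
    by (simp add: L1_def L2_def L12_def L21[unfolded L12_def] K1_def K12_def K2_def qf_def)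
  also have "\<dots> = trsq M + (- 2 * (S1 * L1 + 2 * S12 * L12 + S2 * L2)
     + ((S1 * K1 + S12 * K12)^2 + 2 * (S1 * K12 + S12 * K2) * (S12 * K1 + S2 * K12) + (S12 * K12 + S2 * K2)^2))"
    by (simp add: power2_eq_square algebra_simps)
  also have "\<dots> \<le> trsq M + (- 2 * (L1 + L2) + 3 * ((qf M v1 + qf M v2) * (L1 + L2)))"
    unfolding S1_def S2_def S12_def
  proof (intro add_left_mono rank_two_trace_bound k0 k1' kg)
    show "0 \<le> K1" "0 \<le> K2" by (simp_all add: K1_def K2_def)
    show "K12^2 \<le> K1 * K2" unfolding K12_def K1_def K2_def by (rule Cauchy_Schwarz_ineq)
    show "0 \<le> L1" "0 \<le> L2" "0 \<le> qf M v1" "0 \<le> qf M v2" using gd(3) by (simp_all add: L1_def L2_def psd_def)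
    show "L12^2 \<le> L1 * L2" unfolding L12_def L1_def L2_def by (rule psd_cauchy_schwarz[OF gd(3)])
    have "inner v1 (M g1) = K1" "inner v2 (M g2) = K2"
      using gd(12) by (simp_all add: K1_def K2_def g1_def g2_def flip: gd(12))
    then show "K1^2 \<le> qf M v1 * L1" "K2^2 \<le> qf M v2 * L2"
      using psd_cauchy_schwarz[OF gd(3), of v1 g1] psd_cauchy_schwarz[OF gd(3), of v2 g2] by (simp_all add: L1_def L2_def)
  qed
  finally show "trsq Mp \<le> trsq M - 2 * (qf M (M (fst v)) + qf M (M (snd v)))
       + 3 * (qf2 M v * (qf M (M (fst v)) + qf M (M (snd v))))"
    by (simp add: qf2_def L1_def L2_def g1_def g2_def v1_def v2_def algebra_simps)
qed

end

text \<open>Taylor expansion of order two. In the induction, multiplying by x - y creates a third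
  order term with a favourable sign, which is dropped.\<close>

lemma power_second_order:
  fixes x y :: real
  assumes "0 \<le> y" "y \<le> x"
  shows "(x - y)^(n+2) \<le> x^(n+2) - real (n+2) * x^(n+1) * y + real (n+2) * real (n+1) / 2 * x^n * y^2"
proof (induction n)
  case 0
  then show ?case by (simp add: power2_eq_square algebra_simps)
next
  case (Suc n)
  have "(x - y)^(Suc n+2) = (x - y) * (x - y)^(n+2)" by simp
  also have "\<dots> \<le> (x - y) * (x^(n+2) - real (n+2) * x^(n+1) * y + real (n+2) * real (n+1) / 2 * x^n * y^2)"
    by (rule mult_left_mono[OF Suc]) (use assms in auto)
  also have "\<dots> = x^(Suc n+2) - real (Suc n+2) * x^(Suc n+1) * y + real (Suc n+2) * real (Suc n+1) / 2 * x^(Suc n) * y^2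
      - real (n+2) * real (n+1) / 2 * x^n * y^3"
    by (simp add: power2_eq_square power3_eq_cube field_simps)
  also have "\<dots> \<le> x^(Suc n+2) - real (Suc n+2) * x^(Suc n+1) * y + real (Suc n+2) * real (Suc n+1) / 2 * x^(Suc n) * y^2"
    using assms by simp
  finally show ?case .
qed

text \<open>The tangent lies below a convex function. This is how the increase caused by the shift
  is compared with the decrease caused by the column.\<close>

lemma power_tangent:
  fixes x z :: real
  assumes "0 \<le> x" "0 \<le> z"
  shows "x^(n+1) - real (n+1) * x^n * (x - z) \<le> z^(n+1)"
proof (induction n)
  case (Suc n)
  have "x^(Suc n+1) - real (Suc n+1) * x^Suc n * (x - z) + real (n+1) * x^n * (x - z)^2 = z * (x^(n+1) - real (n+1) * x^n * (x - z))"
    by (simp add: power2_eq_square algebra_simps)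
  also have "\<dots> \<le> z * z^(n+1)" by (rule mult_left_mono[OF Suc assms(2)])
  finally have "x^(Suc n+1) - real (Suc n+1) * x^Suc n * (x - z) + real (n+1) * x^n * (x - z)^2 \<le> z^(Suc n+1)" by simp
  moreover have "0 \<le> real (n+1) * x^n * (x - z)^2" using assms by simp
  ultimately show ?case by linarith
qed simp

lemma qf2_nonneg: "psd P \<Longrightarrow> 0 \<le> qf2 P e"
  by (simp add: qf2_def psd_def)

section \<open>Expected change of both parts of the potential\<close>

context parseval_frame
begin

definition tr :: "('h \<Rightarrow> 'h) \<Rightarrow> real" where
  "tr P = (\<Sum>l<d. qf2 P (E l))"

lemma tr_fsum: "tr P = fsum (qf P)"
  by (simp add: tr_def fsum_def qf2_def)

lemma tr_nonneg: "psd P \<Longrightarrow> 0 \<le> tr P"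
  unfolding tr_def by (intro sum_nonneg qf2_nonneg)

text \<open>The law of one column: \<open>v\<close> is isotropic, and the fourth moments are those of a sparse
  Rademacher combination of the frame, where \<open>R\<close> is the ratio of dimension and sparsity.\<close>

definition column_law :: "'o pmf \<Rightarrow> ('o \<Rightarrow> 'h \<times> 'h) \<Rightarrow> real \<Rightarrow> bool" where
  "column_law q v R \<longleftrightarrow> finite (set_pmf q) \<and> (\<forall>\<omega>. fst (v \<omega>) \<in> H \<and> snd (v \<omega>) \<in> H) \<and>
    (\<forall>P. psd P \<longrightarrow> EV q (\<lambda>\<omega>. qf2 P (v \<omega>)) = tr P) \<and>
    (\<forall>P Q. psd P \<longrightarrow> psd Q \<longrightarrow> EV q (\<lambda>\<omega>. qf2 P (v \<omega>) * qf2 Q (v \<omega>))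
       \<le> 3 * (tr P * tr Q + R * (\<Sum>l<d. qf2 P (E l) * qf2 Q (E l))))"

text \<open>\<phi>, \<nu> and \<gamma> control the trace, the norm and the coherence of
  \<open>M\<close> with the frame. The gain is quadratic in the column and exact by isotropy; the
  losses are fourth moments, in which \<gamma> measures the deviation of a sparse column from a
  dense one.\<close>

lemma update_expectation:
  assumes q: "column_law q v R" and R: "0 \<le> R"
    and g: "good B M" and gp: "\<And>\<omega>. good (upd B (v \<omega>)) (Mp \<omega>)"
    and \<phi>: "tr M \<le> \<phi>" and \<nu>: "\<And>u. u \<in> H \<Longrightarrow> inner (M u) (M u) \<le> \<nu> * qf M u"
    and coh: "\<And>P. psd P \<Longrightarrow> R * (\<Sum>l<d. qf2 P (E l) * qf2 M (E l)) \<le> \<gamma> * tr P"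
  shows "EV q (\<lambda>\<omega>. trsq (Mp \<omega>)) \<le> trsq M + (9 * (\<phi> + \<gamma>) - 2) * fsum (\<lambda>m. qf M (M m))"
    and "fst e \<in> H \<Longrightarrow> snd e \<in> H \<Longrightarrow> EV q (\<lambda>\<omega>. qf2 (Mp \<omega>) e ^ (n+2)) \<le>
       qf2 M e ^ (n+2) + real (n+2) * qf2 M e ^ (n+1) * (inner (M (fst e)) (M (fst e)) + inner (M (snd e)) (M (snd e)))
         * (3 * (\<phi> + \<gamma>) + 3 * real (n+1) / 2 * (\<nu> + \<gamma>) - 1)"
proof -
  note gd = goodD[OF g]
  note l = selfadjD[OF gd(5)]
  have fin: "finite (set_pmf q)" and vH: "\<And>\<omega>. fst (v \<omega>) \<in> H" "\<And>\<omega>. snd (v \<omega>) \<in> H"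
    and iso: "\<And>P. psd P \<Longrightarrow> EV q (\<lambda>\<omega>. qf2 P (v \<omega>)) = tr P"
    and four: "\<And>P Q. psd P \<Longrightarrow> psd Q \<Longrightarrow> EV q (\<lambda>\<omega>. qf2 P (v \<omega>) * qf2 Q (v \<omega>))
       \<le> 3 * (tr P * tr Q + R * (\<Sum>l<d. qf2 P (E l) * qf2 Q (E l)))"
    using q by (auto simp: column_law_def)
  note ub = upd_bounds[OF g gp vH]
  have fourM: "EV q (\<lambda>\<omega>. qf2 M (v \<omega>) * qf2 P (v \<omega>)) \<le> 3 * (\<phi> + \<gamma>) * tr P" if P: "psd P" for P
  proof -
    have "EV q (\<lambda>\<omega>. qf2 P (v \<omega>) * qf2 M (v \<omega>)) \<le> 3 * (tr P * tr M + \<gamma> * tr P)"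
      by (rule order_trans[OF four[OF P gd(3)]]) (use coh[OF P] in simp)
    also have "\<dots> \<le> 3 * (tr P * \<phi> + \<gamma> * tr P)"
      using \<phi> tr_nonneg[OF P] by (intro mult_left_mono add_right_mono) auto
    finally show ?thesis by (simp add: algebra_simps)
  qed
  show "EV q (\<lambda>\<omega>. trsq (Mp \<omega>)) \<le> trsq M + (9 * (\<phi> + \<gamma>) - 2) * fsum (\<lambda>m. qf M (M m))"
  proof -
    \<comment> \<open>The cube of \<open>M\<close>: its form at the column is the leading decrease
      of the square trace.\<close>
    define Q where "Q = (\<lambda>x. M (M (M x)))"
    have qfQ: "qf Q x = qf M (M x)" for x by (simp add: qf_def Q_def gd(12))
    have "selfadj Q" unfolding selfadj_def
      by (intro conjI allI linearI) (simp_all add: Q_def l gd(12))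
    then have Q: "psd Q" using gd(3) by (simp add: psd_def qfQ)
    have trQ: "tr Q = fsum (\<lambda>m. qf M (M m))" unfolding tr_fsum qfQ[abs_def] ..
    have qf2Q: "qf2 Q w = qf M (M (fst w)) + qf M (M (snd w))" for w by (simp add: qf2_def qfQ)
    have "EV q (\<lambda>\<omega>. trsq (Mp \<omega>)) \<le> EV q (\<lambda>\<omega>. trsq M - 2 * qf2 Q (v \<omega>) + 3 * (qf2 M (v \<omega>) * qf2 Q (v \<omega>)))"
      by (rule EV_mono[OF fin]) (use ub(3) in \<open>simp add: qf2Q\<close>)
    also have "\<dots> = trsq M - 2 * tr Q + 3 * EV q (\<lambda>\<omega>. qf2 M (v \<omega>) * qf2 Q (v \<omega>))"
      by (simp add: EV_add[OF fin] EV_diff[OF fin] iso[OF Q])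
    also have "\<dots> \<le> trsq M - 2 * tr Q + 3 * (3 * (\<phi> + \<gamma>) * tr Q)"
      using fourM[OF Q] by simp
    finally show ?thesis by (simp add: trQ algebra_simps)
  qed
  assume e: "fst e \<in> H" "snd e \<in> H"
  define X where "X = qf2 M e"
  define w where "w = inner (M (fst e)) (M (fst e)) + inner (M (snd e)) (M (snd e))"
  \<comment> \<open>Chosen such that \<open>qf2 P (v \<omega>)\<close> is the leading decrease of
    \<open>qf2 M e\<close>; its trace \<open>w\<close> is the squared norm of \<open>M\<close>
    applied to both parts of \<open>e\<close>.\<close>
  define P where "P = (\<lambda>x. inner (M (fst e)) x *\<^sub>R M (fst e) + inner (M (snd e)) x *\<^sub>R M (snd e))"
  have qfP: "qf P x = (inner (M (fst e)) x)^2 + (inner (M (snd e)) x)^2" for x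
    by (simp add: qf_def P_def inner_add_right power2_eq_square inner_commute)
  have "selfadj P" unfolding selfadj_def
    by (intro conjI allI linearI) (simp_all add: P_def inner_add_right inner_add_left algebra_simps inner_commute)
  then have P: "psd P" by (simp add: psd_def qfP)
  have eH: "M (fst e) \<in> H" "M (snd e) \<in> H" using gd(10) e by auto
  have trP: "tr P = w"
  proof -
    have "tr P = fsum (\<lambda>m. (inner m (M (fst e)))^2 + (inner m (M (snd e)))^2)"
      unfolding tr_fsum by (rule fsum_cong) (simp add: qfP inner_commute)
    then show ?thesis unfolding fsum_add parseval'[OF eH(1)] parseval'[OF eH(2)] w_def .
  qed
  have X0: "0 \<le> X" unfolding X_def by (rule qf2_nonneg[OF gd(3)])
  have w0: "0 \<le> w" by (simp add: w_def)
  have wX: "w \<le> \<nu> * X" using \<nu>[OF e(1)] \<nu>[OF e(2)] by (simp add: w_def X_def qf2_def algebra_simps)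
  \<comment> \<open>By Cauchy-Schwarz \<open>P\<close> is dominated by \<open>X\<close> times
    \<open>M\<close>. This reduces the coherence of \<open>P\<close> with itself to that of
    \<open>P\<close> with \<open>M\<close>, which is assumed.\<close>
  have PX: "qf2 P z \<le> X * qf2 M z" for z
  proof -
    have "qf P x \<le> X * qf M x" for x
      using psd_cauchy_schwarz[OF gd(3), of "fst e" x] psd_cauchy_schwarz[OF gd(3), of "snd e" x]
      by (simp add: qfP gd(12) X_def qf2_def algebra_simps)
    then show ?thesis by (simp add: qf2_def distrib_left add_mono)
  qed
  have PP: "EV q (\<lambda>\<omega>. (qf2 P (v \<omega>))^2) \<le> 3 * (w * X * (\<nu> + \<gamma>))"
  proof -
    have "(\<Sum>l<d. qf2 P (E l) * qf2 P (E l)) \<le> (\<Sum>l<d. X * (qf2 P (E l) * qf2 M (E l)))"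
      by (rule sum_mono) (use mult_left_mono[OF PX qf2_nonneg[OF P]] in \<open>simp add: mult_ac\<close>)
    also have "\<dots> = X * (\<Sum>l<d. qf2 P (E l) * qf2 M (E l))" by (simp add: sum_distrib_left)
    finally have "R * (\<Sum>l<d. qf2 P (E l) * qf2 P (E l)) \<le> R * (X * (\<Sum>l<d. qf2 P (E l) * qf2 M (E l)))"
      using R by (rule mult_left_mono)
    also have "\<dots> = X * (R * (\<Sum>l<d. qf2 P (E l) * qf2 M (E l)))" by simp
    also have "\<dots> \<le> X * (\<gamma> * w)" using coh[OF P] X0 by (intro mult_left_mono) (auto simp: trP)
    finally have 1: "R * (\<Sum>l<d. qf2 P (E l) * qf2 P (E l)) \<le> X * (\<gamma> * w)" .
    have 2: "w * w \<le> w * (\<nu> * X)" using wX w0 by (rule mult_left_mono)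
    have "EV q (\<lambda>\<omega>. (qf2 P (v \<omega>))^2) \<le> 3 * (w * w + R * (\<Sum>l<d. qf2 P (E l) * qf2 P (E l)))"
      using four[OF P P] by (simp add: power2_eq_square trP)
    also have "\<dots> \<le> 3 * (w * (\<nu> * X) + X * (\<gamma> * w))" using 1 2 by simp
    finally show ?thesis by (simp add: algebra_simps)
  qed
  define c where "c = real (n+2) * real (n+1) / 2"
  have c0: "0 \<le> c" by (simp add: c_def)
  have step: "qf2 (Mp \<omega>) e ^ (n+2) \<le> X^(n+2) - real (n+2) * X^(n+1) * (qf2 P (v \<omega>) - qf2 M (v \<omega>) * qf2 P (v \<omega>))
      + c * X^n * (qf2 P (v \<omega>))^2" for \<omega>
  proof -
    define Y where "Y = X - qf2 (Mp \<omega>) e"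
    have P2: "qf2 P (v \<omega>) = ((inner (M (fst e)) (fst (v \<omega>)))^2 + (inner (M (fst e)) (snd (v \<omega>)))^2) +
      ((inner (M (snd e)) (fst (v \<omega>)))^2 + (inner (M (snd e)) (snd (v \<omega>)))^2)"
      by (simp add: qf2_def qfP)
    have Y0: "0 \<le> Y" using ub(5)[of \<omega> "fst e"] ub(5)[of \<omega> "snd e"] by (simp add: Y_def X_def qf2_def)
    have YX: "Y \<le> X" using ub(4)[of \<omega> "fst e"] ub(4)[of \<omega> "snd e"] by (simp add: Y_def qf2_def)
    have YP: "Y \<le> qf2 P (v \<omega>)" using ub(1)[of "fst e" \<omega>] ub(1)[of "snd e" \<omega>]
      unfolding P2 Y_def X_def qf2_def[of M] qf2_def[of "Mp \<omega>"] by linarith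
    have YL: "(1 - qf2 M (v \<omega>)) * qf2 P (v \<omega>) \<le> Y"
      using ub(2)[of \<omega> "fst e"] ub(2)[of \<omega> "snd e"] unfolding P2 distrib_left
      by (simp add: Y_def X_def qf2_def)
    have "qf2 (Mp \<omega>) e ^ (n+2) = (X - Y)^(n+2)" by (simp add: Y_def)
    also have "\<dots> \<le> X^(n+2) - real (n+2) * X^(n+1) * Y + c * X^n * Y^2"
      using power_second_order[OF Y0 YX, of n] by (simp add: c_def)
    also have "\<dots> \<le> X^(n+2) - real (n+2) * X^(n+1) * ((1 - qf2 M (v \<omega>)) * qf2 P (v \<omega>)) + c * X^n * (qf2 P (v \<omega>))^2"
      using X0 c0 Y0 YP by (intro add_mono diff_mono mult_left_mono YL power_mono) auto
    finally show ?thesis by (simp add: algebra_simps)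
  qed
  have "EV q (\<lambda>\<omega>. qf2 (Mp \<omega>) e ^ (n+2)) \<le> EV q (\<lambda>\<omega>. X^(n+2) - real (n+2) * X^(n+1) * (qf2 P (v \<omega>) - qf2 M (v \<omega>) * qf2 P (v \<omega>))
      + c * X^n * (qf2 P (v \<omega>))^2)"
    by (rule EV_mono[OF fin step])
  also have "\<dots> = X^(n+2) - real (n+2) * X^(n+1) * (w - EV q (\<lambda>\<omega>. qf2 M (v \<omega>) * qf2 P (v \<omega>)))
      + c * X^n * EV q (\<lambda>\<omega>. (qf2 P (v \<omega>))^2)"
    by (simp add: EV_add[OF fin] EV_diff[OF fin] iso[OF P] trP)
  also have "\<dots> \<le> X^(n+2) - real (n+2) * X^(n+1) * (w - 3 * (\<phi> + \<gamma>) * w) + c * X^n * (3 * (w * X * (\<nu> + \<gamma>)))"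
    using fourM[OF P] PP X0 c0 by (intro add_mono diff_mono mult_left_mono) (auto simp: trP)
  also have "\<dots> = X^(n+2) + real (n+2) * X^(n+1) * w * (3 * (\<phi> + \<gamma>) + 3 * real (n+1) / 2 * (\<nu> + \<gamma>) - 1)"
    by (simp add: c_def field_simps)
  finally show "EV q (\<lambda>\<omega>. qf2 (Mp \<omega>) e ^ (n+2)) \<le>
       qf2 M e ^ (n+2) + real (n+2) * qf2 M e ^ (n+1) * (inner (M (fst e)) (M (fst e)) + inner (M (snd e)) (M (snd e)))
         * (3 * (\<phi> + \<gamma>) + 3 * real (n+1) / 2 * (\<nu> + \<gamma>) - 1)"
    by (simp add: X_def w_def)
qed

definition weight :: "'h \<times> 'h \<Rightarrow> 'h \<Rightarrow> real" where
  "weight v y = (inner (fst v) y)^2 + (inner (snd v) y)^2"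

text \<open>As long as the barriers stay good, the last one is nonnegative, which is the desired
  bound with all shifts added up. Once the potential exceeds 1 it bounds any probability trivially;
  this replaces a stopping time.\<close>

lemma chain:
  fixes v :: "'o \<Rightarrow> 'h \<times> 'h"
  assumes fin: "finite (set_pmf q)" and pot0: "\<And>B M. good B M \<Longrightarrow> 0 \<le> pot M"
    and step: "\<And>B M. good B M \<Longrightarrow> pot M \<le> 1 \<Longrightarrow>
      \<exists>Mp. (\<forall>\<omega>. good (upd (\<lambda>x. B x - \<delta> *\<^sub>R Pi x) (v \<omega>)) (Mp \<omega>)) \<and> EV q (\<lambda>\<omega>. pot (Mp \<omega>)) \<le> pot M"
  shows "good B M \<Longrightarrow> measure_pmf.prob (replicate_pmf k q)
     {cs. \<exists>y\<in>H. qf B y + (\<Sum>\<omega>\<leftarrow>cs. weight (v \<omega>) y) < \<delta> * k * inner y y} \<le> pot M"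
proof (induction k arbitrary: B M)
  case 0
  have "0 \<le> qf B y" for y using goodD(2)[OF 0] by (simp add: psd_def)
  then have "{cs. cs = [] \<and> (\<exists>y\<in>H. qf B y + (\<Sum>\<omega>\<leftarrow>cs. weight (v \<omega>) y) < 0)} = {}"
    by (auto simp: not_less)
  moreover have "measure_pmf.prob (return_pmf []) {cs. \<exists>y\<in>H. qf B y + (\<Sum>\<omega>\<leftarrow>cs. weight (v \<omega>) y) < \<delta> * real 0 * inner y y}
    = (if \<exists>y\<in>H. qf B y < 0 then 1 else 0)"
    by (simp add: measure_return_pmf indicator_def)
  ultimately show ?case using pot0[OF 0] \<open>\<And>y. 0 \<le> qf B y\<close> by (auto simp: not_less[symmetric])
next
  case (Suc k)
  show ?case
  proof (cases "pot M \<le> 1")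
    case False
    then show ?thesis by (meson measure_pmf.prob_le_1 linear order_trans)
  next
    case True
    obtain Mp where Mp: "\<And>\<omega>. good (upd (\<lambda>x. B x - \<delta> *\<^sub>R Pi x) (v \<omega>)) (Mp \<omega>)"
      "EV q (\<lambda>\<omega>. pot (Mp \<omega>)) \<le> pot M"
      using step[OF Suc.prems True] by blast
    let ?A = "{cs. \<exists>y\<in>H. qf B y + (\<Sum>\<omega>\<leftarrow>cs. weight (v \<omega>) y) < \<delta> * real (Suc k) * inner y y}"
    have "{xs. \<omega> # xs \<in> ?A} = {cs. \<exists>y\<in>H. qf (upd (\<lambda>x. B x - \<delta> *\<^sub>R Pi x) (v \<omega>)) y
        + (\<Sum>\<omega>\<leftarrow>cs. weight (v \<omega>) y) < \<delta> * k * inner y y}" for \<omega>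
    proof -
      have eq: "qf (upd (\<lambda>x. B x - \<delta> *\<^sub>R Pi x) (v \<omega>)) y = qf B y - \<delta> * inner y y + weight (v \<omega>) y" if "y \<in> H" for y
        unfolding qf_upd weight_def using Pi_id[OF that] by (simp add: qf_def inner_diff_right)
      then have "(qf B y + (\<Sum>\<omega>\<leftarrow>\<omega> # xs. weight (v \<omega>) y) < \<delta> * real (Suc k) * inner y y) \<longleftrightarrow>
         (qf (upd (\<lambda>x. B x - \<delta> *\<^sub>R Pi x) (v \<omega>)) y + (\<Sum>\<omega>\<leftarrow>xs. weight (v \<omega>) y) < \<delta> * k * inner y y)"
        if "y \<in> H" for y xs unfolding eq[OF that] by (simp add: algebra_simps)
      then show ?thesis by blast
    qed
    then have "measure_pmf.prob (replicate_pmf (Suc k) q) ?A = EV q (\<lambda>\<omega>. measure_pmf.prob (replicate_pmf k q)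
      {cs. \<exists>y\<in>H. qf (upd (\<lambda>x. B x - \<delta> *\<^sub>R Pi x) (v \<omega>)) y + (\<Sum>\<omega>\<leftarrow>cs. weight (v \<omega>) y) < \<delta> * k * inner y y})"
      unfolding prob_replicate_Suc[OF fin] by simp
    also have "\<dots> \<le> EV q (\<lambda>\<omega>. pot (Mp \<omega>))"
      by (rule EV_mono[OF fin Suc.IH[OF Mp(1)]])
    finally show ?thesis using Mp(2) by linarith
  qed
qed

end

section \<open>Leverage scores and the potential\<close>

context parseval_frame
begin

text \<open>The norm of a positive operator is at most its trace, proved by Cauchy-Schwarz over the
  frame in place of an eigenbasis.\<close>

lemma psd_trace_bound:
  assumes P: "psd P" and m: "m \<in> H"
  shows "qf P m \<le> tr P * inner m m"
proof -
  note l = selfadjD[OF P[unfolded psd_def, THEN conjunct1]]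
  have "qf P m = inner (P m) (Pi m)" by (simp add: Pi_id[OF m] qf_def inner_commute)
  also have "\<dots> = fsum (\<lambda>f. inner f m * inner f (P m))" by (rule inner_Pi)
  finally have q: "qf P m = fsum (\<lambda>f. inner f m * inner f (P m))" .
  have "0 \<le> fsum (\<lambda>f. (inner f m)^2) + 2 * t * fsum (\<lambda>f. inner f m * inner f (P m)) + t^2 * fsum (\<lambda>f. (inner f (P m))^2)" for t
  proof -
    have "0 \<le> fsum (\<lambda>f. (inner f m + t * inner f (P m))^2)" by (rule fsum_nonneg) simp
    also have "\<dots> = fsum (\<lambda>f. (inner f m)^2 + 2 * t * (inner f m * inner f (P m)) + t^2 * (inner f (P m))^2)"
      by (rule fsum_cong) (simp add: power2_eq_square algebra_simps)
    finally show ?thesis unfolding fsum_add fsum_scale .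
  qed
  from quadratic_nonneg[OF this] have "(qf P m)^2 \<le> fsum (\<lambda>f. (inner f (P m))^2) * inner m m"
    by (simp add: q parseval'[OF m])
  also have "\<dots> \<le> (tr P * qf P m) * inner m m"
  proof (rule mult_right_mono)
    have "fsum (\<lambda>f. (inner f (P m))^2) \<le> fsum (\<lambda>f. qf P m * qf P f)"
      by (rule fsum_mono) (use psd_cauchy_schwarz[OF P, of _ m] in \<open>simp add: mult.commute\<close>)
    then show "fsum (\<lambda>f. (inner f (P m))^2) \<le> tr P * qf P m" unfolding fsum_scale tr_fsum by (simp add: mult.commute)
  qed simp
  finally have "qf P m * qf P m \<le> qf P m * (tr P * inner m m)" by (simp add: power2_eq_square mult_ac)
  moreover have "0 \<le> qf P m" using P by (simp add: psd_def)
  moreover have "0 \<le> tr P * inner m m" using tr_nonneg[OF P] by simp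
  ultimately show ?thesis by (cases "qf P m = 0") (auto simp: mult_le_cancel_left)
qed

text \<open>Leverage score of a row in real coordinates; it is twice the complex one, as the row
  contributes two real vectors of equal length in the application.\<close>

definition lev :: "nat \<Rightarrow> real" where
  "lev l = inner (fst (E l)) (fst (E l)) + inner (snd (E l)) (snd (E l))"

lemma lev_nonneg: "0 \<le> lev l"
  by (simp add: lev_def)

lemma fsum_lev: "fsum (\<lambda>m. inner m m) = (\<Sum>l<d. lev l)"
  by (simp add: fsum_def lev_def)

lemma qf2_trace_bound: "psd P \<Longrightarrow> l < d \<Longrightarrow> qf2 P (E l) \<le> tr P * lev l"
  using psd_trace_bound[of P] frame_in by (simp add: qf2_def lev_def distrib_left add_mono)

end

text \<open>\<open>L\<close> is the set of rows with a typical leverage score; the remaining rows are negligible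
  on average. No union bound over all rows is needed, so $\log d$ does not enter.\<close>

locale sketch_params = parseval_frame E d H
  for E :: "nat \<Rightarrow> 'h::real_inner \<times> 'h" and d :: nat and H :: "'h set" +
  fixes K A c\<^sub>0 N :: real and n \<xi> :: nat
  assumes d_pos: "0 < d" and N1: "1 \<le> N" and K1: "1 \<le> K" and A1: "1 \<le> A"
    and N_eq: "(\<Sum>l<d. lev l) = N"
    and heavy: "(\<Sum>l\<in>{l. l < d \<and> lev l > K * N / d}. d * (lev l)^2) \<le> 1"
    and n_large: "80 * K^2 * N^2 \<le> 2^(n+2)"
    and \<xi>1: "1 \<le> \<xi>" and n_\<xi>: "real (n+2) \<le> A * \<xi>" and n_N: "real (n+2) \<le> A * sqrt N"
    and c0: "(54 + 4 * K) * (12 + 6 * A) \<le> c\<^sub>0"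
begin

definition L :: "nat set" where
  "L = {l. l < d \<and> lev l \<le> K * N / d}"

text \<open>Both summands are scaled to be at most 1/80 at the initial \<open>M\<close>, the
  identity divided by \<open>c\<^sub>0 * N\<close>. Each may then grow by a factor of about 80
  before the potential exceeds 1. Only typical rows enter, as the others would not start
  small.\<close>

definition pot :: "('h \<Rightarrow> 'h) \<Rightarrow> real" where
  "pot M = c\<^sub>0^2 * N / 80 * trsq M + 1 / (80 * d * (K / c\<^sub>0)^(n+2)) * (\<Sum>l\<in>L. (d * qf2 M (E l))^(n+2))"

lemma c0_bounds: "0 < c\<^sub>0" "1000 \<le> c\<^sub>0" "18 * (54 + 4 * K) \<le> c\<^sub>0"
proof -
  have "(54 + 4 * K) * 18 \<le> (54 + 4 * K) * (12 + 6 * A)" using K1 A1 by (intro mult_left_mono) auto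
  then show "18 * (54 + 4 * K) \<le> c\<^sub>0" using c0 by linarith
  moreover have "18 * (54 + 4 * 1) \<le> 18 * (54 + 4 * K)" using K1 by (intro mult_left_mono add_left_mono) auto
  ultimately show "1000 \<le> c\<^sub>0" by simp
  then show "0 < c\<^sub>0" by linarith
qed

lemma finite_L: "finite L"
  by (simp add: L_def)

lemma coeffs_pos: "0 < c\<^sub>0^2 * N / 80" "0 < 1 / (80 * d * (K / c\<^sub>0)^(n+2))"
  using c0_bounds N1 K1 d_pos by (simp_all add: divide_pos_pos)

lemma trsq_nonneg: "0 \<le> trsq M"
  unfolding trsq_def by (rule fsum_nonneg) simp

lemma pot_parts:
  assumes "good B M" "pot M \<le> 1"
  shows "trsq M \<le> (9 / (c\<^sub>0 * sqrt N))^2" "(\<Sum>l\<in>L. (d * qf2 M (E l))^(n+2)) \<le> 80 * d * (K / c\<^sub>0)^(n+2)"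
proof -
  note gd = goodD[OF assms(1)]
  let ?S = "(\<Sum>l\<in>L. (d * qf2 M (E l))^(n+2))"
  have S: "0 \<le> ?S" by (intro sum_nonneg zero_le_power mult_nonneg_nonneg qf2_nonneg gd) auto
  have "0 \<le> c\<^sub>0^2 * N / 80 * trsq M" using coeffs_pos trsq_nonneg by (intro mult_nonneg_nonneg) auto
  moreover have "0 \<le> 1 / (80 * d * (K / c\<^sub>0)^(n+2)) * ?S" using coeffs_pos S by (intro mult_nonneg_nonneg) auto
  ultimately have a: "c\<^sub>0^2 * N / 80 * trsq M \<le> 1" and b: "1 / (80 * d * (K / c\<^sub>0)^(n+2)) * ?S \<le> 1"
    using assms(2) unfolding pot_def by linarith+
  have p: "0 < c\<^sub>0^2 * N" using c0_bounds N1 by simp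
  \<comment> \<open>80 is rounded up to 81, which has a rational square root.\<close>
  have "(9 / (c\<^sub>0 * sqrt N))^2 = 81 / (c\<^sub>0^2 * N)" using N1 by (simp add: power_divide power_mult_distrib)
  moreover have "trsq M \<le> 81 / (c\<^sub>0^2 * N)" using a p by (simp add: field_simps)
  ultimately show "trsq M \<le> (9 / (c\<^sub>0 * sqrt N))^2" by simp
  define X where "X = 80 * d * (K / c\<^sub>0)^(n+2)"
  have "0 < X" unfolding X_def using c0_bounds K1 d_pos by simp
  moreover have "1 / X * ?S \<le> 1" using b by (simp only: X_def)
  ultimately have "?S \<le> X" by (simp only: times_divide_eq_left mult_1 pos_divide_le_eq)
  then show "?S \<le> 80 * d * (K / c\<^sub>0)^(n+2)" by (simp only: X_def)
qed

text \<open>On ordinary rows \<open>d * qf2 Mt (E l)\<close> is at most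
  \<open>4 * K / c\<^sub>0\<close>. On heavy rows and on those where \<open>M\<close> has become
  large, both factors are bounded by leverage scores, and the squares of these scores have a small
  sum.\<close>

lemma coherence:
  assumes g: "good B M" and p: "pot M \<le> 1" and P: "psd P"
    and Mtp: "psd Mt" and Mt: "\<And>u. u \<in> H \<Longrightarrow> qf Mt u \<le> 2 * qf M u"
  shows "d / \<xi> * (\<Sum>l<d. qf2 P (E l) * qf2 Mt (E l)) \<le> (4 * K + 36) / (c\<^sub>0 * \<xi>) * tr P"
proof -
  note gd = goodD[OF g]
  note pp = pot_parts[OF g p]
  define \<eta> where "\<eta> = 9 / (c\<^sub>0 * sqrt N)"
  have \<eta>0: "0 \<le> \<eta>" using c0_bounds N1 by (simp add: \<eta>_def)
  have "c\<^sub>0 * 1 \<le> c\<^sub>0 * sqrt N" using c0_bounds N1 by (intro mult_left_mono) auto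
  then have \<eta>9: "\<eta> \<le> 9 / c\<^sub>0" unfolding \<eta>_def using c0_bounds by (intro divide_left_mono) auto
  have Mt2: "qf2 Mt (E l) \<le> 2 * qf2 M (E l)" if "l < d" for l
    using Mt[OF frame_in(1)[OF that]] Mt[OF frame_in(2)[OF that]] by (simp add: qf2_def)
  have Mlev: "qf2 M (E l) \<le> 9 / c\<^sub>0 * lev l" if l: "l < d" for l
  proof -
    have "qf2 M (E l) \<le> \<eta> * lev l"
      using norm_bound(3)[OF g pp(1)[folded \<eta>_def] frame_in(1)[OF l] \<eta>0]
        norm_bound(3)[OF g pp(1)[folded \<eta>_def] frame_in(2)[OF l] \<eta>0]
      by (simp add: qf2_def lev_def distrib_left)
    also have "\<dots> \<le> 9 / c\<^sub>0 * lev l" using \<eta>9 lev_nonneg by (intro mult_right_mono)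
    finally show ?thesis .
  qed
  \<comment> \<open>Typical rows on which \<open>M\<close> exceeds twice its initial bound
    \<open>K / c\<^sub>0\<close>. The potential counts each of them with a weight of at least
    2^(n+2).\<close>
  define Bd where "Bd = {l\<in>L. 2 * K / c\<^sub>0 < d * qf2 M (E l)}"
  define Hv where "Hv = {l. l < d \<and> lev l > K * N / d}"
  have q0: "0 \<le> 2 * K / c\<^sub>0" using K1 c0_bounds by simp
  have finB: "finite Bd" using finite_L by (simp add: Bd_def)
  have cardB: "real (card Bd) * 2^(n+2) \<le> 80 * d"
  proof -
    have "real (card Bd) * (2 * K / c\<^sub>0)^(n+2) = (\<Sum>l\<in>Bd. (2 * K / c\<^sub>0)^(n+2))" by simp
    also have "\<dots> \<le> (\<Sum>l\<in>Bd. (d * qf2 M (E l))^(n+2))"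
      by (intro sum_mono power_mono q0) (auto simp: Bd_def)
    also have "\<dots> \<le> (\<Sum>l\<in>L. (d * qf2 M (E l))^(n+2))"
      by (intro sum_mono2 finite_L zero_le_power mult_nonneg_nonneg qf2_nonneg gd) (auto simp: Bd_def)
    also have "\<dots> \<le> 80 * d * (K / c\<^sub>0)^(n+2)" by (rule pp(2))
    finally have "real (card Bd) * (2^(n+2) * (K / c\<^sub>0)^(n+2)) \<le> 80 * d * (K / c\<^sub>0)^(n+2)"
      by (metis power_mult_distrib times_divide_eq_right)
    moreover have "0 < (K / c\<^sub>0)^(n+2)" using K1 c0_bounds by simp
    ultimately show ?thesis by (simp only: mult.assoc[symmetric] mult_le_cancel_right)
  qed
  \<comment> \<open>There are at most 80 d / 2^(n+2) such rows, and each score is at most K N / d;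
    \<open>n_large\<close> balances the two.\<close>
  have sumB: "(\<Sum>l\<in>Bd. d * (lev l)^2) \<le> 1"
  proof -
    have "(\<Sum>l\<in>Bd. d * (lev l)^2) \<le> (\<Sum>l\<in>Bd. d * (K * N / d)^2)"
      by (intro sum_mono mult_left_mono power_mono) (auto simp: Bd_def L_def lev_nonneg)
    also have "\<dots> = real (card Bd) * (K^2 * N^2) / d" using d_pos by (simp add: power2_eq_square field_simps)
    also have "\<dots> \<le> 1"
    proof -
      have "real (card Bd) * (80 * K^2 * N^2) \<le> real (card Bd) * 2^(n+2)"
        using n_large by (intro mult_left_mono) auto
      then have "real (card Bd) * (80 * K^2 * N^2) \<le> 80 * d" using cardB by linarith
      then have "real (card Bd) * (K^2 * N^2) \<le> d" by (simp add: algebra_simps)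
      then show ?thesis using d_pos by (simp add: divide_le_eq)
    qed
    finally show ?thesis .
  qed
  have t0: "0 \<le> tr P" by (rule tr_nonneg[OF P])
  have summand: "qf2 P (E l) * (d * qf2 Mt (E l)) \<le> 4 * K / c\<^sub>0 * qf2 P (E l)
      + (if l \<in> Bd then tr P * (18 / c\<^sub>0) * (d * (lev l)^2) else 0) + (if l \<in> Hv then tr P * (18 / c\<^sub>0) * (d * (lev l)^2) else 0)"
    if l: "l < d" for l
  proof (cases "l \<in> Bd \<or> l \<in> Hv")
    case True
    have "qf2 P (E l) * (d * qf2 Mt (E l)) \<le> (tr P * lev l) * (d * (2 * (9 / c\<^sub>0 * lev l)))"
    proof (rule mult_mono[OF qf2_trace_bound[OF P l]])
      show "d * qf2 Mt (E l) \<le> d * (2 * (9 / c\<^sub>0 * lev l))"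
        using order_trans[OF Mt2[OF l] mult_left_mono[OF Mlev[OF l], of 2]] by (intro mult_left_mono) auto
      show "0 \<le> tr P * lev l" using t0 lev_nonneg by simp
      have "0 \<le> qf2 P (E l)" by (rule qf2_nonneg[OF P])
      show "0 \<le> d * qf2 Mt (E l)" using qf2_nonneg[OF Mtp] by simp
    qed
    also have "\<dots> = tr P * (18 / c\<^sub>0) * (d * (lev l)^2)" by (simp add: power2_eq_square)
    finally have "qf2 P (E l) * (d * qf2 Mt (E l)) \<le> tr P * (18 / c\<^sub>0) * (d * (lev l)^2)" .
    moreover have "0 \<le> tr P * (18 / c\<^sub>0) * (d * (lev l)^2)" using t0 c0_bounds by simp
    moreover have "0 \<le> 4 * K / c\<^sub>0 * qf2 P (E l)" using K1 c0_bounds qf2_nonneg[OF P] by simp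
    moreover have "a \<le> b + (if l \<in> Bd then z else 0) + (if l \<in> Hv then z else 0)"
      if "a \<le> z" "0 \<le> z" "0 \<le> b" for a b z :: real
      using True that by auto
    ultimately show ?thesis by blast
  next
    case False
    then have "d * qf2 M (E l) \<le> 2 * K / c\<^sub>0" using l by (auto simp: Bd_def Hv_def L_def)
    moreover have "d * qf2 Mt (E l) \<le> d * (2 * qf2 M (E l))" using Mt2[OF l] by (intro mult_left_mono) auto
    ultimately have "d * qf2 Mt (E l) \<le> 4 * K / c\<^sub>0" by simp
    then have "qf2 P (E l) * (d * qf2 Mt (E l)) \<le> qf2 P (E l) * (4 * K / c\<^sub>0)"
      by (rule mult_left_mono[OF _ qf2_nonneg[OF P]])
    then show ?thesis using False by (simp add: mult.commute)
  qed
  have "d * (\<Sum>l<d. qf2 P (E l) * qf2 Mt (E l)) = (\<Sum>l<d. qf2 P (E l) * (d * qf2 Mt (E l)))"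
    by (simp add: sum_distrib_left mult_ac)
  also have "\<dots> \<le> (\<Sum>l<d. 4 * K / c\<^sub>0 * qf2 P (E l)
      + (if l \<in> Bd then tr P * (18 / c\<^sub>0) * (d * (lev l)^2) else 0) + (if l \<in> Hv then tr P * (18 / c\<^sub>0) * (d * (lev l)^2) else 0))"
    by (rule sum_mono) (use summand in simp)
  also have "\<dots> = 4 * K / c\<^sub>0 * tr P + tr P * (18 / c\<^sub>0) * (\<Sum>l\<in>Bd. d * (lev l)^2) + tr P * (18 / c\<^sub>0) * (\<Sum>l\<in>Hv. d * (lev l)^2)"
  proof -
    have i: "(\<Sum>l<d. if l \<in> S then c * f l else 0) = c * (\<Sum>l\<in>S. f l)" if "S \<subseteq> {..<d}" for S and c :: real and f
      using that by (simp add: sum.If_cases Int_absorb1 sum_distrib_left)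
    have "Bd \<subseteq> {..<d}" "Hv \<subseteq> {..<d}" by (auto simp: Bd_def Hv_def L_def)
    then show ?thesis unfolding sum.distrib i tr_def by (simp add: i sum_distrib_left)
  qed
  also have "\<dots> \<le> 4 * K / c\<^sub>0 * tr P + tr P * (18 / c\<^sub>0) * 1 + tr P * (18 / c\<^sub>0) * 1"
    using sumB heavy t0 c0_bounds by (intro add_mono mult_left_mono order_refl) (auto simp: Hv_def)
  also have "\<dots> = (4 * K + 36) / c\<^sub>0 * tr P" by (simp add: add_divide_distrib algebra_simps)
  finally have "d * (\<Sum>l<d. qf2 P (E l) * qf2 Mt (E l)) / \<xi> \<le> (4 * K + 36) / c\<^sub>0 * tr P / \<xi>"
    by (rule divide_right_mono) simp
  then show ?thesis by simp
qed

end

section \<open>The supermartingale step\<close>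

context sketch_params
begin

lemma pot_nonneg: "good B M \<Longrightarrow> 0 \<le> pot M"
  unfolding pot_def using coeffs_pos trsq_nonneg goodD(3)
  by (intro add_nonneg_nonneg mult_nonneg_nonneg sum_nonneg zero_le_power qf2_nonneg) auto

lemma pot_step:
  fixes v :: "'o \<Rightarrow> 'h \<times> 'h"
  assumes q: "column_law q v (d / \<xi>)" and g: "good B M" and p: "pot M \<le> 1"
  shows "\<exists>Mp. (\<forall>\<omega>. good (upd (\<lambda>x. B x - (3/4) *\<^sub>R Pi x) (v \<omega>)) (Mp \<omega>)) \<and> EV q (\<lambda>\<omega>. pot (Mp \<omega>)) \<le> pot M"
proof -
  note gd = goodD[OF g]
  note pp = pot_parts[OF g p]
  note c0p = c0_bounds
  have fin: "finite (set_pmf q)" and vH: "\<And>\<omega>. fst (v \<omega>) \<in> H" "\<And>\<omega>. snd (v \<omega>) \<in> H"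
    using q by (auto simp: column_law_def)
  define \<eta> where "\<eta> = 9 / (c\<^sub>0 * sqrt N)"
  define \<delta> where "\<delta> = (3/4::real)"
  have tM: "trsq M \<le> \<eta>^2" using pp(1) by (simp add: \<eta>_def)
  have \<eta>0: "0 \<le> \<eta>" using c0p N1 by (simp add: \<eta>_def)
  have "c\<^sub>0 * 1 \<le> c\<^sub>0 * sqrt N" using c0p N1 by (intro mult_left_mono) auto
  then have \<eta>9: "\<eta> \<le> 9 / c\<^sub>0" unfolding \<eta>_def using c0p by (intro divide_left_mono) auto
  have "9 / c\<^sub>0 \<le> 9 / 1000" using c0p by (intro divide_left_mono) auto
  then have \<eta>s: "\<eta> \<le> 9/1000" using \<eta>9 by linarith
  obtain Mt where gt: "good (\<lambda>x. B x - \<delta> *\<^sub>R Pi x) Mt"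
    using shift_exists[OF g tM \<eta>0, of \<delta>] \<eta>s by (auto simp: \<delta>_def)
  note gtd = goodD[OF gt]
  have sb: "qf Mt u \<le> qf M u + \<delta> * inner (Mt u) (Mt u)"
    "inner (Mt u) (Mt u) \<le> inner (M u) (M u) + 2 * \<delta> * qf Mt (Mt u)"
    "qf Mt u \<le> 2 * qf M u" "inner (Mt u) (Mt u) \<le> 2 * \<eta> * qf Mt u" if "u \<in> H" for u
    using shift_bounds[OF g tM \<eta>0 _ _ gt that] \<eta>s by (auto simp: \<delta>_def)
  obtain Mp where Mp: "\<And>\<omega>. good (upd (\<lambda>x. B x - \<delta> *\<^sub>R Pi x) (v \<omega>)) (Mp \<omega>)"
    using upd_exists[OF gt vH] by metis
  define \<phi> \<gamma> \<nu> where "\<phi> = 18 / c\<^sub>0" and "\<gamma> = (4 * K + 36) / (c\<^sub>0 * \<xi>)" and "\<nu> = 2 * \<eta>"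
  have \<gamma>0: "0 \<le> \<gamma>" using c0p K1 by (simp add: \<gamma>_def)
  \<comment> \<open>Cauchy-Schwarz between trace and square trace, as an arithmetic-geometric mean
    inequality with the optimal weight \<open>s\<close>. The shift at most doubles the
    trace.\<close>
  have tr: "tr Mt \<le> \<phi>"
  proof -
    define s where "s = 9 / (c\<^sub>0 * N)"
    have s0: "0 < s" using c0p N1 by (simp add: s_def)
    have "tr M \<le> fsum (\<lambda>m. s / 2 * inner m m + 1 / (2 * s) * inner (M m) (M m))"
      unfolding tr_fsum
    proof (rule fsum_mono)
      fix m
      have "0 \<le> inner (s *\<^sub>R m - M m) (s *\<^sub>R m - M m)" by simp
      then have "2 * s * qf M m \<le> s^2 * inner m m + inner (M m) (M m)"
        by (simp add: inner_diff_left inner_diff_right qf_def inner_commute power2_eq_square algebra_simps)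
      then show "qf M m \<le> s / 2 * inner m m + 1 / (2 * s) * inner (M m) (M m)"
        using s0 by (simp add: field_simps power2_eq_square)
    qed
    also have "\<dots> = s / 2 * N + 1 / (2 * s) * trsq M" by (simp only: fsum_add fsum_scale fsum_lev N_eq trsq_def)
    also have "\<dots> \<le> s / 2 * N + 1 / (2 * s) * \<eta>^2" using tM s0 by (intro add_left_mono mult_left_mono) auto
    also have "\<dots> = 9 / c\<^sub>0"
      using c0p N1 by (simp add: s_def \<eta>_def power_divide power_mult_distrib field_simps power2_eq_square)
    finally have "tr M \<le> 9 / c\<^sub>0" .
    moreover have "tr Mt \<le> fsum (\<lambda>m. 2 * qf M m)" unfolding tr_fsum by (rule fsum_mono) (rule sb(3))
    ultimately show ?thesis by (simp add: fsum_scale tr_fsum \<phi>_def)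
  qed
  have coh: "d / \<xi> * (\<Sum>l<d. qf2 P (E l) * qf2 Mt (E l)) \<le> \<gamma> * tr P" if "psd P" for P
    unfolding \<gamma>_def by (rule coherence[OF g p that gtd(3) sb(3)])
  note ue = update_expectation[OF q _ gt Mp tr sb(4)[folded \<nu>_def] coh]
  have fgb: "\<phi> + \<gamma> \<le> (54 + 4 * K) / c\<^sub>0"
  proof -
    have "c\<^sub>0 * 1 \<le> c\<^sub>0 * \<xi>" using c0p \<xi>1 by (intro mult_left_mono) auto
    then have "\<gamma> \<le> (4 * K + 36) / c\<^sub>0" unfolding \<gamma>_def using c0p K1 by (intro divide_left_mono) auto
    then show ?thesis by (simp add: \<phi>_def add_divide_distrib)
  qed
  have fg1: "(54 + 4 * K) / c\<^sub>0 \<le> 1 / 18" using c0p by (simp add: field_simps)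
  \<comment> \<open>The bounds of n + 2 by A \<xi> and by A sqrt N cancel the denominators of
    \<gamma> and \<nu>. What is left is the left side of assumption \<open>c0\<close> divided by
    \<open>4 * c\<^sub>0\<close>, hence at most 1/4.\<close>
  have main: "3 * (\<phi> + \<gamma>) + 3 * real (n+1) / 2 * (\<nu> + \<gamma>) - 1 \<le> - \<delta>"
  proof -
    have "real (n+1) * \<nu> \<le> real (n+2) * \<nu>" using \<eta>0 by (intro mult_right_mono) (auto simp: \<nu>_def)
    also have "\<dots> \<le> (A * sqrt N) * \<nu>" using n_N \<eta>0 by (intro mult_right_mono) (auto simp: \<nu>_def)
    also have "\<dots> = 18 * A / c\<^sub>0" using N1 c0p by (simp add: \<nu>_def \<eta>_def field_simps)
    finally have 1: "real (n+1) * \<nu> \<le> 18 * A / c\<^sub>0" .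
    have "real (n+1) * \<gamma> \<le> real (n+2) * \<gamma>" using \<gamma>0 by (intro mult_right_mono) auto
    also have "\<dots> \<le> (A * \<xi>) * \<gamma>" using n_\<xi> \<gamma>0 by (intro mult_right_mono) auto
    also have "\<dots> = (4 * K + 36) * A / c\<^sub>0" using \<xi>1 c0p by (simp add: \<gamma>_def field_simps)
    finally have 2: "real (n+1) * \<gamma> \<le> (4 * K + 36) * A / c\<^sub>0" .
    have "3 * (\<phi> + \<gamma>) + 3 * real (n+1) / 2 * (\<nu> + \<gamma>) = 3 * (\<phi> + \<gamma>) + 3/2 * (real (n+1) * \<nu> + real (n+1) * \<gamma>)"
      by (simp add: field_simps)
    also have "\<dots> \<le> 3 * ((54 + 4 * K) / c\<^sub>0) + 3/2 * (18 * A / c\<^sub>0 + (4 * K + 36) * A / c\<^sub>0)"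
      using fgb 1 2 by (intro add_mono mult_left_mono) auto
    also have "\<dots> = ((54 + 4 * K) * (12 + 6 * A)) / (4 * c\<^sub>0)" using c0p by (simp add: field_simps)
    also have "\<dots> \<le> c\<^sub>0 / (4 * c\<^sub>0)" using c0 c0p by (intro divide_right_mono) auto
    also have "\<dots> = 1/4" using c0p by simp
    finally show ?thesis unfolding \<delta>_def by linarith
  qed
  have E1: "EV q (\<lambda>\<omega>. trsq (Mp \<omega>)) \<le> trsq M"
  proof -
    have T0: "0 \<le> fsum (\<lambda>m. qf Mt (Mt m))" by (rule fsum_nonneg) (use gtd(3) in \<open>simp add: psd_def\<close>)
    have "trsq Mt \<le> fsum (\<lambda>m. inner (M m) (M m) + (2 * \<delta>) * qf Mt (Mt m))"
      unfolding trsq_def by (rule fsum_mono) (use sb(2) in simp)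
    then have "trsq Mt \<le> trsq M + (2 * \<delta>) * fsum (\<lambda>m. qf Mt (Mt m))"
      unfolding fsum_add fsum_scale trsq_def .
    moreover have "EV q (\<lambda>\<omega>. trsq (Mp \<omega>)) \<le> trsq Mt + (9 * (\<phi> + \<gamma>) - 2) * fsum (\<lambda>m. qf Mt (Mt m))"
      by (rule ue(1)) auto
    ultimately have "EV q (\<lambda>\<omega>. trsq (Mp \<omega>)) \<le> trsq M + (9 * (\<phi> + \<gamma>) - 2 + 2 * \<delta>) * fsum (\<lambda>m. qf Mt (Mt m))"
      by (simp add: algebra_simps)
    \<comment> \<open>Exactly balanced, as 9/18 - 2 + 2 * 3/4 = 0; a larger shift would not pass
      here.\<close>
    moreover have "(9 * (\<phi> + \<gamma>) - 2 + 2 * \<delta>) * fsum (\<lambda>m. qf Mt (Mt m)) \<le> 0"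
    proof (rule mult_nonpos_nonneg[OF _ T0])
      have "\<phi> + \<gamma> \<le> 1/18" using fgb fg1 by linarith
      then show "9 * (\<phi> + \<gamma>) - 2 + 2 * \<delta> \<le> 0" by (simp add: \<delta>_def field_simps)
    qed
    ultimately show ?thesis by linarith
  qed
  have E2: "EV q (\<lambda>\<omega>. qf2 (Mp \<omega>) (E l) ^ (n+2)) \<le> qf2 M (E l) ^ (n+2)" if l: "l < d" for l
  proof -
    define X w where "X = qf2 Mt (E l)" and "w = inner (Mt (fst (E l))) (Mt (fst (E l))) + inner (Mt (snd (E l))) (Mt (snd (E l)))"
    have X0: "0 \<le> X" unfolding X_def by (rule qf2_nonneg[OF gtd(3)])
    have w0: "0 \<le> w" by (simp add: w_def)
    have "EV q (\<lambda>\<omega>. qf2 (Mp \<omega>) (E l) ^ (n+2)) \<le> X^(n+2) + real (n+2) * X^(n+1) * w * (3 * (\<phi> + \<gamma>) + 3 * real (n+1) / 2 * (\<nu> + \<gamma>) - 1)"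
      unfolding X_def w_def by (rule ue(2)) (use frame_in l in auto)
    also have "\<dots> \<le> X^(n+2) + real (n+2) * X^(n+1) * w * (- \<delta>)"
      using main X0 w0 by (intro add_left_mono mult_left_mono) auto
    also have "\<dots> = X^(n+1+1) - real (n+1+1) * X^(n+1) * (\<delta> * w)" by simp
    also have "\<dots> \<le> X^(n+1+1) - real (n+1+1) * X^(n+1) * (X - qf2 M (E l))"
    proof -
      have "X - qf2 M (E l) \<le> \<delta> * w"
        using sb(1)[OF frame_in(1)[OF l]] sb(1)[OF frame_in(2)[OF l]] by (simp add: X_def w_def qf2_def algebra_simps)
      then show ?thesis using X0 by (intro diff_left_mono mult_left_mono) auto
    qed
    \<comment> \<open>The decrease due to the column outweighs the increase due to the shift, and
      convexity passes from differences to powers.\<close>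
    also have "\<dots> \<le> qf2 M (E l) ^ (n+1+1)" by (rule power_tangent[OF X0 qf2_nonneg[OF gd(3)]])
    finally show ?thesis by simp
  qed
  have "EV q (\<lambda>\<omega>. pot (Mp \<omega>)) = c\<^sub>0^2 * N / 80 * EV q (\<lambda>\<omega>. trsq (Mp \<omega>))
     + 1 / (80 * d * (K / c\<^sub>0)^(n+2)) * (\<Sum>l\<in>L. d^(n+2) * EV q (\<lambda>\<omega>. qf2 (Mp \<omega>) (E l) ^ (n+2)))"
    unfolding pot_def EV_add[OF fin] EV_cmult EV_sum[OF fin] power_mult_distrib by simp
  also have "\<dots> \<le> c\<^sub>0^2 * N / 80 * trsq M
     + 1 / (80 * d * (K / c\<^sub>0)^(n+2)) * (\<Sum>l\<in>L. d^(n+2) * qf2 M (E l) ^ (n+2))"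
    using coeffs_pos E1 E2 by (intro add_mono mult_left_mono sum_mono) (auto simp: L_def)
  also have "\<dots> = pot M" unfolding pot_def power_mult_distrib by simp
  finally show ?thesis using Mp by (auto simp: \<delta>_def)
qed

text \<open>The process starts from the barrier \<open>c\<^sub>0 * N\<close> times the identity,
  where the potential is at most 1/80 + 1/80. This offset stays in the conclusion and is absorbed
  later by the choice of \<open>k\<close>.\<close>

theorem lower_bound:
  fixes v :: "'o \<Rightarrow> 'h \<times> 'h"
  assumes q: "column_law q v (d / \<xi>)"
  shows "measure_pmf.prob (replicate_pmf k q)
     {cs. \<exists>y\<in>H. c\<^sub>0 * N * inner y y + (\<Sum>\<omega>\<leftarrow>cs. weight (v \<omega>) y) < 3/4 * k * inner y y} \<le> 1/40"
proof -
  define B :: "'h \<Rightarrow> 'h" where "B = (\<lambda>x. (c\<^sub>0 * N) *\<^sub>R x)"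
  define M :: "'h \<Rightarrow> 'h" where "M = (\<lambda>x. (1 / (c\<^sub>0 * N)) *\<^sub>R x)"
  have cN: "0 < c\<^sub>0 * N" using c0_bounds N1 by simp
  have sa: "selfadj (\<lambda>x::'h. c *\<^sub>R x)" for c
    unfolding selfadj_def by (intro conjI allI linearI) (simp_all add: scaleR_add_right)
  have g: "good B M"
    unfolding good_def inv_pair_def B_def M_def using sa cN
    by (auto simp: qf_def selfadjD(4)[OF Pi_selfadj])
  have "pot M \<le> 1/40"
  proof -
    have "trsq M = N / (c\<^sub>0 * N)^2"
    proof -
      have "trsq M = fsum (\<lambda>m. 1 / (c\<^sub>0 * N)^2 * inner m m)"
        unfolding trsq_def by (rule fsum_cong) (simp add: M_def power2_eq_square)
      then show ?thesis unfolding fsum_scale fsum_lev N_eq by simp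
    qed
    then have 1: "c\<^sub>0^2 * N / 80 * trsq M = 1/80"
      using c0_bounds N1 by (simp add: power2_eq_square)
    have "qf2 M e = (inner (fst e) (fst e) + inner (snd e) (snd e)) / (c\<^sub>0 * N)" for e
      by (simp add: qf2_def qf_def M_def add_divide_distrib)
    then have q2: "qf2 M (E l) = lev l / (c\<^sub>0 * N)" for l by (simp add: lev_def)
    have "(\<Sum>l\<in>L. (d * qf2 M (E l))^(n+2)) \<le> (\<Sum>l\<in>L. (K / c\<^sub>0)^(n+2))"
    proof (intro sum_mono power_mono)
      fix l assume "l \<in> L"
      then have "lev l \<le> K * N / d" by (simp add: L_def)
      then show "d * qf2 M (E l) \<le> K / c\<^sub>0" unfolding q2
        using c0_bounds N1 d_pos by (simp add: field_simps)
      show "0 \<le> d * qf2 M (E l)" unfolding q2 using cN lev_nonneg by simp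
    qed
    also have "\<dots> \<le> d * (K / c\<^sub>0)^(n+2)"
    proof -
      have "card L \<le> d" using card_mono[of "{..<d}" L] by (auto simp: L_def)
      moreover have "0 \<le> (K / c\<^sub>0)^(n+2)" using K1 c0_bounds by simp
      ultimately show ?thesis by (simp only: sum_constant) (intro mult_right_mono, auto)
    qed
    finally have "1 / (80 * d * (K / c\<^sub>0)^(n+2)) * (\<Sum>l\<in>L. (d * qf2 M (E l))^(n+2))
       \<le> 1 / (80 * d * (K / c\<^sub>0)^(n+2)) * (d * (K / c\<^sub>0)^(n+2))"
      using coeffs_pos(2) by (rule mult_left_mono[OF _ less_imp_le])
    also have "\<dots> = 1/80" using K1 c0_bounds d_pos by simp
    finally have "1 / (80 * d * (K / c\<^sub>0)^(n+2)) * (\<Sum>l\<in>L. (d * qf2 M (E l))^(n+2)) \<le> 1/80" .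
    then show ?thesis unfolding pot_def 1 by linarith
  qed
  moreover have "measure_pmf.prob (replicate_pmf k q)
     {cs. \<exists>y\<in>H. qf B y + (\<Sum>\<omega>\<leftarrow>cs. weight (v \<omega>) y) < 3/4 * k * inner y y} \<le> pot M"
    by (rule chain[OF _ pot_nonneg pot_step[OF q] g]) (use q in \<open>auto simp: column_law_def\<close>)
  moreover have "qf B y = c\<^sub>0 * N * inner y y" for y by (simp add: qf_def B_def)
  ultimately show ?thesis by simp
qed

end

section \<open>Moments of sparse Rademacher columns\<close>

lemma EV_rademacher: "EV (rademacher :: real pmf) f = (f 1 + f (- 1)) / 2"
  unfolding rademacher_def by (subst integral_pmf_of_set) auto

lemma finite_rademacher: "finite (set_pmf rademacher)"
  unfolding rademacher_def by (subst set_pmf_of_set) auto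

abbreviation rad_list :: "nat \<Rightarrow> real list pmf" where
  "rad_list n \<equiv> replicate_pmf n rademacher"

lemma finite_rad_list: "finite (set_pmf (rad_list n))"
  by (rule finite_set_replicate_pmf[OF finite_rademacher])

lemma EV_rad_Suc: "EV (rad_list (Suc n)) f = EV (rad_list n) (\<lambda>xs. (f (1 # xs) + f (- 1 # xs)) / 2)"
  unfolding EV_replicate_Suc[OF finite_rademacher] EV_rademacher
  by (simp add: EV_add[OF finite_rad_list])

definition rad_sum :: "nat \<Rightarrow> (nat \<Rightarrow> 'w::real_vector) \<Rightarrow> real list \<Rightarrow> 'w" where
  "rad_sum n b xs = (\<Sum>i<n. (xs ! i) *\<^sub>R b i)"

lemma rad_sum_Cons: "rad_sum (Suc n) b (x # xs) = x *\<^sub>R b 0 + rad_sum n (b \<circ> Suc) xs"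
  by (simp add: rad_sum_def sum.lessThan_Suc_shift del: sum.lessThan_Suc)

definition bf2 :: "('h::real_inner \<Rightarrow> 'h) \<Rightarrow> 'h \<times> 'h \<Rightarrow> 'h \<times> 'h \<Rightarrow> real" where
  "bf2 P x y = inner (fst x) (P (fst y)) + inner (snd x) (P (snd y))"

lemma qf2_add:
  assumes "psd P"
  shows "qf2 P (1 *\<^sub>R b + x) = qf2 P x + 2 * bf2 P x b + qf2 P b"
    and "qf2 P (- 1 *\<^sub>R b + x) = qf2 P x - 2 * bf2 P x b + qf2 P b"
proof -
  have sa: "selfadj P" using assms by (simp add: psd_def)
  note l = selfadjD[OF sa]
  have c: "inner u (P w) = inner w (P u)" for u w using l(2)[of w u] by (simp add: inner_commute)
  show "qf2 P (1 *\<^sub>R b + x) = qf2 P x + 2 * bf2 P x b + qf2 P b"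
    by (simp add: qf2_def qf_def bf2_def l inner_add_left inner_add_right c[of "fst b" "fst x"] c[of "snd b" "snd x"])
  have "P (- y) = - P y" for y using l(4)[of "-1" y] by simp
  then show "qf2 P (- 1 *\<^sub>R b + x) = qf2 P x - 2 * bf2 P x b + qf2 P b"
    by (simp add: qf2_def qf_def bf2_def l inner_diff_left inner_diff_right inner_add_left inner_add_right c[of "fst b" "fst x"] c[of "snd b" "snd x"])
qed

lemma bf2_cauchy_schwarz:
  assumes "psd P"
  shows "(bf2 P x y)^2 \<le> qf2 P x * qf2 P y"
proof -
  have "(a + b)^2 \<le> (p + q) * (r + s)" if "a^2 \<le> p * r" "b^2 \<le> q * s" "0 \<le> p" "0 \<le> q" "0 \<le> r" "0 \<le> s" for a b p q r s :: real
  proof -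
    have "(2 * (a * b))^2 \<le> (p * s + q * r)^2"
    proof -
      have "(a * b)^2 \<le> (p * r) * (q * s)" unfolding power_mult_distrib using that by (intro mult_mono) auto
      moreover have "4 * ((p * s) * (q * r)) \<le> (p * s + q * r)^2"
        using zero_le_power2[of "p * s - q * r"] by (simp add: power2_eq_square algebra_simps)
      ultimately show ?thesis by (simp add: power_mult_distrib algebra_simps)
    qed
    then have "2 * (a * b) \<le> p * s + q * r" using that
      by (meson add_nonneg_nonneg mult_nonneg_nonneg power2_le_imp_le)
    then show ?thesis using that by (simp add: power2_eq_square algebra_simps)
  qed
  then show ?thesis unfolding bf2_def qf2_def using psd_cauchy_schwarz[OF assms] assms
    by (simp add: psd_def)
qed

lemma rad_quadratic:
  fixes b :: "nat \<Rightarrow> 'h::real_inner \<times> 'h"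
  assumes P: "psd P"
  shows "EV (rad_list n) (\<lambda>xs. qf2 P (rad_sum n b xs)) = (\<Sum>i<n. qf2 P (b i))"
proof (induction n arbitrary: b)
  case 0
  have "P 0 = 0" using P selfadjD(6) by (auto simp: psd_def)
  then show ?case by (simp add: rad_sum_def qf2_def qf_def)
next
  case (Suc n)
  have "EV (rad_list (Suc n)) (\<lambda>xs. qf2 P (rad_sum (Suc n) b xs)) =
    EV (rad_list n) (\<lambda>xs. qf2 P (rad_sum n (b \<circ> Suc) xs) + qf2 P (b 0))"
    unfolding EV_rad_Suc rad_sum_Cons qf2_add[OF P] by (intro EV_cong) simp
  also have "\<dots> = (\<Sum>i<Suc n. qf2 P (b i))"
    unfolding EV_add[OF finite_rad_list] Suc.IH by (simp add: sum.lessThan_Suc_shift del: sum.lessThan_Suc)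
  finally show ?case .
qed

text \<open>Averaging over the sign that is peeled off leaves the mixed term
  \<open>4 * (bf2 P x y * bf2 Q x y)\<close>. Cauchy-Schwarz splits it into twice each mixed
  product, so these get the coefficient 1 + 2 = 3.\<close>

lemma rad_quadratic_product:
  fixes b :: "nat \<Rightarrow> 'h::real_inner \<times> 'h"
  assumes P: "psd P" and Q: "psd Q"
  shows "EV (rad_list n) (\<lambda>xs. qf2 P (rad_sum n b xs) * qf2 Q (rad_sum n b xs))
    \<le> 3 * ((\<Sum>i<n. qf2 P (b i)) * (\<Sum>i<n. qf2 Q (b i)))"
proof (induction n arbitrary: b)
  case 0
  have "P 0 = 0" using P selfadjD(6) by (auto simp: psd_def)
  then show ?case by (simp add: rad_sum_def qf2_def qf_def)
next
  case (Suc n)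
  define X where "X = rad_sum n (b \<circ> Suc)"
  define SP SQ where "SP = (\<Sum>i<n. qf2 P ((b \<circ> Suc) i))" and "SQ = (\<Sum>i<n. qf2 Q ((b \<circ> Suc) i))"
  have nn: "0 \<le> qf2 P z" "0 \<le> qf2 Q z" for z using qf2_nonneg[OF P] qf2_nonneg[OF Q] by auto
  have key: "4 * (bf2 P x y * bf2 Q x y) \<le> 2 * (qf2 P x * qf2 Q y + qf2 P y * qf2 Q x)" for x y
  proof -
    have "(bf2 P x y * bf2 Q x y)^2 \<le> (qf2 P x * qf2 P y) * (qf2 Q x * qf2 Q y)"
      unfolding power_mult_distrib using bf2_cauchy_schwarz[OF P] bf2_cauchy_schwarz[OF Q] nn by (intro mult_mono) auto
    moreover have "4 * ((qf2 P x * qf2 Q y) * (qf2 P y * qf2 Q x)) \<le> (qf2 P x * qf2 Q y + qf2 P y * qf2 Q x)^2"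
      using zero_le_power2[of "qf2 P x * qf2 Q y - qf2 P y * qf2 Q x"] by (simp add: power2_eq_square algebra_simps)
    ultimately have "(2 * (bf2 P x y * bf2 Q x y))^2 \<le> (qf2 P x * qf2 Q y + qf2 P y * qf2 Q x)^2"
      by (simp add: power_mult_distrib algebra_simps)
    then have "2 * (bf2 P x y * bf2 Q x y) \<le> qf2 P x * qf2 Q y + qf2 P y * qf2 Q x"
      using nn by (meson add_nonneg_nonneg mult_nonneg_nonneg power2_le_imp_le)
    then show ?thesis by simp
  qed
  have "EV (rad_list (Suc n)) (\<lambda>xs. qf2 P (rad_sum (Suc n) b xs) * qf2 Q (rad_sum (Suc n) b xs)) =
    EV (rad_list n) (\<lambda>xs. (qf2 P (X xs) + qf2 P (b 0)) * (qf2 Q (X xs) + qf2 Q (b 0)) + 4 * (bf2 P (X xs) (b 0) * bf2 Q (X xs) (b 0)))"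
    unfolding EV_rad_Suc rad_sum_Cons qf2_add[OF P] qf2_add[OF Q] X_def[symmetric]
    by (intro EV_cong) (simp add: field_simps)
  also have "\<dots> \<le> EV (rad_list n) (\<lambda>xs. qf2 P (X xs) * qf2 Q (X xs) + 3 * qf2 Q (b 0) * qf2 P (X xs) + 3 * qf2 P (b 0) * qf2 Q (X xs) + qf2 P (b 0) * qf2 Q (b 0))"
  proof (rule EV_mono[OF finite_rad_list])
    fix xs
    show "(qf2 P (X xs) + qf2 P (b 0)) * (qf2 Q (X xs) + qf2 Q (b 0)) + 4 * (bf2 P (X xs) (b 0) * bf2 Q (X xs) (b 0))
      \<le> qf2 P (X xs) * qf2 Q (X xs) + 3 * qf2 Q (b 0) * qf2 P (X xs) + 3 * qf2 P (b 0) * qf2 Q (X xs) + qf2 P (b 0) * qf2 Q (b 0)"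
      using key[of "X xs" "b 0"] by (simp add: algebra_simps)
  qed
  also have "\<dots> = EV (rad_list n) (\<lambda>xs. qf2 P (X xs) * qf2 Q (X xs)) + 3 * qf2 Q (b 0) * SP + 3 * qf2 P (b 0) * SQ + qf2 P (b 0) * qf2 Q (b 0)"
    unfolding EV_add[OF finite_rad_list] EV_cmult X_def rad_quadratic[OF P] rad_quadratic[OF Q] SP_def SQ_def by simp
  also have "\<dots> \<le> 3 * (SP * SQ) + 3 * qf2 Q (b 0) * SP + 3 * qf2 P (b 0) * SQ + qf2 P (b 0) * qf2 Q (b 0)"
    using Suc.IH[of "b \<circ> Suc"] unfolding X_def SP_def SQ_def by linarith
  also have "\<dots> \<le> 3 * ((qf2 P (b 0) + SP) * (qf2 Q (b 0) + SQ))"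
    using mult_nonneg_nonneg[OF nn(1)[of "b 0"] nn(2)[of "b 0"]] by (simp add: algebra_simps)
  also have "\<dots> = 3 * ((\<Sum>i<Suc n. qf2 P (b i)) * (\<Sum>i<Suc n. qf2 Q (b i)))"
    by (simp add: SP_def SQ_def sum.lessThan_Suc_shift del: sum.lessThan_Suc)
  finally show ?case .
qed

section \<open>Positions sampled without replacement\<close>

definition distinct_lists :: "nat \<Rightarrow> nat \<Rightarrow> nat list set" where
  "distinct_lists d k = {s. length s = k \<and> distinct s \<and> set s \<subseteq> {..<d}}"

lemma finite_distinct_lists: "finite (distinct_lists d k)"
  by (rule finite_subset[OF _ finite_lists_length_eq[of "{..<d}" k]]) (auto simp: distinct_lists_def)

lemma distinct_lists_nonempty: "k \<le> d \<Longrightarrow> distinct_lists d k \<noteq> {}"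
proof -
  assume "k \<le> d"
  then have "[0..<k] \<in> distinct_lists d k" by (auto simp: distinct_lists_def)
  then show ?thesis by blast
qed

definition swp :: "nat \<Rightarrow> nat \<Rightarrow> nat \<Rightarrow> nat" where
  "swp a b x = (if x = a then b else if x = b then a else x)"

text \<open>The law of the positions is invariant under transpositions of rows. Hence the marginals
  are constant, and counting determines them.\<close>

lemma sum_distinct_lists_swp:
  assumes "a < d" "b < d"
  shows "(\<Sum>s\<in>distinct_lists d k. f (map (swp a b) s)) = (\<Sum>s\<in>distinct_lists d k. f s :: real)"
proof (rule sum.reindex_bij_witness[of _ "map (swp a b)" "map (swp a b)"])
  have inv: "swp a b (swp a b x) = x" for x by (auto simp: swp_def)
  then have "map (swp a b) (map (swp a b) s) = s" for s by (simp add: o_def)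
  then show "\<And>s. map (swp a b) (map (swp a b) s) = s" "\<And>s. map (swp a b) (map (swp a b) s) = s" by auto
  have inj: "inj (swp a b)" using inv by (metis injI)
  show "map (swp a b) s \<in> distinct_lists d k" if "s \<in> distinct_lists d k" for s
  proof -
    have "swp a b x < d" if "x < d" for x using assms that by (auto simp: swp_def)
    then show ?thesis using that inj by (auto simp: distinct_lists_def distinct_map inj_on_def)
  qed
  then show "\<And>s. s \<in> distinct_lists d k \<Longrightarrow> map (swp a b) s \<in> distinct_lists d k" .
qed auto

lemma distinct_lists_marginal:
  assumes i: "i < k" and l: "l < d"
  shows "(\<Sum>s\<in>distinct_lists d k. if s ! i = l then 1 else 0) = real (card (distinct_lists d k)) / d"
proof -
  let ?D = "distinct_lists d k"
  define n1 where "n1 = (\<lambda>l. \<Sum>s\<in>?D. if s ! i = l then 1 else (0::real))"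
  have eq: "n1 l' = n1 l" if "l' < d" for l'
  proof -
    have "n1 l' = (\<Sum>s\<in>?D. if map (swp l l') s ! i = l' then 1 else 0)"
      unfolding n1_def by (rule sum_distinct_lists_swp[symmetric, OF l that])
    also have "\<dots> = n1 l" unfolding n1_def
      by (rule sum.cong) (use i in \<open>auto simp: distinct_lists_def swp_def\<close>)
    finally show ?thesis .
  qed
  have "(\<Sum>l'<d. n1 l') = (\<Sum>s\<in>?D. \<Sum>l'<d. if s ! i = l' then 1 else 0)"
    unfolding n1_def by (rule sum.swap)
  also have "\<dots> = (\<Sum>s\<in>?D. 1)"
    by (rule sum.cong) (use i in \<open>auto simp: distinct_lists_def dest!: nth_mem\<close>)
  finally have "(\<Sum>l'<d. n1 l') = card ?D" by simp
  moreover have "(\<Sum>l'<d. n1 l') = d * n1 l" using eq by simp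
  ultimately show ?thesis using l by (simp add: n1_def field_simps)
qed

text \<open>Transposing \<open>l'\<close> with another row different from \<open>l\<close> leaves
  the event at position \<open>i\<close> alone, so the mass of the first marginal is shared equally
  by the d - 1 remaining rows.\<close>

lemma distinct_lists_pair_marginal:
  assumes ij: "i < k" "j < k" "i \<noteq> j" and l: "l < d" "l' < d" "l \<noteq> l'"
  shows "(\<Sum>s\<in>distinct_lists d k. if s ! i = l \<and> s ! j = l' then 1 else 0)
     = real (card (distinct_lists d k)) / (real d * (real d - 1))"
proof -
  let ?D = "distinct_lists d k"
  define n2 where "n2 = (\<lambda>l'. \<Sum>s\<in>?D. if s ! i = l \<and> s ! j = l' then 1 else (0::real))"
  have eq: "n2 m = n2 l'" if "m < d" "m \<noteq> l" for m
  proof -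
    have "n2 m = (\<Sum>s\<in>?D. if map (swp l' m) s ! i = l \<and> map (swp l' m) s ! j = m then 1 else 0)"
      unfolding n2_def by (rule sum_distinct_lists_swp[symmetric, OF l(2) that(1)])
    also have "\<dots> = n2 l'" unfolding n2_def
      by (rule sum.cong) (use ij l that in \<open>auto simp: distinct_lists_def swp_def\<close>)
    finally show ?thesis .
  qed
  have n2l: "n2 l = 0" unfolding n2_def
    by (rule sum.neutral) (use ij in \<open>auto simp: distinct_lists_def nth_eq_iff_index_eq\<close>)
  have "(\<Sum>m<d. n2 m) = (\<Sum>s\<in>?D. \<Sum>m<d. if s ! i = l \<and> s ! j = m then 1 else 0)"
    unfolding n2_def by (rule sum.swap)
  also have "\<dots> = (\<Sum>s\<in>?D. if s ! i = l then 1 else 0)"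
    by (rule sum.cong) (use ij in \<open>auto simp: distinct_lists_def dest!: nth_mem[of j]\<close>)
  also have "\<dots> = real (card ?D) / d" by (rule distinct_lists_marginal[OF ij(1) l(1)])
  finally have "(\<Sum>m<d. n2 m) = real (card ?D) / d" .
  moreover have "(\<Sum>m<d. n2 m) = n2 l + (\<Sum>m\<in>{..<d} - {l}. n2 m)" using l by (subst sum.remove) auto
  moreover have "(\<Sum>m\<in>{..<d} - {l}. n2 m) = (real d - 1) * n2 l'"
  proof -
    have "(\<Sum>m\<in>{..<d} - {l}. n2 m) = (\<Sum>m\<in>{..<d} - {l}. n2 l')" by (rule sum.cong) (use eq in auto)
    then show ?thesis using l by (simp add: of_nat_diff)
  qed
  ultimately have "(real d - 1) * n2 l' = real (card ?D) / d" by (simp add: n2l)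
  moreover have "real d - 1 > 0" using l by linarith
  ultimately show ?thesis unfolding n2_def by (simp add: field_simps)
qed

abbreviation pos_list :: "nat \<Rightarrow> nat \<Rightarrow> nat list pmf" where
  "pos_list d k \<equiv> pmf_of_set (distinct_lists d k)"

lemma EV_pos_list: "k \<le> d \<Longrightarrow> EV (pos_list d k) f = (\<Sum>s\<in>distinct_lists d k. f s) / card (distinct_lists d k)"
  by (rule integral_pmf_of_set[OF distinct_lists_nonempty finite_distinct_lists])

lemma finite_pos_list: "k \<le> d \<Longrightarrow> finite (set_pmf (pos_list d k))"
  using distinct_lists_nonempty finite_distinct_lists by (subst set_pmf_of_set) auto

lemma card_distinct_lists_pos: "k \<le> d \<Longrightarrow> 0 < real (card (distinct_lists d k))"
  using distinct_lists_nonempty finite_distinct_lists by (simp add: card_gt_0_iff)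

lemma EV_pos_nth:
  assumes "k \<le> d" "i < k"
  shows "EV (pos_list d k) (\<lambda>s. f (s ! i)) = (\<Sum>l<d. f l) / d"
proof -
  let ?D = "distinct_lists d k"
  have "(\<Sum>s\<in>?D. f (s ! i)) = (\<Sum>s\<in>?D. \<Sum>l<d. f l * (if s ! i = l then 1 else 0))"
    by (rule sum.cong) (use assms in \<open>auto simp: distinct_lists_def if_distrib dest!: nth_mem cong: if_cong\<close>)
  also have "\<dots> = (\<Sum>l<d. f l * (\<Sum>s\<in>?D. if s ! i = l then 1 else 0))"
    by (subst sum.swap) (simp add: sum_distrib_left)
  also have "\<dots> = (\<Sum>l<d. f l * (real (card ?D) / d))"
    by (rule sum.cong) (use distinct_lists_marginal[OF assms(2)] in auto)
  also have "\<dots> = card ?D * ((\<Sum>l<d. f l) / d)"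
    by (simp add: sum_distrib_right[symmetric] sum_divide_distrib[symmetric])
  finally show ?thesis using card_distinct_lists_pos[OF assms(1)] by (simp add: EV_pos_list[OF assms(1)])
qed

lemma EV_pos_pair:
  assumes "k \<le> d" "i < k" "j < k" "i \<noteq> j"
  shows "EV (pos_list d k) (\<lambda>s. f (s ! i) * g (s ! j)) =
    ((\<Sum>l<d. f l) * (\<Sum>l<d. g l) - (\<Sum>l<d. f l * g l)) / (real d * (real d - 1))"
proof -
  let ?D = "distinct_lists d k"
  have "(\<Sum>s\<in>?D. f (s ! i) * g (s ! j)) = (\<Sum>s\<in>?D. \<Sum>l<d. \<Sum>l'<d. (f l * g l') * (if s ! i = l \<and> s ! j = l' then 1 else 0))"
  proof (rule sum.cong)
    fix s assume s: "s \<in> ?D"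
    have lt: "s ! i < d" "s ! j < d" using s assms by (auto simp: distinct_lists_def dest!: nth_mem)
    have "(\<Sum>l<d. \<Sum>l'<d. (f l * g l') * (if s ! i = l \<and> s ! j = l' then 1 else 0))
      = (\<Sum>l<d. if s ! i = l then f l * g (s ! j) else 0)"
      by (rule sum.cong) (use lt in \<open>auto simp: if_distrib cong: if_cong\<close>)
    then show "f (s ! i) * g (s ! j) = (\<Sum>l<d. \<Sum>l'<d. (f l * g l') * (if s ! i = l \<and> s ! j = l' then 1 else 0))"
      using lt by simp
  qed simp
  also have "\<dots> = (\<Sum>l<d. \<Sum>s\<in>?D. \<Sum>l'<d. (f l * g l') * (if s ! i = l \<and> s ! j = l' then 1 else 0))"
    by (rule sum.swap)
  also have "\<dots> = (\<Sum>l<d. \<Sum>l'<d. \<Sum>s\<in>?D. (f l * g l') * (if s ! i = l \<and> s ! j = l' then 1 else 0))"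
    by (rule sum.cong[OF refl sum.swap])
  also have "\<dots> = (\<Sum>l<d. \<Sum>l'<d. (f l * g l') * (\<Sum>s\<in>?D. if s ! i = l \<and> s ! j = l' then 1 else 0))"
    by (simp add: sum_distrib_left)
  also have "\<dots> = (\<Sum>l<d. \<Sum>l'<d. (f l * g l' - (if l = l' then f l * g l' else 0)) * (card ?D / (real d * (real d - 1))))"
  proof (intro sum.cong refl)
    fix l l' assume l: "l \<in> {..<d}" "l' \<in> {..<d}"
    show "(f l * g l') * (\<Sum>s\<in>?D. if s ! i = l \<and> s ! j = l' then 1 else 0)
      = (f l * g l' - (if l = l' then f l * g l' else 0)) * (card ?D / (real d * (real d - 1)))"
    proof (cases "l = l'")
      case True
      have "(\<Sum>s\<in>?D. if s ! i = l \<and> s ! j = l' then 1 else (0::real)) = 0"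
        by (rule sum.neutral) (use assms True in \<open>auto simp: distinct_lists_def nth_eq_iff_index_eq\<close>)
      then show ?thesis using True by simp
    next
      case False
      then show ?thesis using distinct_lists_pair_marginal[OF assms(2-4), of l d l'] l by simp
    qed
  qed
  also have "\<dots> = (\<Sum>l<d. \<Sum>l'<d. f l * g l' - (if l = l' then f l * g l' else 0)) * (card ?D / (real d * (real d - 1)))"
    by (simp only: sum_distrib_right)
  also have "(\<Sum>l<d. \<Sum>l'<d. f l * g l' - (if l = l' then f l * g l' else 0)) = (\<Sum>l<d. f l) * (\<Sum>l<d. g l) - (\<Sum>l<d. f l * g l)"
    by (simp add: sum_subtractf sum_product)
  finally show ?thesis using card_distinct_lists_pos[OF assms(1)] by (simp add: EV_pos_list[OF assms(1)])
qed

lemma EV_pos_sum: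
  assumes "k \<le> d"
  shows "EV (pos_list d k) (\<lambda>s. \<Sum>i<k. f (s ! i)) = k / d * (\<Sum>l<d. f l)"
  unfolding EV_sum[OF finite_pos_list[OF assms]] by (simp add: EV_pos_nth[OF assms])

text \<open>Distinct positions are at most as correlated as independent ones, since (k - 1)/(d - 1)
  \<le> k/d. The case \<open>d = 1\<close> is separate because the denominator d - 1
  vanishes.\<close>

lemma EV_pos_product:
  assumes "k \<le> d" "1 \<le> d" "\<And>l. 0 \<le> f l" "\<And>l. 0 \<le> g l"
  shows "EV (pos_list d k) (\<lambda>s. (\<Sum>i<k. f (s ! i)) * (\<Sum>i<k. g (s ! i)))
    \<le> k / d * (\<Sum>l<d. f l * g l) + (k / d)^2 * ((\<Sum>l<d. f l) * (\<Sum>l<d. g l))"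
proof -
  define F G FG where "F = (\<Sum>l<d. f l)" and "G = (\<Sum>l<d. g l)" and "FG = (\<Sum>l<d. f l * g l)"
  have FG0: "0 \<le> F" "0 \<le> G" "0 \<le> FG" unfolding F_def G_def FG_def by (auto intro!: sum_nonneg mult_nonneg_nonneg assms)
  have "EV (pos_list d k) (\<lambda>s. (\<Sum>i<k. f (s ! i)) * (\<Sum>i<k. g (s ! i)))
    = (\<Sum>i<k. \<Sum>j<k. EV (pos_list d k) (\<lambda>s. f (s ! i) * g (s ! j)))"
    unfolding sum_product EV_sum[OF finite_pos_list[OF assms(1)]] ..
  also have "\<dots> \<le> (\<Sum>i<k. \<Sum>j<k. (if i = j then FG / d else 0) + (if i = j then 0 else F * G / (real d * (real d - 1))))"
  proof (intro sum_mono)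
    fix i j assume ij: "i \<in> {..<k}" "j \<in> {..<k}"
    show "EV (pos_list d k) (\<lambda>s. f (s ! i) * g (s ! j)) \<le> (if i = j then FG / d else 0) + (if i = j then 0 else F * G / (real d * (real d - 1)))"
    proof (cases "i = j")
      case True
      then show ?thesis using EV_pos_nth[OF assms(1), of i "\<lambda>l. f l * g l"] ij by (simp add: FG_def)
    next
      case False
      then have "d \<ge> 2" using ij assms(1) by auto
      then have "0 < real d * (real d - 1)" by simp
      then have "(F * G - FG) / (real d * (real d - 1)) \<le> F * G / (real d * (real d - 1))"
        using FG0 by (intro divide_right_mono) auto
      then show ?thesis using EV_pos_pair[OF assms(1), of i j f g] ij False by (simp add: F_def G_def FG_def)
    qed
  qed
  also have "\<dots> = k * (FG / d) + (real k * real k - k) * (F * G / (real d * (real d - 1)))"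
  proof -
    have "(\<Sum>i<k. \<Sum>j<k. if i = j then 0 else c) = (real k * real k - k) * c" for c :: real
    proof -
      have "(\<Sum>i<k. \<Sum>j<k. if i = j then 0 else c) = (\<Sum>i<k. \<Sum>j<k. c - (if i = j then c else 0))"
        by (intro sum.cong refl) auto
      also have "\<dots> = (\<Sum>i<k. k * c - c)" by (simp add: sum_subtractf)
      finally show ?thesis by (simp add: algebra_simps)
    qed
    then show ?thesis by (simp add: sum.distrib)
  qed
  also have "\<dots> \<le> k * (FG / d) + (k / d)^2 * (F * G)"
  proof (cases "d = 1")
    case True
    then have "k = 0 \<or> k = 1" using assms(1) by auto
    then show ?thesis using True FG0 by auto
  next
    case False
    then have d2: "real d - 1 > 0" using assms(2) by simp
    have "(real k - 1) * d \<le> k * (real d - 1)" using assms(1) by (simp add: algebra_simps)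
    then have "(real k - 1) / (real d - 1) \<le> k / d" using d2 assms(2) by (simp add: field_simps)
    then have "k / d * ((real k - 1) / (real d - 1)) \<le> k / d * (k / d)" by (rule mult_left_mono) auto
    then have "k / d * ((real k - 1) / (real d - 1)) * (F * G) \<le> k / d * (k / d) * (F * G)"
      using FG0 by (intro mult_right_mono) auto
    moreover have "(real k * real k - k) * (F * G / (real d * (real d - 1))) = k / d * ((real k - 1) / (real d - 1)) * (F * G)"
    proof -
      have "real k * real k - k = real k * (real k - 1)" by (simp add: algebra_simps)
      then show ?thesis by simp
    qed
    ultimately have "(real k * real k - k) * (F * G / (real d * (real d - 1))) \<le> (k / d)^2 * (F * G)"
      by (simp only: power2_eq_square)
    then show ?thesis by linarith
  qed
  finally show ?thesis by (simp add: F_def G_def FG_def)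
qed

section \<open>Fourth moment of a Rademacher chaos\<close>

text \<open>The variance of the squared norm of a Rademacher sum: four times the sum of squared
  inner products over pairs i < j. The recursion follows the summand that the moment computation
  peels off.\<close>

fun chaos_var :: "nat \<Rightarrow> (nat \<Rightarrow> 'h::real_inner) \<Rightarrow> real" where
  "chaos_var 0 b = 0"
| "chaos_var (Suc n) b = 4 * (\<Sum>i<n. (inner (b 0) (b (Suc i)))^2) + chaos_var n (b \<circ> Suc)"

lemma chaos_var_nonneg: "0 \<le> chaos_var n b"
proof (induction n arbitrary: b)
  case (Suc n)
  have "0 \<le> (\<Sum>i<n. (inner (b 0) (b (Suc i)))^2)" by (rule sum_nonneg) simp
  then show ?case using Suc[of "b \<circ> Suc"] unfolding chaos_var.simps by linarith
qed simp

lemma chaos_var_le: "chaos_var n b \<le> 2 * (\<Sum>i<n. \<Sum>j<n. (inner (b i) (b j))^2)"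
proof (induction n arbitrary: b)
  case (Suc n)
  have "(\<Sum>i<Suc n. \<Sum>j<Suc n. (inner (b i) (b j))^2) = (inner (b 0) (b 0))^2 +
     2 * (\<Sum>i<n. (inner (b 0) (b (Suc i)))^2) + (\<Sum>i<n. \<Sum>j<n. (inner (b (Suc i)) (b (Suc j)))^2)"
    by (simp add: sum.lessThan_Suc_shift sum.distrib inner_commute[of "b (Suc _)" "b 0"] del: sum.lessThan_Suc)
  moreover have "0 \<le> (inner (b 0) (b 0))^2" by simp
  ultimately show ?case using Suc[of "b \<circ> Suc"] unfolding chaos_var.simps o_def by linarith
qed simp

lemma psd_id: "psd (\<lambda>x. x)"
  by (simp add: psd_def selfadj_def qf_def linear_id[unfolded id_def])

lemma rad_linear_fourth:
  fixes a :: "nat \<Rightarrow> real"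
  shows "EV (rad_list n) (\<lambda>xs. (rad_sum n a xs)^4) \<le> 3 * (\<Sum>i<n. (a i)^2)^2"
proof -
  define b where "b = (\<lambda>i. (a i, 0::real))"
  have "qf2 (\<lambda>x. x) (rad_sum n b xs) = (rad_sum n a xs)^2" for xs
    by (simp add: qf2_def qf_def rad_sum_def b_def fst_sum snd_sum power2_eq_square)
  moreover have "qf2 (\<lambda>x. x) (b i) = (a i)^2" for i
    by (simp add: qf2_def qf_def b_def power2_eq_square)
  ultimately show ?thesis using rad_quadratic_product[OF psd_id psd_id, of n b]
    by (simp add: power2_eq_square power4_eq_xxxx mult.assoc)
qed

text \<open>The centered square norm of a Rademacher sum is a martingale in the number of summands; its
  fourth moment is compared with the square of its variance by induction.\<close>

lemma chaos_fourth_aux: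
  fixes b :: "nat \<Rightarrow> 'h::real_inner"
  assumes \<epsilon>: "0 < \<epsilon>"
  shows "EV (rad_list n) (\<lambda>xs. (inner (rad_sum n b xs) (rad_sum n b xs) - (\<Sum>i<n. inner (b i) (b i)))^4)
    \<le> 27 * (chaos_var n b + real (Suc n) * \<epsilon>)^2"
proof (induction n arbitrary: b)
  case 0
  then show ?case by (simp add: rad_sum_def)
next
  case (Suc n)
  define X where "X = rad_sum n (b \<circ> Suc)"
  define Z where "Z = (\<lambda>xs. inner (X xs) (X xs) - (\<Sum>i<n. inner (b (Suc i)) (b (Suc i))))"
  define a where "a = (\<lambda>i. 2 * inner (b 0) (b (Suc i)))"
  define \<alpha> where "\<alpha> = rad_sum n a"
  have \<alpha>: "\<alpha> xs = 2 * inner (b 0) (X xs)" for xs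
    by (simp add: \<alpha>_def rad_sum_def X_def inner_sum_right sum_distrib_left a_def mult_ac)
  \<comment> \<open>The positive \<epsilon> added at every stage keeps \<open>s\<close> and
    \<open>t\<close> away from 0, so that the weight \<open>c\<close> below is defined.\<close>
  define s t where "s = chaos_var n (b \<circ> Suc) + real (Suc n) * \<epsilon>" and "t = (\<Sum>i<n. (a i)^2) + \<epsilon>"
  have s0: "0 < s" using chaos_var_nonneg[of n "b \<circ> Suc"] \<epsilon> by (simp add: s_def add_nonneg_pos)
  have t0: "0 < t" using \<epsilon> by (simp add: t_def add_nonneg_pos sum_nonneg)
  have IH: "EV (rad_list n) (\<lambda>xs. (Z xs)^4) \<le> 27 * s^2"
    using Suc.IH[of "b \<circ> Suc"] unfolding Z_def X_def s_def o_def by simp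
  have A4: "EV (rad_list n) (\<lambda>xs. (\<alpha> xs)^4) \<le> 3 * t^2"
  proof -
    have "EV (rad_list n) (\<lambda>xs. (\<alpha> xs)^4) \<le> 3 * (\<Sum>i<n. (a i)^2)^2" unfolding \<alpha>_def by (rule rad_linear_fourth)
    also have "\<dots> \<le> 3 * t^2" using \<epsilon> by (simp add: t_def power_mono sum_nonneg)
    finally show ?thesis .
  qed
  \<comment> \<open>The optimal weight: both terms into which the mixed moment is split get the
    bound 27 s t, and together they are the mixed term of 27 (s + t)^2.\<close>
  define c where "c = t / (3 * s)"
  have c0: "0 < c" using s0 t0 by (simp add: c_def)
  have "EV (rad_list (Suc n)) (\<lambda>xs. (inner (rad_sum (Suc n) b xs) (rad_sum (Suc n) b xs) - (\<Sum>i<Suc n. inner (b i) (b i)))^4)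
     = EV (rad_list n) (\<lambda>xs. (Z xs)^4 + 6 * ((Z xs)^2 * (\<alpha> xs)^2) + (\<alpha> xs)^4)"
  proof -
    have "inner (x *\<^sub>R b 0 + X xs) (x *\<^sub>R b 0 + X xs) - (\<Sum>i<Suc n. inner (b i) (b i)) = Z xs + x * \<alpha> xs"
      if "x = 1 \<or> x = - 1" for x xs
    proof -
      have "inner (x *\<^sub>R b 0 + X xs) (x *\<^sub>R b 0 + X xs) = (x * x) * inner (b 0) (b 0) + 2 * x * inner (b 0) (X xs) + inner (X xs) (X xs)"
        by (simp only: inner_add_left inner_add_right inner_scaleR_left inner_scaleR_right inner_commute[of "X xs" "b 0"])
           (simp add: algebra_simps)
      moreover have "x * x = 1" using that by auto
      ultimately show ?thesis unfolding Z_def \<alpha> sum.lessThan_Suc_shift by simp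
    qed
    note e = this[OF disjI1[OF refl]] this[OF disjI2[OF refl]]
    show ?thesis unfolding EV_rad_Suc rad_sum_Cons X_def[symmetric]
    proof (rule EV_cong)
      fix xs
      show "((inner (1 *\<^sub>R b 0 + X xs) (1 *\<^sub>R b 0 + X xs) - (\<Sum>i<Suc n. inner (b i) (b i)))^4 +
         (inner (- 1 *\<^sub>R b 0 + X xs) (- 1 *\<^sub>R b 0 + X xs) - (\<Sum>i<Suc n. inner (b i) (b i)))^4) / 2
        = (Z xs)^4 + 6 * ((Z xs)^2 * (\<alpha> xs)^2) + (\<alpha> xs)^4"
        unfolding e by (simp add: power2_eq_square power4_eq_xxxx algebra_simps)
    qed
  qed
  also have "\<dots> \<le> EV (rad_list n) (\<lambda>xs. (Z xs)^4 + (3 * c * (Z xs)^4 + 3 / c * (\<alpha> xs)^4) + (\<alpha> xs)^4)"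
  proof (rule EV_mono[OF finite_rad_list])
    fix xs
    have "0 \<le> (c * (Z xs)^2 - (\<alpha> xs)^2)^2" by simp
    then have "2 * c * ((Z xs)^2 * (\<alpha> xs)^2) \<le> c^2 * (Z xs)^4 + (\<alpha> xs)^4"
      by (simp add: power2_eq_square power4_eq_xxxx algebra_simps)
    then have "6 * ((Z xs)^2 * (\<alpha> xs)^2) \<le> 3 * c * (Z xs)^4 + 3 / c * (\<alpha> xs)^4"
      using c0 by (simp add: field_simps power2_eq_square)
    then show "(Z xs)^4 + 6 * ((Z xs)^2 * (\<alpha> xs)^2) + (\<alpha> xs)^4 \<le> (Z xs)^4 + (3 * c * (Z xs)^4 + 3 / c * (\<alpha> xs)^4) + (\<alpha> xs)^4"
      by simp
  qed
  also have "\<dots> = EV (rad_list n) (\<lambda>xs. (Z xs)^4) + (3 * c * EV (rad_list n) (\<lambda>xs. (Z xs)^4) + 3 / c * EV (rad_list n) (\<lambda>xs. (\<alpha> xs)^4))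
      + EV (rad_list n) (\<lambda>xs. (\<alpha> xs)^4)"
    by (simp only: EV_add[OF finite_rad_list] EV_cmult)
  also have "\<dots> \<le> 27 * s^2 + (3 * c * (27 * s^2) + 3 / c * (3 * t^2)) + 3 * t^2"
    using IH A4 c0 by (intro add_mono mult_left_mono) auto
  also have "\<dots> = 27 * s^2 + 54 * (s * t) + 3 * t^2"
    using s0 t0 by (simp add: c_def field_simps power2_eq_square)
  also have "\<dots> \<le> 27 * (s + t)^2" using zero_le_power2[of t] by (simp add: power2_eq_square algebra_simps)
  also have "s + t = chaos_var (Suc n) b + real (Suc (Suc n)) * \<epsilon>"
    by (simp add: s_def t_def a_def power_mult_distrib sum_distrib_left algebra_simps)
  finally show ?case .
qed

text \<open>\<epsilon> is taken as S / (n + 1), so that the regularisation at most doubles the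
  variance bound: 27 * 2^2 = 108.\<close>

lemma chaos_fourth:
  fixes b :: "nat \<Rightarrow> 'h::real_inner"
  assumes "0 < S" "chaos_var n b \<le> S"
  shows "EV (rad_list n) (\<lambda>xs. (inner (rad_sum n b xs) (rad_sum n b xs) - (\<Sum>i<n. inner (b i) (b i)))^4) \<le> 108 * S^2"
proof -
  have "EV (rad_list n) (\<lambda>xs. (inner (rad_sum n b xs) (rad_sum n b xs) - (\<Sum>i<n. inner (b i) (b i)))^4)
     \<le> 27 * (chaos_var n b + real (Suc n) * (S / Suc n))^2"
    by (rule chaos_fourth_aux) (use assms in simp)
  also have "chaos_var n b + real (Suc n) * (S / Suc n) = chaos_var n b + S" by simp
  also have "27 * (chaos_var n b + S)^2 \<le> 27 * (S + S)^2"
    using assms chaos_var_nonneg[of n b] by (intro mult_left_mono power_mono) auto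
  finally show ?thesis by (simp add: power2_eq_square)
qed

context parseval_frame
begin

text \<open>The value 0 for illegal position lists is chosen because \<open>column_law\<close> asks
  for vectors in \<open>H\<close> at every point, not only on the support.\<close>

definition column :: "nat \<Rightarrow> real list \<times> nat list \<Rightarrow> 'h \<times> 'h" where
  "column \<xi> = (\<lambda>(\<rho>, s). if set s \<subseteq> {..<d} \<and> length s = \<xi>
     then sqrt (d / \<xi>) *\<^sub>R (\<Sum>i<\<xi>. (\<rho> ! i) *\<^sub>R E (s ! i)) else 0)"

lemma column_in: "fst (column \<xi> \<omega>) \<in> H" "snd (column \<xi> \<omega>) \<in> H"
  unfolding column_def
  by (auto split: prod.splits simp: fst_sum snd_sum H_zero dest!: nth_mem intro!: H_scale H_sum frame_in)

text \<open>Given the positions, the Rademacher moments apply. Averaging over the positions yields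
  tr P tr Q and a diagonal sum, and the latter retains one of the two factors
  \<open>d / \<xi>\<close>.\<close>

lemma column_law_column:
  assumes \<xi>: "1 \<le> \<xi>" "\<xi> \<le> d"
  shows "column_law (pair_pmf (rad_list \<xi>) (pos_list d \<xi>)) (column \<xi>) (d / \<xi>)"
proof -
  define c where "c = sqrt (d / \<xi>)"
  have c2: "c^2 = d / \<xi>" by (simp add: c_def)
  have d0: "0 < d" using \<xi> by simp
  have col: "column \<xi> (\<rho>, s) = c *\<^sub>R rad_sum \<xi> (\<lambda>i. E (s ! i)) \<rho>" if "s \<in> set_pmf (pos_list d \<xi>)" for \<rho> s
  proof -
    have "s \<in> distinct_lists d \<xi>"
      using that set_pmf_of_set[OF distinct_lists_nonempty[OF \<xi>(2)] finite_distinct_lists] by simp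
    then show ?thesis by (auto simp: column_def rad_sum_def c_def distinct_lists_def)
  qed
  have fin: "finite (set_pmf (rad_list \<xi>))" "finite (set_pmf (pos_list d \<xi>))"
    by (rule finite_rad_list, rule finite_pos_list[OF \<xi>(2)])
  have sc: "qf2 P (c *\<^sub>R x) = d / \<xi> * qf2 P x" if "psd P" for P x
  proof -
    have sa: "selfadj P" using that by (simp add: psd_def)
    show ?thesis unfolding c2[symmetric]
      by (simp add: qf2_def qf_def selfadjD(4)[OF sa] power2_eq_square algebra_simps)
  qed
  have comm: "EV (pair_pmf (rad_list \<xi>) (pos_list d \<xi>)) f = EV (pos_list d \<xi>) (\<lambda>s. EV (rad_list \<xi>) (\<lambda>\<rho>. f (\<rho>, s)))" for f
    unfolding pair_commute_pmf[of "rad_list \<xi>"] integral_map_pmf EV_pair[OF fin(2,1)] by simp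
  show ?thesis unfolding column_law_def
  proof (intro conjI allI impI)
    show "finite (set_pmf (pair_pmf (rad_list \<xi>) (pos_list d \<xi>)))" using fin by simp
    show "fst (column \<xi> \<omega>) \<in> H" "snd (column \<xi> \<omega>) \<in> H" for \<omega> by (rule column_in)+
    fix P :: "'h \<Rightarrow> 'h" assume P: "psd P"
    have "EV (pair_pmf (rad_list \<xi>) (pos_list d \<xi>)) (\<lambda>\<omega>. qf2 P (column \<xi> \<omega>))
      = EV (pos_list d \<xi>) (\<lambda>s. EV (rad_list \<xi>) (\<lambda>\<rho>. d / \<xi> * qf2 P (rad_sum \<xi> (\<lambda>i. E (s ! i)) \<rho>)))"
      unfolding comm by (intro EV_cong) (simp only: col sc[OF P])
    also have "\<dots> = d / \<xi> * EV (pos_list d \<xi>) (\<lambda>s. \<Sum>i<\<xi>. qf2 P (E (s ! i)))"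
      by (simp only: EV_cmult rad_quadratic[OF P])
    also have "\<dots> = tr P" using \<xi> by (simp add: EV_pos_sum[OF \<xi>(2), of "\<lambda>l. qf2 P (E l)"] tr_def)
    finally show "EV (pair_pmf (rad_list \<xi>) (pos_list d \<xi>)) (\<lambda>\<omega>. qf2 P (column \<xi> \<omega>)) = tr P" .
    fix Q :: "'h \<Rightarrow> 'h" assume Q: "psd Q"
    define T where "T = (\<Sum>l<d. qf2 P (E l) * qf2 Q (E l))"
    have "EV (pair_pmf (rad_list \<xi>) (pos_list d \<xi>)) (\<lambda>\<omega>. qf2 P (column \<xi> \<omega>) * qf2 Q (column \<xi> \<omega>))
      = EV (pos_list d \<xi>) (\<lambda>s. EV (rad_list \<xi>) (\<lambda>\<rho>. (d / \<xi>)^2 *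
          (qf2 P (rad_sum \<xi> (\<lambda>i. E (s ! i)) \<rho>) * qf2 Q (rad_sum \<xi> (\<lambda>i. E (s ! i)) \<rho>))))"
      unfolding comm by (intro EV_cong) (simp only: col sc[OF P] sc[OF Q] power2_eq_square mult_ac)
    also have "\<dots> = (d / \<xi>)^2 * EV (pos_list d \<xi>) (\<lambda>s. EV (rad_list \<xi>) (\<lambda>\<rho>.
          (qf2 P (rad_sum \<xi> (\<lambda>i. E (s ! i)) \<rho>) * qf2 Q (rad_sum \<xi> (\<lambda>i. E (s ! i)) \<rho>))))"
      by (simp only: EV_cmult)
    also have "\<dots> \<le> (d / \<xi>)^2 * EV (pos_list d \<xi>) (\<lambda>s. 3 * ((\<Sum>i<\<xi>. qf2 P (E (s ! i))) * (\<Sum>i<\<xi>. qf2 Q (E (s ! i)))))"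
      by (intro mult_left_mono EV_mono[OF fin(2)] rad_quadratic_product P Q) auto
    also have "\<dots> = (d / \<xi>)^2 * (3 * EV (pos_list d \<xi>) (\<lambda>s. (\<Sum>i<\<xi>. qf2 P (E (s ! i))) * (\<Sum>i<\<xi>. qf2 Q (E (s ! i)))))"
      by (simp only: EV_cmult)
    also have "\<dots> \<le> (d / \<xi>)^2 * (3 * (\<xi> / d * T + (\<xi> / d)^2 * (tr P * tr Q)))"
      unfolding T_def tr_def
      by (intro mult_left_mono EV_pos_product[OF \<xi>(2)] qf2_nonneg P Q) (use d0 in auto)
    also have "\<dots> = 3 * (tr P * tr Q + d / \<xi> * T)"
      using \<xi> d0 by (simp add: power2_eq_square field_simps)
    finally show "EV (pair_pmf (rad_list \<xi>) (pos_list d \<xi>)) (\<lambda>\<omega>. qf2 P (column \<xi> \<omega>) * qf2 Q (column \<xi> \<omega>))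
       \<le> 3 * (tr P * tr Q + d / \<xi> * (\<Sum>l<d. qf2 P (E l) * qf2 Q (E l)))" by (simp add: T_def)
  qed
qed

end

section \<open>Coordinates\<close>

text \<open>Finitely supported real sequences: one inner product space containing Euclidean spaces of
  all dimensions, because the dimension cannot be a type here.\<close>

typedef fvec = "{f :: nat \<Rightarrow> real. finite {i. f i \<noteq> 0}}"
  by (rule exI[of _ "\<lambda>_. 0"]) simp

setup_lifting type_definition_fvec

instantiation fvec :: real_inner
begin

lift_definition zero_fvec :: fvec is "\<lambda>_. 0" by simp

lift_definition plus_fvec :: "fvec \<Rightarrow> fvec \<Rightarrow> fvec" is "\<lambda>f g i. f i + g i"
  subgoal for f g by (rule finite_subset[of _ "{i. f i \<noteq> 0} \<union> {i. g i \<noteq> 0}"]) auto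
  done

lift_definition uminus_fvec :: "fvec \<Rightarrow> fvec" is "\<lambda>f i. - f i"
  by simp

lift_definition minus_fvec :: "fvec \<Rightarrow> fvec \<Rightarrow> fvec" is "\<lambda>f g i. f i - g i"
  subgoal for f g by (rule finite_subset[of _ "{i. f i \<noteq> 0} \<union> {i. g i \<noteq> 0}"]) auto
  done

lift_definition scaleR_fvec :: "real \<Rightarrow> fvec \<Rightarrow> fvec" is "\<lambda>c f i. c * f i"
  subgoal for c f by (rule finite_subset[of _ "{i. f i \<noteq> 0}"]) auto
  done

lift_definition inner_fvec :: "fvec \<Rightarrow> fvec \<Rightarrow> real" is "\<lambda>f g. \<Sum>i | f i \<noteq> 0. f i * g i" .

definition norm_fvec :: "fvec \<Rightarrow> real" where "norm_fvec x = sqrt (inner x x)"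
definition dist_fvec :: "fvec \<Rightarrow> fvec \<Rightarrow> real" where "dist_fvec x y = norm (x - y)"
definition sgn_fvec :: "fvec \<Rightarrow> fvec" where "sgn_fvec x = inverse (norm x) *\<^sub>R x"
definition uniformity_fvec :: "(fvec \<times> fvec) filter" where
  "uniformity_fvec = (INF e\<in>{0 <..}. principal {(x, y). dist x y < e})"
definition open_fvec :: "fvec set \<Rightarrow> bool" where
  "open_fvec U \<longleftrightarrow> (\<forall>x\<in>U. eventually (\<lambda>(x', y). x' = x \<longrightarrow> y \<in> U) uniformity)"

text \<open>Any finite set containing the support may be summed over; thus several vectors share one
  index set in the axioms below.\<close>

lemma inner_fvec_eq:
  assumes "finite S" "\<And>i. Rep_fvec x i \<noteq> 0 \<Longrightarrow> i \<in> S"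
  shows "inner x y = (\<Sum>i\<in>S. Rep_fvec x i * Rep_fvec y i)"
  unfolding inner_fvec.rep_eq by (rule sum.mono_neutral_left) (use assms in auto)

instance
proof
  fix x y z :: fvec and a b r :: real
  show "x + y + z = x + (y + z)" by transfer (simp add: add.assoc)
  show "x + y = y + x" by transfer (simp add: add.commute)
  show "0 + x = x" by transfer simp
  show "- x + x = 0" by transfer simp
  show "x - y = x + - y" by transfer simp
  show "a *\<^sub>R (x + y) = a *\<^sub>R x + a *\<^sub>R y" by transfer (simp add: distrib_left)
  show "(a + b) *\<^sub>R x = a *\<^sub>R x + b *\<^sub>R x" by transfer (simp add: distrib_right)
  show "a *\<^sub>R b *\<^sub>R x = (a * b) *\<^sub>R x" by transfer (simp add: mult.assoc)
  show "1 *\<^sub>R x = x" by transfer simp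
  show "dist x y = norm (x - y)" by (rule dist_fvec_def)
  show "sgn x = inverse (norm x) *\<^sub>R x" by (rule sgn_fvec_def)
  show "uniformity = (INF e\<in>{0 <..}. principal {(x :: fvec, y). dist x y < e})" by (rule uniformity_fvec_def)
  show "open U \<longleftrightarrow> (\<forall>x\<in>U. eventually (\<lambda>(x', y). x' = x \<longrightarrow> y \<in> U) uniformity)" for U :: "fvec set"
    by (rule open_fvec_def)
  show "norm x = sqrt (inner x x)" by (rule norm_fvec_def)
  define S where "S = {i. Rep_fvec x i \<noteq> 0} \<union> {i. Rep_fvec y i \<noteq> 0}"
  have S: "finite S" using Rep_fvec[of x] Rep_fvec[of y] by (simp add: S_def)
  have xS: "inner x w = (\<Sum>i\<in>S. Rep_fvec x i * Rep_fvec w i)" for w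
    by (rule inner_fvec_eq[OF S]) (simp add: S_def)
  have yS: "inner y w = (\<Sum>i\<in>S. Rep_fvec y i * Rep_fvec w i)" for w
    by (rule inner_fvec_eq[OF S]) (simp add: S_def)
  show "inner x y = inner y x" unfolding xS yS by (simp add: mult.commute)
  have "inner (x + y) z = (\<Sum>i\<in>S. Rep_fvec (x + y) i * Rep_fvec z i)"
    by (rule inner_fvec_eq[OF S]) (auto simp: S_def plus_fvec.rep_eq)
  then show "inner (x + y) z = inner x z + inner y z"
    unfolding xS yS by (simp only: plus_fvec.rep_eq distrib_right sum.distrib)
  have "inner (r *\<^sub>R x) y = (\<Sum>i\<in>S. Rep_fvec (r *\<^sub>R x) i * Rep_fvec y i)"
    by (rule inner_fvec_eq[OF S]) (auto simp: S_def scaleR_fvec.rep_eq)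
  then show "inner (r *\<^sub>R x) y = r * inner x y"
    unfolding xS by (simp only: scaleR_fvec.rep_eq sum_distrib_left mult.assoc)
  show "0 \<le> inner x x" unfolding xS by (intro sum_nonneg) simp
  show "(inner x x = 0) = (x = 0)"
  proof
    assume "inner x x = 0"
    then have *: "\<forall>i\<in>S. Rep_fvec x i * Rep_fvec x i = 0"
      unfolding xS by (subst (asm) sum_nonneg_eq_0_iff) (use S in auto)
    have "Rep_fvec x i = Rep_fvec 0 i" for i
    proof (cases "i \<in> S")
      case True
      then have "Rep_fvec x i * Rep_fvec x i = 0" using * by blast
      then show ?thesis by (simp add: zero_fvec.rep_eq)
    next
      case False
      then show ?thesis by (simp add: S_def zero_fvec.rep_eq)
    qed
    then have "Rep_fvec x = Rep_fvec 0" by (rule ext)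
    then show "x = 0" by (rule Rep_fvec_inject[THEN iffD1])
  next
    assume "x = 0"
    then show "inner x x = 0" unfolding xS by (simp add: zero_fvec.rep_eq)
  qed
qed

end

lift_definition fv :: "nat \<Rightarrow> (nat \<Rightarrow> real) \<Rightarrow> fvec" is "\<lambda>n a i. if i < n then a i else 0"
  subgoal for n a by (rule finite_subset[of _ "{..<n}"]) auto
  done

lemma inner_fv: "inner (fv n a) (fv n b) = (\<Sum>i<n. a i * b i)"
  by (subst inner_fvec_eq[of "{..<n}"]) (auto simp: fv.rep_eq split: if_splits)

lemma fv_add: "fv n a + fv n b = fv n (\<lambda>i. a i + b i)"
  by transfer auto

lemma fv_scale: "c *\<^sub>R fv n a = fv n (\<lambda>i. c * a i)"
  by transfer auto

lemma fv_zero: "0 = fv n (\<lambda>_. 0)"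
  by transfer auto

lemma fv_sum: "(\<Sum>i\<in>I. fv n (a i)) = fv n (\<lambda>k. \<Sum>i\<in>I. a i k)"
  by (induction I rule: infinite_finite_induct) (simp_all add: fv_add fv_zero[symmetric])

section \<open>Frames of randomly signed unitary transforms\<close>

lemma cmod_sq: "complex_of_real ((cmod z)^2) = z * cnj z"
  by (rule complex_norm_square)

lemma sum_lessThan_double:
  fixes g :: "nat \<Rightarrow> 'a::comm_monoid_add"
  shows "(\<Sum>k<2*r. g k) = (\<Sum>t<r. g t) + (\<Sum>t<r. g (r + t))"
  using sum_lessThan_add[of g r r] by (simp add: mult_2)

lemma prob_mono_support:
  "(\<And>x. x \<in> set_pmf p \<Longrightarrow> x \<in> A \<Longrightarrow> x \<in> B) \<Longrightarrow> measure_pmf.prob p A \<le> measure_pmf.prob p B"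
proof -
  assume "\<And>x. x \<in> set_pmf p \<Longrightarrow> x \<in> A \<Longrightarrow> x \<in> B"
  then have "measure_pmf.prob p (A \<inter> set_pmf p) \<le> measure_pmf.prob p B"
    by (intro measure_pmf.finite_measure_mono) auto
  then show ?thesis by (simp add: measure_Int_set_pmf)
qed

lemma set_rad_list: "\<sigma> \<in> set_pmf (rad_list n) \<Longrightarrow> length \<sigma> = n \<and> (\<forall>i<n. \<sigma> ! i = 1 \<or> \<sigma> ! i = - 1)"
proof -
  assume "\<sigma> \<in> set_pmf (rad_list n)"
  then have "length \<sigma> = n" "\<sigma> \<in> lists (set_pmf rademacher)" by (auto simp: set_replicate_pmf)
  moreover have "set_pmf (rademacher :: real pmf) = {1, -1}" unfolding rademacher_def by (subst set_pmf_of_set) auto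
  ultimately show ?thesis by (auto simp: in_lists_conv_set dest!: nth_mem)
qed

lemma fv_cong: "(\<And>k. k < n \<Longrightarrow> a k = b k) \<Longrightarrow> fv n a = fv n b"
  by transfer (simp add: fun_eq_iff)

text \<open>\<open>f\<close> holds the entries of the transform and \<open>u\<close> an orthonormal
  basis of the subspace, both complex even over the reals. The 2 in \<open>flat\<close> is due to
  the cosine transform.\<close>

locale rtt_data =
  fixes f :: "nat \<Rightarrow> nat \<Rightarrow> complex" and u :: "nat \<Rightarrow> nat \<Rightarrow> complex" and d r :: nat
  assumes d0: "0 < d" and r1: "1 \<le> r"
    and isometry: "\<And>x. (\<Sum>l<d. (cmod (\<Sum>i<d. cnj (f i l) * x i))^2) = (\<Sum>i<d. (cmod (x i))^2)"
    and flat: "\<And>i l. i < d \<Longrightarrow> l < d \<Longrightarrow> (cmod (f i l))^2 \<le> 2 / d"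
    and orth: "\<And>t t'. t < r \<Longrightarrow> t' < r \<Longrightarrow> (\<Sum>i<d. u t i * cnj (u t' i)) = (if t = t' then 1 else 0)"
begin

definition zf :: "real list \<Rightarrow> nat \<Rightarrow> (nat \<Rightarrow> complex) \<Rightarrow> complex" where
  "zf \<sigma> l x = (\<Sum>i<d. cnj (f i l) * (complex_of_real (\<sigma> ! i) * x i))"

definition comb :: "(nat \<Rightarrow> complex) \<Rightarrow> nat \<Rightarrow> complex" where
  "comb y i = (\<Sum>t<r. y t * u t i)"

text \<open>A complex row as a real map: if the real parts of the coordinates are stored first and
  the imaginary parts after them, as in \<open>yv\<close>, the two vectors give the real and the
  imaginary part of the form.\<close>

definition E :: "real list \<Rightarrow> nat \<Rightarrow> fvec \<times> fvec" where
  "E \<sigma> l = (fv (2*r) (\<lambda>k. if k < r then Re (zf \<sigma> l (u k)) else - Im (zf \<sigma> l (u (k - r)))),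
            fv (2*r) (\<lambda>k. if k < r then Im (zf \<sigma> l (u k)) else Re (zf \<sigma> l (u (k - r)))))"

definition yv :: "(nat \<Rightarrow> complex) \<Rightarrow> fvec" where
  "yv y = fv (2*r) (\<lambda>k. if k < r then Re (y k) else Im (y (k - r)))"

definition H :: "fvec set" where "H = range (fv (2*r))"

lemma H_eq: "H = range yv"
proof -
  have "fv (2*r) a = yv (\<lambda>t. Complex (a t) (a (r + t)))" for a
    unfolding yv_def by (rule fv_cong) auto
  then have "H \<subseteq> range yv" unfolding H_def by blast
  moreover have "range yv \<subseteq> H" unfolding H_def yv_def by blast
  ultimately show ?thesis by blast
qed

lemma zf_comb: "zf \<sigma> l (comb y) = (\<Sum>t<r. zf \<sigma> l (u t) * y t)"
proof -
  have "zf \<sigma> l (comb y) = (\<Sum>i<d. \<Sum>t<r. cnj (f i l) * (complex_of_real (\<sigma> ! i) * u t i) * y t)"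
    unfolding zf_def comb_def by (simp add: sum_distrib_left mult_ac)
  also have "\<dots> = (\<Sum>t<r. \<Sum>i<d. cnj (f i l) * (complex_of_real (\<sigma> ! i) * u t i) * y t)" by (rule sum.swap)
  finally show ?thesis by (simp add: zf_def sum_distrib_right)
qed

lemma inner_E:
  "inner (fst (E \<sigma> l)) (yv y) = Re (zf \<sigma> l (comb y))"
  "inner (snd (E \<sigma> l)) (yv y) = Im (zf \<sigma> l (comb y))"
  unfolding E_def yv_def fst_conv snd_conv inner_fv sum_lessThan_double zf_comb Re_sum Im_sum sum.distrib[symmetric]
  by (rule sum.cong; simp)+

lemma inner_yv: "inner (yv y) (yv y) = (\<Sum>t<r. (cmod (y t))^2)"
  unfolding yv_def inner_fv sum_lessThan_double sum.distrib[symmetric]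
  by (rule sum.cong) (simp_all add: cmod_power2 flip: power2_eq_square)

lemma comb_norm: "(\<Sum>i<d. (cmod (comb y i))^2) = (\<Sum>t<r. (cmod (y t))^2)"
proof -
  have "complex_of_real (\<Sum>i<d. (cmod (comb y i))^2) = (\<Sum>i<d. \<Sum>t<r. \<Sum>t'<r. (y t * u t i) * cnj (y t' * u t' i))"
    unfolding of_real_sum cmod_sq comb_def cnj_sum sum_product ..
  also have "\<dots> = (\<Sum>t<r. \<Sum>i<d. \<Sum>t'<r. (y t * u t i) * cnj (y t' * u t' i))" by (rule sum.swap)
  also have "\<dots> = (\<Sum>t<r. \<Sum>t'<r. \<Sum>i<d. (y t * u t i) * cnj (y t' * u t' i))" by (intro sum.cong refl sum.swap)
  also have "\<dots> = (\<Sum>t<r. \<Sum>t'<r. (y t * cnj (y t')) * (\<Sum>i<d. u t i * cnj (u t' i)))"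
    by (simp add: sum_distrib_left mult_ac)
  also have "\<dots> = (\<Sum>t<r. \<Sum>t'<r. (y t * cnj (y t')) * (if t = t' then 1 else 0))"
    by (intro sum.cong refl) (use orth in auto)
  also have "\<dots> = (\<Sum>t<r. y t * cnj (y t))" by (intro sum.cong refl) (simp add: if_distrib cong: if_cong)
  also have "\<dots> = complex_of_real (\<Sum>t<r. (cmod (y t))^2)" by (simp only: cmod_sq of_real_sum)
  finally show ?thesis by (simp only: of_real_eq_iff)
qed

lemma zf_isometry:
  assumes "\<sigma> \<in> set_pmf (rad_list d)"
  shows "(\<Sum>l<d. (cmod (zf \<sigma> l x))^2) = (\<Sum>i<d. (cmod (x i))^2)"
proof -
  have "(\<Sum>l<d. (cmod (zf \<sigma> l x))^2) = (\<Sum>i<d. (cmod (complex_of_real (\<sigma> ! i) * x i))^2)"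
    unfolding zf_def by (rule isometry)
  also have "\<dots> = (\<Sum>i<d. (cmod (x i))^2)"
    by (rule sum.cong) (use set_rad_list[OF assms] in \<open>auto simp: norm_mult\<close>)
  finally show ?thesis .
qed

lemma frame:
  assumes \<sigma>: "\<sigma> \<in> set_pmf (rad_list d)"
  shows "parseval_frame (E \<sigma>) d H"
proof
  show "0 \<in> H" unfolding H_def fv_zero[of "2*r"] by simp
  show "x + y \<in> H" if "x \<in> H" "y \<in> H" for x y using that unfolding H_def by (auto simp: fv_add)
  show "c *\<^sub>R x \<in> H" if "x \<in> H" for x c using that unfolding H_def by (auto simp: fv_scale)
  show "fst (E \<sigma> l) \<in> H" "snd (E \<sigma> l) \<in> H" for l unfolding H_def E_def by auto
  fix y assume "y \<in> H"
  then obtain w where w: "y = yv w" using H_eq by auto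
  have "(\<Sum>l<d. (inner (fst (E \<sigma> l)) y)^2 + (inner (snd (E \<sigma> l)) y)^2) = (\<Sum>l<d. (cmod (zf \<sigma> l (comb w)))^2)"
    unfolding w inner_E cmod_power2 ..
  then show "(\<Sum>l<d. (inner (fst (E \<sigma> l)) y)^2 + (inner (snd (E \<sigma> l)) y)^2) = inner y y"
    unfolding zf_isometry[OF \<sigma>] comb_norm w inner_yv .
qed

definition h :: "real list \<Rightarrow> nat \<Rightarrow> real" where
  "h \<sigma> l = 2 * (\<Sum>t<r. (cmod (zf \<sigma> l (u t)))^2)"

lemma inner_E_self: "inner (fst (E \<sigma> l)) (fst (E \<sigma> l)) + inner (snd (E \<sigma> l)) (snd (E \<sigma> l)) = h \<sigma> l"
  unfolding E_def fst_conv snd_conv inner_fv sum_lessThan_double h_def sum_distrib_left sum.distrib[symmetric]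
  by (rule sum.cong) (simp_all add: cmod_power2 flip: power2_eq_square)

lemma u_norm:
  assumes "t < r"
  shows "(\<Sum>i<d. (cmod (u t i))^2) = 1"
proof -
  have "complex_of_real (\<Sum>i<d. (cmod (u t i))^2) = complex_of_real 1"
    unfolding of_real_sum cmod_sq using orth[of t t] assms by simp
  then show ?thesis by (rule of_real_eq_iff[THEN iffD1])
qed

lemma sum_h:
  assumes \<sigma>: "\<sigma> \<in> set_pmf (rad_list d)"
  shows "(\<Sum>l<d. h \<sigma> l) = 2 * r"
proof -
  have "(\<Sum>l<d. h \<sigma> l) = 2 * (\<Sum>l<d. \<Sum>t<r. (cmod (zf \<sigma> l (u t)))^2)"
    unfolding h_def by (rule sum_distrib_left[symmetric])
  also have "(\<Sum>l<d. \<Sum>t<r. (cmod (zf \<sigma> l (u t)))^2) = (\<Sum>t<r. \<Sum>l<d. (cmod (zf \<sigma> l (u t)))^2)" by (rule sum.swap)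
  also have "\<dots> = (\<Sum>t<r. 1)"
  proof (rule sum.cong)
    fix t assume "t \<in> {..<r}"
    then show "(\<Sum>l<d. (cmod (zf \<sigma> l (u t)))^2) = 1" unfolding zf_isometry[OF \<sigma>] using u_norm by simp
  qed simp
  finally show ?thesis by simp
qed

text \<open>Makes a leverage score the squared norm of a Rademacher sum of fixed vectors, the signs
  being those of the diagonal matrix. The factor \<open>sqrt 2\<close> matches the 2 in
  \<open>h\<close>.\<close>

definition bvec :: "nat \<Rightarrow> nat \<Rightarrow> fvec" where
  "bvec l i = fv (2*r) (\<lambda>k. sqrt 2 * (if k < r then Re (cnj (f i l) * u k i) else Im (cnj (f i l) * u (k - r) i)))"

lemma h_rad_sum: "inner (rad_sum d (bvec l) \<sigma>) (rad_sum d (bvec l) \<sigma>) = h \<sigma> l"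
proof -
  have "rad_sum d (bvec l) \<sigma> = fv (2*r) (\<lambda>k. sqrt 2 * (if k < r then Re (zf \<sigma> l (u k)) else Im (zf \<sigma> l (u (k - r)))))"
  proof -
    have "rad_sum d (bvec l) \<sigma> = fv (2*r) (\<lambda>k. \<Sum>i<d. (\<sigma> ! i) * (sqrt 2 * (if k < r then Re (cnj (f i l) * u k i) else Im (cnj (f i l) * u (k - r) i))))"
      unfolding rad_sum_def bvec_def fv_scale fv_sum ..
    moreover have "(\<Sum>i<d. (\<sigma> ! i) * (sqrt 2 * (if k < r then Re (cnj (f i l) * u k i) else Im (cnj (f i l) * u (k - r) i))))
       = sqrt 2 * (if k < r then Re (zf \<sigma> l (u k)) else Im (zf \<sigma> l (u (k - r))))" for k
    proof -
      have "Re (zf \<sigma> l x) = (\<Sum>i<d. (\<sigma> ! i) * Re (cnj (f i l) * x i))" "Im (zf \<sigma> l x) = (\<Sum>i<d. (\<sigma> ! i) * Im (cnj (f i l) * x i))" for x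
        unfolding zf_def Re_sum Im_sum by (intro sum.cong refl; simp add: algebra_simps)+
      then show ?thesis by (cases "k < r") (simp_all only: if_True if_False sum_distrib_left mult.left_commute)
    qed
    ultimately show ?thesis by simp
  qed
  moreover have "sqrt 2 * x * (sqrt 2 * x) = 2 * x^2" for x :: real
    using real_sqrt_mult_self[of 2] by (simp add: power2_eq_square mult_ac)
  ultimately show ?thesis unfolding h_def
    by (simp only: inner_fv sum_lessThan_double sum.distrib[symmetric] sum_distrib_left)
       (rule sum.cong, simp_all add: cmod_power2)
qed

lemma inner_bvec: "inner (bvec l i) (bvec l j) = 2 * Re (cnj (f i l) * f j l * (\<Sum>t<r. u t i * cnj (u t j)))"
proof -
  have "inner (bvec l i) (bvec l j) = (\<Sum>t<r. 2 * Re ((cnj (f i l) * u t i) * cnj (cnj (f j l) * u t j)))"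
    unfolding bvec_def inner_fv sum_lessThan_double sum.distrib[symmetric]
  proof (rule sum.cong[OF refl])
    fix t assume "t \<in> {..<r}"
    have s: "sqrt 2 * a * (sqrt 2 * b) = 2 * (a * b)" for a b :: real
      using real_sqrt_mult_self[of 2] by (simp add: mult_ac)
    show "sqrt 2 * (if t < r then Re (cnj (f i l) * u t i) else Im (cnj (f i l) * u (t - r) i)) *
        (sqrt 2 * (if t < r then Re (cnj (f j l) * u t j) else Im (cnj (f j l) * u (t - r) j))) +
        sqrt 2 * (if r + t < r then Re (cnj (f i l) * u (r + t) i) else Im (cnj (f i l) * u (r + t - r) i)) *
        (sqrt 2 * (if r + t < r then Re (cnj (f j l) * u (r + t) j) else Im (cnj (f j l) * u (r + t - r) j)))
       = 2 * Re ((cnj (f i l) * u t i) * cnj (cnj (f j l) * u t j))"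
    proof -
      have g: "2 * (Re A * Re B) + 2 * (Im A * Im B) = 2 * Re (A * cnj B)" for A B by simp
      have tr: "(t < r) = True" using \<open>t \<in> {..<r}\<close> by simp
      show ?thesis unfolding s by (simp only: tr not_add_less1 if_True if_False add_diff_cancel_left' g)
    qed
  qed
  also have "\<dots> = 2 * Re (\<Sum>t<r. (cnj (f i l) * u t i) * cnj (cnj (f j l) * u t j))"
    by (simp only: Re_sum sum_distrib_left)
  also have "(\<Sum>t<r. (cnj (f i l) * u t i) * cnj (cnj (f j l) * u t j)) = cnj (f i l) * f j l * (\<Sum>t<r. u t i * cnj (u t j))"
    by (simp add: sum_distrib_left mult_ac)
  finally show ?thesis .
qed

text \<open>The squared Hilbert-Schmidt norm of an orthogonal projection is its rank. This keeps the
  variance of a leverage score of order r/d^2.\<close>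

lemma projection_norm: "(\<Sum>i<d. \<Sum>j<d. (cmod (\<Sum>t<r. u t i * cnj (u t j)))^2) = r"
proof -
  have "complex_of_real (\<Sum>i<d. \<Sum>j<d. (cmod (\<Sum>t<r. u t i * cnj (u t j)))^2) =
     (\<Sum>i<d. \<Sum>j<d. \<Sum>t<r. \<Sum>t'<r. (u t i * cnj (u t' i)) * (u t' j * cnj (u t j)))"
    unfolding of_real_sum cmod_sq cnj_sum sum_product by (simp add: mult_ac)
  also have "\<dots> = (\<Sum>i<d. \<Sum>t<r. \<Sum>j<d. \<Sum>t'<r. (u t i * cnj (u t' i)) * (u t' j * cnj (u t j)))"
    by (intro sum.cong refl sum.swap)
  also have "\<dots> = (\<Sum>t<r. \<Sum>i<d. \<Sum>j<d. \<Sum>t'<r. (u t i * cnj (u t' i)) * (u t' j * cnj (u t j)))"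
    by (rule sum.swap)
  also have "\<dots> = (\<Sum>t<r. \<Sum>i<d. \<Sum>t'<r. \<Sum>j<d. (u t i * cnj (u t' i)) * (u t' j * cnj (u t j)))"
    by (intro sum.cong refl sum.swap)
  also have "\<dots> = (\<Sum>t<r. \<Sum>t'<r. \<Sum>i<d. \<Sum>j<d. (u t i * cnj (u t' i)) * (u t' j * cnj (u t j)))"
    by (intro sum.cong refl sum.swap)
  also have "\<dots> = (\<Sum>t<r. \<Sum>t'<r. (\<Sum>i<d. u t i * cnj (u t' i)) * (\<Sum>j<d. u t' j * cnj (u t j)))"
    by (simp only: sum_product)
  also have "\<dots> = (\<Sum>t<r. \<Sum>t'<r. if t = t' then 1 else 0)"
    by (intro sum.cong refl) (use orth in auto)
  also have "\<dots> = of_nat r" by simp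
  finally have "complex_of_real (\<Sum>i<d. \<Sum>j<d. (cmod (\<Sum>t<r. u t i * cnj (u t j)))^2) = complex_of_real (real r)"
    unfolding of_real_of_nat_eq .
  then show ?thesis by (rule of_real_eq_iff[THEN iffD1])
qed

text \<open>The mean \<mu> is at most 4r/d and the standard deviation of order sqrt(r)/d. A score
  above 8600 r/d therefore exceeds the mean by at least half of itself, and the fourth moment pays
  for its square. The constant 4300 is just large enough for 442368 / 4300^2 \<le> 1/40.\<close>

lemma leverage_moment:
  assumes l: "l < d"
  shows "EV (rad_list d) (\<lambda>\<sigma>. if 8600 * r / d < h \<sigma> l then d * (h \<sigma> l)^2 else 0) \<le> 1 / (40 * d)"
proof -
  define \<mu> where "\<mu> = (\<Sum>i<d. inner (bvec l i) (bvec l i))"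
  have fl: "(cmod (f i l))^2 \<le> 2 / d" if "i < d" for i using flat[OF that l] .
  have \<mu>: "\<mu> \<le> 4 * r / d"
  proof -
    have self: "inner (bvec l i) (bvec l i) = 2 * (cmod (f i l))^2 * (\<Sum>t<r. (cmod (u t i))^2)" for i
    proof -
      have "cnj (f i l) * f i l * (\<Sum>t<r. u t i * cnj (u t i)) = complex_of_real ((cmod (f i l))^2 * (\<Sum>t<r. (cmod (u t i))^2))"
        unfolding of_real_mult of_real_sum cmod_sq by (simp add: mult.commute)
      then show ?thesis unfolding inner_bvec by simp
    qed
    have "\<mu> \<le> (\<Sum>i<d. 2 * (2 / d) * (\<Sum>t<r. (cmod (u t i))^2))"
      unfolding \<mu>_def self by (intro sum_mono mult_right_mono mult_left_mono sum_nonneg) (use fl in auto)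
    also have "\<dots> = 4 / d * (\<Sum>i<d. \<Sum>t<r. (cmod (u t i))^2)" by (simp add: sum_distrib_left)
    also have "(\<Sum>i<d. \<Sum>t<r. (cmod (u t i))^2) = (\<Sum>t<r. \<Sum>i<d. (cmod (u t i))^2)" by (rule sum.swap)
    also have "\<dots> = (\<Sum>t<r. 1)" by (rule sum.cong) (simp_all add: u_norm)
    finally show ?thesis by simp
  qed
  define S where "S = 32 * real r / d^2"
  have S0: "0 < S" using r1 d0 by (simp add: S_def)
  have "chaos_var d (bvec l) \<le> S"
  proof -
    have "chaos_var d (bvec l) \<le> 2 * (\<Sum>i<d. \<Sum>j<d. (inner (bvec l i) (bvec l j))^2)" by (rule chaos_var_le)
    also have "\<dots> \<le> 2 * (\<Sum>i<d. \<Sum>j<d. 16 / d^2 * (cmod (\<Sum>t<r. u t i * cnj (u t j)))^2)"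
    proof (intro mult_left_mono sum_mono)
      fix i j assume ij: "i \<in> {..<d}" "j \<in> {..<d}"
      define p where "p = (\<Sum>t<r. u t i * cnj (u t j))"
      have "(inner (bvec l i) (bvec l j))^2 = 4 * (Re (cnj (f i l) * f j l * p))^2"
      proof -
        have "(2 * x)^2 = 4 * x^2" for x :: real by (simp add: power_mult_distrib)
        then show ?thesis unfolding inner_bvec p_def .
      qed
      also have "\<dots> \<le> 4 * (cmod (cnj (f i l) * f j l * p))^2"
        by (intro mult_left_mono) (auto simp: cmod_power2)
      also have "\<dots> = 4 * ((cmod (f i l))^2 * (cmod (f j l))^2) * (cmod p)^2"
        by (simp add: norm_mult power_mult_distrib)
      also have "\<dots> \<le> 4 * ((2 / d) * (2 / d)) * (cmod p)^2"
        using fl ij by (intro mult_right_mono mult_left_mono mult_mono) auto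
      also have "\<dots> = 16 / d^2 * (cmod p)^2" by (simp add: power2_eq_square)
      finally show "(inner (bvec l i) (bvec l j))^2 \<le> 16 / d^2 * (cmod (\<Sum>t<r. u t i * cnj (u t j)))^2" by (simp add: p_def)
    qed auto
    also have "\<dots> = 2 * (16 / d^2 * (\<Sum>i<d. \<Sum>j<d. (cmod (\<Sum>t<r. u t i * cnj (u t j)))^2))"
      by (simp only: sum_distrib_left)
    also have "\<dots> = S" unfolding projection_norm by (simp add: S_def)
    finally show ?thesis .
  qed
  from chaos_fourth[OF S0 this]
  have four: "EV (rad_list d) (\<lambda>\<sigma>. (h \<sigma> l - \<mu>)^4) \<le> 108 * S^2"
    unfolding h_rad_sum \<mu>_def .
  \<comment> \<open>From X \<le> 2Y and 4300 r/d \<le> Y it follows that X^2 \<le> 4 Y^2 \<le> 4 (d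
    / (4300 r))^2 Y^4.\<close>
  define c where "c = 4 * d * (d / (4300 * r))^2"
  have "EV (rad_list d) (\<lambda>\<sigma>. if 8600 * r / d < h \<sigma> l then d * (h \<sigma> l)^2 else 0)
     \<le> EV (rad_list d) (\<lambda>\<sigma>. c * (h \<sigma> l - \<mu>)^4)"
  proof (rule EV_mono[OF finite_rad_list])
    fix \<sigma>
    show "(if 8600 * r / d < h \<sigma> l then d * (h \<sigma> l)^2 else 0) \<le> c * (h \<sigma> l - \<mu>)^4"
    proof (cases "8600 * r / d < h \<sigma> l")
      case True
      define X Y where "X = h \<sigma> l" and "Y = h \<sigma> l - \<mu>"
      have "4 * r / d \<le> 4300 * r / d" by (intro divide_right_mono) auto
      moreover have "8600 * r / d = 2 * (4300 * r / d)" by simp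
      moreover have "y \<le> 2 * (y - m) \<and> b \<le> y - m" if "a \<le> b" "c' = 2 * b" "c' < y" "m \<le> a" for a b c' y m :: real
        using that by auto
      ultimately have XY: "X \<le> 2 * Y" "4300 * r / d \<le> Y" using True \<mu> unfolding X_def Y_def by blast+
      have Y0: "0 < 4300 * r / d" using r1 d0 by simp
      have X0: "0 \<le> X" unfolding X_def h_def by (simp add: sum_nonneg)
      have 1: "X^2 \<le> (2 * Y)^2" by (rule power_mono[OF XY(1) X0])
      have 2: "(4300 * r / d)^2 \<le> Y^2" by (rule power_mono[OF XY(2) less_imp_le[OF Y0]])
      have "(d / (4300 * r))^2 * (4300 * r / d)^2 = 1" using r1 d0 by (simp add: power_mult_distrib[symmetric])
      then have "1 \<le> (d / (4300 * r))^2 * Y^2" using mult_left_mono[OF 2, of "(d / (4300 * r))^2"] by simp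
      then have "Y^2 * 1 \<le> Y^2 * ((d / (4300 * r))^2 * Y^2)" by (intro mult_left_mono) auto
      then have "d * (4 * Y^2) \<le> d * (4 * ((d / (4300 * r))^2 * Y^4))" by (intro mult_left_mono) (auto simp: power2_eq_square power4_eq_xxxx mult_ac)
      moreover have "d * X^2 \<le> d * (4 * Y^2)" using 1 by (intro mult_left_mono) (auto simp: power_mult_distrib)
      ultimately have "d * X^2 \<le> c * Y^4" by (simp add: c_def mult_ac)
      then show ?thesis using True by (simp add: X_def Y_def)
    qed (simp add: c_def)
  qed
  also have "\<dots> = c * EV (rad_list d) (\<lambda>\<sigma>. (h \<sigma> l - \<mu>)^4)" by (rule EV_cmult)
  also have "\<dots> \<le> c * (108 * S^2)" using four by (intro mult_left_mono) (auto simp: c_def)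
  also have "\<dots> = 442368 / 4300^2 / d"
    using r1 d0 by (simp add: c_def S_def power_divide power_mult_distrib field_simps power2_eq_square)
  also have "\<dots> \<le> 1 / (40 * d)" using d0 by (simp add: field_simps)
  finally show ?thesis .
qed

end

context rtt_data
begin

abbreviation col_pmf :: "nat \<Rightarrow> (real list \<times> nat list) pmf" where
  "col_pmf \<xi> \<equiv> pair_pmf (rad_list \<xi>) (pos_list d \<xi>)"

text \<open>The squared modulus of one entry of the adjoint of the sketching matrix applied to
  \<open>x\<close>, before the division by \<open>k\<close>.\<close>

definition energy :: "nat \<Rightarrow> real list \<Rightarrow> real list \<times> nat list \<Rightarrow> (nat \<Rightarrow> complex) \<Rightarrow> real" where
  "energy \<xi> \<sigma> \<omega> x = d / \<xi> * (cmod (\<Sum>i<\<xi>. complex_of_real (fst \<omega> ! i) * zf \<sigma> (snd \<omega> ! i) x))^2"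

lemma weight_column:
  assumes \<sigma>: "\<sigma> \<in> set_pmf (rad_list d)" and \<xi>: "\<xi> \<le> d" and \<omega>: "\<omega> \<in> set_pmf (col_pmf \<xi>)"
  shows "parseval_frame.weight (parseval_frame.column (E \<sigma>) d \<xi> \<omega>) (yv y) = energy \<xi> \<sigma> \<omega> (comb y)"
proof -
  interpret fr: parseval_frame "E \<sigma>" d H by (rule frame[OF \<sigma>])
  obtain \<rho> s where rs: "\<omega> = (\<rho>, s)" by (cases \<omega>)
  have "s \<in> distinct_lists d \<xi>"
    using \<omega> set_pmf_of_set[OF distinct_lists_nonempty[OF \<xi>] finite_distinct_lists] rs by simp
  then have col: "fr.column \<xi> \<omega> = sqrt (d / \<xi>) *\<^sub>R (\<Sum>i<\<xi>. (\<rho> ! i) *\<^sub>R E \<sigma> (s ! i))"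
    unfolding fr.column_def rs by (auto simp: distinct_lists_def)
  define Z where "Z = (\<Sum>i<\<xi>. complex_of_real (\<rho> ! i) * zf \<sigma> (s ! i) (comb y))"
  have 1: "inner (fst (fr.column \<xi> \<omega>)) (yv y) = sqrt (d / \<xi>) * Re Z"
    unfolding col Z_def by (simp add: fst_sum inner_sum_left inner_E Re_sum)
  have 2: "inner (snd (fr.column \<xi> \<omega>)) (yv y) = sqrt (d / \<xi>) * Im Z"
    unfolding col Z_def by (simp add: snd_sum inner_sum_left inner_E Im_sum)
  have "fr.weight (fr.column \<xi> \<omega>) (yv y) = d / \<xi> * ((Re Z)^2 + (Im Z)^2)"
    unfolding fr.weight_def 1 2 power_mult_distrib by (simp add: distrib_left)
  then show ?thesis by (simp add: energy_def Z_def rs cmod_power2)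
qed

definition heavy_sum :: "real list \<Rightarrow> real" where
  "heavy_sum \<sigma> = (\<Sum>l<d. if 8600 * r / d < h \<sigma> l then d * (h \<sigma> l)^2 else 0)"

lemma EV_heavy_sum: "EV (rad_list d) heavy_sum \<le> 1/40"
proof -
  have "EV (rad_list d) heavy_sum = (\<Sum>l<d. EV (rad_list d) (\<lambda>\<sigma>. if 8600 * r / d < h \<sigma> l then d * (h \<sigma> l)^2 else 0))"
    unfolding heavy_sum_def by (rule EV_sum[OF finite_rad_list])
  also have "\<dots> \<le> (\<Sum>l<d. 1 / (40 * d))" by (rule sum_mono) (use leverage_moment in simp)
  also have "\<dots> = 1/40" using d0 by simp
  finally show ?thesis .
qed

text \<open>For fixed signs the failure probability is at most 1/40 when \<open>heavy_sum\<close> is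
  at most 1, and trivially at most \<open>heavy_sum\<close> otherwise. So 1/40 +
  \<open>heavy_sum\<close> is always a bound, and its mean is at most 1/20.\<close>

theorem lower_tail:
  assumes A1: "1 \<le> A" and c0: "(54 + 4 * 4300) * (12 + 6 * A) \<le> c\<^sub>0"
    and n_large: "80 * 4300^2 * (2 * real r)^2 \<le> 2^(n+2)"
    and \<xi>: "1 \<le> \<xi>" "\<xi> \<le> d" and n_\<xi>: "real (n+2) \<le> A * \<xi>" and n_N: "real (n+2) \<le> A * sqrt (2 * real r)"
  shows "measure_pmf.prob (pair_pmf (rad_list d) (replicate_pmf k (col_pmf \<xi>)))
     {(\<sigma>, cs). \<exists>y. c\<^sub>0 * (2 * real r) * (\<Sum>t<r. (cmod (y t))^2) + (\<Sum>\<omega>\<leftarrow>cs. energy \<xi> \<sigma> \<omega> (comb y))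
        < 3/4 * k * (\<Sum>t<r. (cmod (y t))^2)} \<le> 1/20"
proof -
  define Bad where "Bad = (\<lambda>\<sigma>. {cs. \<exists>y. c\<^sub>0 * (2 * real r) * (\<Sum>t<r. (cmod (y t))^2) + (\<Sum>\<omega>\<leftarrow>cs. energy \<xi> \<sigma> \<omega> (comb y))
        < 3/4 * k * (\<Sum>t<r. (cmod (y t))^2)})"
  have finc: "finite (set_pmf (col_pmf \<xi>))" using finite_rad_list finite_pos_list[OF \<xi>(2)] by simp
  have fink: "finite (set_pmf (replicate_pmf k (col_pmf \<xi>)))" by (rule finite_set_replicate_pmf[OF finc])
  have hs0: "0 \<le> heavy_sum \<sigma>" for \<sigma> unfolding heavy_sum_def by (rule sum_nonneg) simp
  have step: "measure_pmf.prob (replicate_pmf k (col_pmf \<xi>)) (Bad \<sigma>) \<le> 1/40 + heavy_sum \<sigma>"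
    if \<sigma>: "\<sigma> \<in> set_pmf (rad_list d)" for \<sigma>
  proof (cases "heavy_sum \<sigma> \<le> 1")
    case False
    have "measure_pmf.prob (replicate_pmf k (col_pmf \<xi>)) (Bad \<sigma>) \<le> 1" by (rule measure_pmf.prob_le_1)
    then show ?thesis using False by linarith
  next
    case True
    interpret fr: parseval_frame "E \<sigma>" d H by (rule frame[OF \<sigma>])
    have lev: "fr.lev l = h \<sigma> l" for l unfolding fr.lev_def by (rule inner_E_self)
    interpret sp: sketch_params "E \<sigma>" d H 4300 A c\<^sub>0 "2 * real r" n \<xi>
    proof
      show "0 < d" by (rule d0)
      show "1 \<le> 2 * real r" using r1 by simp
      show "(1::real) \<le> 4300" by simp
      show "1 \<le> A" by (rule A1)
      show "(\<Sum>l<d. fr.lev l) = 2 * real r" unfolding lev using sum_h[OF \<sigma>] by simp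
      have "(\<Sum>l\<in>{l. l < d \<and> 4300 * (2 * real r) / d < fr.lev l}. d * (fr.lev l)^2)
         = (\<Sum>l\<in>{l\<in>{..<d}. 8600 * r / d < h \<sigma> l}. d * (h \<sigma> l)^2)"
        unfolding lev by (rule sum.cong) auto
      also have "\<dots> = heavy_sum \<sigma>" unfolding heavy_sum_def by (rule sum.inter_filter) simp
      finally show "(\<Sum>l\<in>{l. l < d \<and> 4300 * (2 * real r) / d < fr.lev l}. d * (fr.lev l)^2) \<le> 1"
        using True by simp
      show "80 * 4300^2 * (2 * real r)^2 \<le> 2^(n+2)" by (rule n_large)
      show "1 \<le> \<xi>" by (rule \<xi>(1))
      show "real (n+2) \<le> A * \<xi>" by (rule n_\<xi>)
      show "real (n+2) \<le> A * sqrt (2 * real r)" by (rule n_N)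
      show "(54 + 4 * 4300) * (12 + 6 * A) \<le> c\<^sub>0" by (rule c0)
    qed
    have "measure_pmf.prob (replicate_pmf k (col_pmf \<xi>)) (Bad \<sigma>) \<le> measure_pmf.prob (replicate_pmf k (col_pmf \<xi>))
      {cs. \<exists>y\<in>H. c\<^sub>0 * (2 * real r) * inner y y + (\<Sum>\<omega>\<leftarrow>cs. fr.weight (fr.column \<xi> \<omega>) y) < 3/4 * k * inner y y}"
    proof (rule prob_mono_support)
      fix cs assume cs: "cs \<in> set_pmf (replicate_pmf k (col_pmf \<xi>))" and bad: "cs \<in> Bad \<sigma>"
      then obtain y where y: "c\<^sub>0 * (2 * real r) * (\<Sum>t<r. (cmod (y t))^2) + (\<Sum>\<omega>\<leftarrow>cs. energy \<xi> \<sigma> \<omega> (comb y))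
        < 3/4 * k * (\<Sum>t<r. (cmod (y t))^2)" by (auto simp: Bad_def)
      have "cs \<in> lists (set_pmf (col_pmf \<xi>))" using cs unfolding set_replicate_pmf by blast
      then have m: "map (\<lambda>\<omega>. fr.weight (fr.column \<xi> \<omega>) (yv y)) cs = map (\<lambda>\<omega>. energy \<xi> \<sigma> \<omega> (comb y)) cs"
        by (intro map_cong refl weight_column[OF \<sigma> \<xi>(2)]) (auto simp: in_lists_conv_set)
      have "c\<^sub>0 * (2 * real r) * inner (yv y) (yv y) + (\<Sum>\<omega>\<leftarrow>cs. fr.weight (fr.column \<xi> \<omega>) (yv y)) < 3/4 * k * inner (yv y) (yv y)"
        unfolding inner_yv m by (rule y)
      moreover have "yv y \<in> H" using H_eq by blast
      ultimately show "cs \<in> {cs. \<exists>y\<in>H. c\<^sub>0 * (2 * real r) * inner y y + (\<Sum>\<omega>\<leftarrow>cs. fr.weight (fr.column \<xi> \<omega>) y) < 3/4 * k * inner y y}"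
        by blast
    qed
    also have "\<dots> \<le> 1/40" by (rule sp.lower_bound[OF fr.column_law_column[OF \<xi>]])
    finally show ?thesis using hs0[of \<sigma>] by linarith
  qed
  have "measure_pmf.prob (pair_pmf (rad_list d) (replicate_pmf k (col_pmf \<xi>))) {(\<sigma>, cs). cs \<in> Bad \<sigma>}
    = EV (rad_list d) (\<lambda>\<sigma>. EV (replicate_pmf k (col_pmf \<xi>)) (\<lambda>cs. indicator {(\<sigma>, cs). cs \<in> Bad \<sigma>} (\<sigma>, cs)))"
    unfolding prob_eq_EV by (rule EV_pair[OF finite_rad_list fink])
  also have "\<dots> = EV (rad_list d) (\<lambda>\<sigma>. measure_pmf.prob (replicate_pmf k (col_pmf \<xi>)) (Bad \<sigma>))"
  proof -
    have "indicator {(\<sigma>, cs). cs \<in> Bad \<sigma>} (\<sigma>, cs) = (indicator (Bad \<sigma>) cs :: real)" for \<sigma> cs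
      by (simp add: indicator_def)
    then show ?thesis unfolding prob_eq_EV by simp
  qed
  also have "\<dots> \<le> EV (rad_list d) (\<lambda>\<sigma>. 1/40 + heavy_sum \<sigma>)"
    by (rule EV_mono[OF finite_rad_list step])
  also have "\<dots> = 1/40 + EV (rad_list d) heavy_sum" by (simp add: EV_add[OF finite_rad_list])
  also have "\<dots> \<le> 1/20" using EV_heavy_sum by simp
  finally show ?thesis unfolding Bad_def by simp
qed

end

section \<open>The transforms are unitary with flat entries\<close>

lemma sum_cis_int:
  fixes k :: int
  assumes "0 < d" "\<not> int d dvd k"
  shows "(\<Sum>l<d. cis (2 * pi * of_int k * real l / real d)) = 0"
proof -
  let ?z = "cis (2 * pi * of_int k / real d)"
  have "cis (2 * pi * of_int k * real l / real d) = ?z ^ l" for l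
    by (simp add: Complex.DeMoivre mult_ac)
  then have s: "(\<Sum>l<d. cis (2 * pi * of_int k * real l / real d)) = (\<Sum>l<d. ?z ^ l)" by simp
  have "?z \<noteq> 1"
  proof
    assume "?z = 1"
    then have "cos (2 * pi * of_int k / real d) = 1" by (metis cis.simps(1) one_complex.simps(1))
    then obtain m :: int where "2 * pi * of_int k / real d = of_int m * 2 * pi" using cos_one_2pi_int by blast
    then have "real_of_int k = of_int m * real d" using assms(1) pi_gt_zero by (simp add: field_simps)
    then have "real_of_int k = real_of_int (m * int d)" by simp
    then have "k = m * int d" by (simp only: of_int_eq_iff)
    then show False using assms(2) by simp
  qed
  moreover have "?z ^ d = 1"
  proof -
    have "?z ^ d = cis (2 * pi * of_int k)" using assms(1) by (simp add: Complex.DeMoivre)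
    then show ?thesis using cis_multiple_2pi[of "of_int k"] by simp
  qed
  ultimately show ?thesis unfolding s by (simp add: geometric_sum)
qed

lemma dft_rows:
  assumes "i < d" "j < d"
  shows "(\<Sum>l<d. dft d $$ (i,l) * cnj (dft d $$ (j,l))) = (if i = j then 1 else 0)"
proof -
  have d0: "0 < d" using assms by simp
  have e: "dft d $$ (i,l) * cnj (dft d $$ (j,l)) = cis (2 * pi * of_int (int j - int i) * real l / real d) / of_nat d" if "l < d" for l
  proof -
    have "cis (- 2 * pi * real i * real l / real d) * cis (2 * pi * real j * real l / real d)
       = cis (2 * pi * of_int (int j - int i) * real l / real d)"
      using d0 by (simp add: cis_mult field_simps)
    moreover have "complex_of_real (sqrt (real d)) * complex_of_real (sqrt (real d)) = of_nat d"
      by (simp flip: of_real_mult)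
    ultimately show ?thesis using assms that by (simp add: dft_def cis_cnj times_divide_times_eq)
  qed
  have "(\<Sum>l<d. dft d $$ (i,l) * cnj (dft d $$ (j,l))) = (\<Sum>l<d. cis (2 * pi * of_int (int j - int i) * real l / real d)) / of_nat d"
    unfolding sum_divide_distrib by (rule sum.cong) (use e in auto)
  moreover have "(\<Sum>l<d. cis (2 * pi * of_int (int j - int i) * real l / real d)) = 0" if "i \<noteq> j"
  proof (rule sum_cis_int[OF d0])
    show "\<not> int d dvd int j - int i"
    proof
      assume dv: "int d dvd int j - int i"
      have "\<bar>int d\<bar> \<le> \<bar>int j - int i\<bar>" by (rule dvd_imp_le_int[OF _ dv]) (use that in auto)
      then show False using assms by linarith
    qed
  qed
  ultimately show ?thesis using d0 by auto
qed

text \<open>Multiplied by 2 sin(th), the sum telescopes to sin(2 d th), which vanishes because 2 d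
  th is a multiple of \<pi>. The bound on \<open>k\<close> keeps sin(th) away from 0.\<close>

lemma sum_cos_odd:
  fixes k :: int
  assumes "k \<noteq> 0" "\<bar>k\<bar> < 2 * int d"
  shows "(\<Sum>l<d. cos (pi * (2 * real l + 1) * of_int k / (2 * real d))) = 0"
proof -
  define th where "th = pi * of_int k / (2 * real d)"
  have d0: "0 < d" using assms by linarith
  have "2 * sin th * (\<Sum>l<n. cos ((2 * real l + 1) * th)) = sin (2 * real n * th)" for n
  proof (induction n)
    case (Suc n)
    have "sin (2 * real (Suc n) * th) - sin (2 * real n * th) = 2 * sin th * cos ((2 * real n + 1) * th)"
    proof -
      have "2 * real (Suc n) * th = (2 * real n + 1) * th + th" "2 * real n * th = (2 * real n + 1) * th - th"
        by (simp_all add: algebra_simps)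
      then show ?thesis by (simp only: sin_add sin_diff) simp
    qed
    then show ?case using Suc by (simp add: distrib_left)
  qed simp
  then have "2 * sin th * (\<Sum>l<d. cos ((2 * real l + 1) * th)) = sin (2 * real d * th)" .
  also have "2 * real d * th = of_int k * pi" using d0 by (simp add: th_def)
  also have "sin (of_int k * pi) = 0" unfolding sin_zero_iff_int2 by blast
  finally have "2 * sin th * (\<Sum>l<d. cos ((2 * real l + 1) * th)) = 0" .
  moreover have "sin th \<noteq> 0"
  proof
    assume "sin th = 0"
    then obtain m :: int where "th = of_int m * pi" using sin_zero_iff_int2 by blast
    then have "of_int k = (of_int m :: real) * (2 * real d)" using d0 pi_gt_zero by (simp add: th_def field_simps)
    then have "real_of_int k = real_of_int (m * (2 * int d))" by simp
    then have km: "k = m * (2 * int d)" by (simp only: of_int_eq_iff)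
    then have "m \<noteq> 0" using assms(1) by auto
    then have "2 * int d \<le> \<bar>k\<bar>" unfolding km abs_mult using d0 by simp
    then show False using assms(2) by linarith
  qed
  ultimately have "(\<Sum>l<d. cos ((2 * real l + 1) * th)) = 0" by simp
  then show ?thesis by (simp add: th_def mult_ac)
qed

definition dct_entry :: "nat \<Rightarrow> nat \<Rightarrow> nat \<Rightarrow> real" where
  "dct_entry d i j = sqrt ((if i = 0 then 1 else 2) / real d) * cos (pi * (2 * real j + 1) * real i / (2 * real d))"

lemma dct_rows:
  assumes "i < d" "j < d"
  shows "(\<Sum>l<d. dct_entry d i l * dct_entry d j l) = (if i = j then 1 else 0)"
proof -
  have d0: "0 < d" using assms by simp
  define a where "a = (\<lambda>i::nat. sqrt ((if i = 0 then 1 else 2) / real d))"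
  define C where "C = (\<lambda>k::int. \<Sum>l<d. cos (pi * (2 * real l + 1) * of_int k / (2 * real d)))"
  have "dct_entry d i l * dct_entry d j l = a i * a j / 2 *
     (cos (pi * (2 * real l + 1) * of_int (int i - int j) / (2 * real d)) + cos (pi * (2 * real l + 1) * of_int (int i + int j) / (2 * real d)))" for l
  proof -
    let ?x = "pi * (2 * real l + 1) * real i / (2 * real d)" and ?y = "pi * (2 * real l + 1) * real j / (2 * real d)"
    have e: "pi * (2 * real l + 1) * of_int (int i - int j) / (2 * real d) = ?x - ?y"
      "pi * (2 * real l + 1) * of_int (int i + int j) / (2 * real d) = ?x + ?y"
      by (simp_all add: diff_divide_distrib[symmetric] add_divide_distrib[symmetric] algebra_simps)
    have "cos ?x * cos ?y = (cos (?x - ?y) + cos (?x + ?y)) / 2" by (rule cos_times_cos)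
    then show ?thesis unfolding e dct_entry_def a_def by simp
  qed
  then have S: "(\<Sum>l<d. dct_entry d i l * dct_entry d j l) = a i * a j / 2 * (C (int i - int j) + C (int i + int j))"
    by (simp only: C_def sum.distrib[symmetric] sum_distrib_left)
  have C0: "C 0 = d" by (simp add: C_def)
  have Cz: "C k = 0" if "k \<noteq> 0" "\<bar>k\<bar> < 2 * int d" for k unfolding C_def by (rule sum_cos_odd[OF that])
  show ?thesis
  proof (cases "i = j")
    case False
    have "C (int i - int j) = 0" "C (int i + int j) = 0" using False assms by (auto intro!: Cz)
    then show ?thesis using S False by simp
  next
    case True
    have sq: "a i * a i = (if i = 0 then 1 else 2) / real d" unfolding a_def by (rule real_sqrt_mult_self[THEN trans]) auto
    show ?thesis
    proof (cases "i = 0")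
      case i0: True
      have "(\<Sum>l<d. dct_entry d i l * dct_entry d j l) = (a i * a i) / 2 * (C 0 + C 0)" using S i0 True by simp
      also have "\<dots> = 1" unfolding sq C0 using i0 d0 by simp
      finally show ?thesis using True by simp
    next
      case i0: False
      have "C (int i + int j) = 0" using i0 True assms by (intro Cz) auto
      then show ?thesis using S True C0 sq d0 i0 by simp
    qed
  qed
qed

lemma wht_sign_real: "cnj (wht_sign q i j) = wht_sign q i j"
  by (simp add: wht_sign_def)

lemma wht_rows:
  assumes "i < 2^q" "j < 2^q"
  shows "(\<Sum>l<2^q. wht_sign q i l * wht_sign q j l) = (if i = j then 2^q else 0)"
  using assms
proof (induction q arbitrary: i j)
  case (Suc q)
  define S where "S = (\<Sum>l<2^q. wht_sign q (i div 2) l * wht_sign q (j div 2) l)"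
  have IH: "S = (if i div 2 = j div 2 then 2^q else 0)"
    unfolding S_def by (rule Suc.IH) (use Suc.prems in auto)
  have "(\<Sum>l<2 * 2^q. wht_sign (Suc q) i l * wht_sign (Suc q) j l) = S + (if odd i then -1 else 1) * (if odd j then -1 else 1) * S"
    unfolding sum_split_parity wht_sign_Suc S_def by (simp add: sum_negf)
  moreover have "i = j" if "i div 2 = j div 2" "odd i = odd j"
    using that by (metis even_two_times_div_two odd_two_times_div_two_succ)
  ultimately show ?case using IH by auto
qed simp

lemma trig_entries:
  assumes F: "F \<in> complex_trig_transforms d" and d0: "0 < d"
  shows "\<And>i j. i < d \<Longrightarrow> j < d \<Longrightarrow> (\<Sum>l<d. F $$ (i,l) * cnj (F $$ (j,l))) = (if i = j then 1 else 0)"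
    and "\<And>i l. i < d \<Longrightarrow> l < d \<Longrightarrow> (cmod (F $$ (i,l)))^2 \<le> 2 / d"
proof -
  consider (dct) "F = dct d" | (wht) q where "d = 2^q" "F = walsh_hadamard q" | (dft) "F = dft d"
    using F by (auto simp: complex_trig_transforms_def real_trig_transforms_def)
  then have "(\<forall>i j. i < d \<longrightarrow> j < d \<longrightarrow> (\<Sum>l<d. F $$ (i,l) * cnj (F $$ (j,l))) = (if i = j then 1 else 0)) \<and>
     (\<forall>i l. i < d \<longrightarrow> l < d \<longrightarrow> (cmod (F $$ (i,l)))^2 \<le> 2 / d)"
  proof cases
    case dct
    have e: "F $$ (i,l) = complex_of_real (dct_entry d i l)" if "i < d" "l < d" for i l
      using that by (simp add: dct dct_def dct_entry_def)
    have that_eq: "(\<Sum>l<d. F $$ (i,l) * cnj (F $$ (j,l))) = complex_of_real (\<Sum>l<d. dct_entry d i l * dct_entry d j l)"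
      if "i < d" "j < d" for i j
      unfolding of_real_sum by (rule sum.cong) (use e that in auto)
    then have 1: "(\<Sum>l<d. F $$ (i,l) * cnj (F $$ (j,l))) = (if i = j then 1 else 0)" if "i < d" "j < d" for i j
      unfolding that_eq[OF that] dct_rows[OF that] by simp
    have 2: "(cmod (F $$ (i,l)))^2 \<le> 2 / d" if "i < d" "l < d" for i l
    proof -
      let ?c = "cos (pi * (2 * real l + 1) * real i / (2 * real d))"
      have "(cmod (F $$ (i,l)))^2 = (if i = 0 then 1 else 2) / real d * ?c^2"
        using e[OF that] by (simp add: dct_entry_def power_mult_distrib norm_mult)
      also have "\<dots> \<le> 2 / real d * 1"
        by (intro mult_mono divide_right_mono) (auto simp: abs_square_le_1)
      finally show ?thesis by simp
    qed
    show ?thesis using 1 2 by blast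
  next
    case (wht q)
    define s where "s = complex_of_real (1 / sqrt (2^q))"
    have e: "F $$ (i,l) = s * wht_sign q i l" if "i < d" "l < d" for i l
      using that wht by (simp add: walsh_hadamard_def wht_sign_def s_def)
    have ss: "s * s = 1 / 2^q" unfolding s_def by (simp flip: of_real_mult)
    have 1: "(\<Sum>l<d. F $$ (i,l) * cnj (F $$ (j,l))) = (if i = j then 1 else 0)" if "i < d" "j < d" for i j
    proof -
      have "(\<Sum>l<d. F $$ (i,l) * cnj (F $$ (j,l))) = (\<Sum>l<d. (s * s) * (wht_sign q i l * wht_sign q j l))"
        by (rule sum.cong) (use e that in \<open>auto simp: wht_sign_real s_def\<close>)
      also have "\<dots> = (s * s) * (\<Sum>l<2^q. wht_sign q i l * wht_sign q j l)" by (simp add: sum_distrib_left wht)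
      finally show ?thesis using wht_rows[of i q j] that wht by (simp add: ss)
    qed
    have 2: "(cmod (F $$ (i,l)))^2 \<le> 2 / d" if "i < d" "l < d" for i l
      using e[OF that] by (simp add: norm_mult power_mult_distrib s_def wht_sign_def norm_power power_divide wht divide_right_mono norm_divide)
    show ?thesis using 1 2 by blast
  next
    case dft
    have 2: "(cmod (F $$ (i,l)))^2 \<le> 2 / d" if "i < d" "l < d" for i l
      using that by (simp add: dft dft_def norm_divide power_divide divide_right_mono)
    show ?thesis using dft_rows 2 dft by blast
  qed
  then show "\<And>i j. i < d \<Longrightarrow> j < d \<Longrightarrow> (\<Sum>l<d. F $$ (i,l) * cnj (F $$ (j,l))) = (if i = j then 1 else 0)"
    and "\<And>i l. i < d \<Longrightarrow> l < d \<Longrightarrow> (cmod (F $$ (i,l)))^2 \<le> 2 / d" by blast+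
qed

text \<open>Orthonormal rows mean F F* = I, so the adjoint of F is an isometry; the exchange of sums
  replaces the matrix product.\<close>

lemma rows_isometry:
  fixes f :: "nat \<Rightarrow> nat \<Rightarrow> complex"
  assumes rows: "\<And>i j. i < d \<Longrightarrow> j < d \<Longrightarrow> (\<Sum>l<d. f i l * cnj (f j l)) = (if i = j then 1 else 0)"
  shows "(\<Sum>l<d. (cmod (\<Sum>i<d. cnj (f i l) * x i))^2) = (\<Sum>i<d. (cmod (x i))^2)"
proof -
  have "complex_of_real (\<Sum>l<d. (cmod (\<Sum>i<d. cnj (f i l) * x i))^2) = (\<Sum>l<d. \<Sum>i<d. \<Sum>j<d. (cnj (f i l) * x i) * cnj (cnj (f j l) * x j))"
    unfolding of_real_sum complex_norm_square cnj_sum sum_product ..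
  also have "\<dots> = (\<Sum>i<d. \<Sum>l<d. \<Sum>j<d. (cnj (f i l) * x i) * cnj (cnj (f j l) * x j))" by (rule sum.swap)
  also have "\<dots> = (\<Sum>i<d. \<Sum>j<d. \<Sum>l<d. (cnj (f i l) * x i) * cnj (cnj (f j l) * x j))" by (intro sum.cong refl sum.swap)
  also have "\<dots> = (\<Sum>i<d. \<Sum>j<d. (x i * cnj (x j)) * (\<Sum>l<d. f j l * cnj (f i l)))"
    by (simp add: sum_distrib_left mult_ac)
  also have "\<dots> = (\<Sum>i<d. \<Sum>j<d. (x i * cnj (x j)) * (if j = i then 1 else 0))"
    by (intro sum.cong refl) (use rows in auto)
  also have "\<dots> = (\<Sum>i<d. x i * cnj (x i))" by (intro sum.cong refl) (simp add: if_distrib cong: if_cong)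
  also have "\<dots> = complex_of_real (\<Sum>i<d. (cmod (x i))^2)" by (simp only: complex_norm_square of_real_sum)
  finally show ?thesis by (simp only: of_real_eq_iff)
qed

section \<open>The law of SparseRTT\<close>

lemma replicate_pmf_map: "replicate_pmf n (map_pmf f p) = map_pmf (map f) (replicate_pmf n p)"
  by (induction n) (simp_all add: map_pmf_def bind_assoc_pmf bind_return_pmf)

lemma rademacher_of_real: "(rademacher :: 'a::real_normed_field pmf) = map_pmf of_real (rademacher :: real pmf)"
  unfolding rademacher_def by (subst map_pmf_of_set_inj) (auto simp: inj_on_def)

lemma rad_list_of_real:
  "replicate_pmf n (rademacher :: 'a::real_normed_field pmf) = map_pmf (map of_real) (rad_list n)"
  by (subst rademacher_of_real) (rule replicate_pmf_map)

lemma EV_replicate_sum_list: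
  assumes "finite (set_pmf q)"
  shows "EV (replicate_pmf k q) (\<lambda>cs. \<Sum>c\<leftarrow>cs. g c) = real k * EV q g"
proof (induction k)
  case (Suc k)
  note fk = finite_set_replicate_pmf[OF assms, of k]
  have "EV (replicate_pmf (Suc k) q) (\<lambda>cs. \<Sum>c\<leftarrow>cs. g c) = EV q (\<lambda>x. g x + EV (replicate_pmf k q) (\<lambda>cs. \<Sum>c\<leftarrow>cs. g c))"
    unfolding EV_replicate_Suc[OF assms] by (simp add: EV_add[OF fk])
  then show ?case unfolding Suc by (simp add: EV_add[OF assms] distrib_right)
qed simp

lemma distinct_lists_nth: "s \<in> distinct_lists d k \<Longrightarrow> t < k \<Longrightarrow> s ! t < d"
proof -
  assume s: "s \<in> distinct_lists d k" and t: "t < k"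
  have "s ! t \<in> set s" by (rule nth_mem) (use s t in \<open>simp add: distinct_lists_def\<close>)
  then show ?thesis using s unfolding distinct_lists_def by blast
qed

definition sparse_vec :: "nat \<Rightarrow> nat \<Rightarrow> real list \<times> nat list \<Rightarrow> 'a::real_normed_field vec" where
  "sparse_vec d \<xi> c = vec d (\<lambda>l. of_real (sqrt (real d / real \<xi>)) *
     (\<Sum>i<\<xi>. map of_real (fst c) ! i * unit_vec d (snd c ! i) $ l))"

definition rtt_matrix ::
  "'a::real_normed_field mat \<Rightarrow> nat \<Rightarrow> nat \<Rightarrow> nat \<Rightarrow> real list \<times> (real list \<times> nat list) list \<Rightarrow> 'a mat" where
  "rtt_matrix F d k \<xi> \<omega> = mat_diag d (\<lambda>i. map of_real (fst \<omega>) ! i) * F *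
     (of_real (1 / sqrt (real k)) \<cdot>\<^sub>m mat_of_cols d (map (sparse_vec d \<xi>) (snd \<omega>)))"

abbreviation rtt_pmf :: "nat \<Rightarrow> nat \<Rightarrow> nat \<Rightarrow> (real list \<times> (real list \<times> nat list) list) pmf" where
  "rtt_pmf d k \<xi> \<equiv> pair_pmf (rad_list d) (replicate_pmf k (pair_pmf (rad_list \<xi>) (pos_list d \<xi>)))"

text \<open>The signs are drawn as real numbers and only then mapped into the field, so that one
  probability space serves both fields.\<close>

lemma sparse_rtt_law:
  fixes F :: "'a::real_normed_field mat"
  shows "sparse_rtt F d k \<xi> = map_pmf (rtt_matrix F d k \<xi>) (rtt_pmf d k \<xi>)"
proof -
  note rl = rad_list_of_real[where 'a = 'a]
  have 1: "(sparse_column d \<xi> :: 'a vec pmf) = map_pmf (sparse_vec d \<xi>) (pair_pmf (rad_list \<xi>) (pos_list d \<xi>))"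
    unfolding sparse_column_def rl distinct_lists_def[symmetric]
    by (simp add: map_pmf_def pair_pmf_def bind_assoc_pmf bind_return_pmf sparse_vec_def)
  show ?thesis
    unfolding sparse_rtt_def sparse_col_def 1 replicate_pmf_map rl
    by (simp add: map_pmf_def pair_pmf_def bind_assoc_pmf bind_return_pmf rtt_matrix_def)
qed

definition sparse_entry :: "nat \<Rightarrow> nat \<Rightarrow> nat \<Rightarrow> real list \<times> nat list \<Rightarrow> nat \<Rightarrow> real" where
  "sparse_entry d k \<xi> c l = 1 / sqrt k * (sqrt (d / \<xi>) * (\<Sum>i<\<xi>. fst c ! i * (if snd c ! i = l then 1 else 0)))"

lemma set_rtt_pmf:
  assumes "\<omega> \<in> set_pmf (rtt_pmf d k \<xi>)" "\<xi> \<le> d"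
  shows "fst \<omega> \<in> set_pmf (rad_list d)" "length (fst \<omega>) = d" "length (snd \<omega>) = k"
    "\<And>c. c \<in> set (snd \<omega>) \<Longrightarrow> length (fst c) = \<xi> \<and> snd c \<in> distinct_lists d \<xi>"
proof -
  show "fst \<omega> \<in> set_pmf (rad_list d)" "length (fst \<omega>) = d" "length (snd \<omega>) = k"
    using assms by (auto simp: set_replicate_pmf)
  fix c assume "c \<in> set (snd \<omega>)"
  then have "c \<in> set_pmf (pair_pmf (rad_list \<xi>) (pos_list d \<xi>))"
    using assms by (auto simp: set_replicate_pmf)
  then show "length (fst c) = \<xi> \<and> snd c \<in> distinct_lists d \<xi>"
    using set_pmf_of_set[OF distinct_lists_nonempty[OF assms(2)] finite_distinct_lists]
    by (auto simp: set_replicate_pmf)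
qed

lemma rtt_matrix_carrier:
  assumes "F \<in> carrier_mat d d" "\<omega> \<in> set_pmf (rtt_pmf d k \<xi>)" "\<xi> \<le> d"
  shows "rtt_matrix F d k \<xi> \<omega> \<in> carrier_mat d k"
  using assms(1) set_rtt_pmf(3)[OF assms(2,3)] unfolding rtt_matrix_def by (auto simp: mat_diag_def)

lemma rtt_matrix_index:
  fixes F :: "'a::real_normed_field mat"
  assumes F: "F \<in> carrier_mat d d" and \<omega>: "\<omega> \<in> set_pmf (rtt_pmf d k \<xi>)" and \<xi>: "\<xi> \<le> d" and ij: "i < d" "j < k"
  shows "rtt_matrix F d k \<xi> \<omega> $$ (i,j) = (\<Sum>l<d. of_real (fst \<omega> ! i) * F $$ (i,l) * of_real (sparse_entry d k \<xi> (snd \<omega> ! j) l))"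
proof -
  note s = set_rtt_pmf[OF \<omega> \<xi>]
  have c: "length (fst (snd \<omega> ! j)) = \<xi>" "snd (snd \<omega> ! j) \<in> distinct_lists d \<xi>"
    using s(4)[of "snd \<omega> ! j"] s(3) ij by auto
  have pos: "snd (snd \<omega> ! j) ! t < d" if "t < \<xi>" for t
    by (rule distinct_lists_nth[OF c(2) that])
  let ?S = "of_real (1 / sqrt (real k)) \<cdot>\<^sub>m mat_of_cols d (map (sparse_vec d \<xi>) (snd \<omega>)) :: 'a mat"
  have S: "?S $$ (l,j) = of_real (sparse_entry d k \<xi> (snd \<omega> ! j) l)" if l: "l < d" for l
  proof -
    have "(\<Sum>t<\<xi>. map of_real (fst (snd \<omega> ! j)) ! t * unit_vec d (snd (snd \<omega> ! j) ! t) $ l)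
       = (of_real (\<Sum>t<\<xi>. fst (snd \<omega> ! j) ! t * (if snd (snd \<omega> ! j) ! t = l then 1 else 0)) :: 'a)"
      unfolding of_real_sum by (rule sum.cong) (use c pos l in auto)
    then show ?thesis using l ij s(3)
      by (simp add: mat_of_cols_def sparse_vec_def sparse_entry_def)
  qed
  have dS: "?S \<in> carrier_mat d k" using s(3) by auto
  have "rtt_matrix F d k \<xi> \<omega> $$ (i,j) = (\<Sum>l = 0..<d. (of_real (fst \<omega> ! i) * F $$ (i,l)) * ?S $$ (l,j))"
    unfolding rtt_matrix_def mat_diag_mult_left[OF F] using ij s(2) dS
    by (subst index_mult_mat) (auto simp: scalar_prod_def simp del: index_smult_mat)
  also have "\<dots> = (\<Sum>l = 0..<d. of_real (fst \<omega> ! i) * F $$ (i,l) * of_real (sparse_entry d k \<xi> (snd \<omega> ! j) l))"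
    by (rule sum.cong) (use S in auto)
  finally show ?thesis by (simp only: atLeast0LessThan)
qed

lemma EV_rad_square:
  "EV (rad_list n) (\<lambda>\<rho>. (cmod (\<Sum>i<n. complex_of_real (\<rho> ! i) * z i))^2) = (\<Sum>i<n. (cmod (z i))^2)"
proof -
  have "qf2 (\<lambda>x. x) (rad_sum n (\<lambda>i. (Re (z i), Im (z i))) \<rho>) = (cmod (\<Sum>i<n. complex_of_real (\<rho> ! i) * z i))^2" for \<rho>
    unfolding qf2_def qf_def rad_sum_def cmod_power2 by (simp add: fst_sum snd_sum Re_sum Im_sum power2_eq_square)
  moreover have "qf2 (\<lambda>x. x) (Re (z i), Im (z i)) = (cmod (z i))^2" for i
    unfolding qf2_def qf_def cmod_power2 by (simp add: power2_eq_square)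
  ultimately show ?thesis using rad_quadratic[OF psd_id, of n "\<lambda>i. (Re (z i), Im (z i))"] by simp
qed

context rtt_data
begin

lemma EV_energy:
  assumes \<xi>: "1 \<le> \<xi>" "\<xi> \<le> d" and \<sigma>: "\<sigma> \<in> set_pmf (rad_list d)"
  shows "EV (col_pmf \<xi>) (\<lambda>c. energy \<xi> \<sigma> c x) = (\<Sum>i<d. (cmod (x i))^2)"
proof -
  have "EV (col_pmf \<xi>) (\<lambda>c. energy \<xi> \<sigma> c x) = EV (pair_pmf (pos_list d \<xi>) (rad_list \<xi>)) (\<lambda>(s, \<rho>). energy \<xi> \<sigma> (\<rho>, s) x)"
    by (subst pair_commute_pmf) (simp add: case_prod_unfold)
  also have "\<dots> = EV (pos_list d \<xi>) (\<lambda>s. EV (rad_list \<xi>) (\<lambda>\<rho>. energy \<xi> \<sigma> (\<rho>, s) x))"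
    unfolding EV_pair[OF finite_pos_list[OF \<xi>(2)] finite_rad_list] by simp
  also have "\<dots> = EV (pos_list d \<xi>) (\<lambda>s. d / \<xi> * (\<Sum>i<\<xi>. (cmod (zf \<sigma> (s ! i) x))^2))"
    unfolding energy_def fst_conv snd_conv EV_cmult EV_rad_square ..
  also have "\<dots> = (\<Sum>l<d. (cmod (zf \<sigma> l x))^2)"
    unfolding EV_cmult using EV_pos_sum[OF \<xi>(2), of "\<lambda>l. (cmod (zf \<sigma> l x))^2"] \<xi> by simp
  finally show ?thesis unfolding zf_isometry[OF \<sigma>] .
qed

end

section \<open>The real and the complex case\<close>

lemma sum_mult_delta:
  fixes Z :: "nat \<Rightarrow> complex"
  assumes "s < d"
  shows "(\<Sum>l<d. A * (B * (if s = l then Z l else 0))) = A * (B * Z s)"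
proof -
  have "(\<Sum>l<d. A * (B * (if s = l then Z l else 0))) = A * (B * (\<Sum>l<d. if s = l then Z l else 0))"
    by (simp only: sum_distrib_left)
  then show ?thesis using assms by simp
qed

text \<open>Covers the inclusion of the reals and the identity of the complex numbers. Norms are
  preserved, so all estimates can be made in the complex image.\<close>

locale field_embedding =
  fixes \<iota> :: "'a::{real_normed_field,conjugatable_ordered_field} \<Rightarrow> complex"
  assumes emb_add: "\<iota> (a + b) = \<iota> a + \<iota> b"
    and emb_mult: "\<iota> (a * b) = \<iota> a * \<iota> b"
    and emb_of_real: "\<iota> (of_real x) = complex_of_real x"
    and emb_conj: "\<iota> (conjugate a) = cnj (\<iota> a)"
    and emb_norm: "cmod (\<iota> a) = norm a"
begin

lemma emb_zero: "\<iota> 0 = 0" using emb_of_real[of 0] by simp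

lemma emb_sum: "\<iota> (\<Sum>i\<in>I. g i) = (\<Sum>i\<in>I. \<iota> (g i))"
  by (induction I rule: infinite_finite_induct) (auto simp: emb_zero emb_add)

lemma sqnorm_emb: "v \<in> carrier_vec n \<Longrightarrow> sqnorm v = (\<Sum>i<n. (cmod (\<iota> (v $ i)))^2)"
  by (auto simp: sqnorm_def emb_norm)

lemma adjoint_mult_index:
  assumes "\<Omega> \<in> carrier_mat d k" "x \<in> carrier_vec d" "j < k"
  shows "\<iota> ((mat_adjoint \<Omega> *\<^sub>v x) $ j) = (\<Sum>i<d. cnj (\<iota> (\<Omega> $$ (i,j))) * \<iota> (x $ i))"
proof -
  have "(mat_adjoint \<Omega> *\<^sub>v x) $ j = (\<Sum>i = 0..<d. conjugate (\<Omega> $$ (i,j)) * x $ i)"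
    using assms by (auto simp: mat_adjoint_def scalar_prod_def intro!: sum.cong)
  then show ?thesis by (simp add: emb_sum emb_mult emb_conj atLeast0LessThan)
qed

lemma adjoint_mult_carrier:
  "\<Omega> \<in> carrier_mat d k \<Longrightarrow> mat_adjoint \<Omega> *\<^sub>v x \<in> carrier_vec k"
  by (auto simp: mat_adjoint_def intro!: carrier_vecI)

end

locale sketch_setup = field_embedding \<iota> for \<iota> :: "'a::{real_normed_field,conjugatable_ordered_field} \<Rightarrow> complex" +
  fixes F :: "'a mat" and F\<^sub>c :: "complex mat" and d :: nat
  assumes d0: "0 < d" and trig: "F\<^sub>c \<in> complex_trig_transforms d" and F: "F \<in> carrier_mat d d"
    and F_emb: "\<And>i l. i < d \<Longrightarrow> l < d \<Longrightarrow> F\<^sub>c $$ (i,l) = \<iota> (F $$ (i,l))"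
begin

abbreviation "f \<equiv> \<lambda>i l. F\<^sub>c $$ (i,l)"

lemma rtt_dataI:
  assumes "1 \<le> r" "\<And>t t'. t < r \<Longrightarrow> t' < r \<Longrightarrow> (\<Sum>i<d. u t i * cnj (u t' i)) = (if t = t' then 1 else 0)"
  shows "rtt_data f u d r"
proof
  show "(\<Sum>l<d. (cmod (\<Sum>i<d. cnj (f i l) * x i))^2) = (\<Sum>i<d. (cmod (x i))^2)" for x
    by (rule rows_isometry[OF trig_entries(1)[OF trig d0]])
qed (use assms d0 trig_entries(2)[OF trig d0] in auto)

lemma emb_rtt_matrix:
  assumes "\<omega> \<in> set_pmf (rtt_pmf d k \<xi>)" "\<xi> \<le> d" "i < d" "j < k"
  shows "\<iota> (rtt_matrix F d k \<xi> \<omega> $$ (i,j)) = (\<Sum>l<d. complex_of_real (fst \<omega> ! i) * f i l * complex_of_real (sparse_entry d k \<xi> (snd \<omega> ! j) l))"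
  unfolding rtt_matrix_index[OF F assms] emb_sum emb_mult emb_of_real
  by (rule sum.cong) (use F_emb assms(3) in auto)

text \<open>After exchanging sums, each entry on the left is a signed and scaled sum of \<xi>
  entries of the transformed vector, which links the matrix to the abstract columns.\<close>

lemma sqnorm_sketch:
  assumes R: "rtt_data f u d r" and \<omega>: "\<omega> \<in> set_pmf (rtt_pmf d k \<xi>)" and \<xi>: "\<xi> \<le> d" and x: "x \<in> carrier_vec d"
  shows "sqnorm (mat_adjoint (rtt_matrix F d k \<xi> \<omega>) *\<^sub>v x)
    = 1 / k * (\<Sum>c\<leftarrow>snd \<omega>. rtt_data.energy f d \<xi> (fst \<omega>) c (\<lambda>i. \<iota> (x $ i)))"
proof -
  interpret R: rtt_data f u d r by (rule R)
  note s = set_rtt_pmf[OF \<omega> \<xi>]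
  define X where "X = (\<lambda>i. \<iota> (x $ i))"
  have \<Omega>: "rtt_matrix F d k \<xi> \<omega> \<in> carrier_mat d k" by (rule rtt_matrix_carrier[OF F \<omega> \<xi>])
  have e: "(cmod (\<iota> ((mat_adjoint (rtt_matrix F d k \<xi> \<omega>) *\<^sub>v x) $ j)))^2 = 1 / k * R.energy \<xi> (fst \<omega>) (snd \<omega> ! j) X"
    if j: "j < k" for j
  proof -
    define c where "c = snd \<omega> ! j"
    have c: "snd c \<in> distinct_lists d \<xi>" using s(4)[of c] s(3) j by (auto simp: c_def)
    have pos: "snd c ! t < d" if "t < \<xi>" for t by (rule distinct_lists_nth[OF c that])
    have "\<iota> ((mat_adjoint (rtt_matrix F d k \<xi> \<omega>) *\<^sub>v x) $ j)
       = (\<Sum>i<d. cnj (\<Sum>l<d. complex_of_real (fst \<omega> ! i) * f i l * complex_of_real (sparse_entry d k \<xi> c l)) * X i)"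
      unfolding adjoint_mult_index[OF \<Omega> x j] X_def c_def
      by (rule sum.cong) (use emb_rtt_matrix[OF \<omega> \<xi> _ j] in auto)
    also have "\<dots> = (\<Sum>i<d. \<Sum>l<d. complex_of_real (sparse_entry d k \<xi> c l) * (cnj (f i l) * (complex_of_real (fst \<omega> ! i) * X i)))"
      by (simp add: sum_distrib_left sum_distrib_right mult_ac)
    also have "\<dots> = (\<Sum>l<d. \<Sum>i<d. complex_of_real (sparse_entry d k \<xi> c l) * (cnj (f i l) * (complex_of_real (fst \<omega> ! i) * X i)))"
      by (rule sum.swap)
    also have "\<dots> = (\<Sum>l<d. complex_of_real (sparse_entry d k \<xi> c l) * R.zf (fst \<omega>) l X)"
      by (simp add: R.zf_def sum_distrib_left)
    also have "\<dots> = (\<Sum>l<d. \<Sum>t<\<xi>. complex_of_real (1 / sqrt k * sqrt (d / \<xi>)) * (complex_of_real (fst c ! t) *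
        (if snd c ! t = l then R.zf (fst \<omega>) l X else 0)))"
      unfolding sparse_entry_def
      by (rule sum.cong[OF refl]) (simp add: sum_distrib_left sum_distrib_right mult_ac if_distrib cong: if_cong)
    also have "\<dots> = (\<Sum>t<\<xi>. \<Sum>l<d. complex_of_real (1 / sqrt k * sqrt (d / \<xi>)) * (complex_of_real (fst c ! t) *
        (if snd c ! t = l then R.zf (fst \<omega>) l X else 0)))" by (rule sum.swap)
    also have "\<dots> = (\<Sum>t<\<xi>. complex_of_real (1 / sqrt k * sqrt (d / \<xi>)) * (complex_of_real (fst c ! t) * R.zf (fst \<omega>) (snd c ! t) X))"
      by (rule sum.cong[OF refl], rule sum_mult_delta) (use pos in auto)
    also have "\<dots> = complex_of_real (1 / sqrt k * sqrt (d / \<xi>)) * (\<Sum>t<\<xi>. complex_of_real (fst c ! t) * R.zf (fst \<omega>) (snd c ! t) X)"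
      by (rule sum_distrib_left[symmetric])
    finally have "(cmod (\<iota> ((mat_adjoint (rtt_matrix F d k \<xi> \<omega>) *\<^sub>v x) $ j)))^2
       = (1 / sqrt k * sqrt (d / \<xi>))^2 * (cmod (\<Sum>t<\<xi>. complex_of_real (fst c ! t) * R.zf (fst \<omega>) (snd c ! t) X))^2"
      by (simp only: norm_mult power_mult_distrib norm_of_real power2_abs)
    also have "(1 / sqrt k * sqrt (d / \<xi>))^2 = 1 / k * (d / \<xi>)"
      unfolding power_mult_distrib power_divide by simp
    finally show ?thesis by (simp add: R.energy_def c_def)
  qed
  have "sqnorm (mat_adjoint (rtt_matrix F d k \<xi> \<omega>) *\<^sub>v x) = (\<Sum>j<k. 1 / k * R.energy \<xi> (fst \<omega>) (snd \<omega> ! j) X)"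
    unfolding sqnorm_emb[OF adjoint_mult_carrier[OF \<Omega>]] by (rule sum.cong) (use e in auto)
  also have "\<dots> = 1 / k * (\<Sum>c\<leftarrow>snd \<omega>. R.energy \<xi> (fst \<omega>) c X)"
    unfolding sum_list_sum_nth by (simp add: s(3) sum_distrib_left atLeast0LessThan)
  finally show ?thesis by (simp add: X_def)
qed

lemma first_moment:
  assumes \<xi>: "1 \<le> \<xi>" "\<xi> \<le> d" and k: "0 < k" and x: "x \<in> carrier_vec d"
  shows "EV (sparse_rtt F d k \<xi>) (\<lambda>\<Omega>. sqnorm (mat_adjoint \<Omega> *\<^sub>v x)) = sqnorm x"
proof -
  \<comment> \<open>The energy does not depend on the subspace. A single unit vector as orthonormal
    system gives access to its expectation.\<close>
  define u :: "nat \<Rightarrow> nat \<Rightarrow> complex" where "u = (\<lambda>t i. if i = 0 then 1 else 0)"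
  have R: "rtt_data f u d 1"
    by (rule rtt_dataI) (use d0 in \<open>auto simp: u_def if_distrib cong: if_cong\<close>)
  interpret R: rtt_data f u d 1 by (rule R)
  let ?X = "\<lambda>i. \<iota> (x $ i)"
  have fc: "finite (set_pmf (R.col_pmf \<xi>))" using finite_rad_list finite_pos_list[OF \<xi>(2)] by simp
  have "EV (sparse_rtt F d k \<xi>) (\<lambda>\<Omega>. sqnorm (mat_adjoint \<Omega> *\<^sub>v x))
    = EV (rtt_pmf d k \<xi>) (\<lambda>\<omega>. sqnorm (mat_adjoint (rtt_matrix F d k \<xi> \<omega>) *\<^sub>v x))"
    unfolding sparse_rtt_law by simp
  also have "\<dots> = EV (rtt_pmf d k \<xi>) (\<lambda>\<omega>. 1 / k * (\<Sum>c\<leftarrow>snd \<omega>. R.energy \<xi> (fst \<omega>) c ?X))"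
    by (rule EV_cong) (rule sqnorm_sketch[OF R _ \<xi>(2) x])
  also have "\<dots> = EV (rad_list d) (\<lambda>\<sigma>. 1 / k * (k * EV (R.col_pmf \<xi>) (\<lambda>c. R.energy \<xi> \<sigma> c ?X)))"
    unfolding EV_pair[OF finite_rad_list finite_set_replicate_pmf[OF fc]] fst_conv snd_conv EV_cmult
      EV_replicate_sum_list[OF fc] ..
  also have "\<dots> = EV (rad_list d) (\<lambda>\<sigma>. sqnorm x)"
    by (rule EV_cong) (use k in \<open>simp add: R.EV_energy[OF \<xi>] sqnorm_emb[OF x]\<close>)
  finally show ?thesis by simp
qed

lemma set_sparse_rtt: "\<xi> \<le> d \<Longrightarrow> set_pmf (sparse_rtt F d k \<xi>) \<subseteq> carrier_mat d k"
  unfolding sparse_rtt_law using rtt_matrix_carrier[OF F] by auto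

lemma rtt_cost:
  assumes "\<Omega> \<in> set_pmf (sparse_rtt F d k \<xi>)" "1 \<le> \<xi>" "\<xi> \<le> d" "0 < k"
  shows "\<exists>c. linop {..<d} {..<k} (\<lambda>i j. \<iota> (\<Omega> $$ (i,j))) c \<and>
    real c \<le> real d * (311 + 128 * log 2 (k * \<xi>)) + 2 * k * \<xi>"
proof -
  obtain \<omega> where \<omega>: "\<omega> \<in> set_pmf (rtt_pmf d k \<xi>)" "\<Omega> = rtt_matrix F d k \<xi> \<omega>"
    using assms(1) unfolding sparse_rtt_law by auto
  note s = set_rtt_pmf[OF \<omega>(1) assms(3)]
  define T where "T = (\<lambda>j. set (snd (snd \<omega> ! j)))"
  have c: "snd (snd \<omega> ! j) \<in> distinct_lists d \<xi>" if "j < k" for j using s(4)[of "snd \<omega> ! j"] s(3) that by auto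
  have T: "T j \<subseteq> {..<d} \<and> T j \<noteq> {} \<and> card (T j) \<le> \<xi>" if "j < k" for j
    using c[OF that] assms(2) by (auto simp: T_def distinct_lists_def distinct_card)
  have S: "complex_of_real (sparse_entry d k \<xi> (snd \<omega> ! j) l) = 0" if "j < k" "l < d" "l \<notin> T j" for l j
  proof -
    have "snd (snd \<omega> ! j) ! t \<noteq> l" if "t < \<xi>" for t
      using c[OF \<open>j < k\<close>] \<open>l \<notin> T j\<close> that by (auto simp: T_def distinct_lists_def)
    then show ?thesis by (simp add: sparse_entry_def)
  qed
  have "\<exists>c. linop {..<d} {..<k} (\<lambda>i j. \<Sum>l<d. complex_of_real (fst \<omega> ! i) * F\<^sub>c $$ (i,l) * complex_of_real (sparse_entry d k \<xi> (snd \<omega> ! j) l)) c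
    \<and> real c \<le> real d * (311 + 128 * log 2 (k * \<xi>)) + 2 * k * \<xi>"
    by (rule linop_sparse_rtt[OF trig d0 assms(4), where T = T]) (use T S in blast)+
  then obtain c where "linop {..<d} {..<k} (\<lambda>i j. \<Sum>l<d. complex_of_real (fst \<omega> ! i) * F\<^sub>c $$ (i,l) * complex_of_real (sparse_entry d k \<xi> (snd \<omega> ! j) l)) c"
    and cc: "real c \<le> real d * (311 + 128 * log 2 (k * \<xi>)) + 2 * k * \<xi>" by blast
  from this(1) have "linop {..<d} {..<k} (\<lambda>i j. \<iota> (\<Omega> $$ (i,j))) c"
    by (rule linop_cong) (use emb_rtt_matrix[OF \<omega>(1) assms(3)] \<omega>(2) in auto)
  then show ?thesis using cc by blast
qed

end

section \<open>Orthonormal bases of subspaces\<close>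

lemma maximal_subset:
  assumes "maximal B (\<lambda>B. B \<subseteq> V \<and> Q B)"
  shows "B \<subseteq> V" "Q B" "\<And>S. B \<subseteq> S \<Longrightarrow> S \<subseteq> V \<Longrightarrow> Q S \<Longrightarrow> B = S"
  using assms unfolding maximal_def by blast+

text \<open>A maximal independent subset of \<open>V\<close> exists, since independent sets have at
  most \<open>d\<close> elements, and by maximality it spans \<open>V\<close>. Regarded in
  \<open>V\<close> as a vector space of its own, it determines the dimension.\<close>

lemma subspace_basis:
  fixes V :: "'a::field vec set"
  assumes V: "VectorSpace.subspace class_ring V (module_vec TYPE('a) d)"
  obtains B where "finite B" "B \<subseteq> V" "\<not> module.lin_dep class_ring (module_vec TYPE('a) d) B"
    "module.span class_ring (module_vec TYPE('a) d) B = V"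
    "vectorspace.dim class_ring ((module_vec TYPE('a) d)\<lparr>carrier := V\<rparr>) = card B"
proof -
  interpret vs: vec_space "TYPE('a)" d .
  have sub: "submodule class_ring V (module_vec TYPE('a) d)" using V by (simp add: subspace_def)
  have Vc: "V \<subseteq> carrier_vec d" using sub unfolding submodule_def module_vec_simps by blast
  let ?P = "\<lambda>B. B \<subseteq> V \<and> vs.lin_indpt B"
  have "\<exists>B. finite B \<and> maximal B ?P"
  proof (rule maximal_exists)
    fix B assume P: "?P B"
    have li: "vs.lin_indpt B" by (rule conjunct2[OF P])
    have Bc: "B \<subseteq> carrier_vec d" by (rule subset_trans[OF conjunct1[OF P] Vc])
    show "finite B \<and> card B \<le> vs.dim"
      using vs.li_le_dim(1)[OF vs.fin_dim Bc li] vs.li_le_dim(2)[OF vs.fin_dim Bc li] by (rule conjI)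
  next
    have "vs.lin_indpt {}" by (simp add: vs.lin_dep_def)
    then show "?P {}" by simp
  qed
  then obtain B where fB: "finite B \<and> maximal B ?P" ..
  note mx = maximal_subset[OF conjunct2[OF fB]]
  note B = conjunct1[OF fB] mx(1,2)
  have Bc: "B \<subseteq> carrier_vec d" by (rule subset_trans[OF B(2) Vc])
  have span: "vs.span B = V"
  proof
    show "vs.span B \<subseteq> V" by (rule vs.span_is_subset[OF B(2) sub])
    show "V \<subseteq> vs.span B"
    proof
      fix v assume v: "v \<in> V"
      show "v \<in> vs.span B"
      proof (rule ccontr)
        assume n: "v \<notin> vs.span B"
        have vB: "v \<notin> B"
        proof
          assume "v \<in> B"
          then have "v \<in> vs.span B" by (rule vs.span_mem[OF Bc])
          then show False using n by (rule notE[rotated])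
        qed
        have "vs.lin_indpt (insert v B)"
          using vs.lin_dep_iff_in_span[OF Bc B(3) subsetD[OF Vc v] vB] n by simp
        then have "B = insert v B" by (rule mx(3)[OF subset_insertI insert_subsetI[OF v B(2)]])
        then have "v \<in> B" by (rule ssubst) (rule insertI1)
        then show False using vB by (rule notE[rotated])
      qed
    qed
  qed
  interpret W: vectorspace class_ring "(module_vec TYPE('a) d)\<lparr>carrier := V\<rparr>"
    using vs.subspace_is_vs[OF V] by simp
  have "W.basis B"
    unfolding W.basis_def
    using vs.span_li_not_depend[OF B(2) sub] span B(2,3) by simp
  then have "W.dim = card B" by (rule W.dim_basis[OF B(1)])
  then show ?thesis by (intro that[OF B span])
qed

text \<open>Gram-Schmidt without normalisation, as the field class offers no square roots; lengths
  are divided out after the embedding into the complex numbers.\<close>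

lemma orthogonal_basis:
  fixes V :: "'a::conjugatable_ordered_field vec set"
  assumes V: "VectorSpace.subspace class_ring V (module_vec TYPE('a) d)"
    and dim: "vectorspace.dim class_ring ((module_vec TYPE('a) d)\<lparr>carrier := V\<rparr>) = r"
  obtains w where "\<And>t. t < r \<Longrightarrow> w t \<in> carrier_vec d"
    "\<And>t t'. t < r \<Longrightarrow> t' < r \<Longrightarrow> w t \<bullet>c w t' = 0 \<longleftrightarrow> t \<noteq> t'"
    "\<And>x. x \<in> V \<Longrightarrow> \<exists>a. \<forall>i<d. x $ i = (\<Sum>t<r. a t * w t $ i)"
proof -
  interpret vs: cof_vec_space d "TYPE('a)" .
  obtain B where B: "finite B" "B \<subseteq> V" "vs.lin_indpt B" "vs.span B = V" "r = card B"
    using subspace_basis[OF V] dim by metis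
  have Vc: "V \<subseteq> carrier_vec d" using V unfolding subspace_def submodule_def module_vec_simps by blast
  obtain ws where ws: "set ws = B" "distinct ws" using finite_distinct_list[OF B(1)] by blast
  define us where "us = gram_schmidt d ws"
  have g: "vs.span (set ws) = vs.span (set us)" "corthogonal us" "set us \<subseteq> carrier_vec d" "length us = length ws" "distinct us"
    using vs.gram_schmidt_result[of ws us] ws B Vc by (auto simp: us_def)
  have len: "length us = r" using g(4) ws B(5) distinct_card by force
  show ?thesis
  proof (rule that[of "\<lambda>t. us ! t"])
    show "us ! t \<in> carrier_vec d" if "t < r" for t using that g(3) len by auto
    show "us ! t \<bullet>c us ! t' = 0 \<longleftrightarrow> t \<noteq> t'" if "t < r" "t' < r" for t t'
      using corthogonalD[OF g(2)] that len by auto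
    fix x assume "x \<in> V"
    then have "x \<in> vs.span (set us)" using B(4) g(1) ws(1) by simp
    then obtain a where a: "x = vs.lincomb a (set us)"
      using vs.finite_in_span[OF finite_set g(3)] by auto
    have "x $ i = (\<Sum>t<r. a (us ! t) * us ! t $ i)" if "i < d" for i
    proof -
      have "x $ i = (\<Sum>u\<in>set us. a u * u $ i)" unfolding a by (rule vs.lincomb_index[OF that g(3)])
      also have "\<dots> = (\<Sum>t<r. a (us ! t) * us ! t $ i)"
        by (rule sum.reindex_bij_betw[symmetric]) (use bij_betw_nth[OF g(5)] len in auto)
      finally show ?thesis .
    qed
    then show "\<exists>a. \<forall>i<d. x $ i = (\<Sum>t<r. a t * us ! t $ i)" by (intro exI[of _ "\<lambda>t. a (us ! t)"]) auto
  qed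
qed

section \<open>The injection property\<close>

context field_embedding
begin

lemma emb_eq_0: "\<iota> a = 0 \<longleftrightarrow> a = 0"
  using emb_norm[of a] by (metis norm_eq_zero)

lemma emb_cscalar_prod:
  assumes "v \<in> carrier_vec d" "w \<in> carrier_vec d"
  shows "\<iota> (v \<bullet>c w) = (\<Sum>i<d. \<iota> (v $ i) * cnj (\<iota> (w $ i)))"
proof -
  have "v \<bullet>c w = (\<Sum>i<d. v $ i * conjugate (w $ i))"
    using assms by (auto simp: scalar_prod_def atLeast0LessThan intro!: sum.cong)
  then show ?thesis by (simp add: emb_sum emb_mult emb_conj)
qed

lemma orthonormal_basis:
  fixes V :: "'a vec set"
  assumes V: "VectorSpace.subspace class_ring V (module_vec TYPE('a) d)"
    and dim: "vectorspace.dim class_ring ((module_vec TYPE('a) d)\<lparr>carrier := V\<rparr>) = r"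
  obtains u where "\<And>t t'. t < r \<Longrightarrow> t' < r \<Longrightarrow> (\<Sum>i<d. u t i * cnj (u t' i)) = (if t = t' then 1 else 0)"
    "\<And>x. x \<in> V \<Longrightarrow> \<exists>y. \<forall>i<d. \<iota> (x $ i) = (\<Sum>t<r. y t * u t i)"
proof -
  obtain w where wc: "\<And>t. t < r \<Longrightarrow> w t \<in> carrier_vec d"
    and orth: "\<And>t t'. t < r \<Longrightarrow> t' < r \<Longrightarrow> w t \<bullet>c w t' = 0 \<longleftrightarrow> t \<noteq> t'"
    and span: "\<And>x. x \<in> V \<Longrightarrow> \<exists>a. \<forall>i<d. x $ i = (\<Sum>t<r. a t * w t $ i)"
    using orthogonal_basis[OF V dim] by blast
  define s where "s = (\<lambda>t. sqrt (sqnorm (w t)))"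
  define u where "u = (\<lambda>t i. \<iota> (w t $ i) / complex_of_real (s t))"
  have sq: "\<iota> (w t \<bullet>c w t) = complex_of_real (sqnorm (w t))" if "t < r" for t
    unfolding emb_cscalar_prod[OF wc[OF that] wc[OF that]] sqnorm_emb[OF wc[OF that]] of_real_sum complex_norm_square ..
  have sn: "sqnorm (w t) \<noteq> 0" "0 \<le> sqnorm (w t)" if "t < r" for t
  proof
    assume "sqnorm (w t) = 0"
    then have "\<iota> (w t \<bullet>c w t) = 0" unfolding sq[OF that] by simp
    then show False using orth[OF that that] emb_eq_0 by blast
  next
    show "0 \<le> sqnorm (w t)" unfolding sqnorm_def by (rule sum_nonneg) simp
  qed
  have ss: "complex_of_real (s t) * complex_of_real (s t) = complex_of_real (sqnorm (w t))" "s t \<noteq> 0" if "t < r" for t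
    using sn[OF that] by (auto simp: s_def simp flip: of_real_mult)
  show ?thesis
  proof (rule that[of u])
    fix t t' assume t: "t < r" "t' < r"
    have "(\<Sum>i<d. u t i * cnj (u t' i)) = \<iota> (w t \<bullet>c w t') / (complex_of_real (s t) * complex_of_real (s t'))"
      unfolding u_def emb_cscalar_prod[OF wc[OF t(1)] wc[OF t(2)]] by (simp add: sum_divide_distrib)
    also have "\<dots> = (if t = t' then 1 else 0)"
    proof (cases "t = t'")
      case True
      then show ?thesis using sq[OF t(1)] ss(1)[OF t(1)] sn(1)[OF t(1)] by simp
    next
      case False
      then have "w t \<bullet>c w t' = 0" using orth[OF t] by blast
      then show ?thesis using False emb_zero by simp
    qed
    finally show "(\<Sum>i<d. u t i * cnj (u t' i)) = (if t = t' then 1 else 0)" .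
  next
    fix x assume "x \<in> V"
    then obtain a where a: "\<forall>i<d. x $ i = (\<Sum>t<r. a t * w t $ i)" using span by blast
    have "\<iota> (x $ i) = (\<Sum>t<r. (\<iota> (a t) * s t) * u t i)" if i: "i < d" for i
    proof -
      have "\<iota> (x $ i) = (\<Sum>t<r. \<iota> (a t) * \<iota> (w t $ i))" using a i by (simp add: emb_sum emb_mult)
      also have "\<dots> = (\<Sum>t<r. (\<iota> (a t) * s t) * u t i)"
        by (rule sum.cong) (use ss(2) in \<open>auto simp: u_def\<close>)
      finally show ?thesis .
    qed
    then show "\<exists>y. \<forall>i<d. \<iota> (x $ i) = (\<Sum>t<r. y t * u t i)"
      by (intro exI[of _ "\<lambda>t. \<iota> (a t) * complex_of_real (s t)"] allI impI)
  qed
qed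

end

context sketch_setup
begin

text \<open>The offset of the barrier is \<open>c\<^sub>0 * (2 * real r)\<close>, at most k/4 by the
  assumption on \<open>k\<close>. Of the 3/4 gained per column, 1/2 remains after dividing by
  \<open>k\<close>.\<close>

lemma osi_sparse_rtt:
  assumes r: "1 \<le> r" and A1: "1 \<le> A" and c0: "(54 + 4 * 4300) * (12 + 6 * A) \<le> c\<^sub>0"
    and n_large: "80 * 4300^2 * (2 * real r)^2 \<le> 2^(n+2)"
    and \<xi>: "1 \<le> \<xi>" "\<xi> \<le> d" and n_\<xi>: "real (n+2) \<le> A * \<xi>" and n_N: "real (n+2) \<le> A * sqrt (2 * real r)"
    and k: "8 * c\<^sub>0 * real r \<le> real k" and rk: "r \<le> k"
  shows "osi d k r (1 / 2) (sparse_rtt F d k \<xi>)"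
proof -
  have k0: "0 < k" using r rk by simp
  have inj: "19 / 20 \<le> measure_pmf.prob (sparse_rtt F d k \<xi>) {\<Omega>. \<forall>x \<in> V. 1 / 2 * sqnorm x \<le> sqnorm (mat_adjoint \<Omega> *\<^sub>v x)}"
    if V: "VectorSpace.subspace class_ring V (module_vec TYPE('a) d)"
      and dim: "vectorspace.dim class_ring ((module_vec TYPE('a) d)\<lparr>carrier := V\<rparr>) = r" for V
  proof -
    obtain u where orth: "\<And>t t'. t < r \<Longrightarrow> t' < r \<Longrightarrow> (\<Sum>i<d. u t i * cnj (u t' i)) = (if t = t' then 1 else 0)"
      and span: "\<And>x. x \<in> V \<Longrightarrow> \<exists>y. \<forall>i<d. \<iota> (x $ i) = (\<Sum>t<r. y t * u t i)"
      using orthonormal_basis[OF V dim] by blast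
    have R: "rtt_data f u d r" by (rule rtt_dataI[OF r orth])
    interpret R: rtt_data f u d r by (rule R)
    have Vc: "V \<subseteq> carrier_vec d" using V unfolding subspace_def submodule_def module_vec_simps by blast
    define Bad where "Bad = {(\<sigma>, cs). \<exists>y. c\<^sub>0 * (2 * real r) * (\<Sum>t<r. (cmod (y t))^2) + (\<Sum>c\<leftarrow>cs. R.energy \<xi> \<sigma> c (R.comb y))
        < 3/4 * k * (\<Sum>t<r. (cmod (y t))^2)}"
    define G where "G = {\<Omega>. \<forall>x \<in> V. 1 / 2 * sqnorm x \<le> sqnorm (mat_adjoint \<Omega> *\<^sub>v x)}"
    have "1 - measure_pmf.prob (rtt_pmf d k \<xi>) (rtt_matrix F d k \<xi> -` G) = measure_pmf.prob (rtt_pmf d k \<xi>) (- (rtt_matrix F d k \<xi> -` G))"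
      using measure_pmf.prob_compl[of "rtt_matrix F d k \<xi> -` G" "rtt_pmf d k \<xi>"] by (simp add: Compl_eq_Diff_UNIV)
    also have "\<dots> \<le> measure_pmf.prob (rtt_pmf d k \<xi>) Bad"
    proof (rule prob_mono_support)
      fix \<omega> assume \<omega>: "\<omega> \<in> set_pmf (rtt_pmf d k \<xi>)" and "\<omega> \<in> - (rtt_matrix F d k \<xi> -` G)"
      then obtain x where x: "x \<in> V" and lt: "sqnorm (mat_adjoint (rtt_matrix F d k \<xi> \<omega>) *\<^sub>v x) < 1 / 2 * sqnorm x"
        by (auto simp: G_def not_le)
      have xc: "x \<in> carrier_vec d" using x Vc by blast
      obtain y where y: "\<forall>i<d. \<iota> (x $ i) = (\<Sum>t<r. y t * u t i)" using span[OF x] by blast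
      have zf: "R.zf \<sigma> l (\<lambda>i. \<iota> (x $ i)) = R.zf \<sigma> l (R.comb y)" for \<sigma> l
        unfolding R.zf_def R.comb_def by (rule sum.cong) (use y in auto)
      have en: "R.energy \<xi> \<sigma> c (\<lambda>i. \<iota> (x $ i)) = R.energy \<xi> \<sigma> c (R.comb y)" for \<sigma> c
        unfolding R.energy_def zf ..
      define Y where "Y = (\<Sum>t<r. (cmod (y t))^2)"
      define S where "S = (\<Sum>c\<leftarrow>snd \<omega>. R.energy \<xi> (fst \<omega>) c (R.comb y))"
      have "sqnorm x = (\<Sum>i<d. (cmod (R.comb y i))^2)"
        unfolding sqnorm_emb[OF xc] R.comb_def by (rule sum.cong) (use y in auto)
      then have sx: "sqnorm x = Y" unfolding Y_def R.comb_norm .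
      have "1 / k * S < 1 / 2 * Y"
        using lt unfolding sqnorm_sketch[OF R \<omega> \<xi>(2) xc] en sx S_def .
      then have S: "S < k / 2 * Y" using k0 by (simp add: field_simps)
      have "0 \<le> Y" unfolding Y_def by (rule sum_nonneg) simp
      then have "8 * c\<^sub>0 * real r * Y \<le> real k * Y" by (rule mult_right_mono[OF k])
      then have "c\<^sub>0 * (2 * real r) * Y + S < 3/4 * k * Y" using S by (simp add: algebra_simps)
      then show "\<omega> \<in> Bad" unfolding Bad_def Y_def S_def by (auto simp: case_prod_unfold)
    qed
    also have "\<dots> \<le> 1 / 20"
      unfolding Bad_def by (rule R.lower_tail[OF A1 c0 n_large \<xi> n_\<xi> n_N])
    finally have "19 / 20 \<le> measure_pmf.prob (rtt_pmf d k \<xi>) (rtt_matrix F d k \<xi> -` G)" by linarith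
    then show ?thesis unfolding sparse_rtt_law measure_map_pmf G_def .
  qed
  show ?thesis
    unfolding osi_def using set_sparse_rtt[OF \<xi>(2)] rk first_moment[OF \<xi> k0] inj by auto
qed

end

text \<open>The bound by \<open>2 * sqrt (real r)\<close> is what makes an exponent of order log r
  also of order sqrt N.\<close>

lemma log_factor_bounds:
  assumes "1 \<le> r"
  shows "1 \<le> log_factor r" "log_factor r \<le> real r" "log_factor r \<le> 2 * sqrt (real r)" "log 2 (real r) \<le> 3 / 2 * log_factor r"
proof -
  show 1: "1 \<le> log_factor r" by (simp add: log_factor_def)
  have r: "1 \<le> real r" using assms by simp
  show "log_factor r \<le> real r" using ln_le_minus_one[of "real r"] r by (simp add: log_factor_def)
  have s: "1 \<le> sqrt (real r)" using r by simp
  have "ln (real r) = 2 * ln (sqrt (real r))" using r by (simp add: ln_sqrt)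
  also have "\<dots> \<le> 2 * sqrt (real r)" using ln_le_minus_one[of "sqrt (real r)"] s by simp
  finally show "log_factor r \<le> 2 * sqrt (real r)"
    unfolding log_factor_def using s by (intro max.boundedI) linarith+
  have l2: "2 / 3 \<le> ln (2::real)" using ln2_ge_two_thirds .
  have "log 2 (real r) = ln (real r) / ln 2" by (simp add: log_def)
  also have "\<dots> \<le> ln (real r) / (2 / 3)" by (rule divide_left_mono[OF l2]) (use r l2 in auto)
  also have "\<dots> \<le> 3 / 2 * log_factor r" by (simp add: log_factor_def)
  finally show "log 2 (real r) \<le> 3 / 2 * log_factor r" .
qed

lemma log_le_self: "0 < x \<Longrightarrow> log 2 x \<le> 3 / 2 * x" for x :: real
proof -
  assume x: "0 < x"
  have l2: "2 / 3 \<le> ln (2::real)" using ln2_ge_two_thirds .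
  have "ln x \<le> x" using ln_le_minus_one[OF x] by simp
  then have "log 2 x \<le> x / ln 2" unfolding log_def by (rule divide_right_mono) simp
  also have "\<dots> \<le> x / (2 / 3)" by (rule divide_left_mono[OF l2]) (use x l2 in auto)
  finally show ?thesis by simp
qed

context sketch_setup
begin

text \<open>With A = 76 and K = 4300, the smallest admissible \<open>c\<^sub>0\<close> is (54 + 4 *
  4300) * (12 + 6 * 76) = 8074872, and 64598976 is eight times that.\<close>

lemma exists_sketch:
  assumes r: "1 \<le> r" "r \<le> d"
  shows "\<exists>k \<xi>. k = 64598976 * r \<and> 1 \<le> \<xi> \<and> \<xi> \<le> d \<and> real \<xi> \<le> 38 * log_factor r \<and>
    osi d k r (1 / 2) (sparse_rtt F d k \<xi>) \<and>
    (\<forall>\<Omega> \<in> set_pmf (sparse_rtt F d k \<xi>). \<Omega> \<in> carrier_mat d k \<and>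
       (\<exists>c. linop {..<d} {..<k} (\<lambda>i j. \<iota> (\<Omega> $$ (i,j))) c \<and> real c \<le> 5000000000 * (real d * log_factor r)))"
proof -
  note lf = log_factor_bounds[OF r(1)]
  define L where "L = nat \<lceil>log 2 (real r)\<rceil>"
  \<comment> \<open>2^(n+2) = 2^33 * 2^(2L), where 2^33 exceeds 80 * 4300^2 * 2^2 and 2^(2L) is at
    least r^2.\<close>
  define n where "n = 31 + 2 * L"
  \<comment> \<open>Capped at \<open>d\<close>, beyond which no distinct positions exist. If the cap
    is active, n + 2 is still at most 38 d, because \<open>log_factor r\<close> \<le> r \<le>
    d.\<close>
  define \<xi> where "\<xi> = min d (n + 2)"
  define k where "k = 64598976 * r"
  have r1: "1 \<le> real r" using r by simp
  have L: "log 2 (real r) \<le> real L" "real L \<le> log 2 (real r) + 1"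
    using r1 zero_le_log_cancel_iff[of 2 "real r"] unfolding L_def by linarith+
  have rL: "real r \<le> 2 ^ L"
    using L(1) r1 by (simp add: log_le_iff powr_realpow)
  have p: "real (n + 2) \<le> 38 * log_factor r"
    using L(2) lf(1,4) unfolding n_def by simp
  have \<xi>: "1 \<le> \<xi>" "\<xi> \<le> d" using d0 by (auto simp: \<xi>_def)
  have \<xi>p: "real \<xi> \<le> 38 * log_factor r" using p unfolding \<xi>_def by linarith
  have n_\<xi>: "real (n + 2) \<le> 76 * real \<xi>"
  proof (cases "d \<le> n + 2")
    case True
    then have "\<xi> = d" by (simp add: \<xi>_def)
    then show ?thesis using p lf(2) r(2) by linarith
  next
    case False
    then have "\<xi> = n + 2" by (simp add: \<xi>_def)
    then show ?thesis by linarith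
  qed
  have n_N: "real (n + 2) \<le> 76 * sqrt (2 * real r)"
  proof -
    have "sqrt (real r) \<le> sqrt (2 * real r)" by simp
    then show ?thesis using p lf(3) by linarith
  qed
  have n_large: "80 * 4300^2 * (2 * real r)^2 \<le> 2^(n+2)"
  proof -
    have "(real r)^2 \<le> (2 ^ L)^2" by (rule power_mono[OF rL]) simp
    then have "5916800000 * (real r)^2 \<le> 2^33 * (2 ^ L)^2" by (intro mult_mono) auto
    also have "\<dots> = 2^(n+2)" by (simp add: n_def power_add power_mult power_mult_distrib[symmetric] power2_eq_square)
    finally show ?thesis by (simp add: power_mult_distrib)
  qed
  have osi: "osi d k r (1 / 2) (sparse_rtt F d k \<xi>)"
    by (rule osi_sparse_rtt[OF r(1), of 76 8074872 n]) (use n_large \<xi> n_\<xi> n_N in \<open>auto simp: k_def\<close>)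
  have cost: "\<exists>c. linop {..<d} {..<k} (\<lambda>i j. \<iota> (\<Omega> $$ (i,j))) c \<and> real c \<le> 5000000000 * (real d * log_factor r)"
    if \<Omega>: "\<Omega> \<in> set_pmf (sparse_rtt F d k \<xi>)" for \<Omega>
  proof -
    have k0: "0 < k" using r by (simp add: k_def)
    obtain c where c: "linop {..<d} {..<k} (\<lambda>i j. \<iota> (\<Omega> $$ (i,j))) c"
      and cc: "real c \<le> real d * (311 + 128 * log 2 (k * \<xi>)) + 2 * k * \<xi>"
      using rtt_cost[OF \<Omega> \<xi> k0] by blast
    have "log 2 (real (k * \<xi>)) = log 2 64598976 + log 2 (real r) + log 2 (real \<xi>)"
      using r1 \<xi> by (simp add: k_def log_mult)
    also have "\<dots> \<le> 26 + 3 / 2 * log_factor r + 3 / 2 * (38 * log_factor r)"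
    proof -
      have "log 2 (64598976::real) \<le> log 2 (2 ^ 26)" by (subst log_le_cancel_iff) auto
      also have "\<dots> = 26" by (subst log_pow_cancel) auto
      finally have "log 2 (64598976::real) \<le> 26" .
      moreover have "log 2 (real \<xi>) \<le> 3 / 2 * real \<xi>" using \<xi> by (intro log_le_self) simp
      ultimately show ?thesis using lf(4) \<xi>p by linarith
    qed
    also have "\<dots> \<le> 85 * log_factor r" using lf(1) by linarith
    finally have lg: "log 2 (real (k * \<xi>)) \<le> 85 * log_factor r" .
    have "311 + 128 * log 2 (real (k * \<xi>)) \<le> 11191 * log_factor r" using lg lf(1) by linarith
    then have "real d * (311 + 128 * log 2 (real (k * \<xi>))) \<le> real d * (11191 * log_factor r)"
      by (rule mult_left_mono) simp
    \<comment> \<open>The sparse combination costs O(r \<xi>), absorbed by r \<le> d; 4909522176 is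
      2 * 64598976 * 38.\<close>
    moreover have "real (2 * k * \<xi>) \<le> 4909522176 * (real d * log_factor r)"
    proof -
      have "real r * real \<xi> \<le> real d * (38 * log_factor r)" by (rule mult_mono) (use r \<xi>p in auto)
      then show ?thesis by (simp add: k_def mult_ac)
    qed
    ultimately have "real c \<le> real d * (11191 * log_factor r) + 4909522176 * (real d * log_factor r)"
      by (rule order_trans[OF cc add_mono])
    moreover have "real d * (11191 * log_factor r) = 11191 * (real d * log_factor r)" by simp
    moreover have "0 \<le> real d * log_factor r" using lf(1) by simp
    ultimately have "real c \<le> 5000000000 * (real d * log_factor r)" by linarith
    then show ?thesis using c by blast
  qed
  show ?thesis using \<xi> \<xi>p osi cost set_sparse_rtt[OF \<xi>(2), of k] unfolding k_def by blast
qed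

end

text \<open>The definitions of the two real transforms are polymorphic, so their complex instances
  serve as \<open>F\<^sub>c\<close>.\<close>

lemma real_trig_embedding:
  assumes "F \<in> (real_trig_transforms d :: real mat set)" "0 < d"
  obtains F\<^sub>c where "sketch_setup complex_of_real F F\<^sub>c d"
proof -
  consider "F = dct d" | q where "d = 2^q" "F = walsh_hadamard q"
    using assms(1) by (auto simp: real_trig_transforms_def)
  then obtain F\<^sub>c where "F\<^sub>c \<in> complex_trig_transforms d" "F \<in> carrier_mat d d"
    "\<And>i l. i < d \<Longrightarrow> l < d \<Longrightarrow> F\<^sub>c $$ (i,l) = complex_of_real (F $$ (i,l))"
  proof cases
    case 1
    show ?thesis by (rule that[of "dct d"]) (auto simp: 1 dct_def complex_trig_transforms_def real_trig_transforms_def)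
  next
    case 2
    show ?thesis by (rule that[of "walsh_hadamard q"]) (auto simp: 2 walsh_hadamard_def complex_trig_transforms_def real_trig_transforms_def)
  qed
  then have "sketch_setup complex_of_real F F\<^sub>c d" using assms(2) by unfold_locales auto
  then show ?thesis by (rule that)
qed

lemma complex_trig_embedding:
  assumes "F \<in> complex_trig_transforms d" "0 < d"
  shows "sketch_setup (\<lambda>z. z) F F d"
proof -
  have "F \<in> carrier_mat d d"
    using assms(1) by (auto simp: complex_trig_transforms_def real_trig_transforms_def dct_def dft_def walsh_hadamard_def)
  then show ?thesis using assms by unfold_locales auto
qed

theorem theorem4p2:
  "\<exists>C > 0::real.
     (\<forall>d r. \<forall>F \<in> (real_trig_transforms d :: real mat set). 1 \<le> r \<and> r \<le> d \<longrightarrow>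
       (\<exists>k \<xi>. real k \<le> C * real r \<and>
          1 \<le> \<xi> \<and> \<xi> \<le> d \<and> real \<xi> \<le> C * ((1 + ln (real d) / real r) * log_factor r) \<and>
          osi d k r (1 / 2) (sparse_rtt F d k \<xi>) \<and>
          (\<forall>n. \<forall>\<Omega> \<in> set_pmf (sparse_rtt F d k \<xi>).
             \<exists>p. computes_sketch n \<Omega> p \<and>
                 real (length p) \<le> C * (real n * real d * log_factor r)))) \<and>
     (\<forall>d r. \<forall>F \<in> complex_trig_transforms d. 1 \<le> r \<and> r \<le> d \<longrightarrow>
       (\<exists>k \<xi>. real k \<le> C * real r \<and>
          1 \<le> \<xi> \<and> \<xi> \<le> d \<and> real \<xi> \<le> C * ((1 + ln (real d) / real r) * log_factor r) \<and>
          osi d k r (1 / 2) (sparse_rtt F d k \<xi>) \<and>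
          (\<forall>n. \<forall>\<Omega> \<in> set_pmf (sparse_rtt F d k \<xi>).
             \<exists>p. computes_sketch n \<Omega> p \<and>
                 real (length p) \<le> C * (real n * real d * log_factor r))))"
proof -
  \<comment> \<open>The largest constant that occurs: 5000000000 per row entry, times 6 for
    simulating complex arithmetic over the reals.\<close>
  define C :: real where "C = 30000000000"
  have sparsity: "real \<xi> \<le> C * ((1 + ln (real d) / real r) * log_factor r)"
    if "real \<xi> \<le> 38 * log_factor r" "1 \<le> r" "r \<le> d" for \<xi> d r
  proof -
    have l: "1 \<le> log_factor r" by (simp add: log_factor_def)
    \<comment> \<open>The logarithm of \<open>d\<close> is nonnegative because d \<ge> 1, so the
      first factor is at least 1.\<close>
    have "1 * log_factor r \<le> (1 + ln (real d) / real r) * log_factor r"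
      by (rule mult_right_mono) (use l that in auto)
    then show ?thesis using that(1) l unfolding C_def by linarith
  qed
  have length_bound: "real len \<le> C * (real n * real d * log_factor r)"
    if "len \<le> n * m" "real m \<le> C * (real d * log_factor r)" for len n m d r
  proof -
    have "real len \<le> real n * real m" using that(1) by (metis of_nat_le_iff of_nat_mult)
    also have "\<dots> \<le> real n * (C * (real d * log_factor r))" by (rule mult_left_mono[OF that(2)]) simp
    finally show ?thesis by (simp add: mult_ac)
  qed
  have pos: "0 \<le> real d * log_factor r" for d r by (simp add: log_factor_def)
  have R: "\<exists>k \<xi>. real k \<le> C * real r \<and> 1 \<le> \<xi> \<and> \<xi> \<le> d \<and> real \<xi> \<le> C * ((1 + ln (real d) / real r) * log_factor r) \<and>
      osi d k r (1 / 2) (sparse_rtt F d k \<xi>) \<and>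
      (\<forall>n. \<forall>\<Omega> \<in> set_pmf (sparse_rtt F d k \<xi>). \<exists>p. computes_sketch n \<Omega> p \<and> real (length p) \<le> C * (real n * real d * log_factor r))"
    if F: "F \<in> (real_trig_transforms d :: real mat set)" and r: "1 \<le> r" "r \<le> d" for d r F
  proof -
    obtain F\<^sub>c where S: "sketch_setup complex_of_real F F\<^sub>c d" using real_trig_embedding[OF F] r by auto
    obtain k \<xi> where k: "k = 64598976 * r" and \<xi>: "1 \<le> \<xi>" "\<xi> \<le> d" "real \<xi> \<le> 38 * log_factor r"
      and osi: "osi d k r (1 / 2) (sparse_rtt F d k \<xi>)"
      and cost: "\<forall>\<Omega> \<in> set_pmf (sparse_rtt F d k \<xi>). \<Omega> \<in> carrier_mat d k \<and>
       (\<exists>c. linop {..<d} {..<k} (\<lambda>i j. complex_of_real (\<Omega> $$ (i,j))) c \<and> real c \<le> 5000000000 * (real d * log_factor r))"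
      using sketch_setup.exists_sketch[OF S r] by blast
    have "\<exists>p. computes_sketch n \<Omega> p \<and> real (length p) \<le> C * (real n * real d * log_factor r)"
      if "\<Omega> \<in> set_pmf (sparse_rtt F d k \<xi>)" for n \<Omega>
    proof -
      obtain c where c: "\<Omega> \<in> carrier_mat d k" "linop {..<d} {..<k} (\<lambda>i j. complex_of_real (\<Omega> $$ (i,j))) c"
        "real c \<le> 5000000000 * (real d * log_factor r)" using cost \<open>\<Omega> \<in> _\<close> by blast
      obtain p where p: "computes_sketch n \<Omega> p" "length p \<le> n * (6 * c)" using sketch_real[OF c(1,2)] by blast
      have "real (6 * c) \<le> C * (real d * log_factor r)" using c(3) unfolding C_def of_nat_mult of_nat_numeral by linarith
      then show ?thesis using p(1) length_bound[OF p(2)] by blast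
    qed
    moreover have "real k \<le> C * real r" unfolding k C_def by simp
    ultimately show ?thesis using \<xi> osi sparsity[OF \<xi>(3) r] by blast
  qed
  have Cx: "\<exists>k \<xi>. real k \<le> C * real r \<and> 1 \<le> \<xi> \<and> \<xi> \<le> d \<and> real \<xi> \<le> C * ((1 + ln (real d) / real r) * log_factor r) \<and>
      osi d k r (1 / 2) (sparse_rtt F d k \<xi>) \<and>
      (\<forall>n. \<forall>\<Omega> \<in> set_pmf (sparse_rtt F d k \<xi>). \<exists>p. computes_sketch n \<Omega> p \<and> real (length p) \<le> C * (real n * real d * log_factor r))"
    if F: "F \<in> complex_trig_transforms d" and r: "1 \<le> r" "r \<le> d" for d r F
  proof -
    have S: "sketch_setup (\<lambda>z. z) F F d" using complex_trig_embedding[OF F] r by auto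
    obtain k \<xi> where k: "k = 64598976 * r" and \<xi>: "1 \<le> \<xi>" "\<xi> \<le> d" "real \<xi> \<le> 38 * log_factor r"
      and osi: "osi d k r (1 / 2) (sparse_rtt F d k \<xi>)"
      and cost: "\<forall>\<Omega> \<in> set_pmf (sparse_rtt F d k \<xi>). \<Omega> \<in> carrier_mat d k \<and>
       (\<exists>c. linop {..<d} {..<k} (\<lambda>i j. \<Omega> $$ (i,j)) c \<and> real c \<le> 5000000000 * (real d * log_factor r))"
      using sketch_setup.exists_sketch[OF S r] by blast
    have "\<exists>p. computes_sketch n \<Omega> p \<and> real (length p) \<le> C * (real n * real d * log_factor r)"
      if "\<Omega> \<in> set_pmf (sparse_rtt F d k \<xi>)" for n \<Omega>
    proof -
      obtain c where c: "\<Omega> \<in> carrier_mat d k" "linop {..<d} {..<k} (\<lambda>i j. \<Omega> $$ (i,j)) c"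
        "real c \<le> 5000000000 * (real d * log_factor r)" using cost \<open>\<Omega> \<in> _\<close> by blast
      obtain p where p: "computes_sketch n \<Omega> p" "length p \<le> n * c" using sketch_complex[OF c(1,2)] by blast
      have "real c \<le> C * (real d * log_factor r)" using c(3) pos[of d r] unfolding C_def by linarith
      then show ?thesis using p(1) length_bound[OF p(2)] by blast
    qed
    moreover have "real k \<le> C * real r" unfolding k C_def by simp
    ultimately show ?thesis using \<xi> osi sparsity[OF \<xi>(3) r] by blast
  qed
  have "0 < C" by (simp add: C_def)
  then show ?thesis using R Cx by (intro exI[of _ C]) blast
qed

end
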